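(* Let $\gamma\in(-1,1)$ and fix an integer $m\ge1$. Then any $f\in L^2_\gamma(\mathbb{D};S^m(T^*\mathbb{D}))$ uniquely decomposes in the form $$f=d^{-\gamma}\,\mathrm{d}^sq+f^{\mathrm{itt}},\qquad q\in H^{1,-\gamma}_0(\mathbb{D};S^{m-1}(T^*\mathbb{D})),$$ where $f^{\mathrm{itt}}\in L^2_\gamma(\mathbb{D};S^m(T^*\mathbb{D}))$ takes the following form. - If $m=2p$ with $p>0$: $$f^{\mathrm{itt}}=\sum_{j=0}^pL^{p-j}\tilde f_{2j},\qquad\tilde f_0\in L^2_\gamma(\mathbb{D}),\quad\tilde f_{2j}\in L^2_\gamma(\mathbb{D};S^{2j}_{\mathrm{tt}}(T^*\mathbb{D}))\ (1\le j\le p).$$ Moreover, $I_{2p}d^\gamma f=I_{2p}d^\gamma f^{\mathrm{itt}}=\sum_{j=0}^pI_{2j}d^\gamma\tilde f_{2j}$. - If $m=2p+1$ with $p\ge0$: $$f^{\mathrm{itt}}=L^p\big(d^{-\gamma}\star\mathrm{d}h\big)+\sum_{j=0}^pL^{p-j}\tilde f_{2j+1},\qquad h\in H^{1,-\gamma}_0(\mathbb{D}),\quad\tilde f_{2j+1}\in L^2_\gamma(\mathbb{D};S^{2j+1}_{\mathrm{tt}}(T^*\mathbb{D}))\ (0\le j\le p).$$ Moreover, $I_{2p+1}d^\gamma f=I_{2p+1}d^\gamma f^{\mathrm{itt}}=I_1(\star\mathrm{d}h)+\sum_{j=0}^pI_{2j+1}d^\gamma\tilde f_{2j+1}$.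
   Context: $\mathbb{D}=\{z=x+iy\in\mathbb{C}:|z|\le 1\}$ with Euclidean metric $g=\mathrm{d}x^2+\mathrm{d}y^2$, $d(z)=1-|z|^2$; functions and tensors are complex-valued. $L^2_\gamma(\mathbb{D})=L^2(\mathbb{D},d^\gamma\,\mathrm{d}x\,\mathrm{d}y)$. $H^{1,\gamma}_0(\mathbb{D})$ is the completion of $C_c^\infty(\mathbb{D}^\circ)$ for $\|u\|^2=\|u\|^2_{L^2_\gamma}+\|\nabla u\|^2_{L^2_\gamma}$. $L^2_\gamma(\mathbb{D};S^m(T^*\mathbb{D}))$, $H^{1,\gamma}_0(\mathbb{D};S^m(T^*\mathbb{D}))$ are the symmetric covariant $m$-tensor fields with all components in $L^2_\gamma(\mathbb{D})$, resp. $H^{1,\gamma}_0(\mathbb{D})$ ($S^0$ means functions). $\mathrm{d}^s=\sigma\circ\nabla$ ($\nabla$ total covariant derivative, $\sigma$ symmetrization), extended to a bounded operator $H^{1,-\gamma}_0(\mathbb{D};S^{m-1}(T^*\mathbb{D}))\to L^2_{-\gamma}(\mathbb{D};S^m(T^*\mathbb{D}))$. $Lv=\sigma(g\otimes v)$. $\star$ is the complex-linear Hodge star: $\star\mathrm{d}x=\mathrm{d}y$, $\star\mathrm{d}y=-\mathrm{d}x$. With $\partial=\frac12(\partial_x-i\partial_y)$, $\bar\partial=\frac12(\partial_x+i\partial_y)$, for $m\ge1$, $$L^2_\gamma(\mathbb{D};S^m_{\mathrm{tt}}(T^*\mathbb{D}))=\{f_m\,\mathrm{d}z^m+f_{-m}\,\mathrm{d}\bar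 z^m:\ f_m\in L^2_\gamma(\mathbb{D})\cap\ker\bar\partial,\ f_{-m}\in L^2_\gamma(\mathbb{D})\cap\ker\partial\}.$$ For $f\in L^2_\gamma(\mathbb{D};S^m(T^*\mathbb{D}))$, $I_md^\gamma f(\beta,\alpha)=\int_0^{2\cos\alpha}f_{z(t)}(v,\dots,v)\,d(z(t))^\gamma\,\mathrm{d}t$, where $(\beta,\alpha)\in\partial_+S\mathbb{D}=(\mathbb{R}/2\pi\mathbb{Z})\times[-\pi/2,\pi/2]$, $z(t)=e^{i\beta}+te^{i(\beta+\pi+\alpha)}$ and $v$ is the unit vector with angle $\beta+\pi+\alpha$; this is bounded into $L^2(\partial_+S\mathbb{D},(\cos\alpha)^{-2\gamma}\,\mathrm{d}\beta\,\mathrm{d}\alpha)$. $I_1(\star\mathrm{d}h)$ denotes $I_1d^\gamma(d^{-\gamma}\star\mathrm{d}h)$, the unweighted integral of $\star\mathrm{d}h$ along geodesics. *)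

theory Defs
  imports "HOL-Analysis.Analysis" "HOL-Combinatorics.Permutations"
begin

text \<open>
  Elements of \<open>L\<^sup>2\<close> and Sobolev spaces are represented by functions; only their values on the disk
  matter, and two representatives are identified when they agree almost everywhere. The Euclidean
  plane is the type of complex numbers, whose Lebesgue measure is \<open>dx dy\<close>.
\<close>

abbreviation disk :: "complex set" where
  "disk \<equiv> cball 0 1"

definition bdf :: "complex \<Rightarrow> real" where
  "bdf z = 1 - (cmod z)\<^sup>2"

definition wmeas :: "real \<Rightarrow> complex measure" where
  "wmeas \<gamma> = density (lebesgue_on disk) (\<lambda>z. ennreal (bdf z powr \<gamma>))"

definition L2 :: "real \<Rightarrow> (complex \<Rightarrow> complex) set" where
  "L2 \<gamma> = {u. u \<in> borel_measurable (lebesgue_on disk) \<and>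
              integrable (wmeas \<gamma>) (\<lambda>z. (cmod (u z))\<^sup>2)}"

definition L2norm :: "real \<Rightarrow> (complex \<Rightarrow> complex) \<Rightarrow> real" where
  "L2norm \<gamma> u = sqrt (LINT z|wmeas \<gamma>. (cmod (u z))\<^sup>2)"

datatype axis = Xdir | Ydir

primrec unit_vec :: "axis \<Rightarrow> complex" where
  "unit_vec Xdir = 1"
| "unit_vec Ydir = \<i>"

primrec coord :: "axis \<Rightarrow> complex \<Rightarrow> real" where
  "coord Xdir v = Re v"
| "coord Ydir v = Im v"

definition pd :: "axis \<Rightarrow> (complex \<Rightarrow> complex) \<Rightarrow> complex \<Rightarrow> complex" where
  "pd i u z = frechet_derivative u (at z) (unit_vec i)"

text \<open>
  Smoothness is in the real sense: iterated partial derivatives of all orders exist and are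
  (Frechet) differentiable, hence continuous.
\<close>

definition smooth :: "(complex \<Rightarrow> complex) \<Rightarrow> bool" where
  "smooth u \<longleftrightarrow> (\<forall>I :: axis list. \<forall>z. foldr pd I u differentiable (at z))"

definition test_fun :: "(complex \<Rightarrow> complex) \<Rightarrow> bool" where
  "test_fun \<phi> \<longleftrightarrow> smooth \<phi> \<and> closure {z. \<phi> z \<noteq> 0} \<subseteq> ball 0 1"

text \<open>
  The completion of the test functions for the weighted \<open>H\<^sup>1\<close> norm is realised inside \<open>L\<^sup>2\<close>:
  \<open>u\<close> is the \<open>L\<^sup>2\<close> limit of test functions whose gradients converge in \<open>L\<^sup>2\<close>, and the gradient of
  \<open>u\<close> is the limit of the gradients. The limit gradient \<open>g\<close> is determined by \<open>u\<close> almost everywhere,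
  because the weight is bounded above and below on compact subsets of the open disk, so that
  \<open>g\<close> is the distributional gradient of \<open>u\<close> there.
\<close>

definition H10_grad ::
    "real \<Rightarrow> (complex \<Rightarrow> complex) \<Rightarrow> (axis \<Rightarrow> complex \<Rightarrow> complex) \<Rightarrow> bool" where
  "H10_grad \<gamma> u g \<longleftrightarrow> u \<in> L2 \<gamma> \<and> (\<forall>i. g i \<in> L2 \<gamma>) \<and>
     (\<exists>\<phi> :: nat \<Rightarrow> complex \<Rightarrow> complex.
        (\<forall>n. test_fun (\<phi> n)) \<and>
        (\<lambda>n. L2norm \<gamma> (\<lambda>z. \<phi> n z - u z)) \<longlonglongrightarrow> 0 \<and>
        (\<forall>i. (\<lambda>n. L2norm \<gamma> (\<lambda>z. pd i (\<phi> n) z - g i z)) \<longlonglongrightarrow> 0))"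

definition H10 :: "real \<Rightarrow> (complex \<Rightarrow> complex) set" where
  "H10 \<gamma> = {u. \<exists>g. H10_grad \<gamma> u g}"

definition grad :: "real \<Rightarrow> (complex \<Rightarrow> complex) \<Rightarrow> axis \<Rightarrow> complex \<Rightarrow> complex" where
  "grad \<gamma> u = (SOME g. H10_grad \<gamma> u g)"

text \<open>
  Kernels of \<open>\<partial>bar = (\<partial>\<^sub>x + i \<partial>\<^sub>y) / 2\<close> and \<open>\<partial> = (\<partial>\<^sub>x - i \<partial>\<^sub>y) / 2\<close> on \<open>L\<^sup>2\<close>, in the sense of
  distributions on the open disk.
\<close>

definition del :: "(complex \<Rightarrow> complex) \<Rightarrow> complex \<Rightarrow> complex" where
  "del u z = (pd Xdir u z - \<i> * pd Ydir u z) / 2"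

definition dbar :: "(complex \<Rightarrow> complex) \<Rightarrow> complex \<Rightarrow> complex" where
  "dbar u z = (pd Xdir u z + \<i> * pd Ydir u z) / 2"

definition ker_del :: "(complex \<Rightarrow> complex) set" where
  "ker_del = {u. \<forall>\<phi>. test_fun \<phi> \<longrightarrow> (LINT z|lebesgue_on disk. u z * del \<phi> z) = 0}"

definition ker_dbar :: "(complex \<Rightarrow> complex) set" where
  "ker_dbar = {u. \<forall>\<phi>. test_fun \<phi> \<longrightarrow> (LINT z|lebesgue_on disk. u z * dbar \<phi> z) = 0}"

text \<open>
  A covariant \<open>m\<close>-tensor field \<open>T\<close> is given by its components \<open>T z I\<close> in the coordinates \<open>x, y\<close>,
  where \<open>I\<close> is an index list of length \<open>m\<close>; its values at index lists of other lengths are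
  irrelevant. A function \<open>u\<close> is the 0-tensor field \<open>scal u\<close>.
\<close>

type_synonym tfield = "complex \<Rightarrow> axis list \<Rightarrow> complex"

definition scal :: "(complex \<Rightarrow> complex) \<Rightarrow> tfield" where
  "scal u = (\<lambda>z I. u z)"

definition teq :: "nat \<Rightarrow> tfield \<Rightarrow> tfield \<Rightarrow> bool" where
  "teq m S T \<longleftrightarrow> (\<forall>I. length I = m \<longrightarrow> (AE z in lebesgue_on disk. S z I = T z I))"

definition symmetric :: "nat \<Rightarrow> tfield \<Rightarrow> bool" where
  "symmetric m T \<longleftrightarrow>
     (\<forall>z\<in>disk. \<forall>I J. length I = m \<and> mset I = mset J \<longrightarrow> T z I = T z J)"

definition L2T :: "real \<Rightarrow> nat \<Rightarrow> tfield set" where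
  "L2T \<gamma> m = {T. symmetric m T \<and> (\<forall>I. length I = m \<longrightarrow> (\<lambda>z. T z I) \<in> L2 \<gamma>)}"

definition H10T :: "real \<Rightarrow> nat \<Rightarrow> tfield set" where
  "H10T \<gamma> m = {T. symmetric m T \<and> (\<forall>I. length I = m \<longrightarrow> (\<lambda>z. T z I) \<in> H10 \<gamma>)}"

definition tadd :: "tfield \<Rightarrow> tfield \<Rightarrow> tfield" where
  "tadd S T = (\<lambda>z I. S z I + T z I)"

definition wmul :: "real \<Rightarrow> tfield \<Rightarrow> tfield" where
  "wmul \<gamma> T = (\<lambda>z I. of_real (bdf z powr \<gamma>) * T z I)"

definition symmetrize :: "tfield \<Rightarrow> tfield" where
  "symmetrize T = (\<lambda>z I.
     (\<Sum>\<pi> | \<pi> permutes {..<length I}. T z (permute_list \<pi> I)) / fact (length I))"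

text \<open>
  The metric is flat, so covariant derivatives of components are partial derivatives. In \<open>nabla \<gamma>\<close>
  and \<open>ds \<gamma>\<close> the parameter is the weight of the Sobolev space to which the operator is extended.
\<close>

fun nabla :: "real \<Rightarrow> tfield \<Rightarrow> tfield" where
  "nabla \<gamma> T z [] = 0"
| "nabla \<gamma> T z (i # I) = grad \<gamma> (\<lambda>w. T w I) i z"

definition ds :: "real \<Rightarrow> tfield \<Rightarrow> tfield" where
  "ds \<gamma> T = symmetrize (nabla \<gamma> T)"

fun metric_times :: "tfield \<Rightarrow> tfield" where
  "metric_times T z (i # j # I) = (if i = j then T z I else 0)"
| "metric_times T z I = 0"

definition Lop :: "tfield \<Rightarrow> tfield" where
  "Lop T = symmetrize (metric_times T)"

fun star :: "tfield \<Rightarrow> tfield" where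
  "star w z [Xdir] = - w z [Ydir]"
| "star w z [Ydir] = w z [Xdir]"
| "star w z I = 0"

primrec dz :: "axis \<Rightarrow> complex" where
  "dz Xdir = 1"
| "dz Ydir = \<i>"

primrec dzbar :: "axis \<Rightarrow> complex" where
  "dzbar Xdir = 1"
| "dzbar Ydir = - \<i>"

definition cov_power :: "(axis \<Rightarrow> complex) \<Rightarrow> axis list \<Rightarrow> complex" where
  "cov_power \<omega> I = prod_list (map \<omega> I)"

definition L2tt :: "real \<Rightarrow> nat \<Rightarrow> tfield set" where
  "L2tt \<gamma> m = {T. T \<in> L2T \<gamma> m \<and>
     (\<exists>a b. a \<in> L2 \<gamma> \<inter> ker_dbar \<and> b \<in> L2 \<gamma> \<inter> ker_del \<and>
        teq m T (\<lambda>z I. a z * cov_power dz I + b z * cov_power dzbar I))}"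

definition apply_diag :: "nat \<Rightarrow> (axis list \<Rightarrow> complex) \<Rightarrow> complex \<Rightarrow> complex" where
  "apply_diag m S v =
     (\<Sum>I | length I = m. S I * of_real (prod_list (map (\<lambda>i. coord i v) I)))"

text \<open>
  \<open>xray m \<gamma> f\<close> is \<open>I\<^sub>m d\<^sup>\<gamma> f\<close>. For \<open>f\<close> in \<open>L2T \<gamma> m\<close> the integral converges absolutely for almost
  every \<open>(\<beta>, \<alpha>)\<close>, and the transform is considered as an element of \<open>L\<^sup>2\<close> of \<open>influx \<gamma>\<close>.
\<close>

definition xray :: "nat \<Rightarrow> real \<Rightarrow> tfield \<Rightarrow> real \<times> real \<Rightarrow> complex" where
  "xray m \<gamma> f = (\<lambda>(\<beta>, \<alpha>).
     let v = cis (\<beta> + pi + \<alpha>); z = (\<lambda>t. cis \<beta> + of_real t * v) in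
     LINT t|lebesgue_on {0..2 * cos \<alpha>}.
       apply_diag m (f (z t)) v * of_real (bdf (z t) powr \<gamma>))"

definition influx :: "real \<Rightarrow> (real \<times> real) measure" where
  "influx \<gamma> = density (lebesgue_on ({0..<2 * pi} \<times> {- pi / 2..pi / 2}))
     (\<lambda>(\<beta>, \<alpha>). ennreal (cos \<alpha> powr (- 2 * \<gamma>)))"

definition decomposes :: "real \<Rightarrow> nat \<Rightarrow> tfield \<Rightarrow> tfield \<Rightarrow> tfield \<Rightarrow> bool" where
  "decomposes \<gamma> m f q fitt \<longleftrightarrow>
     q \<in> H10T (- \<gamma>) (m - 1) \<and> fitt \<in> L2T \<gamma> m \<and>
     teq m f (tadd (wmul (- \<gamma>) (ds (- \<gamma>) q)) fitt)"

definition itt_even :: "real \<Rightarrow> nat \<Rightarrow> tfield \<Rightarrow> (nat \<Rightarrow> tfield) \<Rightarrow> bool" where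
  "itt_even \<gamma> p fitt ft \<longleftrightarrow>
     ft 0 \<in> L2T \<gamma> 0 \<and> (\<forall>j\<in>{1..p}. ft j \<in> L2tt \<gamma> (2 * j)) \<and>
     teq (2 * p) fitt (\<lambda>z I. \<Sum>j=0..p. (Lop ^^ (p - j)) (ft j) z I)"

definition star_d :: "real \<Rightarrow> (complex \<Rightarrow> complex) \<Rightarrow> tfield" where
  "star_d \<gamma> h = star (nabla \<gamma> (scal h))"

definition itt_odd ::
    "real \<Rightarrow> nat \<Rightarrow> tfield \<Rightarrow> (complex \<Rightarrow> complex) \<Rightarrow> (nat \<Rightarrow> tfield) \<Rightarrow> bool" where
  "itt_odd \<gamma> p fitt h ft \<longleftrightarrow>
     h \<in> H10 (- \<gamma>) \<and> (\<forall>j\<in>{0..p}. ft j \<in> L2tt \<gamma> (2 * j + 1)) \<and>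
     teq (2 * p + 1) fitt
       (tadd ((Lop ^^ p) (wmul (- \<gamma>) (star_d (- \<gamma>) h)))
             (\<lambda>z I. \<Sum>j=0..p. (Lop ^^ (p - j)) (ft j) z I))"

end

theory Submission
  imports Defs
begin

text \<open>
  A symmetric tensor of rank \<open>m\<close> is determined by its values on \<open>(v, \<dots>, v)\<close>, a polynomial
  \<open>\<Sum>\<^sub>k c\<^sub>k v\<^sup>m\<^sup>-\<^sup>k cnj v\<^sup>k\<close> whose coefficients are the Fourier modes of the tensor. In modes the operator \<open>L\<close>
  is multiplication by \<open>v cnj v\<close>, that is, a shift; a transverse trace-free tensor has only its two
  extreme modes, one in \<open>ker \<partial>bar\<close> and one in \<open>ker \<partial>\<close>; and the \<open>k\<close>-th mode of \<open>d\<^sup>s q\<close> is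
  \<open>\<partial> q\<^sub>k + \<partial>bar q\<^sub>k\<^sub>-\<^sub>1\<close>. The decomposition of \<open>f\<close> is therefore the system
  \<open>f\<^sub>k = d\<^sup>-\<^sup>\<gamma> (\<partial> q\<^sub>k + \<partial>bar q\<^sub>k\<^sub>-\<^sub>1) + a\<^sub>k\<close>, with \<open>a\<^sub>k\<close> in \<open>ker \<partial>bar\<close> below the middle degree and in
  \<open>ker \<partial>\<close> above it. It is triangular from both ends: \<open>f\<^sub>0\<close> gives \<open>q\<^sub>0\<close> and \<open>a\<^sub>0\<close>, then \<open>f\<^sub>1\<close> gives \<open>q\<^sub>1\<close>
  and \<open>a\<^sub>1\<close>, and so on up to the middle (\<open>wirt_chain_exists\<close>, \<open>wirt_chain_unique\<close>), and likewise from
  \<open>f\<^sub>m\<close> downwards with \<open>\<partial>\<close> and \<open>\<partial>bar\<close> exchanged. For \<open>m = 2p\<close> the two chains determine all \<open>q\<^sub>k\<close>, and what remains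
  of the middle mode is the free function of the decomposition. For \<open>m = 2p + 1\<close> both chains end at
  \<open>q\<^sub>p\<close>; since \<open>d\<^sup>-\<^sup>\<gamma> \<star>dh\<close> has the modes \<open>- i d\<^sup>-\<^sup>\<gamma> \<partial>h\<close> and \<open>i d\<^sup>-\<^sup>\<gamma> \<partial>bar h\<close>, one chain ends with \<open>q\<^sub>p - i h\<close>
  and the other with \<open>q\<^sub>p + i h\<close>, which determines \<open>q\<^sub>p\<close> and \<open>h\<close>.

  Each step of a chain is the orthogonal decomposition of \<open>L\<^sup>2\<close> for the weight \<open>d\<^sup>\<gamma>\<close> into
  \<open>d\<^sup>-\<^sup>\<gamma> \<partial>q\<close>, with \<open>q\<close> in \<open>H\<^sub>0\<^sup>1\<close> for the weight \<open>d\<^sup>-\<^sup>\<gamma>\<close>, and \<open>ker \<partial>bar\<close>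
  (\<open>wirt_decomposition_exists\<close>, \<open>wirt_decomposition_unique\<close>). The weights cancel in the inner product, so
  orthogonality is the definition of \<open>ker \<partial>bar\<close>. That the first summand is closed, and that it determines
  \<open>q\<close>, is the estimate \<open>del_controls_H1\<close>: for the weight \<open>d\<^sup>\<mu>\<close> with \<open>\<mu> = - \<gamma> < 1\<close>, the norms of a test
  function and of its gradient are at most a constant times the norm of its \<open>\<partial>\<close>-derivative alone. For
  \<open>\<nu> < 0\<close> the function \<open>\<nu> log d\<close> is strictly subharmonic, and the Bochner--Kodaira identity yields a Hardy
  inequality for the weight \<open>d\<^sup>\<nu>\<close>; applied to \<open>d u\<close> with \<open>\<nu> = \<mu> - 2\<close> it gives a Hardy inequality
  for all \<open>\<mu> < 1\<close>, which absorbs the difference between the norms of \<open>\<partial>u\<close> and \<open>\<partial>bar u\<close>.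

  On a unit vector the metric is \<open>v cnj v = 1\<close>, so \<open>L\<close> does not change line integrals. The term
  \<open>d\<^sup>-\<^sup>\<gamma> d\<^sup>s q\<close>, multiplied by \<open>d\<^sup>\<gamma>\<close>, is along a chord the derivative of the values of \<open>q\<close>, which vanish at
  both ends if \<open>q\<close> is a test function. The limit on almost every chord is taken with Santalo's formula; it
  needs convergence of the gradients in \<open>L\<^sup>1\<close>, which follows from convergence in \<open>L\<^sup>2\<close> for the weight
  \<open>d\<^sup>-\<^sup>\<gamma>\<close>, because \<open>d\<^sup>\<gamma>\<close> is integrable for \<open>\<gamma> > -1\<close> (\<open>AE_chord_gradient\<close>).
\<close>

section \<open>Square-integrable functions\<close>

definition sqint :: "'a measure \<Rightarrow> ('a \<Rightarrow> complex) set" where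
  "sqint M = {u. u \<in> borel_measurable M \<and> integrable M (\<lambda>x. (cmod (u x))\<^sup>2)}"

definition sqnorm :: "'a measure \<Rightarrow> ('a \<Rightarrow> complex) \<Rightarrow> real" where
  "sqnorm M u = sqrt (LINT x|M. (cmod (u x))\<^sup>2)"

lemma sqintD:
  assumes "u \<in> sqint M"
  shows "u \<in> borel_measurable M" "integrable M (\<lambda>x. (cmod (u x))\<^sup>2)"
  using assms by (auto simp: sqint_def)

lemma sqnorm_nonneg [simp]: "0 \<le> sqnorm M u"
  by (simp add: sqnorm_def)

lemma sqnorm_sq: "(sqnorm M u)\<^sup>2 = (LINT x|M. (cmod (u x))\<^sup>2)"
  by (simp add: sqnorm_def)

lemma cmod_mult_le_sum_squares: "cmod (a * b) \<le> (cmod a)\<^sup>2 + (cmod b)\<^sup>2"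
proof -
  have "0 \<le> (cmod a - cmod b)\<^sup>2" by simp
  then have "2 * (cmod a * cmod b) \<le> (cmod a)\<^sup>2 + (cmod b)\<^sup>2"
    by (simp add: power2_diff)
  moreover have "0 \<le> cmod a * cmod b" by simp
  ultimately have "cmod a * cmod b \<le> (cmod a)\<^sup>2 + (cmod b)\<^sup>2" by linarith
  then show ?thesis by (simp add: norm_mult)
qed

lemma cmod_add_sq_le: "(cmod (a + b))\<^sup>2 \<le> 2 * (cmod a)\<^sup>2 + 2 * (cmod b)\<^sup>2"
proof -
  have "(cmod (a + b))\<^sup>2 \<le> (cmod a + cmod b)\<^sup>2"
    by (intro power_mono norm_triangle_ineq) simp
  moreover have "0 \<le> (cmod a - cmod b)\<^sup>2" by simp
  ultimately show ?thesis by (simp add: power2_sum power2_diff)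
qed

lemma sqint_mult_integrable:
  assumes "u \<in> sqint M" "v \<in> sqint M"
  shows "integrable M (\<lambda>x. u x * v x)"
proof (rule Bochner_Integration.integrable_bound)
  show "integrable M (\<lambda>x. (cmod (u x))\<^sup>2 + (cmod (v x))\<^sup>2)"
    using assms by (auto simp: sqint_def)
  show "(\<lambda>x. u x * v x) \<in> borel_measurable M"
    using assms by (auto simp: sqint_def)
  show "AE x in M. norm (u x * v x) \<le> norm ((cmod (u x))\<^sup>2 + (cmod (v x))\<^sup>2)"
    using cmod_mult_le_sum_squares by (auto simp del: norm_mult)
qed

lemma sqint_cnj: "u \<in> sqint M \<Longrightarrow> (\<lambda>x. cnj (u x)) \<in> sqint M"
  unfolding sqint_def
  using borel_measurable_continuous_on[of cnj u M] by (auto intro!: continuous_intros)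

lemma sqint_add:
  assumes "u \<in> sqint M" "v \<in> sqint M"
  shows "(\<lambda>x. u x + v x) \<in> sqint M"
  unfolding sqint_def
proof (intro CollectI conjI)
  show m: "(\<lambda>x. u x + v x) \<in> borel_measurable M"
    using assms by (auto simp: sqint_def)
  show "integrable M (\<lambda>x. (cmod (u x + v x))\<^sup>2)"
  proof (rule Bochner_Integration.integrable_bound)
    show "integrable M (\<lambda>x. 2 * (cmod (u x))\<^sup>2 + 2 * (cmod (v x))\<^sup>2)"
      using assms by (auto simp: sqint_def)
    show "AE x in M. norm ((cmod (u x + v x))\<^sup>2) \<le> norm (2 * (cmod (u x))\<^sup>2 + 2 * (cmod (v x))\<^sup>2)"
      using cmod_add_sq_le by auto
  qed (use m in measurable)
qed

lemma sqint_scale: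
  assumes "u \<in> sqint M"
  shows "(\<lambda>x. c * u x) \<in> sqint M"
  using assms by (auto simp: sqint_def norm_mult power_mult_distrib)

lemma sqint_diff:
  assumes "u \<in> sqint M" "v \<in> sqint M"
  shows "(\<lambda>x. u x - v x) \<in> sqint M"
  using sqint_add[OF assms(1) sqint_scale[OF assms(2), of "-1"]] by simp

lemma sqint_zero [simp]: "(\<lambda>x. 0) \<in> sqint M"
  by (simp add: sqint_def)

lemma sqint_sum:
  assumes "\<And>i. i \<in> A \<Longrightarrow> u i \<in> sqint M"
  shows "(\<lambda>x. \<Sum>i\<in>A. u i x) \<in> sqint M"
  using assms by (induction A rule: infinite_finite_induct) (auto intro: sqint_add)

lemma sqnorm_cong_AE:
  assumes "u \<in> borel_measurable M" "v \<in> borel_measurable M" "AE x in M. v x = u x"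
  shows "sqnorm M v = sqnorm M u"
proof -
  have "(LINT x|M. (cmod (v x))\<^sup>2) = (LINT x|M. (cmod (u x))\<^sup>2)"
    by (rule integral_cong_AE) (use assms in \<open>auto elim: eventually_mono\<close>)
  then show ?thesis by (simp add: sqnorm_def)
qed

lemma sqnorm_cnj [simp]: "sqnorm M (\<lambda>x. cnj (u x)) = sqnorm M u"
  by (simp add: sqnorm_def)

lemma sqnorm_scale: "sqnorm M (\<lambda>x. c * u x) = cmod c * sqnorm M u"
  by (simp add: sqnorm_def norm_mult power_mult_distrib real_sqrt_mult)

lemma sqnorm_minus_commute: "sqnorm M (\<lambda>x. u x - v x) = sqnorm M (\<lambda>x. v x - u x)"
  by (simp add: sqnorm_def norm_minus_commute)

lemma Cauchy_Schwarz_sqint: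
  assumes u: "u \<in> sqint M" and v: "v \<in> sqint M"
  shows "(LINT x|M. cmod (u x * v x)) \<le> sqnorm M u * sqnorm M v"
proof -
  define A where "A = (LINT x|M. (cmod (u x))\<^sup>2)"
  define B where "B = (LINT x|M. cmod (u x * v x))"
  define C where "C = (LINT x|M. (cmod (v x))\<^sup>2)"
  note i = sqintD(2)[OF u] sqintD(2)[OF v] integrable_norm[OF sqint_mult_integrable[OF u v]]
  have AC: "0 \<le> A" "0 \<le> B" "0 \<le> C" by (auto simp: A_def B_def C_def)
  have *: "0 \<le> t\<^sup>2 * A - 2 * t * B + C" for t
  proof -
    have "0 \<le> (LINT x|M. (t * cmod (u x) - cmod (v x))\<^sup>2)" by simp
    also have "\<dots> = (LINT x|M. t\<^sup>2 * (cmod (u x))\<^sup>2 - 2 * t * cmod (u x * v x) + (cmod (v x))\<^sup>2)"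
      by (intro Bochner_Integration.integral_cong)
         (auto simp: power2_diff power_mult_distrib norm_mult algebra_simps)
    also have "\<dots> = t\<^sup>2 * A - 2 * t * B + C"
      unfolding A_def B_def C_def using i by simp
    finally show ?thesis .
  qed
  have "B\<^sup>2 \<le> A * C"
  proof (cases "A = 0")
    case True
    have "B = 0"
    proof (rule ccontr)
      assume "B \<noteq> 0"
      then have "B > 0" using AC by simp
      have "0 \<le> C - 2 * ((C + 1) / (2 * B)) * B"
        using *[of "(C + 1) / (2 * B)"] unfolding True by linarith
      moreover have "2 * ((C + 1) / (2 * B)) * B = C + 1" using \<open>B > 0\<close> by simp
      ultimately show False by simp
    qed
    then show ?thesis using True by simp
  next
    case False
    then have "A > 0" using AC by simp
    have "0 \<le> (B / A)\<^sup>2 * A - 2 * (B / A) * B + C" by (rule *)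
    also have "\<dots> = C - B\<^sup>2 / A" using \<open>A > 0\<close> by (simp add: field_simps power2_eq_square)
    finally show ?thesis using \<open>A > 0\<close> by (simp add: field_simps)
  qed
  then have "sqrt (B\<^sup>2) \<le> sqrt (A * C)" by (rule real_sqrt_le_mono)
  then show ?thesis using AC by (simp add: A_def B_def C_def sqnorm_def real_sqrt_mult)
qed

lemma Cauchy_Schwarz_integral:
  assumes "u \<in> sqint M" "v \<in> sqint M"
  shows "cmod (LINT x|M. u x * v x) \<le> sqnorm M u * sqnorm M v"
  using Cauchy_Schwarz_sqint[OF assms] by (rule order_trans[OF integral_norm_bound])

lemma sqnorm_triangle:
  assumes u: "u \<in> sqint M" and v: "v \<in> sqint M"
  shows "sqnorm M (\<lambda>x. u x + v x) \<le> sqnorm M u + sqnorm M v"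
proof (rule power2_le_imp_le)
  have "(sqnorm M (\<lambda>x. u x + v x))\<^sup>2 \<le>
      (LINT x|M. (cmod (u x))\<^sup>2 + 2 * cmod (u x * v x) + (cmod (v x))\<^sup>2)"
    unfolding sqnorm_sq
  proof (rule integral_mono)
    show "integrable M (\<lambda>x. (cmod (u x + v x))\<^sup>2)" using sqint_add[OF u v] by (rule sqintD)
    show "integrable M (\<lambda>x. (cmod (u x))\<^sup>2 + 2 * cmod (u x * v x) + (cmod (v x))\<^sup>2)"
      using integrable_norm[OF sqint_mult_integrable[OF u v]] sqintD(2)[OF u] sqintD(2)[OF v] by simp
    fix x
    have "(cmod (u x + v x))\<^sup>2 \<le> (cmod (u x) + cmod (v x))\<^sup>2"
      by (intro power_mono norm_triangle_ineq) simp
    then show "(cmod (u x + v x))\<^sup>2 \<le> (cmod (u x))\<^sup>2 + 2 * cmod (u x * v x) + (cmod (v x))\<^sup>2"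
      by (simp add: power2_sum norm_mult algebra_simps)
  qed
  also have "\<dots> = (sqnorm M u)\<^sup>2 + 2 * (LINT x|M. cmod (u x * v x)) + (sqnorm M v)\<^sup>2"
    unfolding sqnorm_sq
    using integrable_norm[OF sqint_mult_integrable[OF u v]] sqintD(2)[OF u] sqintD(2)[OF v] by simp
  also have "\<dots> \<le> (sqnorm M u + sqnorm M v)\<^sup>2"
    using Cauchy_Schwarz_sqint[OF u v] by (simp add: power2_sum)
  finally show "(sqnorm M (\<lambda>x. u x + v x))\<^sup>2 \<le> (sqnorm M u + sqnorm M v)\<^sup>2" .
qed simp

lemma sqnorm_triangle_diff:
  assumes "u \<in> sqint M" "v \<in> sqint M" "w \<in> sqint M"
  shows "sqnorm M (\<lambda>x. u x - w x) \<le> sqnorm M (\<lambda>x. u x - v x) + sqnorm M (\<lambda>x. v x - w x)"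
  using sqnorm_triangle[OF sqint_diff[OF assms(1,2)] sqint_diff[OF assms(2,3)]] by simp

lemma sqnorm_mono:
  assumes "v \<in> sqint M" "u \<in> borel_measurable M" "AE x in M. cmod (u x) \<le> cmod (v x)"
  shows "u \<in> sqint M" "sqnorm M u \<le> sqnorm M v"
proof -
  have le: "AE x in M. (cmod (u x))\<^sup>2 \<le> (cmod (v x))\<^sup>2"
    using assms(3) by eventually_elim (simp add: power_mono)
  have i: "integrable M (\<lambda>x. (cmod (u x))\<^sup>2)"
    by (rule Bochner_Integration.integrable_bound[OF sqintD(2)[OF assms(1)]])
       (use assms le in \<open>auto elim: eventually_mono\<close>)
  then show "u \<in> sqint M" using assms by (simp add: sqint_def)
  show "sqnorm M u \<le> sqnorm M v"
    unfolding sqnorm_def using integral_mono_AE[OF i sqintD(2)[OF assms(1)] le] by simp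
qed

lemma sqnorm_eq_0:
  assumes "u \<in> sqint M" "sqnorm M u = 0"
  shows "AE x in M. u x = 0"
proof -
  have "(LINT x|M. (cmod (u x))\<^sup>2) = 0" using assms(2) by (simp add: sqnorm_def)
  then have "AE x in M. (cmod (u x))\<^sup>2 = 0"
    using integral_nonneg_eq_0_iff_AE[OF sqintD(2)[OF assms(1)]] by simp
  then show ?thesis by eventually_elim simp
qed

lemma tendsto_integral_sqint:
  assumes u: "\<And>n. u n \<in> sqint M" "u' \<in> sqint M" and v: "v \<in> sqint M"
    and lim: "(\<lambda>n. sqnorm M (\<lambda>x. u n x - u' x)) \<longlonglongrightarrow> 0"
  shows "(\<lambda>n. LINT x|M. u n x * v x) \<longlonglongrightarrow> (LINT x|M. u' x * v x)"
proof (rule LIM_zero_cancel, rule Lim_null_comparison)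
  show "(\<lambda>n. sqnorm M (\<lambda>x. u n x - u' x) * sqnorm M v) \<longlonglongrightarrow> 0"
    using tendsto_mult_right[OF lim] by simp
  have "cmod ((LINT x|M. u n x * v x) - (LINT x|M. u' x * v x)) \<le>
      sqnorm M (\<lambda>x. u n x - u' x) * sqnorm M v" for n
  proof -
    have "(LINT x|M. u n x * v x) - (LINT x|M. u' x * v x) = (LINT x|M. (u n x - u' x) * v x)"
      using sqint_mult_integrable[OF u(1) v, of n] sqint_mult_integrable[OF u(2) v]
      by (simp add: left_diff_distrib)
    then show ?thesis using Cauchy_Schwarz_integral[OF sqint_diff[OF u(1) u(2)] v, of n] by simp
  qed
  then show "\<forall>\<^sub>F n in sequentially. norm ((LINT x|M. u n x * v x) - (LINT x|M. u' x * v x)) \<le>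
      sqnorm M (\<lambda>x. u n x - u' x) * sqnorm M v" by simp
qed

lemma tendsto_sqnorm:
  assumes u: "\<And>n. u n \<in> sqint M" "u' \<in> sqint M"
    and lim: "(\<lambda>n. sqnorm M (\<lambda>x. u n x - u' x)) \<longlonglongrightarrow> 0"
  shows "(\<lambda>n. sqnorm M (u n)) \<longlonglongrightarrow> sqnorm M u'"
proof (rule LIM_zero_cancel, rule Lim_null_comparison[OF _ lim])
  have "\<bar>sqnorm M (u n) - sqnorm M u'\<bar> \<le> sqnorm M (\<lambda>x. u n x - u' x)" for n
    using sqnorm_triangle[OF sqint_diff[OF u(1) u(2)] u(2), of n]
      sqnorm_triangle[OF sqint_diff[OF u(2) u(1)] u(1), of n n]
      sqnorm_minus_commute[of M "u n" u'] by simp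
  then show "\<forall>\<^sub>F n in sequentially.
      norm (sqnorm M (u n) - sqnorm M u') \<le> sqnorm M (\<lambda>x. u n x - u' x)" by simp
qed

text \<open>
  Riesz--Fischer. Along a subsequence whose consecutive differences have squared norm at most
  \<open>8\<^sup>-\<^sup>k\<close>, the series \<open>\<Sum>\<^sub>k 4\<^sup>k |u\<^sub>k\<^sub>+\<^sub>1 - u\<^sub>k|\<^sup>2\<close> is integrable, hence finite almost everywhere, and there
  the differences decay like \<open>2\<^sup>-\<^sup>k\<close>. Fatou's lemma turns pointwise into norm convergence.
\<close>

lemma sqint_complete:
  assumes u: "\<And>n. u n \<in> sqint M"
    and C: "\<And>e. e > 0 \<Longrightarrow> \<exists>N. \<forall>n\<ge>N. \<forall>m\<ge>N. sqnorm M (\<lambda>x. u n x - u m x) < e"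
  obtains v where "v \<in> sqint M" "(\<lambda>n. sqnorm M (\<lambda>x. u n x - v x)) \<longlonglongrightarrow> 0"
proof -
  note [measurable] = sqintD(1)[OF u]
  have "\<exists>r :: nat \<Rightarrow> nat. \<forall>k. (\<forall>n\<ge>r k. \<forall>m\<ge>r k. (sqnorm M (\<lambda>x. u n x - u m x))\<^sup>2 < (1/8)^k) \<and> r (Suc k) > r k"
  proof (rule dependent_nat_choice)
    fix x k :: nat
    have *: "\<exists>N. \<forall>n\<ge>N. \<forall>m\<ge>N. (sqnorm M (\<lambda>x. u n x - u m x))\<^sup>2 < (1/8)^k" for k
    proof -
      obtain N where "\<forall>n\<ge>N. \<forall>m\<ge>N. sqnorm M (\<lambda>x. u n x - u m x) < sqrt ((1/8)^k)"
        using C[of "sqrt ((1/8)^k)"] by auto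
      then have "\<forall>n\<ge>N. \<forall>m\<ge>N. (sqnorm M (\<lambda>x. u n x - u m x))\<^sup>2 < (sqrt ((1/8)^k))\<^sup>2"
        using power_strict_mono[OF _ sqnorm_nonneg zero_less_numeral] by meson
      then have "\<forall>n\<ge>N. \<forall>m\<ge>N. (sqnorm M (\<lambda>x. u n x - u m x))\<^sup>2 < (1/8)^k"
        by (simp only: real_sqrt_pow2 zero_le_power zero_le_divide_1_iff zero_le_numeral)
      then show ?thesis by blast
    qed
    show "\<exists>x. \<forall>n\<ge>x. \<forall>m\<ge>x. (sqnorm M (\<lambda>x. u n x - u m x))\<^sup>2 < (1/8)^0" by (rule *)
    obtain N where N: "\<forall>n\<ge>N. \<forall>m\<ge>N. (sqnorm M (\<lambda>x. u n x - u m x))\<^sup>2 < (1/8)^(Suc k)"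
      using * by blast
    show "\<exists>y. (\<forall>n\<ge>y. \<forall>m\<ge>y. (sqnorm M (\<lambda>x. u n x - u m x))\<^sup>2 < (1/8)^(Suc k)) \<and> x < y"
      by (rule exI[of _ "max N (Suc x)"]) (use N in auto)
  qed
  then obtain r where r: "\<And>k n m. n \<ge> r k \<Longrightarrow> m \<ge> r k \<Longrightarrow> (sqnorm M (\<lambda>x. u n x - u m x))\<^sup>2 < (1/8)^k"
    and rSuc: "\<And>k. r k < r (Suc k)" by blast
  have rmono: "strict_mono r" using rSuc by (simp add: strict_mono_Suc_iff)
  define d where "d k x = (cmod (u (r (Suc k)) x - u (r k) x))\<^sup>2" for k x
  have [measurable]: "d k \<in> borel_measurable M" for k unfolding d_def by measurable
  have nn: "(\<integral>\<^sup>+ x. ennreal ((cmod (u n x - u m x))\<^sup>2) \<partial>M) = ennreal ((sqnorm M (\<lambda>x. u n x - u m x))\<^sup>2)" for n m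
    unfolding sqnorm_sq by (rule nn_integral_eq_integral[OF sqintD(2)[OF sqint_diff[OF u u]]]) simp
  have "(\<integral>\<^sup>+ x. (\<Sum>k. ennreal (4^k * d k x)) \<partial>M) = (\<Sum>k. \<integral>\<^sup>+ x. ennreal (4^k * d k x) \<partial>M)"
    by (rule nn_integral_suminf) measurable
  also have "\<dots> \<le> (\<Sum>k. ennreal ((1/2)^k))"
  proof (rule suminf_le)
    fix k
    have "(\<integral>\<^sup>+ x. ennreal (4^k * d k x) \<partial>M) = ennreal (4^k) * (\<integral>\<^sup>+ x. ennreal (d k x) \<partial>M)"
      by (simp add: ennreal_mult' nn_integral_cmult)
    also have "\<dots> = ennreal (4^k * (sqnorm M (\<lambda>x. u (r (Suc k)) x - u (r k) x))\<^sup>2)"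
      unfolding d_def nn by (simp add: ennreal_mult')
    also have "\<dots> \<le> ennreal (4^k * (1/8)^k)"
      using r[of k "r (Suc k)" "r k"] rSuc[of k] by (intro ennreal_leI mult_left_mono) auto
    also have "4^k * (1/8)^k = ((1/2)^k :: real)" by (simp flip: power_mult_distrib)
    finally show "(\<integral>\<^sup>+ x. ennreal (4^k * d k x) \<partial>M) \<le> ennreal ((1/2)^k)" .
  qed auto
  also have "\<dots> < \<infinity>"
    by (subst suminf_ennreal2) (auto intro: summable_geometric simp: less_top[symmetric])
  finally have "AE x in M. (\<Sum>k. ennreal (4^k * d k x)) \<noteq> \<infinity>"
    by (intro nn_integral_noteq_infinite) auto
  then have conv: "AE x in M. convergent (\<lambda>k. u (r k) x)"
  proof eventually_elim
    fix x assume "(\<Sum>k. ennreal (4^k * d k x)) \<noteq> \<infinity>"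
    then have "summable (\<lambda>k. 4^k * d k x)"
      by (intro summable_suminf_not_top) (auto simp: d_def)
    then have "Bseq (\<lambda>k. 4^k * d k x)"
      by (intro convergent_imp_Bseq) (auto simp: convergent_def dest: summable_LIMSEQ_zero)
    then obtain K where K: "K > 0" "\<And>k. norm (4^k * d k x) \<le> K" by (auto elim: BseqE)
    have "cmod (u (r (Suc k)) x - u (r k) x) \<le> sqrt K * (1/2)^k" for k
    proof (rule power2_le_imp_le)
      have "4^k * (cmod (u (r (Suc k)) x - u (r k) x))\<^sup>2 \<le> K"
        using K(2)[of k] by (simp add: d_def)
      then have "(cmod (u (r (Suc k)) x - u (r k) x))\<^sup>2 \<le> K * (1/4)^k"
        by (simp add: field_simps)
      also have "K * (1/4)^k = (sqrt K * (1/2)^k)\<^sup>2"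
      proof -
        have "((1/2 :: real)^k)\<^sup>2 = (1/4)^k"
          unfolding power2_eq_square power_mult_distrib[symmetric] by simp
        then show ?thesis using K(1) by (simp add: power_mult_distrib)
      qed
      finally show "(cmod (u (r (Suc k)) x - u (r k) x))\<^sup>2 \<le> (sqrt K * (1/2)^k)\<^sup>2" .
    qed (use K in simp)
    then have "summable (\<lambda>k. u (r (Suc k)) x - u (r k) x)"
      by (intro summable_comparison_test'[OF summable_mult[OF summable_geometric, of "1/2" "sqrt K"]]) auto
    then have "convergent (\<lambda>n. \<Sum>k<n. u (r (Suc k)) x - u (r k) x)"
      by (simp add: summable_iff_convergent)
    then have "convergent (\<lambda>n. u (r n) x - u (r 0) x)"
      by (simp add: sum_lessThan_telescope[of "\<lambda>k. u (r k) x"])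
    then show "convergent (\<lambda>k. u (r k) x)"
      using convergent_add[OF _ convergent_const[of "u (r 0) x"]] by fastforce
  qed
  define v where "v x = lim (\<lambda>k. u (r k) x)" for x
  have [measurable]: "v \<in> borel_measurable M" unfolding v_def by measurable
  have lim: "AE x in M. (\<lambda>k. u (r k) x) \<longlonglongrightarrow> v x"
    using conv by eventually_elim (simp add: v_def convergent_LIMSEQ_iff)
  have key: "(\<integral>\<^sup>+ x. ennreal ((cmod (u n x - v x))\<^sup>2) \<partial>M) \<le> ennreal ((1/8)^k)" if "n \<ge> r k" for n k
  proof -
    have "(\<integral>\<^sup>+ x. ennreal ((cmod (u n x - v x))\<^sup>2) \<partial>M) =
        (\<integral>\<^sup>+ x. liminf (\<lambda>j. ennreal ((cmod (u n x - u (r j) x))\<^sup>2)) \<partial>M)"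
    proof (rule nn_integral_cong_AE)
      show "AE x in M. ennreal ((cmod (u n x - v x))\<^sup>2) = liminf (\<lambda>j. ennreal ((cmod (u n x - u (r j) x))\<^sup>2))"
        using lim
      proof eventually_elim
        fix x assume "(\<lambda>k. u (r k) x) \<longlonglongrightarrow> v x"
        then have "(\<lambda>j. ennreal ((cmod (u n x - u (r j) x))\<^sup>2)) \<longlonglongrightarrow> ennreal ((cmod (u n x - v x))\<^sup>2)"
          by (intro tendsto_intros) auto
        then show "ennreal ((cmod (u n x - v x))\<^sup>2) = liminf (\<lambda>j. ennreal ((cmod (u n x - u (r j) x))\<^sup>2))"
          by (metis lim_imp_Liminf sequentially_bot)
      qed
    qed
    also have "\<dots> \<le> liminf (\<lambda>j. \<integral>\<^sup>+ x. ennreal ((cmod (u n x - u (r j) x))\<^sup>2) \<partial>M)"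
      by (rule nn_integral_liminf) measurable
    also have "\<dots> \<le> ennreal ((1/8)^k)"
    proof (rule Liminf_le)
      show "\<forall>\<^sub>F j in sequentially. (\<integral>\<^sup>+ x. ennreal ((cmod (u n x - u (r j) x))\<^sup>2) \<partial>M) \<le> ennreal ((1/8)^k)"
        unfolding nn using eventually_ge_at_top[of k]
      proof eventually_elim
        fix j assume "k \<le> j"
        then have "r k \<le> r j" using rmono by (simp add: strict_mono_less_eq)
        then show "ennreal ((sqnorm M (\<lambda>x. u n x - u (r j) x))\<^sup>2) \<le> ennreal ((1/8)^k)"
          using r[OF that, of "r j"] by (intro ennreal_leI) simp
      qed
    qed simp
    finally show ?thesis .
  qed
  have dsq: "(\<lambda>x. u n x - v x) \<in> sqint M" if "n \<ge> r k" for n k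
    unfolding sqint_def using key[OF that]
    by (auto intro!: integrableI_bounded simp: less_top[symmetric] top_unique)
  have vs: "v \<in> sqint M"
    using sqint_diff[OF u[of "r 0"] dsq[of 0 "r 0"]] by simp
  moreover have "(\<lambda>n. sqnorm M (\<lambda>x. u n x - v x)) \<longlonglongrightarrow> 0"
  proof (rule LIMSEQ_I)
    fix e :: real assume e: "e > 0"
    then obtain k where k: "(1/8 :: real)^k < e\<^sup>2"
      using real_arch_pow_inv[of "e\<^sup>2" "1/8"] by auto
    have "norm (sqnorm M (\<lambda>x. u n x - v x) - 0) < e" if "n \<ge> r k" for n
    proof -
      have "ennreal ((sqnorm M (\<lambda>x. u n x - v x))\<^sup>2) \<le> ennreal ((1/8)^k)"
        unfolding sqnorm_sq using key[OF that] nn_integral_eq_integral[OF sqintD(2)[OF dsq[OF that]]] by simp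
      then have "(sqnorm M (\<lambda>x. u n x - v x))\<^sup>2 < e\<^sup>2" using k by simp
      then show ?thesis using e by (simp add: power2_less_imp_less)
    qed
    then show "\<exists>no. \<forall>n\<ge>no. norm (sqnorm M (\<lambda>x. u n x - v x) - 0) < e" by blast
  qed
  ultimately show ?thesis by (rule that)
qed

lemma sqnorm_sq_diff:
  assumes a: "a \<in> sqint M" and w: "w \<in> sqint M"
  shows "(sqnorm M (\<lambda>x. a x - c * w x))\<^sup>2 =
    (sqnorm M a)\<^sup>2 - 2 * Re (cnj c * (LINT x|M. a x * cnj (w x))) + (cmod c)\<^sup>2 * (sqnorm M w)\<^sup>2"
proof -
  have i: "integrable M (\<lambda>x. a x * cnj (w x))"
    by (rule sqint_mult_integrable[OF a sqint_cnj[OF w]])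
  have "(cmod (a x - c * w x))\<^sup>2 = (cmod (a x))\<^sup>2 - 2 * Re (cnj c * (a x * cnj (w x))) + (cmod c)\<^sup>2 * (cmod (w x))\<^sup>2" for x
    unfolding cmod_power2 by (simp add: power2_eq_square algebra_simps)
  then have "(sqnorm M (\<lambda>x. a x - c * w x))\<^sup>2 = (LINT x|M. (cmod (a x))\<^sup>2 - 2 * Re (cnj c * (a x * cnj (w x))) + (cmod c)\<^sup>2 * (cmod (w x))\<^sup>2)"
    unfolding sqnorm_sq by simp
  also have "\<dots> = (sqnorm M a)\<^sup>2 - 2 * (LINT x|M. Re (cnj c * (a x * cnj (w x)))) + (cmod c)\<^sup>2 * (sqnorm M w)\<^sup>2"
    unfolding sqnorm_sq
    using sqintD(2)[OF a] sqintD(2)[OF w] integrable_Re[OF integrable_mult_right[OF i, of "cnj c"]]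
    by (simp del: times_complex.simps complex_cnj_mult)
  also have "(LINT x|M. Re (cnj c * (a x * cnj (w x)))) = Re (cnj c * (LINT x|M. a x * cnj (w x)))"
    using i by (subst integral_Re) auto
  finally show ?thesis .
qed

text \<open>
  A minimising sequence converges by the parallelogram law; its limit need not lie in \<open>V\<close> itself.
\<close>

lemma sqint_projection:
  fixes V :: "('a \<Rightarrow> complex) set"
  assumes f: "f \<in> sqint M" and V: "V \<subseteq> sqint M"
    and V0: "(\<lambda>x. 0) \<in> V"
    and Vadd: "\<And>u v. u \<in> V \<Longrightarrow> v \<in> V \<Longrightarrow> (\<lambda>x. u x + v x) \<in> V"
    and Vscale: "\<And>c u. u \<in> V \<Longrightarrow> (\<lambda>x. c * u x) \<in> V"
  obtains v w where "v \<in> sqint M" "\<And>n. w n \<in> V" "(\<lambda>n. sqnorm M (\<lambda>x. w n x - v x)) \<longlonglongrightarrow> 0"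
    "\<And>u. u \<in> V \<Longrightarrow> (LINT x|M. (f x - v x) * cnj (u x)) = 0"
proof -
  define D where "D = (INF u\<in>V. (sqnorm M (\<lambda>x. f x - u x))\<^sup>2)"
  have bdd: "bdd_below ((\<lambda>u. (sqnorm M (\<lambda>x. f x - u x))\<^sup>2) ` V)"
    by (rule bdd_belowI[of _ 0]) auto
  have D: "D \<le> (sqnorm M (\<lambda>x. f x - u x))\<^sup>2" if "u \<in> V" for u
    unfolding D_def by (rule cINF_lower[OF bdd that])
  have "\<exists>u\<in>V. (sqnorm M (\<lambda>x. f x - u x))\<^sup>2 < D + 1 / real (Suc n)" for n
    using cINF_less_iff[OF _ bdd, of "D + 1 / real (Suc n)"] V0 by (auto simp: D_def)
  then obtain w where w: "\<And>n. w n \<in> V"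
    and wD: "\<And>n. (sqnorm M (\<lambda>x. f x - w n x))\<^sup>2 < D + 1 / real (Suc n)" by metis
  have ws: "w n \<in> sqint M" for n using w V by blast
  have par: "(sqnorm M (\<lambda>x. w n x - w m x))\<^sup>2 \<le> 2 / real (Suc n) + 2 / real (Suc m)" for n m
  proof -
    define h where "h x = (1/2) * (w n x + w m x)" for x
    have hV: "h \<in> V" unfolding h_def using Vscale[OF Vadd[OF w[of n] w[of m]], of "1/2"] by simp
    then have hs: "h \<in> sqint M" using V by blast
    note i = sqintD(2)[OF sqint_diff[OF f ws[of n]]] sqintD(2)[OF sqint_diff[OF f ws[of m]]]
       sqintD(2)[OF sqint_diff[OF f hs]]
    have "(cmod (w n x - w m x))\<^sup>2 = 2 * (cmod (f x - w n x))\<^sup>2 + 2 * (cmod (f x - w m x))\<^sup>2 - 4 * (cmod (f x - h x))\<^sup>2" for x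
      unfolding cmod_power2 h_def by (simp add: power2_eq_square field_simps)
    then have "(sqnorm M (\<lambda>x. w n x - w m x))\<^sup>2 = 2 * (sqnorm M (\<lambda>x. f x - w n x))\<^sup>2 + 2 * (sqnorm M (\<lambda>x. f x - w m x))\<^sup>2 - 4 * (sqnorm M (\<lambda>x. f x - h x))\<^sup>2"
      unfolding sqnorm_sq using i by simp
    then show ?thesis using wD[of n] wD[of m] D[OF hV] by simp
  qed
  have C: "\<exists>N. \<forall>n\<ge>N. \<forall>m\<ge>N. sqnorm M (\<lambda>x. w n x - w m x) < e" if "e > 0" for e
  proof -
    obtain N where N: "inverse (real (Suc N)) < e\<^sup>2 / 4"
      using reals_Archimedean[of "e\<^sup>2 / 4"] \<open>e > 0\<close> by auto
    have "sqnorm M (\<lambda>x. w n x - w m x) < e" if "n \<ge> N" "m \<ge> N" for n m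
    proof (rule power2_less_imp_less)
      have *: "1 / real (Suc k) \<le> inverse (real (Suc N))" if "k \<ge> N" for k
        using that by (simp add: field_simps)
      have "2 / real (Suc n) + 2 / real (Suc m) \<le> 4 * inverse (real (Suc N))"
        using *[OF that(1)] *[OF that(2)] by simp
      then show "(sqnorm M (\<lambda>x. w n x - w m x))\<^sup>2 < e\<^sup>2" using par[of n m] N by simp
    qed (use \<open>e > 0\<close> in simp)
    then show ?thesis by blast
  qed
  obtain v where v: "v \<in> sqint M" and wv: "(\<lambda>n. sqnorm M (\<lambda>x. w n x - v x)) \<longlonglongrightarrow> 0"
    using sqint_complete[OF ws C] by blast
  have lim: "(\<lambda>n. (sqnorm M (\<lambda>x. f x - w n x - u x))\<^sup>2) \<longlonglongrightarrow> (sqnorm M (\<lambda>x. f x - v x - u x))\<^sup>2"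
    if "u \<in> sqint M" for u
    using wv ws v f that
    by (intro tendsto_power tendsto_sqnorm)
       (auto intro!: sqint_diff simp: sqnorm_minus_commute)
  have le: "(sqnorm M (\<lambda>x. f x - v x))\<^sup>2 \<le> D"
  proof (rule LIMSEQ_le[OF lim[OF sqint_zero, simplified]])
    have "(\<lambda>n. D + 1 / real (Suc n)) \<longlonglongrightarrow> D + 0"
      by (intro tendsto_intros LIMSEQ_Suc[OF lim_1_over_n])
    then show "(\<lambda>n. D + 1 / real (Suc n)) \<longlonglongrightarrow> D" by simp
  qed (use wD less_imp_le in blast)
  have ge: "D \<le> (sqnorm M (\<lambda>x. f x - v x - u x))\<^sup>2" if "u \<in> V" for u
  proof (rule LIMSEQ_le_const[OF lim])
    show "u \<in> sqint M" using that V by blast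
    show "\<exists>N. \<forall>n\<ge>N. D \<le> (sqnorm M (\<lambda>x. f x - w n x - u x))\<^sup>2"
      using D[OF Vadd[OF w that]] by (simp add: diff_diff_eq)
  qed
  have orth: "(LINT x|M. (f x - v x) * cnj (u x)) = 0" if u: "u \<in> V" for u
  proof -
    define a where "a x = f x - v x" for x
    define I where "I = (LINT x|M. a x * cnj (u x))"
    have as: "a \<in> sqint M" unfolding a_def by (rule sqint_diff[OF f v])
    have us: "u \<in> sqint M" using u V by blast
    \<comment> \<open>Minimality is tested on the variation of the minimiser by \<open>t I u\<close>, with \<open>t\<close> tending to \<open>0\<close>.\<close>
    have *: "2 * t * (cmod I)\<^sup>2 \<le> t * (t * ((cmod I)\<^sup>2 * (sqnorm M u)\<^sup>2))" if "t > 0" for t :: real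
    proof -
      have "(sqnorm M a)\<^sup>2 \<le> (sqnorm M (\<lambda>x. a x - (of_real t * I) * u x))\<^sup>2"
        unfolding a_def by (rule order_trans[OF le ge[OF Vscale[OF u]]])
      also have "\<dots> = (sqnorm M a)\<^sup>2 - 2 * t * (cmod I)\<^sup>2 + t * (t * ((cmod I)\<^sup>2 * (sqnorm M u)\<^sup>2))"
      proof -
        have "Re (cnj (of_real t * I) * I) = t * (cmod I)\<^sup>2"
          unfolding cmod_power2 by (simp add: power2_eq_square algebra_simps)
        then show ?thesis unfolding sqnorm_sq_diff[OF as us] I_def[symmetric]
          using \<open>t > 0\<close> by (simp add: norm_mult power_mult_distrib power2_eq_square algebra_simps)
      qed
      finally show ?thesis by simp
    qed
    have "(cmod I)\<^sup>2 \<le> 0"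
    proof (rule tendsto_lowerbound)
      show "((\<lambda>t. t * ((cmod I)\<^sup>2 * (sqnorm M u)\<^sup>2)) \<longlongrightarrow> 0) (at_right 0)"
        by (auto intro!: tendsto_eq_intros)
      have "(cmod I)\<^sup>2 \<le> t * ((cmod I)\<^sup>2 * (sqnorm M u)\<^sup>2)" if "t > 0" for t
      proof -
        have "2 * (cmod I)\<^sup>2 \<le> t * ((cmod I)\<^sup>2 * (sqnorm M u)\<^sup>2)"
          using *[OF that] that by (simp add: mult.assoc)
        moreover have "0 \<le> (cmod I)\<^sup>2" by simp
        ultimately show ?thesis by linarith
      qed
      then show "\<forall>\<^sub>F t in at_right 0. (cmod I)\<^sup>2 \<le> t * ((cmod I)\<^sup>2 * (sqnorm M u)\<^sup>2)"
        by (auto simp: eventually_at_right_field intro: exI[of _ 1])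
    qed simp
    then show ?thesis by (simp add: I_def a_def)
  qed
  show ?thesis using that[OF v w wv orth] by blast
qed

section \<open>Integration by parts in the disk\<close>

lemma pd_eqI:
  assumes "(u has_derivative D) (at z)"
  shows "pd i u z = D (unit_vec i)"
  using frechet_derivative_at[OF assms] by (simp add: pd_def)

lemma has_derivative_pd:
  assumes "u differentiable at z"
  shows "(u has_derivative (\<lambda>v. of_real (Re v) * pd Xdir u z + of_real (Im v) * pd Ydir u z)) (at z)"
proof -
  let ?D = "frechet_derivative u (at z)"
  have D: "(u has_derivative ?D) (at z)" using assms by (simp add: frechet_derivative_works)
  have lin: "linear ?D" using assms by (rule linear_frechet_derivative)
  have "?D v = of_real (Re v) * pd Xdir u z + of_real (Im v) * pd Ydir u z" for v
  proof -
    have "v = Re v *\<^sub>R 1 + Im v *\<^sub>R \<i>" by (simp add: complex_eq_iff)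
    then have "?D v = ?D (Re v *\<^sub>R 1 + Im v *\<^sub>R \<i>)" by simp
    also have "\<dots> = Re v *\<^sub>R ?D 1 + Im v *\<^sub>R ?D \<i>"
      using lin by (simp only: linear_add linear_cmul)
    finally show ?thesis by (simp add: pd_def scaleR_conv_of_real)
  qed
  then have "?D = (\<lambda>v. of_real (Re v) * pd Xdir u z + of_real (Im v) * pd Ydir u z)" by blast
  with D show ?thesis by simp
qed

lemma pd_const [simp]: "pd i (\<lambda>z. c) z = 0"
  by (rule pd_eqI[THEN trans]) (auto intro: derivative_eq_intros)

lemma pd_add:
  assumes "u differentiable at z" "v differentiable at z"
  shows "pd i (\<lambda>z. u z + v z) z = pd i u z + pd i v z"
  using pd_eqI[OF has_derivative_add[OF assms[unfolded frechet_derivative_works]]] by (simp add: pd_def)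

lemma pd_cmult:
  assumes "u differentiable at z"
  shows "pd i (\<lambda>z. c * u z) z = c * pd i u z"
  using pd_eqI[OF has_derivative_mult_right[OF assms[unfolded frechet_derivative_works]]] by (simp add: pd_def)

lemma pd_mult:
  assumes "u differentiable at z" "v differentiable at z"
  shows "pd i (\<lambda>z. u z * v z) z = pd i u z * v z + u z * pd i v z"
  using pd_eqI[OF has_derivative_mult[OF assms[unfolded frechet_derivative_works]]] by (simp add: pd_def)

lemma differentiable_cnj:
  assumes "u differentiable at z"
  shows "(\<lambda>z. cnj (u z)) differentiable at z"
  using has_derivative_cnj[OF assms[unfolded frechet_derivative_works]] by (auto simp: differentiable_def)

lemma pd_cnj:
  assumes "u differentiable at z"
  shows "pd i (\<lambda>z. cnj (u z)) z = cnj (pd i u z)"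
  using pd_eqI[OF has_derivative_cnj[OF assms[unfolded frechet_derivative_works]]] by (simp add: pd_def)

lemma pd_cong_open:
  assumes "open S" "z \<in> S" "\<And>w. w \<in> S \<Longrightarrow> u w = v w"
  shows "pd i u z = pd i v z" "u differentiable at z \<longleftrightarrow> v differentiable at z"
proof -
  have *: "(u has_derivative D) (at z) \<longleftrightarrow> (v has_derivative D) (at z)" for D
    using has_derivative_transform_within_open[of u D z UNIV S v]
      has_derivative_transform_within_open[of v D z UNIV S u] assms by auto
  then show "pd i u z = pd i v z" unfolding pd_def frechet_derivative_def by simp
  show "u differentiable at z \<longleftrightarrow> v differentiable at z" using * by (simp add: differentiable_def)
qed

lemma has_derivative_translate:
  assumes "(u has_derivative D) (at (z + c))"
  shows "((\<lambda>z. u (z + c)) has_derivative D) (at z)"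
proof -
  have "((\<lambda>z. z + c) has_derivative (\<lambda>h. h)) (at z)" by (auto intro!: derivative_eq_intros)
  from has_derivative_compose[OF this assms] show ?thesis .
qed

lemma pd_translate:
  assumes "u differentiable at (z + c)"
  shows "(\<lambda>z. u (z + c)) differentiable at z" "pd i (\<lambda>z. u (z + c)) z = pd i u (z + c)"
  using has_derivative_translate[OF assms[unfolded frechet_derivative_works]]
    pd_eqI[OF has_derivative_translate[OF assms[unfolded frechet_derivative_works]]]
  by (auto simp: differentiable_def pd_def)

lemma has_vector_derivative_line:
  assumes "u differentiable at (z + of_real t * v)"
  shows "((\<lambda>t. u (z + of_real t * v)) has_vector_derivative
     (of_real (Re v) * pd Xdir u (z + of_real t * v) + of_real (Im v) * pd Ydir u (z + of_real t * v))) (at t)"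
proof -
  have 1: "((\<lambda>t. z + of_real t * v) has_derivative (\<lambda>h. of_real h * v)) (at t)"
    by (auto intro!: derivative_eq_intros)
  from has_derivative_compose[OF 1 has_derivative_pd[OF assms]]
  show ?thesis
    by (simp add: has_vector_derivative_def scaleR_conv_of_real algebra_simps)
qed

text \<open>
  The class in which integration by parts is carried out. It contains the test functions and their
  derivatives, and it is stable under multiplication by functions that are \<open>C\<^sup>1\<close> in the open disk
  only, such as the powers of \<open>1 - |z|\<^sup>2\<close>.
\<close>

definition C1c :: "(complex \<Rightarrow> complex) \<Rightarrow> bool" where
  "C1c u \<longleftrightarrow> (\<forall>z. u differentiable at z) \<and> (\<forall>i. continuous_on UNIV (pd i u)) \<and>
     (\<exists>K. compact K \<and> K \<subseteq> ball 0 1 \<and> (\<forall>z. z \<notin> K \<longrightarrow> u z = 0))"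

lemma C1cD:
  assumes "C1c u"
  shows "u differentiable at z" "continuous_on UNIV u" "continuous_on UNIV (pd i u)"
  using assms unfolding C1c_def
  by (auto intro!: differentiable_imp_continuous_on simp: differentiable_on_def)

lemma C1c_support:
  assumes "C1c u"
  obtains K where "compact K" "K \<subseteq> ball 0 1" "\<And>z. z \<notin> K \<Longrightarrow> u z = 0" "\<And>z i. z \<notin> K \<Longrightarrow> pd i u z = 0"
proof -
  obtain K where K: "compact K" "K \<subseteq> ball 0 1" "\<And>z. z \<notin> K \<Longrightarrow> u z = 0"
    using assms by (auto simp: C1c_def)
  have "pd i u z = 0" if "z \<notin> K" for i z
    using pd_cong_open(1)[of "- K" z u "\<lambda>_. 0" i] K that
    by (simp add: open_Compl compact_imp_closed)
  with K that show ?thesis by blast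
qed

lemma C1c_zero_outside:
  assumes "C1c u" "z \<notin> ball 0 1"
  shows "u z = 0" "pd i u z = 0"
  using C1c_support[OF assms(1)] assms(2) by (metis subsetD)+

lemma C1c_mult_local:
  assumes u: "C1c u" and a: "\<And>z. z \<in> ball 0 1 \<Longrightarrow> a differentiable at z"
    and ac: "\<And>i. continuous_on (ball 0 1) (pd i a)"
  shows "C1c (\<lambda>z. u z * a z)" "pd i (\<lambda>z. u z * a z) z = pd i u z * a z + u z * pd i a z"
proof -
  obtain K where K: "compact K" "K \<subseteq> ball 0 1" "\<And>z. z \<notin> K \<Longrightarrow> u z = 0" "\<And>z i. z \<notin> K \<Longrightarrow> pd i u z = 0"
    using C1c_support[OF u] by blast
  have oK: "open (- K)" using K by (simp add: open_Compl compact_imp_closed)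
  have out: "(\<lambda>z. u z * a z) differentiable at z" "pd i (\<lambda>z. u z * a z) z = 0" if "z \<notin> K" for z i
    using pd_cong_open[of "- K" z "\<lambda>z. u z * a z" "\<lambda>_. 0"] oK K that by auto
  have ins: "(\<lambda>z. u z * a z) differentiable at z"
    "pd i (\<lambda>z. u z * a z) z = pd i u z * a z + u z * pd i a z" if "z \<in> ball 0 1" for z i
    using pd_mult[OF C1cD(1)[OF u] a[OF that]] differentiable_mult[OF C1cD(1)[OF u] a[OF that]] by auto
  show eq: "pd i (\<lambda>z. u z * a z) z = pd i u z * a z + u z * pd i a z" for i z
    using ins(2) out(2) K by (cases "z \<in> K") auto
  have ac0: "continuous_on (ball 0 1) a"
    using a by (intro differentiable_imp_continuous_on)
      (simp add: differentiable_on_def differentiable_at_withinI)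
  have "continuous_on (ball 0 1 \<union> - K) (pd i (\<lambda>z. u z * a z))" for i
  proof (rule continuous_on_open_Un)
    show "continuous_on (ball 0 1) (pd i (\<lambda>z. u z * a z))"
      unfolding eq
      by (intro continuous_intros ac ac0 continuous_on_subset[OF C1cD(2)[OF u]]
          continuous_on_subset[OF C1cD(3)[OF u]]) auto
    show "continuous_on (- K) (pd i (\<lambda>z. u z * a z))"
      by (rule continuous_on_eq[of _ "\<lambda>_. 0"]) (auto simp: out)
  qed (use oK in auto)
  moreover have "ball 0 1 \<union> - K = UNIV" using K by auto
  ultimately have "continuous_on UNIV (pd i (\<lambda>z. u z * a z))" for i by simp
  moreover have "(\<lambda>z. u z * a z) differentiable at z" for z
    using ins(1) out(1) K by (cases "z \<in> K") auto
  ultimately show "C1c (\<lambda>z. u z * a z)"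
    unfolding C1c_def using K by (metis mult_zero_left)
qed

lemma C1c_mult:
  assumes "C1c u" "C1c v"
  shows "C1c (\<lambda>z. u z * v z)" "pd i (\<lambda>z. u z * v z) z = pd i u z * v z + u z * pd i v z"
  using C1c_mult_local[OF assms(1), of v] C1cD(1)[OF assms(2)]
    continuous_on_subset[OF C1cD(3)[OF assms(2)] subset_UNIV] by simp_all

lemma C1c_cnj:
  assumes "C1c u"
  shows "C1c (\<lambda>z. cnj (u z))" "pd i (\<lambda>z. cnj (u z)) z = cnj (pd i u z)"
proof -
  show eq: "pd i (\<lambda>z. cnj (u z)) z = cnj (pd i u z)" for i z
    by (rule pd_cnj[OF C1cD(1)[OF assms]])
  have "continuous_on UNIV (pd i (\<lambda>z. cnj (u z)))" for i
    unfolding eq by (intro continuous_intros C1cD[OF assms])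
  then show "C1c (\<lambda>z. cnj (u z))"
    using assms unfolding C1c_def by (metis differentiable_cnj complex_cnj_zero)
qed

lemma integrable_continuous_zero_outside:
  fixes f :: "complex \<Rightarrow> complex"
  assumes "continuous_on UNIV f" "\<And>z. z \<notin> ball 0 1 \<Longrightarrow> f z = 0"
  shows "integrable lborel f"
proof -
  have "integrable lborel (\<lambda>z. indicator (cball 0 1) z *\<^sub>R f z)"
    by (rule borel_integrable_compact) (use assms in \<open>auto intro: continuous_on_subset\<close>)
  also have "(\<lambda>z. indicator (cball 0 1) z *\<^sub>R f z) = f"
    using assms(2) by (auto simp: indicator_def fun_eq_iff)
  finally show ?thesis .
qed

definition C0c :: "(complex \<Rightarrow> complex) \<Rightarrow> bool" where
  "C0c f \<longleftrightarrow> continuous_on UNIV f \<and> (\<exists>K. compact K \<and> K \<subseteq> ball 0 1 \<and> (\<forall>z. z \<notin> K \<longrightarrow> f z = 0))"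

lemma C0c_zero_outside: "C0c f \<Longrightarrow> z \<notin> ball 0 1 \<Longrightarrow> f z = 0"
  unfolding C0c_def by blast

lemma C0c_integrable: "C0c f \<Longrightarrow> integrable lborel f"
  by (rule integrable_continuous_zero_outside) (auto simp: C0c_def)

lemma C0c_mult_ball:
  assumes "C0c f" "continuous_on (ball 0 1) g"
  shows "C0c (\<lambda>z. f z * g z)" "C0c (\<lambda>z. g z * f z)"
proof -
  obtain K where K: "compact K" "K \<subseteq> ball 0 1" "\<And>z. z \<notin> K \<Longrightarrow> f z = 0" and c: "continuous_on UNIV f"
    using assms(1) by (auto simp: C0c_def)
  have oK: "open (- K)" using K by (simp add: open_Compl compact_imp_closed)
  have "continuous_on (ball 0 1 \<union> - K) (\<lambda>z. f z * g z)"
  proof (rule continuous_on_open_Un)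
    show "continuous_on (ball 0 1) (\<lambda>z. f z * g z)"
      by (intro continuous_intros continuous_on_subset[OF c] assms) auto
    show "continuous_on (- K) (\<lambda>z. f z * g z)"
      by (rule continuous_on_eq[of _ "\<lambda>_. 0"]) (auto simp: K)
  qed (use oK in auto)
  moreover have "ball 0 1 \<union> - K = UNIV" using K by auto
  ultimately show "C0c (\<lambda>z. f z * g z)" unfolding C0c_def using K by (metis mult_zero_left)
  then show "C0c (\<lambda>z. g z * f z)" by (simp add: mult.commute)
qed

lemma C0c_mult:
  assumes "C0c f" "continuous_on UNIV g"
  shows "C0c (\<lambda>z. f z * g z)" "C0c (\<lambda>z. g z * f z)"
  using C0c_mult_ball[OF assms(1) continuous_on_subset[OF assms(2)]] by auto

lemma C0c_cont: "C0c f \<Longrightarrow> continuous_on UNIV f" by (simp add: C0c_def)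

lemma C0c_add:
  assumes "C0c f" "C0c g"
  shows "C0c (\<lambda>z. f z + g z)"
proof -
  obtain K L where K: "compact K" "K \<subseteq> ball 0 1" "\<And>z. z \<notin> K \<Longrightarrow> f z = 0"
    and L: "compact L" "L \<subseteq> ball 0 1" "\<And>z. z \<notin> L \<Longrightarrow> g z = 0"
    using assms by (auto simp: C0c_def)
  have "compact (K \<union> L)" "K \<union> L \<subseteq> ball 0 1" "\<forall>z. z \<notin> K \<union> L \<longrightarrow> f z + g z = 0"
    using K L by (auto simp: compact_Un)
  then show ?thesis using assms unfolding C0c_def by (intro conjI continuous_intros) blast+
qed

lemma C0c_cmult: "C0c f \<Longrightarrow> C0c (\<lambda>z. c * f z)"
  by (rule C0c_mult(2)) auto

lemma C0c_diff: "C0c f \<Longrightarrow> C0c g \<Longrightarrow> C0c (\<lambda>z. f z - g z)"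
  using C0c_add[of f "\<lambda>z. (-1) * g z"] C0c_cmult[of g "-1"] by simp

lemma C0c_cnj: "C0c f \<Longrightarrow> C0c (\<lambda>z. cnj (f z))"
  unfolding C0c_def by (auto intro!: continuous_intros) 

lemma C1c_C0c:
  assumes "C1c u"
  shows "C0c u" "C0c (pd i u)"
  using C1c_support[OF assms] C1cD[OF assms] unfolding C0c_def by metis+

lemma C1c_bounded:
  assumes "C1c u"
  obtains B where "B \<ge> 0" "\<And>z. cmod (pd i u z) \<le> B"
proof -
  have "bounded (pd i u ` cball 0 1)"
    by (intro compact_imp_bounded compact_continuous_image continuous_on_subset[OF C1cD(3)[OF assms]]) auto
  then obtain B where B: "\<And>z. z \<in> cball 0 1 \<Longrightarrow> cmod (pd i u z) \<le> B"
    unfolding bounded_iff by blast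
  have "cmod (pd i u z) \<le> max B 0" for z
    using B[of z] C1c_zero_outside(2)[OF assms, of z i] by (cases "z \<in> ball 0 1") auto
  then show ?thesis using that[of "max B 0"] by auto
qed

lemma line_derivative:
  assumes "C1c u"
  shows "((\<lambda>t. u (z + of_real t * unit_vec i)) has_vector_derivative pd i u (z + of_real t * unit_vec i)) (at t)"
  using has_vector_derivative_line[OF C1cD(1)[OF assms], where v="unit_vec i"] by (cases i) auto

lemma C1c_Lipschitz:
  assumes "C1c u" "\<And>z. cmod (pd i u z) \<le> B"
  shows "cmod (u (z + of_real h * unit_vec i) - u z) \<le> B * \<bar>h\<bar>"
proof -
  have "norm ((\<lambda>t. u (z + of_real t * unit_vec i)) h - (\<lambda>t. u (z + of_real t * unit_vec i)) 0) \<le> B * norm (h - 0)"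
  proof (rule differentiable_bound[where S=UNIV])
    fix t :: real
    show "((\<lambda>t. u (z + of_real t * unit_vec i)) has_derivative (\<lambda>s. s *\<^sub>R pd i u (z + of_real t * unit_vec i))) (at t within UNIV)"
      using line_derivative[OF assms(1)] by (simp add: has_vector_derivative_def)
    show "onorm (\<lambda>s. s *\<^sub>R pd i u (z + of_real t * unit_vec i)) \<le> B"
      by (rule onorm_le) (simp, metis assms(2) abs_ge_zero mult.commute mult_right_mono)
  qed auto
  then show ?thesis by simp
qed

lemma tendsto_difference_quotient:
  assumes u: "C1c u" and g: "continuous_on UNIV g"
    and h: "h \<longlonglongrightarrow> 0" "\<And>n. h n \<noteq> 0" "\<And>n. \<bar>h n\<bar> \<le> 1"
  shows "(\<lambda>n. LINT z|lborel. (u (z + of_real (h n) * unit_vec i) - u z) / of_real (h n) * g z)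
    \<longlonglongrightarrow> (LINT z|lborel. pd i u z * g z)"
proof -
  obtain B where B: "B \<ge> 0" "\<And>z. cmod (pd i u z) \<le> B" using C1c_bounded[OF u] by blast
  have "bounded (g ` cball 0 2)"
    by (intro compact_imp_bounded compact_continuous_image continuous_on_subset[OF g]) auto
  then obtain G where G: "\<And>z. z \<in> cball 0 2 \<Longrightarrow> cmod (g z) \<le> G"
    unfolding bounded_iff by blast
  have cu: "continuous_on UNIV (\<lambda>z. u (z + c))" for c
    by (rule continuous_on_compose2[OF C1cD(2)[OF u]]) (auto intro!: continuous_intros)
  show ?thesis
  proof (rule integral_dominated_convergence)
    show "(\<lambda>z. pd i u z * g z) \<in> borel_measurable lborel"
      using borel_measurable_continuous_onI[OF continuous_on_mult[OF C1cD(3)[OF u] g]] by simp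
    show "(\<lambda>z. (u (z + of_real (h n) * unit_vec i) - u z) / of_real (h n) * g z) \<in> borel_measurable lborel" for n
    proof -
      have "continuous_on UNIV (\<lambda>z. (u (z + of_real (h n) * unit_vec i) - u z) / of_real (h n) * g z)"
        using h(2)[of n] by (intro continuous_on_mult continuous_on_divide continuous_on_diff cu C1cD(2)[OF u] g continuous_on_const) simp
      then show ?thesis by (simp add: borel_measurable_continuous_onI)
    qed
    \<comment> \<open>Translations by at most \<open>1\<close> keep the support in the disk of radius \<open>2\<close>.\<close>
    show "integrable lborel (\<lambda>z::complex. indicator (cball 0 2) z *\<^sub>R (B * G))"
      by (rule borel_integrable_compact) auto
    show "AE z in lborel. (\<lambda>n. (u (z + of_real (h n) * unit_vec i) - u z) / of_real (h n) * g z)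
        \<longlonglongrightarrow> pd i u z * g z"
    proof (rule AE_I2)
      fix z
      have "((\<lambda>t. (u (z + of_real t * unit_vec i) - u z) / of_real t) \<longlongrightarrow> pd i u z) (at 0)"
      proof (rule LIM_zero_cancel, rule tendsto_norm_zero_cancel)
        let ?f = "\<lambda>t. u (z + of_real t * unit_vec i)"
        have lim0: "((\<lambda>t. norm (?f (0 + t) - ?f 0 - t *\<^sub>R pd i u z) / norm t) \<longlongrightarrow> 0) (at 0)"
          using line_derivative[OF u, of z i 0]
          unfolding has_vector_derivative_def has_derivative_at by simp
        have eq: "norm (?f (0 + t) - ?f 0 - t *\<^sub>R pd i u z) / norm t =
            norm ((?f t - u z) / of_real t - pd i u z)" if "t \<noteq> 0" for t
        proof -
          have "(?f t - u z) / of_real t - pd i u z = (?f (0 + t) - ?f 0 - t *\<^sub>R pd i u z) / of_real t"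
            using that by (simp add: scaleR_conv_of_real diff_divide_distrib)
          then show ?thesis by (simp only: norm_divide norm_of_real real_norm_def)
        qed
        show "((\<lambda>t. norm ((?f t - u z) / of_real t - pd i u z)) \<longlongrightarrow> 0) (at 0)"
          by (rule Lim_transform_eventually[OF lim0]) (use eq in \<open>auto simp: eventually_at_filter\<close>)
      qed
      moreover have "filterlim h (at 0) sequentially" using h(1,2) by (simp add: filterlim_at)
      ultimately have "(\<lambda>n. (u (z + of_real (h n) * unit_vec i) - u z) / of_real (h n)) \<longlonglongrightarrow> pd i u z"
        by (rule filterlim_compose)
      then show "(\<lambda>n. (u (z + of_real (h n) * unit_vec i) - u z) / of_real (h n) * g z) \<longlonglongrightarrow> pd i u z * g z"
        by (rule tendsto_mult_right)
    qed
    show "AE z in lborel. norm ((u (z + of_real (h n) * unit_vec i) - u z) / of_real (h n) * g z)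
        \<le> indicator (cball 0 2) z *\<^sub>R (B * G)" for n
    proof (rule AE_I2)
      fix z
      show "norm ((u (z + of_real (h n) * unit_vec i) - u z) / of_real (h n) * g z) \<le> indicator (cball 0 2) z *\<^sub>R (B * G)"
      proof (cases "z \<in> cball 0 2")
        case True
        have "cmod ((u (z + of_real (h n) * unit_vec i) - u z) / of_real (h n)) \<le> B"
          using C1c_Lipschitz[OF u B(2), of z "h n"] h(2)[of n] by (simp add: norm_divide field_simps)
        then have "norm ((u (z + of_real (h n) * unit_vec i) - u z) / of_real (h n) * g z) \<le> B * G"
          unfolding norm_mult using G[OF True] B by (intro mult_mono) auto
        then show ?thesis using True by simp
      next
        case False
        have e: "cmod (unit_vec i) = 1" by (cases i) auto
        have "cmod z \<le> cmod (z + of_real (h n) * unit_vec i) + cmod (of_real (h n) * unit_vec i)"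
          using norm_triangle_ineq4[of "z + of_real (h n) * unit_vec i" "of_real (h n) * unit_vec i"] by simp
        then have "1 \<le> cmod (z + of_real (h n) * unit_vec i)"
          using False h(3)[of n] by (simp add: norm_mult e)
        then have "u (z + of_real (h n) * unit_vec i) = 0" "u z = 0"
          using C1c_zero_outside(1)[OF u] False by auto
        then show ?thesis using False by simp
      qed
    qed
  qed
qed

lemma lborel_integral_translate:
  fixes f :: "complex \<Rightarrow> complex"
  assumes "f \<in> borel_measurable borel"
  shows "(LINT z|lborel. f (z + c)) = (LINT z|lborel. f z)"
proof -
  have "(LINT z|lborel. f z) = (LINT z|distr lborel borel ((+) c). f z)"
    by (simp only: lborel_distr_plus)
  also have "\<dots> = (LINT z|lborel. f (c + z))"
    by (rule integral_distr) (use assms in auto)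
  finally show ?thesis by (simp add: add.commute)
qed

text \<open>Translation invariance of the integral, differentiated in the direction of the translation.\<close>

lemma integral_pd_eq_0:
  assumes u: "C1c u"
  shows "(LINT z|lborel. pd i u z) = 0"
proof -
  define h :: "nat \<Rightarrow> real" where "h n = inverse (real (Suc n))" for n
  have h: "h \<longlonglongrightarrow> 0" "\<And>n. h n \<noteq> 0" "\<And>n. \<bar>h n\<bar> \<le> 1"
    unfolding h_def by (rule LIMSEQ_inverse_real_of_nat) (auto simp: inverse_eq_divide)
  have "(\<lambda>n. LINT z|lborel. (u (z + of_real (h n) * unit_vec i) - u z) / of_real (h n) * 1)
    \<longlonglongrightarrow> (LINT z|lborel. pd i u z * 1)"
    using tendsto_difference_quotient[OF u continuous_on_const h] .
  moreover have "(LINT z|lborel. (u (z + of_real (h n) * unit_vec i) - u z) / of_real (h n) * 1) = 0" for n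
  proof -
    have i1: "integrable lborel u"
      by (rule integrable_continuous_zero_outside[OF C1cD(2)[OF u] C1c_zero_outside(1)[OF u]])
    then have m: "u \<in> borel_measurable borel" by (simp add: borel_measurable_integrable)
    define c where "c = of_real (h n) * unit_vec i"
    have i2: "integrable lborel (\<lambda>z. u (z + c))"
      using i1 integrable_distr_eq[of "(+) c" lborel borel u] m
      by (simp add: lborel_distr_plus add.commute)
    show ?thesis unfolding c_def[symmetric] using i1 i2 lborel_integral_translate[OF m, of c] by simp
  qed
  ultimately have "(\<lambda>n. 0) \<longlonglongrightarrow> (LINT z|lborel. pd i u z * 1)" by (simp only:)
  then have "(LINT z|lborel. pd i u z * 1) = 0" by (rule LIMSEQ_unique[OF _ tendsto_const])
  then show ?thesis by simp
qed

lemma integral_by_parts: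
  assumes u: "C1c u" and v: "C1c v"
  shows "(LINT z|lborel. pd i u z * v z) = - (LINT z|lborel. u z * pd i v z)"
proof -
  have "0 = (LINT z|lborel. pd i u z * v z + u z * pd i v z)"
    using integral_pd_eq_0[OF C1c_mult(1)[OF u v], of i] by (simp add: C1c_mult(2)[OF u v])
  also have "\<dots> = (LINT z|lborel. pd i u z * v z) + (LINT z|lborel. u z * pd i v z)"
    by (intro Bochner_Integration.integral_add C0c_integrable C0c_mult C1c_C0c C1cD u v)
  finally show ?thesis by (simp add: eq_neg_iff_add_eq_0)
qed

text \<open>
  Formally, both sides are \<open>- \<integral> u \<partial>\<^sub>i\<partial>\<^sub>j v\<close>. Difference quotients in the direction \<open>i\<close> replace the second
  derivative, which need not exist.
\<close>

lemma integral_curl: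
  assumes u: "C1c u" and v: "C1c v"
  shows "(LINT z|lborel. pd i u z * pd j v z) = (LINT z|lborel. pd j u z * pd i v z)"
proof -
  define h :: "nat \<Rightarrow> real" where "h n = inverse (real (Suc n))" for n
  have h: "h \<longlonglongrightarrow> 0" "\<And>n. h n \<noteq> 0" "\<And>n. \<bar>h n\<bar> \<le> 1"
    unfolding h_def by (rule LIMSEQ_inverse_real_of_nat) (auto simp: inverse_eq_divide)
  have 1: "(\<lambda>n. LINT z|lborel. (u (z + of_real (h n) * unit_vec i) - u z) / of_real (h n) * pd j v z)
    \<longlonglongrightarrow> (LINT z|lborel. pd i u z * pd j v z)"
    by (rule tendsto_difference_quotient[OF u C1cD(3)[OF v] h])
  have 2: "(\<lambda>n. LINT z|lborel. (v (z + of_real (- h n) * unit_vec i) - v z) / of_real (- h n) * pd j u z)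
    \<longlonglongrightarrow> (LINT z|lborel. pd i v z * pd j u z)"
    by (rule tendsto_difference_quotient[OF v C1cD(3)[OF u]]) (use h in \<open>auto intro: tendsto_eq_intros\<close>)
  have "(LINT z|lborel. (u (z + of_real (h n) * unit_vec i) - u z) / of_real (h n) * pd j v z) =
     (LINT z|lborel. (v (z + of_real (- h n) * unit_vec i) - v z) / of_real (- h n) * pd j u z)" for n
  proof -
    define c where "c = of_real (h n) * unit_vec i"
    let ?H = "complex_of_real (h n)"
    define uc where "uc z = u (z + c)" for z
    have uc: "uc differentiable at z" "pd j uc z = pd j u (z + c)" for z j
      unfolding uc_def using pd_translate[OF C1cD(1)[OF u]] by auto
    have puc: "continuous_on UNIV (pd j uc)" for j unfolding uc
      by (rule continuous_on_compose2[OF C1cD(3)[OF u]]) (auto intro!: continuous_intros)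
    have cuc: "continuous_on UNIV uc" unfolding uc_def
      by (rule continuous_on_compose2[OF C1cD(2)[OF u]]) (auto intro!: continuous_intros)
    have vuc: "C1c (\<lambda>z. v z * uc z)" "\<And>j z. pd j (\<lambda>z. v z * uc z) z = pd j v z * uc z + v z * pd j uc z"
      using C1c_mult_local[OF v, of uc] uc(1) continuous_on_subset[OF puc] by auto
    note cs = C1cD[OF v] C1cD[OF u] puc cuc
    have 0: "0 = (LINT z|lborel. pd j v z * uc z + v z * pd j uc z)"
      using integral_pd_eq_0[OF vuc(1), of j] by (simp add: vuc(2))
    have 1: "0 = (LINT z|lborel. pd j v z * u z + v z * pd j u z)"
      using integral_pd_eq_0[OF C1c_mult(1)[OF v u], of j] by (simp add: C1c_mult(2)[OF v u])
    have "(LINT z|lborel. pd j v z * (uc z - u z)) + (LINT z|lborel. v z * pd j uc z) - (LINT z|lborel. v z * pd j u z)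
       = (LINT z|lborel. pd j v z * uc z + v z * pd j uc z) - (LINT z|lborel. pd j v z * u z + v z * pd j u z)"
    proof -
      have "integrable lborel (\<lambda>z. pd j v z * uc z)" "integrable lborel (\<lambda>z. v z * pd j uc z)"
        "integrable lborel (\<lambda>z. pd j v z * u z)" "integrable lborel (\<lambda>z. v z * pd j u z)"
        by (intro C0c_integrable C0c_mult C1c_C0c u v cs)+
      then show ?thesis by (simp add: right_diff_distrib)
    qed
    also have "\<dots> = 0" using 0 1 by simp
    also have "(LINT z|lborel. v z * pd j uc z) = (LINT z|lborel. v (z - c) * pd j u z)"
    proof -
      have m: "(\<lambda>z. v (z - c) * pd j u z) \<in> borel_measurable borel"
        by (intro borel_measurable_continuous_onI continuous_on_mult cs continuous_on_compose2[OF C1cD(2)[OF v]])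
          (auto intro!: continuous_intros)
      show ?thesis using lborel_integral_translate[OF m, of c] by (simp add: uc)
    qed
    finally have A: "(LINT z|lborel. pd j v z * (uc z - u z)) =
        (LINT z|lborel. v z * pd j u z) - (LINT z|lborel. v (z - c) * pd j u z)"
      by (simp add: algebra_simps eq_diff_eq)
    have cvc: "continuous_on UNIV (\<lambda>z. v (z - c))"
      by (rule continuous_on_compose2[OF C1cD(2)[OF v]]) (auto intro!: continuous_intros)
    have "integrable lborel (\<lambda>z. v z * pd j u z)" "integrable lborel (\<lambda>z. v (z - c) * pd j u z)"
      by (intro C0c_integrable C0c_mult(1) C1c_C0c(1) u v cs) (intro C0c_integrable C0c_mult(2) C1c_C0c(2) cvc u)
    then have A': "(LINT z|lborel. pd j v z * (uc z - u z)) = (LINT z|lborel. (v z - v (z - c)) * pd j u z)"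
      unfolding A by (simp add: left_diff_distrib)
    have "(LINT z|lborel. (u (z + c) - u z) / ?H * pd j v z) = (LINT z|lborel. pd j v z * (uc z - u z)) / ?H"
      unfolding uc_def by (subst integral_divide_zero[symmetric]) (simp add: field_simps)
    also have "\<dots> = (LINT z|lborel. (v (z - c) - v z) / (- ?H) * pd j u z)"
      unfolding A' by (subst integral_divide_zero[symmetric])
        (intro Bochner_Integration.integral_cong refl, use h(2)[of n] in \<open>simp add: field_simps\<close>)
    finally show ?thesis by (simp add: c_def)
  qed
  with 1 2 have "(LINT z|lborel. pd i u z * pd j v z) = (LINT z|lborel. pd i v z * pd j u z)"
    using LIMSEQ_unique by auto
  then show ?thesis by (simp add: mult.commute)
qed

lemma C1c_del_C0c:
  assumes "C1c u"
  shows "C0c (del u)" "C0c (dbar u)"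
proof -
  have "C0c (\<lambda>z. (1/2) * (pd Xdir u z - \<i> * pd Ydir u z))" "C0c (\<lambda>z. (1/2) * (pd Xdir u z + \<i> * pd Ydir u z))"
    by (intro C0c_cmult C0c_diff C0c_add C1c_C0c assms)+
  then show "C0c (del u)" "C0c (dbar u)" by (auto simp: del_def dbar_def fun_eq_iff cong: C0c_def)
qed

lemma del_cnj:
  assumes "C1c u"
  shows "del (\<lambda>z. cnj (u z)) z = cnj (dbar u z)" "dbar (\<lambda>z. cnj (u z)) z = cnj (del u z)"
  by (simp_all add: del_def dbar_def C1c_cnj(2)[OF assms])

lemma pd_del_dbar: "pd Xdir u z = del u z + dbar u z" "pd Ydir u z = \<i> * (del u z - dbar u z)"
  by (simp_all add: del_def dbar_def field_simps)

lemma integral_del_eq_0: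
  assumes "C1c u"
  shows "(LINT z|lborel. del u z) = 0"
  using integral_pd_eq_0[OF assms] C0c_integrable[OF C1c_C0c(2)[OF assms]] by (simp add: del_def)

lemma integral_del_dbar:
  assumes u: "C1c u" and v: "C1c v"
  shows "(LINT z|lborel. del u z * dbar v z - dbar u z * del v z) = 0"
proof -
  have i: "integrable lborel (\<lambda>z. pd i u z * pd j v z)" for i j
    by (intro C0c_integrable C0c_mult C1c_C0c u C1cD v)
  have eq: "del u z * dbar v z - dbar u z * del v z = (\<i>/2) * (pd Xdir u z * pd Ydir v z - pd Ydir u z * pd Xdir v z)" for z
    by (simp add: del_def dbar_def field_simps)
  show ?thesis unfolding eq using i integral_curl[OF u v, of Xdir Ydir] by simp
qed

section \<open>The weighted Bochner--Kodaira identity\<close>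

definition wt :: "real \<Rightarrow> complex \<Rightarrow> complex" where
  "wt \<nu> z = of_real (bdf z powr \<nu>)"

lemma bdf_pos: "z \<in> ball 0 1 \<Longrightarrow> 0 < bdf z"
  by (simp add: bdf_def power_less_one_iff)

lemma bdf_nonneg: "z \<in> disk \<Longrightarrow> 0 \<le> bdf z"
  by (simp add: bdf_def power_le_one)

lemma bdf_le_1: "bdf z \<le> 1"
  by (simp add: bdf_def)

lemma continuous_on_bdf: "continuous_on S bdf"
  unfolding bdf_def by (intro continuous_intros)

lemma wt_has_derivative:
  assumes "z \<in> ball 0 1"
  shows "(wt \<nu> has_derivative (\<lambda>v. of_real (\<nu> * bdf z powr (\<nu> - 1) * (- 2 * (Re z * Re v + Im z * Im v))))) (at z)"
proof -
  have eq: "bdf = (\<lambda>z. 1 - (Re z)\<^sup>2 - (Im z)\<^sup>2)" by (simp add: bdf_def fun_eq_iff cmod_power2)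
  have 1: "(bdf has_derivative (\<lambda>v. - 2 * (Re z * Re v + Im z * Im v))) (at z)"
    unfolding eq by (auto intro!: derivative_eq_intros simp: algebra_simps)
  have "((\<lambda>x. x powr \<nu>) has_real_derivative \<nu> * bdf z powr (\<nu> - 1)) (at (bdf z))"
    by (rule has_real_derivative_powr[OF bdf_pos[OF assms]])
  from has_derivative_compose[OF 1 this[unfolded has_field_derivative_def]]
  have "((\<lambda>z. bdf z powr \<nu>) has_derivative (\<lambda>v. \<nu> * bdf z powr (\<nu> - 1) * (- 2 * (Re z * Re v + Im z * Im v)))) (at z)" .
  from has_derivative_of_real[OF this] show ?thesis by (simp add: wt_def[abs_def])
qed

lemma wt_pd:
  assumes "z \<in> ball 0 1"
  shows "wt \<nu> differentiable at z" "pd i (wt \<nu>) z = of_real (- 2 * \<nu> * coord i z) * wt (\<nu> - 1) z"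
  using wt_has_derivative[OF assms] pd_eqI[OF wt_has_derivative[OF assms]]
  by (auto simp: differentiable_def wt_def) (cases i; simp)

lemma continuous_on_wt: "continuous_on (ball 0 1) (wt \<nu>)"
  using wt_pd(1) by (intro differentiable_imp_continuous_on) (simp add: differentiable_on_def differentiable_at_withinI)

lemma continuous_on_coord: "continuous_on S (coord i)"
proof -
  have "coord i = (if i = Xdir then Re else Im)" by (cases i) (auto simp: fun_eq_iff)
  then show ?thesis by (auto intro!: continuous_intros)
qed

lemma continuous_on_pd_wt: "continuous_on (ball 0 1) (pd i (wt \<nu>))"
proof -
  have "continuous_on (ball 0 1) (\<lambda>z. of_real (- 2 * \<nu> * coord i z) * wt (\<nu> - 1) z)"
    by (intro continuous_intros continuous_on_wt continuous_on_coord)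
  then show ?thesis by (rule continuous_on_eq) (use wt_pd(2) in auto)
qed

lemma del_wt:
  assumes "z \<in> ball 0 1"
  shows "del (wt \<nu>) z = - of_real \<nu> * cnj z * wt (\<nu> - 1) z" "dbar (wt \<nu>) z = - of_real \<nu> * z * wt (\<nu> - 1) z"
  unfolding del_def dbar_def wt_pd(2)[OF assms]
  by (simp_all add: complex_eq_iff field_simps)

lemma wt_mult: "z \<in> ball 0 1 \<Longrightarrow> wt a z * wt b z = wt (a + b) z"
  by (simp add: wt_def powr_add)

lemma wt_1: "z \<in> ball 0 1 \<Longrightarrow> wt 1 z = of_real (bdf z)"
  using bdf_pos[of z] by (simp add: wt_def)

lemma wt_step:
  assumes "z \<in> ball 0 1"
  shows "wt (\<nu> - 1) z = of_real (bdf z) * wt (\<nu> - 2) z"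
    "wt \<nu> z = of_real (bdf z) * (of_real (bdf z) * wt (\<nu> - 2) z)"
  using wt_mult[OF assms, of 1 "\<nu> - 2"] wt_mult[OF assms, of 1 "\<nu> - 1"] wt_1[OF assms] by simp_all

lemma bdf_complex: "complex_of_real (bdf z) = 1 - z * cnj z"
  by (simp only: bdf_def of_real_diff of_real_1 complex_norm_square)

lemma C1c_mult_wt:
  assumes "C1c u"
  shows "C1c (\<lambda>z. u z * wt \<nu> z)"
    "z \<in> ball 0 1 \<Longrightarrow> del (\<lambda>z. u z * wt \<nu> z) z = del u z * wt \<nu> z - of_real \<nu> * u z * cnj z * wt (\<nu> - 1) z"
    "z \<in> ball 0 1 \<Longrightarrow> dbar (\<lambda>z. u z * wt \<nu> z) z = dbar u z * wt \<nu> z - of_real \<nu> * u z * z * wt (\<nu> - 1) z"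
proof -
  note * = C1c_mult_local[of u "wt \<nu>", OF assms wt_pd(1) continuous_on_pd_wt]
  show "C1c (\<lambda>z. u z * wt \<nu> z)" by (rule *)
  have eq: "pd i (\<lambda>z. u z * wt \<nu> z) z = pd i u z * wt \<nu> z + u z * pd i (wt \<nu>) z" for i
    by (rule *)
  have "del (\<lambda>z. u z * wt \<nu> z) z = del u z * wt \<nu> z + u z * del (wt \<nu>) z"
       "dbar (\<lambda>z. u z * wt \<nu> z) z = dbar u z * wt \<nu> z + u z * dbar (wt \<nu>) z"
    unfolding del_def dbar_def eq by (simp_all add: field_simps)
  then show "z \<in> ball 0 1 \<Longrightarrow> del (\<lambda>z. u z * wt \<nu> z) z = del u z * wt \<nu> z - of_real \<nu> * u z * cnj z * wt (\<nu> - 1) z"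
    "z \<in> ball 0 1 \<Longrightarrow> dbar (\<lambda>z. u z * wt \<nu> z) z = dbar u z * wt \<nu> z - of_real \<nu> * u z * z * wt (\<nu> - 1) z"
    by (simp_all add: del_wt algebra_simps)
qed

lemma C1c_mult_z:
  assumes "C1c u"
  shows "C1c (\<lambda>z. u z * z)" "del (\<lambda>z. u z * z) z = del u z * z + u z"
proof -
  have d: "(\<lambda>z::complex. z) differentiable at z" for z by simp
  have p: "pd i (\<lambda>z. z) z = unit_vec i" for i z
    using pd_eqI[OF has_derivative_ident, of i z] .
  have "continuous_on (ball 0 1) (pd i (\<lambda>z. z))" for i
    unfolding p by (rule continuous_on_const)
  note * = C1c_mult_local[OF assms d this]
  show "C1c (\<lambda>z. u z * z)" by (rule *)
  show "del (\<lambda>z. u z * z) z = del u z * z + u z"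
    unfolding del_def *(2) p by (simp add: field_simps)
qed

text \<open>
  Without weight, \<open>\<partial>u\<close> and \<open>\<partial>bar u\<close> have the same norm, since \<open>du \<and> d(cnj u)\<close> is exact. The difference of
  the weighted norms comes from the derivative of the weight.
\<close>

lemma integral_del_sq:
  assumes u: "C1c u"
  shows "(LINT z|lborel. of_real ((cmod (del u z))\<^sup>2) * wt \<nu> z) - (LINT z|lborel. of_real ((cmod (dbar u z))\<^sup>2) * wt \<nu> z)
    = of_real \<nu> * (LINT z|lborel. cnj (u z) * (z * del u z - cnj z * dbar u z) * wt (\<nu> - 1) z)"
proof -
  define v where "v z = cnj (u z) * wt \<nu> z" for z
  have v: "C1c v" unfolding v_def by (intro C1c_mult_wt C1c_cnj u)
  have cs: "C0c (\<lambda>z. of_real ((cmod (del u z))\<^sup>2) * wt \<nu> z)" "C0c (\<lambda>z. of_real ((cmod (dbar u z))\<^sup>2) * wt \<nu> z)"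
    "C0c (\<lambda>z. cnj (u z) * (z * del u z - cnj z * dbar u z) * wt (\<nu> - 1) z)"
    unfolding complex_norm_square
    by (intro C0c_mult_ball continuous_on_wt C0c_mult C1c_del_C0c C0c_cnj C1c_C0c u continuous_intros C0c_cont)+
  have "0 = (LINT z|lborel. del u z * dbar v z - dbar u z * del v z)"
    using integral_del_dbar[OF u v] by simp
  also have "\<dots> = (LINT z|lborel. of_real ((cmod (del u z))\<^sup>2) * wt \<nu> z - of_real ((cmod (dbar u z))\<^sup>2) * wt \<nu> z
       - of_real \<nu> * (cnj (u z) * (z * del u z - cnj z * dbar u z) * wt (\<nu> - 1) z))"
  proof (rule Bochner_Integration.integral_cong[OF refl])
    fix z
    show "del u z * dbar v z - dbar u z * del v z = of_real ((cmod (del u z))\<^sup>2) * wt \<nu> z - of_real ((cmod (dbar u z))\<^sup>2) * wt \<nu> z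
       - of_real \<nu> * (cnj (u z) * (z * del u z - cnj z * dbar u z) * wt (\<nu> - 1) z)"
    proof (cases "z \<in> ball 0 1")
      case True
      show ?thesis unfolding v_def C1c_mult_wt(2,3)[OF C1c_cnj(1)[OF u] True] del_cnj[OF u] complex_norm_square
        by (simp add: algebra_simps)
    next
      case False
      then show ?thesis using C1c_del_C0c[OF u] C1c_C0c(1)[OF u] by (simp add: C0c_zero_outside)
    qed
  qed
  also have "\<dots> = (LINT z|lborel. of_real ((cmod (del u z))\<^sup>2) * wt \<nu> z) - (LINT z|lborel. of_real ((cmod (dbar u z))\<^sup>2) * wt \<nu> z)
     - of_real \<nu> * (LINT z|lborel. cnj (u z) * (z * del u z - cnj z * dbar u z) * wt (\<nu> - 1) z)"
    using cs[THEN C0c_integrable] by (simp only: Bochner_Integration.integral_diff Bochner_Integration.integrable_diff integrable_mult_right integral_mult_right_zero simp_thms)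
  finally show ?thesis by simp
qed

text \<open>
  The pointwise identity that completes the square. Primed letters stand for complex conjugates and \<open>D\<close> for
  \<open>1 - z z'\<close>; the right-hand side then vanishes.
\<close>

lemma Bochner_Kodaira_algebra:
  fixes a b s a' b' s' c z z' D n :: "'a::comm_ring_1"
  shows "(D * b - n * z * s) * (D * b' - n * z' * s') * c - b * b' * (D * (D * c)) - n * (s * s' * c)
          + n * (((a * s' + s * b') * (D * c) - (n - 1) * (s * s') * z' * c) * z + s * s' * (D * c))
          - n * (s' * (z * a - z' * b) * (D * c)) = n * s * s' * c * (z * z' + D - 1)"
  by (simp add: algebra_simps)

text \<open>
  The weighted Bochner--Kodaira identity for the weight \<open>d\<^sup>\<nu>\<close>, where \<open>d\<close> is \<open>bdf\<close>: completing the square in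
  \<open>integral_del_sq\<close> leaves \<open>- \<nu> d\<^sup>\<nu>\<^sup>-\<^sup>2\<close>, which is \<open>d\<^sup>\<nu>\<close> times \<open>\<partial>\<partial>bar\<close> of \<open>\<nu> log d\<close>.
\<close>

lemma Bochner_Kodaira:
  assumes u: "C1c u"
  shows "(LINT z|lborel. of_real ((cmod (del u z))\<^sup>2) * wt \<nu> z) =
      (LINT z|lborel. of_real ((cmod (of_real (bdf z) * dbar u z - of_real \<nu> * z * u z))\<^sup>2) * wt (\<nu> - 2) z)
      - of_real \<nu> * (LINT z|lborel. of_real ((cmod (u z))\<^sup>2) * wt (\<nu> - 2) z)"
proof -
  \<comment> \<open>The cross terms of the square are the total derivative \<open>\<partial>F\<close>, up to a zero-order term.\<close>
  define F where "F z = (u z * cnj (u z) * wt (\<nu> - 1) z) * z" for z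
  have uu: "C1c (\<lambda>z. u z * cnj (u z))" by (intro C1c_mult C1c_cnj u)
  have duu: "del (\<lambda>z. u z * cnj (u z)) z = del u z * cnj (u z) + u z * cnj (dbar u z)" for z
    unfolding del_def C1c_mult(2)[OF u C1c_cnj(1)[OF u]] C1c_cnj(2)[OF u] by (simp add: dbar_def field_simps)
  have F: "C1c F" unfolding F_def by (intro C1c_mult_z C1c_mult_wt uu)
  note cb = continuous_on_wt continuous_on_bdf
  have cs: "C0c (\<lambda>z. of_real ((cmod (del u z))\<^sup>2) * wt \<nu> z)" "C0c (\<lambda>z. of_real ((cmod (dbar u z))\<^sup>2) * wt \<nu> z)"
    "C0c (\<lambda>z. of_real ((cmod (u z))\<^sup>2) * wt (\<nu> - 2) z)"
    "C0c (\<lambda>z. cnj (u z) * (z * del u z - cnj z * dbar u z) * wt (\<nu> - 1) z)"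
    "C0c (\<lambda>z. of_real ((cmod (of_real (bdf z) * dbar u z - of_real \<nu> * z * u z))\<^sup>2) * wt (\<nu> - 2) z)"
    "C0c (del F)"
    unfolding complex_norm_square
    by (intro C0c_mult_ball cb C0c_mult C1c_del_C0c C0c_cnj C0c_diff C1c_C0c u F continuous_intros C0c_cont)+
  let ?I = "\<lambda>f. LINT z|lborel. f z"
  have "?I (\<lambda>z. of_real \<nu> * (cnj (u z) * (z * del u z - cnj z * dbar u z) * wt (\<nu> - 1) z)) =
    ?I (\<lambda>z. of_real ((cmod (of_real (bdf z) * dbar u z - of_real \<nu> * z * u z))\<^sup>2) * wt (\<nu> - 2) z
       - of_real ((cmod (dbar u z))\<^sup>2) * wt \<nu> z - of_real \<nu> * (of_real ((cmod (u z))\<^sup>2) * wt (\<nu> - 2) z) + of_real \<nu> * del F z)"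
  proof (rule Bochner_Integration.integral_cong[OF refl])
    fix z
    show "of_real \<nu> * (cnj (u z) * (z * del u z - cnj z * dbar u z) * wt (\<nu> - 1) z) =
       of_real ((cmod (of_real (bdf z) * dbar u z - of_real \<nu> * z * u z))\<^sup>2) * wt (\<nu> - 2) z
       - of_real ((cmod (dbar u z))\<^sup>2) * wt \<nu> z - of_real \<nu> * (of_real ((cmod (u z))\<^sup>2) * wt (\<nu> - 2) z) + of_real \<nu> * del F z"
    proof (cases "z \<in> ball 0 1")
      case True
      define a b s c where "a = del u z" and "b = dbar u z" and "s = u z" and "c = wt (\<nu> - 2) z"
      have F': "del F z = ((a * cnj s + s * cnj b) * wt (\<nu> - 1) z - of_real (\<nu> - 1) * (s * cnj s) * cnj z * wt (\<nu> - 2) z) * z + s * cnj s * wt (\<nu> - 1) z"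
        unfolding F_def C1c_mult_z(2)[OF C1c_mult_wt(1)[OF uu]] C1c_mult_wt(2)[OF uu True] duu
        by (simp add: a_def b_def s_def)
      define D n where "D = complex_of_real (bdf z)" and "n = complex_of_real \<nu>"
      have real: "cnj D = D" "cnj n = n" by (simp_all add: D_def n_def)
      have D: "z * cnj z + D - 1 = 0" by (simp add: D_def bdf_complex)
      note Bochner_Kodaira_algebra[of D b n z s "cnj b" "cnj z" "cnj s" c a, unfolded D mult_zero_right]
      from this[THEN eq_iff_diff_eq_0[THEN iffD2], symmetric]
      show ?thesis
        unfolding F' wt_step[OF True, of \<nu>] a_def[symmetric] b_def[symmetric] s_def[symmetric] c_def[symmetric]
          complex_norm_square complex_cnj_diff complex_cnj_mult complex_cnj_complex_of_real of_real_diff of_real_1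
          D_def[symmetric] n_def[symmetric] real .
    next
      case False
      then show ?thesis using C1c_del_C0c[OF u] C1c_C0c(1)[OF u] C1c_del_C0c[OF F] by (simp add: C0c_zero_outside)
    qed
  qed
  also have "\<dots> = ?I (\<lambda>z. of_real ((cmod (of_real (bdf z) * dbar u z - of_real \<nu> * z * u z))\<^sup>2) * wt (\<nu> - 2) z)
       - ?I (\<lambda>z. of_real ((cmod (dbar u z))\<^sup>2) * wt \<nu> z) - of_real \<nu> * ?I (\<lambda>z. of_real ((cmod (u z))\<^sup>2) * wt (\<nu> - 2) z) + of_real \<nu> * ?I (del F)"
    using cs[THEN C0c_integrable]
    by (simp only: Bochner_Integration.integral_diff Bochner_Integration.integral_add Bochner_Integration.integrable_diff integrable_mult_right integral_mult_right_zero simp_thms)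
  finally show ?thesis
    using integral_del_sq[OF u, of \<nu>] integral_del_eq_0[OF F]
    by (simp only: integral_mult_right_zero) (simp add: algebra_simps)
qed

section \<open>Hardy inequalities\<close>

lemma sets_wmeas [simp]: "sets (wmeas \<gamma>) = sets (lebesgue_on disk)"
  and space_wmeas [simp]: "space (wmeas \<gamma>) = disk"
  by (simp_all add: wmeas_def)

lemma measurable_wmeas: "borel_measurable (wmeas \<gamma>) = borel_measurable (lebesgue_on disk)"
  by (rule measurable_cong_sets) simp_all

lemma L2_eq_sqint: "L2 \<gamma> = sqint (wmeas \<gamma>)"
  by (simp add: L2_def sqint_def measurable_wmeas)

lemma L2norm_eq_sqnorm: "L2norm \<gamma> = sqnorm (wmeas \<gamma>)"
  by (simp add: L2norm_def sqnorm_def fun_eq_iff)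

lemma borel_imp_lebesgue_on: "f \<in> borel_measurable borel \<Longrightarrow> f \<in> borel_measurable (lebesgue_on S)"
  by (simp add: measurable_completion measurable_restrict_space1)

lemma borel_measurable_bdf: "bdf \<in> borel_measurable borel"
  unfolding bdf_def by measurable

lemma borel_measurable_bdf_powr: "(\<lambda>z. bdf z powr \<gamma>) \<in> borel_measurable borel"
  using borel_measurable_bdf by measurable

lemma bdf_powr_lebesgue_on: "(\<lambda>z. bdf z powr \<gamma>) \<in> borel_measurable (lebesgue_on S)"
  by (rule borel_imp_lebesgue_on[OF borel_measurable_bdf_powr])

lemma null_sphere: "AE z in lebesgue_on disk. z \<in> ball 0 1"
proof -
  have "sphere 0 1 \<in> null_sets (lebesgue :: complex measure)"
    using negligible_sphere[of "0::complex" 1] by (simp add: negligible_iff_null_sets)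
  then have "AE z in lebesgue. z \<notin> sphere (0::complex) 1" by (rule AE_not_in)
  then show ?thesis by (subst AE_restrict_space_iff) (auto elim: eventually_mono)
qed

lemma AE_wmeas: "(AE z in wmeas \<gamma>. P z) \<longleftrightarrow> (AE z in lebesgue_on disk. P z)"
proof -
  have "(AE z in wmeas \<gamma>. P z) \<longleftrightarrow> (AE z in lebesgue_on disk. 0 < ennreal (bdf z powr \<gamma>) \<longrightarrow> P z)"
    unfolding wmeas_def by (rule AE_density) (simp add: bdf_powr_lebesgue_on)
  also have "\<dots> \<longleftrightarrow> (AE z in lebesgue_on disk. P z)"
  proof
    assume "AE z in lebesgue_on disk. 0 < ennreal (bdf z powr \<gamma>) \<longrightarrow> P z"
    with null_sphere show "AE z in lebesgue_on disk. P z"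
    proof eventually_elim
      fix z :: complex assume "z \<in> ball 0 1" and P: "0 < ennreal (bdf z powr \<gamma>) \<longrightarrow> P z"
      then have "0 < bdf z powr \<gamma>" using bdf_pos[of z] by simp
      with P show "P z" by simp
    qed
  qed (auto elim: eventually_mono)
  finally show ?thesis .
qed

lemma
  fixes f :: "complex \<Rightarrow> 'b :: {banach, second_countable_topology}"
  assumes "f \<in> borel_measurable (lebesgue_on disk)"
  shows integrable_wmeas: "integrable (wmeas \<gamma>) f \<longleftrightarrow> integrable (lebesgue_on disk) (\<lambda>z. (bdf z powr \<gamma>) *\<^sub>R f z)"
    and integral_wmeas: "(LINT z|wmeas \<gamma>. f z) = (LINT z|lebesgue_on disk. (bdf z powr \<gamma>) *\<^sub>R f z)"
  unfolding wmeas_def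
  by (rule integrable_density integral_density; use assms bdf_powr_lebesgue_on in auto)+

lemma
  fixes f :: "complex \<Rightarrow> 'b :: {banach, second_countable_topology}"
  assumes "f \<in> borel_measurable borel" "\<And>z. z \<notin> ball 0 1 \<Longrightarrow> f z = 0"
  shows integrable_disk_lborel: "integrable (lebesgue_on disk) f \<longleftrightarrow> integrable lborel f"
    and integral_disk_lborel: "(LINT z|lebesgue_on disk. f z) = (LINT z|lborel. f z)"
proof -
  have eq: "(\<lambda>z. indicator disk z *\<^sub>R f z) = f"
    using assms(2) by (force simp: indicator_def fun_eq_iff)
  show "integrable (lebesgue_on disk) f \<longleftrightarrow> integrable lborel f"
    using assms(1) by (subst integrable_restrict_space) (simp_all add: eq integrable_completion)
  show "(LINT z|lebesgue_on disk. f z) = (LINT z|lborel. f z)"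
    using assms(1) by (subst integral_restrict_space) (simp_all add: eq integral_completion)
qed

lemma C0c_borel: "C0c f \<Longrightarrow> f \<in> borel_measurable borel"
  by (simp add: C0c_def borel_measurable_continuous_onI)

lemma C0c_wmeas:
  assumes "C0c f"
  shows "integrable (wmeas \<nu>) f" "(LINT z|wmeas \<nu>. f z) = (LINT z|lborel. f z * wt \<nu> z)"
proof -
  have w: "C0c (\<lambda>z. f z * wt \<nu> z)" by (intro C0c_mult_ball assms continuous_on_wt)
  note b = C0c_borel[OF w] C0c_zero_outside[OF w]
  have eq: "(bdf z powr \<nu>) *\<^sub>R f z = f z * wt \<nu> z" for z
    by (simp add: wt_def scaleR_conv_of_real)
  show "integrable (wmeas \<nu>) f" "(LINT z|wmeas \<nu>. f z) = (LINT z|lborel. f z * wt \<nu> z)"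
    using integrable_wmeas[OF borel_imp_lebesgue_on[OF C0c_borel[OF assms]], of \<nu>]
      integral_wmeas[OF borel_imp_lebesgue_on[OF C0c_borel[OF assms]], of \<nu>]
      integrable_disk_lborel[OF b] integral_disk_lborel[OF b] C0c_integrable[OF w]
    unfolding eq by simp_all
qed

lemma C0c_sqint:
  assumes "C0c f"
  shows "f \<in> sqint (wmeas \<nu>)"
    "of_real ((sqnorm (wmeas \<nu>) f)\<^sup>2) = (LINT z|lborel. of_real ((cmod (f z))\<^sup>2) * wt \<nu> z)"
proof -
  have c: "C0c (\<lambda>z. complex_of_real ((cmod (f z))\<^sup>2))"
    unfolding complex_norm_square by (intro C0c_mult C0c_cnj C0c_cont assms)
  show "f \<in> sqint (wmeas \<nu>)"
    unfolding sqint_def measurable_wmeas using borel_imp_lebesgue_on[OF C0c_borel[OF assms]]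
      integrable_Re[OF C0c_wmeas(1)[OF c]] by simp
  have "of_real ((sqnorm (wmeas \<nu>) f)\<^sup>2) = (LINT z|wmeas \<nu>. complex_of_real ((cmod (f z))\<^sup>2))"
    unfolding sqnorm_sq by (rule integral_complex_of_real[symmetric])
  also have "\<dots> = (LINT z|lborel. of_real ((cmod (f z))\<^sup>2) * wt \<nu> z)" by (rule C0c_wmeas(2)[OF c])
  finally show "of_real ((sqnorm (wmeas \<nu>) f)\<^sup>2) = (LINT z|lborel. of_real ((cmod (f z))\<^sup>2) * wt \<nu> z)" .
qed

lemma C0c_mult_bdf: "C0c f \<Longrightarrow> C0c (\<lambda>z. of_real (bdf z) * f z)"
  by (rule C0c_mult) (auto intro!: continuous_intros continuous_on_bdf)

lemma sqnorm_bdf_mult: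
  assumes "C0c f"
  shows "sqnorm (wmeas (\<nu> - 2)) (\<lambda>z. of_real (bdf z) * f z) = sqnorm (wmeas \<nu>) f"
proof -
  have "complex_of_real ((sqnorm (wmeas (\<nu> - 2)) (\<lambda>z. of_real (bdf z) * f z))\<^sup>2) = of_real ((sqnorm (wmeas \<nu>) f)\<^sup>2)"
    unfolding C0c_sqint(2)[OF C0c_mult_bdf[OF assms]] C0c_sqint(2)[OF assms]
  proof (rule Bochner_Integration.integral_cong[OF refl])
    fix z
    show "of_real ((cmod (of_real (bdf z) * f z))\<^sup>2) * wt (\<nu> - 2) z = of_real ((cmod (f z))\<^sup>2) * wt \<nu> z"
    proof (cases "z \<in> ball 0 1")
      case True
      show ?thesis unfolding wt_step(2)[OF True, of \<nu>] complex_norm_square by simp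
    qed (simp add: C0c_zero_outside[OF assms])
  qed
  then have "(sqnorm (wmeas (\<nu> - 2)) (\<lambda>z. of_real (bdf z) * f z))\<^sup>2 = (sqnorm (wmeas \<nu>) f)\<^sup>2"
    by (simp only: of_real_eq_iff)
  then show ?thesis by (simp add: power2_eq_iff_nonneg)
qed

lemma Hardy_negative_exponent:
  assumes u: "C1c u" and "\<nu> < 0"
  shows "sqrt (- \<nu>) * sqnorm (wmeas (\<nu> - 2)) u \<le> sqnorm (wmeas \<nu>) (del u)"
proof -
  define G where "G z = of_real (bdf z) * dbar u z - of_real \<nu> * z * u z" for z
  have G: "C0c G" unfolding G_def mult.assoc
    by (intro C0c_diff C0c_cmult C0c_mult_bdf C1c_del_C0c u C0c_mult(2) C1c_C0c continuous_intros)
  have "complex_of_real ((sqnorm (wmeas \<nu>) (del u))\<^sup>2) = of_real ((sqnorm (wmeas (\<nu> - 2)) G)\<^sup>2)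
     - of_real \<nu> * of_real ((sqnorm (wmeas (\<nu> - 2)) u)\<^sup>2)"
    unfolding C0c_sqint(2)[OF G] C0c_sqint(2)[OF C1c_C0c(1)[OF u]] C0c_sqint(2)[OF C1c_del_C0c(1)[OF u]]
      Bochner_Kodaira[OF u] G_def ..
  then have "(sqnorm (wmeas \<nu>) (del u))\<^sup>2 = (sqnorm (wmeas (\<nu> - 2)) G)\<^sup>2 - \<nu> * (sqnorm (wmeas (\<nu> - 2)) u)\<^sup>2"
    by (simp only: of_real_eq_iff flip: of_real_mult of_real_diff)
  then have "(- \<nu>) * (sqnorm (wmeas (\<nu> - 2)) u)\<^sup>2 \<le> (sqnorm (wmeas \<nu>) (del u))\<^sup>2" by simp
  then have "(sqrt (- \<nu>) * sqnorm (wmeas (\<nu> - 2)) u)\<^sup>2 \<le> (sqnorm (wmeas \<nu>) (del u))\<^sup>2"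
    using \<open>\<nu> < 0\<close> by (simp add: power_mult_distrib)
  then show ?thesis by (rule power2_le_imp_le) simp
qed

lemma continuous_mult_sqnorm_le:
  assumes "C0c f" "continuous_on UNIV g" "\<And>z. z \<in> ball 0 1 \<Longrightarrow> cmod (g z) \<le> 1"
  shows "sqnorm (wmeas \<nu>) (\<lambda>z. g z * f z) \<le> sqnorm (wmeas \<nu>) f"
proof (rule sqnorm_mono(2)[OF C0c_sqint(1)[OF assms(1)]])
  show "(\<lambda>z. g z * f z) \<in> borel_measurable (wmeas \<nu>)"
    by (rule sqintD[OF C0c_sqint(1)[OF C0c_mult(2)[OF assms(1,2)]]])
  show "AE z in wmeas \<nu>. cmod (g z * f z) \<le> cmod (f z)"
  proof (rule AE_I2)
    fix z
    show "cmod (g z * f z) \<le> cmod (f z)"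
    proof (cases "z \<in> ball 0 1")
      case True
      then show ?thesis using assms(3)[OF True] by (simp add: norm_mult mult_left_le_one_le)
    qed (use C0c_zero_outside[OF assms(1)] in simp)
  qed
qed

text \<open>
  The Hardy inequality for exponents \<open>\<mu> < 1\<close>, by the twisting of Donnelly and Fefferman:
  \<open>Hardy_negative_exponent\<close>, applied to \<open>d u\<close> with exponent \<open>\<mu> - 2 < 0\<close>, has constant \<open>sqrt (2 - \<mu>)\<close>, and
  the error from differentiating the factor \<open>d\<close> costs at most \<open>1\<close>.
\<close>

lemma Hardy:
  assumes u: "C1c u" and "\<mu> < 1"
  shows "(sqrt (2 - \<mu>) - 1) * sqnorm (wmeas (\<mu> - 2)) u \<le> sqnorm (wmeas \<mu>) (del u)"
proof -
  let ?M = "wmeas (\<mu> - 2)"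
  define v where "v z = u z * wt 1 z" for z
  have v: "C1c v" unfolding v_def by (rule C1c_mult_wt(1)[OF u])
  have c1: "C0c (\<lambda>z. of_real (bdf z) * del u z)" by (intro C0c_mult_bdf C1c_del_C0c u)
  have c2: "C0c (\<lambda>z. (- cnj z) * u z)" by (intro C0c_mult C1c_C0c u continuous_intros)
  have dv: "del v z = of_real (bdf z) * del u z + (- cnj z) * u z" for z
  proof (cases "z \<in> ball 0 1")
    case True
    then have "wt 0 z = 1" using bdf_pos[OF True] by (simp add: wt_def)
    then show ?thesis unfolding v_def C1c_mult_wt(2)[OF u True] by (simp add: wt_1[OF True] algebra_simps)
  qed (simp add: C0c_zero_outside[OF C1c_del_C0c(1)[OF v]] C0c_zero_outside[OF C1c_del_C0c(1)[OF u]]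
      C0c_zero_outside[OF C1c_C0c(1)[OF u]])
  have nv: "sqnorm (wmeas (\<mu> - 2 - 2)) v = sqnorm ?M u"
  proof -
    have "v = (\<lambda>z. of_real (bdf z) * u z)"
    proof
      fix z show "v z = of_real (bdf z) * u z"
        by (cases "z \<in> ball 0 1") (use C0c_zero_outside[OF C1c_C0c(1)[OF u]] in \<open>auto simp: v_def wt_1\<close>)
    qed
    then show ?thesis by (simp only: sqnorm_bdf_mult[OF C1c_C0c(1)[OF u]])
  qed
  have "sqrt (2 - \<mu>) * sqnorm ?M u \<le> sqnorm ?M (del v)"
    using Hardy_negative_exponent[OF v, of "\<mu> - 2"] \<open>\<mu> < 1\<close> unfolding nv by simp
  also have "\<dots> \<le> sqnorm ?M (\<lambda>z. of_real (bdf z) * del u z) + sqnorm ?M (\<lambda>z. (- cnj z) * u z)"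
    unfolding dv[abs_def] by (rule sqnorm_triangle) (intro C0c_sqint c1 c2)+
  also have "sqnorm ?M (\<lambda>z. of_real (bdf z) * del u z) = sqnorm (wmeas \<mu>) (del u)"
    by (rule sqnorm_bdf_mult[OF C1c_del_C0c(1)[OF u]])
  also have "sqnorm ?M (\<lambda>z. (- cnj z) * u z) \<le> sqnorm ?M u"
    by (rule continuous_mult_sqnorm_le) (auto intro!: C1c_C0c u continuous_intros)
  finally show ?thesis by (simp add: algebra_simps)
qed

text \<open>
  By \<open>integral_del_sq\<close> the squared norms \<open>X\<^sup>2\<close> of \<open>\<partial>bar u\<close> and \<open>Y\<^sup>2\<close> of \<open>\<partial>u\<close> differ by at most
  \<open>\<bar>\<mu>\<bar> N (X + Y)\<close>, where \<open>N\<close> is the norm of \<open>u\<close> for the weight \<open>d\<^sup>\<mu>\<^sup>-\<^sup>2\<close>; dividing by \<open>X + Y\<close> leaves an error that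
  the Hardy inequality bounds by \<open>Y\<close>.
\<close>

lemma dbar_le_del:
  assumes u: "C1c u" and "\<mu> < 1"
  shows "sqnorm (wmeas \<mu>) (dbar u) \<le> (1 + \<bar>\<mu>\<bar> / (sqrt (2 - \<mu>) - 1)) * sqnorm (wmeas \<mu>) (del u)"
proof -
  let ?M = "wmeas (\<mu> - 2)"
  define N where "N = sqnorm ?M u"
  define X where "X = sqnorm (wmeas \<mu>) (dbar u)"
  define Y where "Y = sqnorm (wmeas \<mu>) (del u)"
  define a where "a z = of_real (bdf z) * del u z" for z
  define b where "b z = of_real (bdf z) * dbar u z" for z
  have a: "C0c a" and b: "C0c b" unfolding a_def b_def by (intro C0c_mult_bdf C1c_del_C0c u)+
  define w where "w z = z * a z + (- cnj z) * b z" for z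
  have za: "C0c (\<lambda>z. z * a z)" and zb: "C0c (\<lambda>z. (- cnj z) * b z)" by (intro C0c_mult a b continuous_intros)+
  have w: "C0c w" unfolding w_def by (intro C0c_add za zb)
  have "sqnorm ?M w \<le> sqnorm ?M (\<lambda>z. z * a z) + sqnorm ?M (\<lambda>z. (- cnj z) * b z)"
    unfolding w_def by (rule sqnorm_triangle) (intro C0c_sqint za zb)+
  also have "sqnorm ?M (\<lambda>z. z * a z) \<le> sqnorm ?M a"
    by (rule continuous_mult_sqnorm_le) (auto intro!: a continuous_intros)
  also have "sqnorm ?M (\<lambda>z. (- cnj z) * b z) \<le> sqnorm ?M b"
    by (rule continuous_mult_sqnorm_le) (auto intro!: b continuous_intros)
  also have "sqnorm ?M a = Y" unfolding a_def Y_def by (rule sqnorm_bdf_mult[OF C1c_del_C0c(1)[OF u]])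
  also have "sqnorm ?M b = X" unfolding b_def X_def by (rule sqnorm_bdf_mult[OF C1c_del_C0c(2)[OF u]])
  finally have wXY: "sqnorm ?M w \<le> Y + X" by simp
  define J where "J = (LINT z|?M. cnj (u z) * w z)"
  have "J = (LINT z|lborel. cnj (u z) * w z * wt (\<mu> - 2) z)"
    unfolding J_def by (rule C0c_wmeas(2)) (intro C0c_mult C0c_cnj C1c_C0c u C0c_cont w)
  also have "\<dots> = (LINT z|lborel. cnj (u z) * (z * del u z - cnj z * dbar u z) * wt (\<mu> - 1) z)"
  proof (rule Bochner_Integration.integral_cong[OF refl])
    fix z
    show "cnj (u z) * w z * wt (\<mu> - 2) z = cnj (u z) * (z * del u z - cnj z * dbar u z) * wt (\<mu> - 1) z"
      by (cases "z \<in> ball 0 1")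
        (use wt_step(1)[of z \<mu>] C0c_zero_outside[OF C1c_C0c(1)[OF u], of z] in \<open>auto simp: w_def a_def b_def algebra_simps\<close>)
  qed
  finally have "complex_of_real (Y\<^sup>2 - X\<^sup>2) = of_real \<mu> * J"
    using integral_del_sq[OF u, of \<mu>]
    unfolding Y_def X_def of_real_diff C0c_sqint(2)[OF C1c_del_C0c(1)[OF u]] C0c_sqint(2)[OF C1c_del_C0c(2)[OF u]] by simp
  then have "\<bar>Y\<^sup>2 - X\<^sup>2\<bar> = \<bar>\<mu>\<bar> * cmod J"
    by (metis norm_mult norm_of_real real_norm_def)
  also have "cmod J \<le> N * (Y + X)"
  proof -
    have "cmod J \<le> sqnorm ?M (\<lambda>z. cnj (u z)) * sqnorm ?M w"
      unfolding J_def by (rule Cauchy_Schwarz_integral) (intro C0c_sqint C0c_cnj C1c_C0c u w)+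
    also have "\<dots> \<le> N * (Y + X)"
      using wXY by (simp add: N_def mult_left_mono)
    finally show ?thesis .
  qed
  finally have "X\<^sup>2 - Y\<^sup>2 \<le> \<bar>\<mu>\<bar> * (N * (Y + X))"
    by (simp add: mult_left_mono)
  then have *: "(X - Y) * (X + Y) \<le> (\<bar>\<mu>\<bar> * N) * (X + Y)"
    by (simp add: algebra_simps power2_eq_square)
  have N: "0 \<le> N" and XY: "0 \<le> X" "0 \<le> Y" by (simp_all add: N_def X_def Y_def)
  have k: "0 < sqrt (2 - \<mu>) - 1" using \<open>\<mu> < 1\<close> by simp
  have "X - Y \<le> \<bar>\<mu>\<bar> * N"
  proof (cases "X + Y = 0")
    case True
    then have "X - Y = 0" using XY by linarith
    then show ?thesis using N by simp
  next
    case False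
    then have "0 < X + Y" using XY by simp
    then show ?thesis using * mult_le_cancel_right_pos by blast
  qed
  also have "N \<le> Y / (sqrt (2 - \<mu>) - 1)"
    using Hardy[OF u \<open>\<mu> < 1\<close>] k unfolding N_def Y_def by (simp add: field_simps)
  finally have "X - Y \<le> \<bar>\<mu>\<bar> * (Y / (sqrt (2 - \<mu>) - 1))"
    by (simp add: mult_left_mono)
  then show ?thesis unfolding X_def Y_def by (simp add: field_simps)
qed

lemma sqnorm_wmeas_antimono:
  assumes "C0c f" "\<mu> \<le> \<nu>"
  shows "sqnorm (wmeas \<nu>) f \<le> sqnorm (wmeas \<mu>) f"
proof -
  note f = borel_imp_lebesgue_on[OF C0c_borel[OF assms(1)]]
  have m: "(\<lambda>z. (cmod (f z))\<^sup>2) \<in> borel_measurable (lebesgue_on disk)" using f by measurable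
  have "(LINT z|wmeas \<nu>. (cmod (f z))\<^sup>2) \<le> (LINT z|wmeas \<mu>. (cmod (f z))\<^sup>2)"
    unfolding integral_wmeas[OF m]
  proof (rule integral_mono)
    show "integrable (lebesgue_on disk) (\<lambda>z. (bdf z powr \<nu>) *\<^sub>R (cmod (f z))\<^sup>2)"
      "integrable (lebesgue_on disk) (\<lambda>z. (bdf z powr \<mu>) *\<^sub>R (cmod (f z))\<^sup>2)"
      using sqintD(2)[OF C0c_sqint(1)[OF assms(1)]] integrable_wmeas[OF m] by blast+
    fix z assume "z \<in> space (lebesgue_on disk)"
    then have "bdf z powr \<nu> \<le> bdf z powr \<mu>"
      using bdf_nonneg[of z] bdf_le_1[of z] assms(2) by (cases "bdf z = 0") (auto intro: powr_mono')
    then show "(bdf z powr \<nu>) *\<^sub>R (cmod (f z))\<^sup>2 \<le> (bdf z powr \<mu>) *\<^sub>R (cmod (f z))\<^sup>2"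
      by (simp add: mult_right_mono)
  qed
  then show ?thesis by (simp add: sqnorm_def)
qed

lemma del_controls_H1:
  assumes "\<mu> < 1"
  obtains C where "C \<ge> 0" "\<And>u. C1c u \<Longrightarrow> sqnorm (wmeas \<mu>) u \<le> C * sqnorm (wmeas \<mu>) (del u)"
    "\<And>u i. C1c u \<Longrightarrow> sqnorm (wmeas \<mu>) (pd i u) \<le> C * sqnorm (wmeas \<mu>) (del u)"
proof -
  define k where "k = 1 / (sqrt (2 - \<mu>) - 1)"
  define C where "C = 2 + \<bar>\<mu>\<bar> * k + k"
  have k: "0 < k" using assms by (simp add: k_def)
  have C: "k \<le> C" "2 + \<bar>\<mu>\<bar> * k \<le> C" "0 \<le> C" using k by (auto simp: C_def)
  have "sqnorm (wmeas \<mu>) u \<le> C * sqnorm (wmeas \<mu>) (del u)" if u: "C1c u" for u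
  proof -
    have "sqnorm (wmeas \<mu>) u \<le> sqnorm (wmeas (\<mu> - 2)) u"
      by (rule sqnorm_wmeas_antimono[OF C1c_C0c(1)[OF u]]) simp
    also have "\<dots> \<le> k * sqnorm (wmeas \<mu>) (del u)"
      using Hardy[OF u assms] assms by (simp add: k_def field_simps)
    also have "\<dots> \<le> C * sqnorm (wmeas \<mu>) (del u)" by (intro mult_right_mono C) simp
    finally show ?thesis .
  qed
  moreover have "sqnorm (wmeas \<mu>) (pd i u) \<le> C * sqnorm (wmeas \<mu>) (del u)" if u: "C1c u" for u i
  proof -
    obtain c where c: "cmod c = 1" and p: "pd i u = (\<lambda>z. (if i = Xdir then 1 else \<i>) * del u z + c * dbar u z)"
    proof (cases i)
      case Xdir then show ?thesis using that[of 1] by (auto simp: pd_del_dbar fun_eq_iff)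
    next
      case Ydir then show ?thesis using that[of "-\<i>"] by (auto simp: pd_del_dbar fun_eq_iff algebra_simps)
    qed
    have "sqnorm (wmeas \<mu>) (pd i u) \<le> sqnorm (wmeas \<mu>) (\<lambda>z. (if i = Xdir then 1 else \<i>) * del u z) + sqnorm (wmeas \<mu>) (\<lambda>z. c * dbar u z)"
      unfolding p by (rule sqnorm_triangle) (intro sqint_scale C0c_sqint C1c_del_C0c u)+
    also have "\<dots> = sqnorm (wmeas \<mu>) (del u) + sqnorm (wmeas \<mu>) (dbar u)"
      unfolding sqnorm_scale c by simp
    also have "\<dots> \<le> sqnorm (wmeas \<mu>) (del u) + (1 + \<bar>\<mu>\<bar> * k) * sqnorm (wmeas \<mu>) (del u)"
      using dbar_le_del[OF u assms] by (simp add: k_def)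
    also have "\<dots> = (2 + \<bar>\<mu>\<bar> * k) * sqnorm (wmeas \<mu>) (del u)" by (simp add: algebra_simps)
    also have "\<dots> \<le> C * sqnorm (wmeas \<mu>) (del u)" by (intro mult_right_mono C) simp
    finally show ?thesis .
  qed
  ultimately show ?thesis using that C by blast
qed

section \<open>The weighted Sobolev space\<close>

lemma foldr_pd_add:
  assumes "smooth u" "smooth v"
  shows "foldr pd I (\<lambda>z. u z + v z) = (\<lambda>z. foldr pd I u z + foldr pd I v z)"
proof (induction I)
  case (Cons i I)
  have "foldr pd I u differentiable at z" "foldr pd I v differentiable at z" for z
    using assms by (simp_all add: smooth_def)
  then show ?case by (simp add: Cons pd_add fun_eq_iff)
qed simp

lemma foldr_pd_cmult:
  assumes "smooth u"
  shows "foldr pd I (\<lambda>z. c * u z) = (\<lambda>z. c * foldr pd I u z)"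
proof (induction I)
  case (Cons i I)
  have "foldr pd I u differentiable at z" for z using assms by (simp add: smooth_def)
  then show ?case by (simp add: Cons pd_cmult fun_eq_iff)
qed simp

lemma foldr_pd_cnj:
  assumes "smooth u"
  shows "foldr pd I (\<lambda>z. cnj (u z)) = (\<lambda>z. cnj (foldr pd I u z))"
proof (induction I)
  case (Cons i I)
  have "foldr pd I u differentiable at z" for z using assms by (simp add: smooth_def)
  then show ?case by (simp add: Cons pd_cnj fun_eq_iff)
qed simp

lemma smooth_add: "smooth u \<Longrightarrow> smooth v \<Longrightarrow> smooth (\<lambda>z. u z + v z)"
  unfolding smooth_def[of "\<lambda>z. u z + v z"] by (simp add: foldr_pd_add) (simp add: smooth_def)

lemma smooth_cmult: "smooth u \<Longrightarrow> smooth (\<lambda>z. c * u z)"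
  unfolding smooth_def[of "\<lambda>z. c * u z"] by (simp add: foldr_pd_cmult) (simp add: smooth_def)

lemma smooth_cnj: "smooth u \<Longrightarrow> smooth (\<lambda>z. cnj (u z))"
  unfolding smooth_def[of "\<lambda>z. cnj (u z)"]
  by (simp add: foldr_pd_cnj) (simp add: smooth_def differentiable_cnj)

lemma smooth_pd: "smooth u \<Longrightarrow> smooth (pd i u)"
  unfolding smooth_def
proof (intro allI)
  fix I z assume "\<forall>I z. foldr pd I u differentiable at z"
  then have "foldr pd (I @ [i]) u differentiable at z" by blast
  then show "foldr pd I (pd i u) differentiable at z" by simp
qed

lemma smooth_differentiable: "smooth u \<Longrightarrow> u differentiable at z"
  unfolding smooth_def by (drule spec[of _ "[]"]) simp

lemma test_fun_iff:
  "test_fun u \<longleftrightarrow> smooth u \<and> (\<exists>K. compact K \<and> K \<subseteq> ball 0 1 \<and> (\<forall>z. z \<notin> K \<longrightarrow> u z = 0))"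
proof
  assume u: "test_fun u"
  let ?K = "closure {z. u z \<noteq> 0}"
  have K: "?K \<subseteq> ball 0 1" using u by (simp add: test_fun_def)
  then have "compact ?K" by (meson bounded_ball bounded_subset closed_closure compact_eq_bounded_closed)
  then have "\<exists>K. compact K \<and> K \<subseteq> ball 0 1 \<and> (\<forall>z. z \<notin> K \<longrightarrow> u z = 0)"
    using K closure_subset[of "{z. u z \<noteq> 0}"] by blast
  then show "smooth u \<and> (\<exists>K. compact K \<and> K \<subseteq> ball 0 1 \<and> (\<forall>z. z \<notin> K \<longrightarrow> u z = 0))"
    using u by (simp add: test_fun_def)
next
  assume "smooth u \<and> (\<exists>K. compact K \<and> K \<subseteq> ball 0 1 \<and> (\<forall>z. z \<notin> K \<longrightarrow> u z = 0))"
  then obtain K where K: "smooth u" "compact K" "K \<subseteq> ball 0 1" "\<forall>z. z \<notin> K \<longrightarrow> u z = 0" by blast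
  then have "closure {z. u z \<noteq> 0} \<subseteq> K"
    by (intro closure_minimal compact_imp_closed) auto
  then show "test_fun u" using K by (auto simp: test_fun_def)
qed

lemma test_fun_C1c:
  assumes "test_fun u"
  shows "C1c u" "C1c (pd i u)"
proof -
  have s: "smooth u" using assms by (simp add: test_fun_def)
  have c: "continuous_on UNIV w" if "smooth w" for w
    using smooth_differentiable[OF that]
    by (intro differentiable_imp_continuous_on) (simp add: differentiable_on_def differentiable_at_withinI)
  show u: "C1c u"
    unfolding C1c_def using s assms[unfolded test_fun_iff] c[OF smooth_pd[OF s]] smooth_differentiable[OF s] by blast
  obtain K where "compact K" "K \<subseteq> ball 0 1" "\<And>z. z \<notin> K \<Longrightarrow> pd i u z = 0"
    using C1c_support[OF u] by metis
  then show "C1c (pd i u)"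
    unfolding C1c_def using c[OF smooth_pd[OF smooth_pd[OF s]]] smooth_differentiable[OF smooth_pd[OF s]] by blast
qed

lemma test_fun_add: "test_fun u \<Longrightarrow> test_fun v \<Longrightarrow> test_fun (\<lambda>z. u z + v z)"
proof -
  assume u: "test_fun u" and v: "test_fun v"
  obtain K where K: "smooth u" "compact K" "K \<subseteq> ball 0 1" "\<forall>z. z \<notin> K \<longrightarrow> u z = 0"
    using u by (auto simp: test_fun_iff)
  obtain L where L: "smooth v" "compact L" "L \<subseteq> ball 0 1" "\<forall>z. z \<notin> L \<longrightarrow> v z = 0"
    using v by (auto simp: test_fun_iff)
  have "compact (K \<union> L)" "K \<union> L \<subseteq> ball 0 1" "\<forall>z. z \<notin> K \<union> L \<longrightarrow> u z + v z = 0"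
    using K L by (auto simp: compact_Un)
  then show ?thesis using smooth_add[OF K(1) L(1)] unfolding test_fun_iff by blast
qed

lemma test_fun_cmult: "test_fun u \<Longrightarrow> test_fun (\<lambda>z. c * u z)"
proof -
  assume u: "test_fun u"
  obtain K where K: "smooth u" "compact K" "K \<subseteq> ball 0 1" "\<forall>z. z \<notin> K \<longrightarrow> u z = 0"
    using u by (auto simp: test_fun_iff)
  have "\<forall>z. z \<notin> K \<longrightarrow> c * u z = 0" using K(4) by simp
  then show ?thesis using smooth_cmult[OF K(1), of c] K(2,3) unfolding test_fun_iff by blast
qed

lemma test_fun_cnj: "test_fun u \<Longrightarrow> test_fun (\<lambda>z. cnj (u z))"
proof -
  assume u: "test_fun u"
  obtain K where K: "smooth u" "compact K" "K \<subseteq> ball 0 1" "\<forall>z. z \<notin> K \<longrightarrow> u z = 0"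
    using u by (auto simp: test_fun_iff)
  have "\<forall>z. z \<notin> K \<longrightarrow> cnj (u z) = 0" using K(4) by simp
  then show ?thesis using smooth_cnj[OF K(1)] K(2,3) unfolding test_fun_iff by blast
qed

lemma test_fun_zero: "test_fun (\<lambda>z. 0)"
proof -
  have "foldr pd I (\<lambda>z. 0) = (\<lambda>z. 0)" for I
  proof (induction I)
    case (Cons i I)
    have "pd i (\<lambda>z. 0) = (\<lambda>z. 0)" by (rule ext) (rule pd_const)
    then show ?case by (simp add: Cons)
  qed simp
  then show ?thesis unfolding test_fun_def smooth_def by simp
qed

lemma test_fun_pd:
  assumes "test_fun u"
  shows "u differentiable at z"
  using C1cD(1)[OF test_fun_C1c(1)[OF assms]] .

lemma test_fun_sqint:
  assumes "test_fun u"
  shows "u \<in> sqint (wmeas \<mu>)" "pd i u \<in> sqint (wmeas \<mu>)" "del u \<in> sqint (wmeas \<mu>)" "dbar u \<in> sqint (wmeas \<mu>)"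
  by (intro C0c_sqint C1c_C0c C1c_del_C0c test_fun_C1c(1)[OF assms])+

lemma H10_grad_iff:
  "H10_grad \<mu> u g \<longleftrightarrow> u \<in> sqint (wmeas \<mu>) \<and> (\<forall>i. g i \<in> sqint (wmeas \<mu>)) \<and>
     (\<exists>\<phi>. (\<forall>n. test_fun (\<phi> n)) \<and> (\<lambda>n. sqnorm (wmeas \<mu>) (\<lambda>z. \<phi> n z - u z)) \<longlonglongrightarrow> 0 \<and>
        (\<forall>i. (\<lambda>n. sqnorm (wmeas \<mu>) (\<lambda>z. pd i (\<phi> n) z - g i z)) \<longlonglongrightarrow> 0))"
  unfolding H10_grad_def L2_eq_sqint L2norm_eq_sqnorm ..

lemma H10_gradD:
  assumes "H10_grad \<mu> u g"
  shows "u \<in> sqint (wmeas \<mu>)" "g i \<in> sqint (wmeas \<mu>)"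
  using assms unfolding H10_grad_iff by blast+

lemma sqnorm_tendsto_add:
  assumes "\<And>n. u n \<in> sqint M" "u' \<in> sqint M" "\<And>n. v n \<in> sqint M" "v' \<in> sqint M"
    and "(\<lambda>n. sqnorm M (\<lambda>x. u n x - u' x)) \<longlonglongrightarrow> 0" "(\<lambda>n. sqnorm M (\<lambda>x. v n x - v' x)) \<longlonglongrightarrow> 0"
  shows "(\<lambda>n. sqnorm M (\<lambda>x. (u n x + v n x) - (u' x + v' x))) \<longlonglongrightarrow> 0"
proof (rule Lim_null_comparison[OF _ tendsto_add_zero[OF assms(5,6)]])
  show "\<forall>\<^sub>F n in sequentially. norm (sqnorm M (\<lambda>x. (u n x + v n x) - (u' x + v' x))) \<le>
      sqnorm M (\<lambda>x. u n x - u' x) + sqnorm M (\<lambda>x. v n x - v' x)"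
    using sqnorm_triangle[OF sqint_diff[OF assms(1,2)] sqint_diff[OF assms(3,4)]]
    by (simp add: add_diff_add)
qed

lemma sqnorm_tendsto_cmult:
  assumes "(\<lambda>n. sqnorm M (\<lambda>x. u n x - u' x)) \<longlonglongrightarrow> 0"
  shows "(\<lambda>n. sqnorm M (\<lambda>x. c * u n x - c * u' x)) \<longlonglongrightarrow> 0"
proof -
  have "sqnorm M (\<lambda>x. c * u n x - c * u' x) = cmod c * sqnorm M (\<lambda>x. u n x - u' x)" for n
    by (simp only: sqnorm_scale[symmetric] right_diff_distrib)
  then show ?thesis using tendsto_mult_left[OF assms, of "cmod c"] by simp
qed

lemma sqnorm_tendsto_cnj:
  assumes "(\<lambda>n. sqnorm M (\<lambda>x. u n x - u' x)) \<longlonglongrightarrow> 0"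
  shows "(\<lambda>n. sqnorm M (\<lambda>x. cnj (u n x) - cnj (u' x))) \<longlonglongrightarrow> 0"
  using assms by (simp only: complex_cnj_diff[symmetric] sqnorm_cnj)

lemma H10_grad_add:
  assumes u: "H10_grad \<mu> u g" and v: "H10_grad \<mu> v h"
  shows "H10_grad \<mu> (\<lambda>z. u z + v z) (\<lambda>i z. g i z + h i z)"
proof -
  obtain \<phi> where \<phi>: "u \<in> sqint (wmeas \<mu>)" "\<And>i. g i \<in> sqint (wmeas \<mu>)" "\<And>n. test_fun (\<phi> n)"
    "(\<lambda>n. sqnorm (wmeas \<mu>) (\<lambda>z. \<phi> n z - u z)) \<longlonglongrightarrow> 0"
    "\<And>i. (\<lambda>n. sqnorm (wmeas \<mu>) (\<lambda>z. pd i (\<phi> n) z - g i z)) \<longlonglongrightarrow> 0"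
    using u unfolding H10_grad_iff by blast
  obtain \<psi> where \<psi>: "v \<in> sqint (wmeas \<mu>)" "\<And>i. h i \<in> sqint (wmeas \<mu>)" "\<And>n. test_fun (\<psi> n)"
    "(\<lambda>n. sqnorm (wmeas \<mu>) (\<lambda>z. \<psi> n z - v z)) \<longlonglongrightarrow> 0"
    "\<And>i. (\<lambda>n. sqnorm (wmeas \<mu>) (\<lambda>z. pd i (\<psi> n) z - h i z)) \<longlonglongrightarrow> 0"
    using v unfolding H10_grad_iff by blast
  have p: "pd i (\<lambda>z. \<phi> n z + \<psi> n z) z = pd i (\<phi> n) z + pd i (\<psi> n) z" for i n z
    by (rule pd_add) (intro test_fun_pd \<phi> \<psi>)+
  show ?thesis
    unfolding H10_grad_iff
  proof (intro conjI allI exI[of _ "\<lambda>n z. \<phi> n z + \<psi> n z"])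
    show "(\<lambda>n. sqnorm (wmeas \<mu>) (\<lambda>z. (\<phi> n z + \<psi> n z) - (u z + v z))) \<longlonglongrightarrow> 0"
      by (intro sqnorm_tendsto_add \<phi> \<psi> test_fun_sqint)
    show "(\<lambda>n. sqnorm (wmeas \<mu>) (\<lambda>z. pd i (\<lambda>z. \<phi> n z + \<psi> n z) z - (g i z + h i z))) \<longlonglongrightarrow> 0" for i
      unfolding p by (intro sqnorm_tendsto_add \<phi> \<psi> test_fun_sqint)
  qed (intro sqint_add \<phi> \<psi> test_fun_add)+
qed

lemma H10_grad_cmult:
  assumes u: "H10_grad \<mu> u g"
  shows "H10_grad \<mu> (\<lambda>z. c * u z) (\<lambda>i z. c * g i z)"
proof -
  obtain \<phi> where \<phi>: "u \<in> sqint (wmeas \<mu>)" "\<And>i. g i \<in> sqint (wmeas \<mu>)" "\<And>n. test_fun (\<phi> n)"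
    "(\<lambda>n. sqnorm (wmeas \<mu>) (\<lambda>z. \<phi> n z - u z)) \<longlonglongrightarrow> 0"
    "\<And>i. (\<lambda>n. sqnorm (wmeas \<mu>) (\<lambda>z. pd i (\<phi> n) z - g i z)) \<longlonglongrightarrow> 0"
    using u unfolding H10_grad_iff by blast
  have p: "pd i (\<lambda>z. c * \<phi> n z) z = c * pd i (\<phi> n) z" for i n z
    by (rule pd_cmult) (intro test_fun_pd \<phi>)
  show ?thesis
    unfolding H10_grad_iff
  proof (intro conjI allI exI[of _ "\<lambda>n z. c * \<phi> n z"])
    show "(\<lambda>n. sqnorm (wmeas \<mu>) (\<lambda>z. c * \<phi> n z - c * u z)) \<longlonglongrightarrow> 0"
      by (intro sqnorm_tendsto_cmult \<phi>)
    show "(\<lambda>n. sqnorm (wmeas \<mu>) (\<lambda>z. pd i (\<lambda>z. c * \<phi> n z) z - c * g i z)) \<longlonglongrightarrow> 0" for i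
      unfolding p by (intro sqnorm_tendsto_cmult \<phi>)
  qed (intro sqint_scale \<phi> test_fun_cmult)+
qed

lemma H10_grad_cnj:
  assumes u: "H10_grad \<mu> u g"
  shows "H10_grad \<mu> (\<lambda>z. cnj (u z)) (\<lambda>i z. cnj (g i z))"
proof -
  obtain \<phi> where \<phi>: "u \<in> sqint (wmeas \<mu>)" "\<And>i. g i \<in> sqint (wmeas \<mu>)" "\<And>n. test_fun (\<phi> n)"
    "(\<lambda>n. sqnorm (wmeas \<mu>) (\<lambda>z. \<phi> n z - u z)) \<longlonglongrightarrow> 0"
    "\<And>i. (\<lambda>n. sqnorm (wmeas \<mu>) (\<lambda>z. pd i (\<phi> n) z - g i z)) \<longlonglongrightarrow> 0"
    using u unfolding H10_grad_iff by blast
  have p: "pd i (\<lambda>z. cnj (\<phi> n z)) z = cnj (pd i (\<phi> n) z)" for i n z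
    by (rule pd_cnj) (intro test_fun_pd \<phi>)
  show ?thesis
    unfolding H10_grad_iff
  proof (intro conjI allI exI[of _ "\<lambda>n z. cnj (\<phi> n z)"])
    show "(\<lambda>n. sqnorm (wmeas \<mu>) (\<lambda>z. cnj (\<phi> n z) - cnj (u z))) \<longlonglongrightarrow> 0"
      by (intro sqnorm_tendsto_cnj \<phi>)
    show "(\<lambda>n. sqnorm (wmeas \<mu>) (\<lambda>z. pd i (\<lambda>z. cnj (\<phi> n z)) z - cnj (g i z))) \<longlonglongrightarrow> 0" for i
      unfolding p by (intro sqnorm_tendsto_cnj \<phi>)
  qed (intro sqint_cnj \<phi> test_fun_cnj)+
qed

lemma H10_grad_zero: "H10_grad \<mu> (\<lambda>z. 0) (\<lambda>i z. 0)"
  unfolding H10_grad_iff using test_fun_zero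
  by (auto intro!: exI[of _ "\<lambda>n z. 0"] simp: sqnorm_def)

lemma H10_grad_sum:
  assumes "\<And>k. k \<in> A \<Longrightarrow> H10_grad \<mu> (u k) (g k)"
  shows "H10_grad \<mu> (\<lambda>z. \<Sum>k\<in>A. u k z) (\<lambda>i z. \<Sum>k\<in>A. g k i z)"
  using assms
proof (induction A rule: infinite_finite_induct)
  case (insert k A)
  then show ?case using H10_grad_add[of \<mu> "u k" "g k"] by simp
qed (simp_all add: H10_grad_zero)

lemma H10_grad_diff:
  assumes u: "H10_grad \<mu> u g" and v: "H10_grad \<mu> v h"
  shows "H10_grad \<mu> (\<lambda>z. u z - v z) (\<lambda>i z. g i z - h i z)"
  using H10_grad_add[OF u H10_grad_cmult[OF v, of "-1"]] by simp

lemma integral_cnj_mult_self: "(LINT z|M. cnj (u z) * u z) = of_real ((sqnorm M u)\<^sup>2)"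
proof -
  have "cnj (u z) * u z = complex_of_real ((cmod (u z))\<^sup>2)" for z
    unfolding complex_norm_square by (rule mult.commute)
  then show ?thesis by (simp only: integral_complex_of_real sqnorm_sq)
qed

text \<open>
  The weighted gradient is closable. If test functions \<open>\<psi>\<^sub>n\<close> tend to \<open>0\<close> and \<open>\<partial>\<^sub>i \<psi>\<^sub>n\<close> tends to \<open>k\<close>, then
  integration by parts moves the derivative away from \<open>\<psi>\<^sub>n\<close> in the pairing with a fixed \<open>\<partial>\<^sub>i \<psi>\<^sub>m\<close>, so
  that \<open>k\<close> is orthogonal to every \<open>\<partial>\<^sub>i \<psi>\<^sub>m\<close>, hence to its own limit \<open>k\<close>.
\<close>

lemma H10_grad_of_zero:
  assumes "H10_grad \<mu> u g" and u0: "AE z in lebesgue_on disk. u z = 0"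
  shows "AE z in lebesgue_on disk. g i z = 0"
proof -
  let ?M = "wmeas \<mu>"
  obtain \<psi> where \<psi>: "u \<in> sqint ?M" "\<And>i. g i \<in> sqint ?M" "\<And>n. test_fun (\<psi> n)"
    "(\<lambda>n. sqnorm ?M (\<lambda>z. \<psi> n z - u z)) \<longlonglongrightarrow> 0"
    "\<And>i. (\<lambda>n. sqnorm ?M (\<lambda>z. pd i (\<psi> n) z - g i z)) \<longlonglongrightarrow> 0"
    using assms(1) unfolding H10_grad_iff by blast
  note pC = test_fun_C1c[OF \<psi>(3)]
  have \<psi>0: "(\<lambda>n. sqnorm ?M (\<lambda>z. \<psi> n z - 0)) \<longlonglongrightarrow> 0"
  proof -
    have "sqnorm ?M (\<lambda>z. \<psi> n z - 0) = sqnorm ?M (\<lambda>z. \<psi> n z - u z)" for n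
    proof (rule sqnorm_cong_AE)
      show "(\<lambda>z. \<psi> n z - u z) \<in> borel_measurable ?M" "(\<lambda>z. \<psi> n z - 0) \<in> borel_measurable ?M"
        using sqintD(1)[OF \<psi>(1)] sqintD(1)[OF test_fun_sqint(1)[OF \<psi>(3)]] by simp_all
      show "AE z in ?M. \<psi> n z - 0 = \<psi> n z - u z"
        unfolding AE_wmeas using u0 by eventually_elim simp
    qed
    then show ?thesis using \<psi>(4) by simp
  qed
  have orth: "(LINT z|?M. g i z * cnj (pd i (\<psi> m) z)) = 0" for m
  proof -
    define \<xi> where "\<xi> z = cnj (pd i (\<psi> m) z) * wt \<mu> z" for z
    have \<xi>: "C1c \<xi>" unfolding \<xi>_def by (intro C1c_mult_wt C1c_cnj pC)
    \<comment> \<open>The weight is divided out again, so that the pairing with \<open>\<psi> n\<close> is one in the weighted \<open>L\<^sup>2\<close> space.\<close>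
    define \<eta> where "\<eta> z = pd i \<xi> z * wt (- \<mu>) z" for z
    have \<eta>: "C0c \<eta>" unfolding \<eta>_def by (intro C0c_mult_ball C1c_C0c \<xi> continuous_on_wt)
    have eq: "(LINT z|?M. pd i (\<psi> n) z * cnj (pd i (\<psi> m) z)) = - (LINT z|?M. \<psi> n z * \<eta> z)" for n
    proof -
      have "(LINT z|?M. pd i (\<psi> n) z * cnj (pd i (\<psi> m) z)) = (LINT z|lborel. pd i (\<psi> n) z * cnj (pd i (\<psi> m) z) * wt \<mu> z)"
        by (intro C0c_wmeas C0c_mult C0c_cont C0c_cnj C1c_C0c pC)
      also have "\<dots> = (LINT z|lborel. pd i (\<psi> n) z * \<xi> z)" by (simp add: \<xi>_def mult.assoc)
      also have "\<dots> = - (LINT z|lborel. \<psi> n z * pd i \<xi> z)" by (rule integral_by_parts[OF pC(1) \<xi>])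
      also have "(LINT z|lborel. \<psi> n z * pd i \<xi> z) = (LINT z|lborel. \<psi> n z * \<eta> z * wt \<mu> z)"
      proof (rule Bochner_Integration.integral_cong[OF refl])
        fix z
        show "\<psi> n z * pd i \<xi> z = \<psi> n z * \<eta> z * wt \<mu> z"
        proof (cases "z \<in> ball 0 1")
          case True
          have "wt (- \<mu>) z * wt \<mu> z = 1" using wt_mult[OF True, of "- \<mu>" \<mu>] bdf_pos[OF True] by (simp add: wt_def)
          then show ?thesis by (simp add: \<eta>_def mult.assoc)
        qed (simp add: C0c_zero_outside[OF C1c_C0c(1)[OF pC(1)]])
      qed
      also have "\<dots> = (LINT z|?M. \<psi> n z * \<eta> z)"
        by (rule C0c_wmeas(2)[symmetric]) (intro C0c_mult C0c_cont \<eta> C1c_C0c pC)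
      finally show ?thesis .
    qed
    have "(\<lambda>n. LINT z|?M. \<psi> n z * \<eta> z) \<longlonglongrightarrow> (LINT z|?M. 0 * \<eta> z)"
      by (intro tendsto_integral_sqint test_fun_sqint \<psi>(3) sqint_zero C0c_sqint \<eta> \<psi>0)
    from tendsto_minus[OF this] have "(\<lambda>n. LINT z|?M. pd i (\<psi> n) z * cnj (pd i (\<psi> m) z)) \<longlonglongrightarrow> 0"
      unfolding eq by simp
    moreover have "(\<lambda>n. LINT z|?M. pd i (\<psi> n) z * cnj (pd i (\<psi> m) z)) \<longlonglongrightarrow> (LINT z|?M. g i z * cnj (pd i (\<psi> m) z))"
      by (intro tendsto_integral_sqint test_fun_sqint \<psi> sqint_cnj)
    ultimately show ?thesis using LIMSEQ_unique by blast
  qed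
  have "(\<lambda>m. LINT z|?M. cnj (pd i (\<psi> m) z) * g i z) \<longlonglongrightarrow> (LINT z|?M. cnj (g i z) * g i z)"
    by (intro tendsto_integral_sqint sqint_cnj test_fun_sqint \<psi> sqnorm_tendsto_cnj)
  then have "(\<lambda>m. 0) \<longlonglongrightarrow> (LINT z|?M. cnj (g i z) * g i z)"
    using orth by (simp add: mult.commute)
  then have "(LINT z|?M. cnj (g i z) * g i z) = 0" using LIMSEQ_unique tendsto_const by blast
  then have "sqnorm ?M (g i) = 0" by (simp add: integral_cnj_mult_self)
  from sqnorm_eq_0[OF \<psi>(2) this] show ?thesis by (simp add: AE_wmeas)
qed

lemma H10_grad_unique:
  assumes "H10_grad \<mu> u g" "H10_grad \<mu> v h" "AE z in lebesgue_on disk. u z = v z"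
  shows "AE z in lebesgue_on disk. g i z = h i z"
proof -
  have "AE z in lebesgue_on disk. g i z - h i z = 0"
    by (rule H10_grad_of_zero[OF H10_grad_diff[OF assms(1,2)]]) (use assms(3) in eventually_elim, simp)
  then show ?thesis by eventually_elim simp
qed

lemma H10_grad_grad: "u \<in> H10 \<mu> \<Longrightarrow> H10_grad \<mu> u (grad \<mu> u)"
  unfolding grad_def H10_def by (auto intro: someI[of "H10_grad \<mu> u"])

lemma borel_measurable_wt: "wt \<mu> \<in> borel_measurable (lebesgue_on S)"
proof -
  have "(\<lambda>z. complex_of_real (bdf z powr \<mu>)) \<in> borel_measurable (lebesgue_on S)"
    using bdf_powr_lebesgue_on by simp
  then show ?thesis by (simp add: wt_def[abs_def])
qed

lemma sqint_weight_shift: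
  assumes "u \<in> sqint (wmeas (- \<gamma>))"
  shows "(\<lambda>z. wt (- \<gamma>) z * u z) \<in> sqint (wmeas \<gamma>)"
    "sqnorm (wmeas \<gamma>) (\<lambda>z. wt (- \<gamma>) z * u z) = sqnorm (wmeas (- \<gamma>)) u"
proof -
  have um: "u \<in> borel_measurable (lebesgue_on disk)" using sqintD(1)[OF assms] by (simp add: measurable_wmeas)
  note wm = borel_measurable_wt[of "- \<gamma>" disk]
  have m: "(\<lambda>z. (cmod (u z))\<^sup>2) \<in> borel_measurable (lebesgue_on disk)"
    "(\<lambda>z. (cmod (wt (- \<gamma>) z * u z))\<^sup>2) \<in> borel_measurable (lebesgue_on disk)"
    using um wm by measurable
  have eq: "(bdf z powr \<gamma>) *\<^sub>R (cmod (wt (- \<gamma>) z * u z))\<^sup>2 = (bdf z powr (- \<gamma>)) *\<^sub>R (cmod (u z))\<^sup>2" if "z \<in> disk" for z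
  proof (cases "bdf z = 0")
    case False
    then have "bdf z > 0" using bdf_nonneg[OF that] by simp
    then have "bdf z powr \<gamma> * (bdf z powr (- \<gamma>) * bdf z powr (- \<gamma>)) = bdf z powr (- \<gamma>)"
      by (simp flip: powr_add)
    then show ?thesis by (auto simp: wt_def norm_mult power_mult_distrib power2_eq_square mult.assoc[symmetric])
  qed simp
  have "integrable (wmeas \<gamma>) (\<lambda>z. (cmod (wt (- \<gamma>) z * u z))\<^sup>2)"
    unfolding integrable_wmeas[OF m(2)]
    using sqintD(2)[OF assms] unfolding integrable_wmeas[OF m(1)]
    by (subst Bochner_Integration.integrable_cong[OF refl eq]) (simp_all only: space_lebesgue_on)
  then show "(\<lambda>z. wt (- \<gamma>) z * u z) \<in> sqint (wmeas \<gamma>)"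
    unfolding sqint_def measurable_wmeas using um wm by auto
  have "(LINT z|wmeas \<gamma>. (cmod (wt (- \<gamma>) z * u z))\<^sup>2) = (LINT z|wmeas (- \<gamma>). (cmod (u z))\<^sup>2)"
    unfolding integral_wmeas[OF m(2)] integral_wmeas[OF m(1)]
    by (rule Bochner_Integration.integral_cong[OF refl eq]) (simp only: space_lebesgue_on)
  then show "sqnorm (wmeas \<gamma>) (\<lambda>z. wt (- \<gamma>) z * u z) = sqnorm (wmeas (- \<gamma>)) u"
    by (simp add: sqnorm_def)
qed

lemma integral_wmeas_cancel:
  assumes "f \<in> borel_measurable (lebesgue_on disk)"
  shows "(LINT z|wmeas \<gamma>. wt (- \<gamma>) z * f z) = (LINT z|lebesgue_on disk. f z)"
proof -
  note wm = borel_measurable_wt[of "- \<gamma>" disk]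
  have m: "(\<lambda>z. wt (- \<gamma>) z * f z) \<in> borel_measurable (lebesgue_on disk)"
    using wm assms by measurable
  show ?thesis unfolding integral_wmeas[OF m]
  proof (rule integral_cong_AE)
    show "(\<lambda>z. (bdf z powr \<gamma>) *\<^sub>R (wt (- \<gamma>) z * f z)) \<in> borel_measurable (lebesgue_on disk)"
      using m bdf_powr_lebesgue_on by (intro borel_measurable_scaleR)
    show "AE z in lebesgue_on disk. (bdf z powr \<gamma>) *\<^sub>R (wt (- \<gamma>) z * f z) = f z"
      using null_sphere
    proof eventually_elim
      fix z :: complex assume z: "z \<in> ball 0 1"
      have "bdf z powr \<gamma> * bdf z powr (- \<gamma>) = 1" using bdf_pos[OF z] by (simp flip: powr_add)
      then have "wt \<gamma> z * wt (- \<gamma>) z = 1" by (simp add: wt_def flip: of_real_mult)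
      then show "(bdf z powr \<gamma>) *\<^sub>R (wt (- \<gamma>) z * f z) = f z"
        by (simp add: wt_def scaleR_conv_of_real mult.assoc[symmetric])
    qed
  qed (rule assms)
qed

section \<open>Decomposition by a Wirtinger derivative\<close>

text \<open>
  The two Wirtinger derivatives of a function with gradient \<open>g\<close>, and the kernel of the adjoint of each:
  \<open>\<partial>\<close> and \<open>ker \<partial>bar\<close> for \<open>True\<close>, \<open>\<partial>bar\<close> and \<open>ker \<partial>\<close> for \<open>False\<close>. Complex conjugation exchanges the two.
\<close>

definition wirt :: "bool \<Rightarrow> (axis \<Rightarrow> complex \<Rightarrow> complex) \<Rightarrow> complex \<Rightarrow> complex" where
  "wirt b g z = (g Xdir z + (if b then - \<i> else \<i>) * g Ydir z) / 2"

definition wker :: "bool \<Rightarrow> (complex \<Rightarrow> complex) set" where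
  "wker b = (if b then ker_dbar else ker_del)"

lemma wirt_pd: "wirt True (\<lambda>i. pd i u) = del u" "wirt False (\<lambda>i. pd i u) = dbar u"
  by (simp_all add: wirt_def del_def dbar_def fun_eq_iff)

lemma wirt_cnj: "wirt b (\<lambda>i z. cnj (g i z)) z = cnj (wirt (\<not> b) g z)"
  by (simp add: wirt_def)

lemma wirt_diff: "wirt b (\<lambda>i z. g i z - h i z) z = wirt b g z - wirt b h z"
  by (simp add: wirt_def field_simps)

lemma wirt_add: "wirt b (\<lambda>i z. g i z + h i z) z = wirt b g z + wirt b h z"
  by (simp add: wirt_def field_simps)

lemma wirt_cmult: "wirt b (\<lambda>i z. c * g i z) z = c * wirt b g z"
  by (simp add: wirt_def field_simps)

lemma wirt_sqint: "(\<And>i. g i \<in> sqint M) \<Longrightarrow> wirt b g \<in> sqint M"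
proof -
  assume g: "\<And>i. g i \<in> sqint M"
  have "(\<lambda>z. (1/2) * (g Xdir z + (if b then - \<i> else \<i>) * g Ydir z)) \<in> sqint M"
    by (intro sqint_scale sqint_add g)
  then show ?thesis by (simp add: wirt_def[abs_def])
qed

lemma sqnorm_tendsto_wirt:
  assumes "\<And>n i. u n i \<in> sqint M" "\<And>i. g i \<in> sqint M"
    and "\<And>i. (\<lambda>n. sqnorm M (\<lambda>z. u n i z - g i z)) \<longlonglongrightarrow> 0"
  shows "(\<lambda>n. sqnorm M (\<lambda>z. wirt b (u n) z - wirt b g z)) \<longlonglongrightarrow> 0"
proof -
  let ?c = "if b then - \<i> else \<i>"
  have eq: "wirt b h z = (1/2) * (h Xdir z + ?c * h Ydir z)" for h z
    by (simp add: wirt_def)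
  show ?thesis unfolding eq
    by (intro sqnorm_tendsto_cmult sqnorm_tendsto_add sqint_scale assms)
qed

lemma test_fun_diff: "test_fun u \<Longrightarrow> test_fun v \<Longrightarrow> test_fun (\<lambda>z. u z - v z)"
  using test_fun_add[of u "\<lambda>z. (-1) * v z"] test_fun_cmult[of v "-1"] by simp

lemma del_diff:
  assumes "test_fun u" "test_fun v"
  shows "del (\<lambda>z. u z - v z) z = del u z - del v z" "pd i (\<lambda>z. u z - v z) z = pd i u z - pd i v z"
proof -
  have *: "pd i (\<lambda>z. u z - v z) z = pd i u z - pd i v z" for i
    using pd_add[OF test_fun_pd[OF assms(1)] test_fun_pd[OF test_fun_cmult[OF assms(2), of "-1"]], of i z]
      pd_cmult[OF test_fun_pd[OF assms(2)], of i "-1" z] by simp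
  show "pd i (\<lambda>z. u z - v z) z = pd i u z - pd i v z" by (rule *)
  show "del (\<lambda>z. u z - v z) z = del u z - del v z" by (simp add: del_def * field_simps)
qed

lemma ker_dbar_diff:
  assumes "a \<in> sqint (wmeas \<gamma>)" "a \<in> ker_dbar" "b \<in> sqint (wmeas \<gamma>)" "b \<in> ker_dbar"
  shows "(\<lambda>z. a z - b z) \<in> ker_dbar"
  unfolding ker_dbar_def
proof (intro CollectI allI impI)
  fix \<phi> assume \<phi>: "test_fun \<phi>"
  have i: "integrable (lebesgue_on disk) (\<lambda>z. c z * dbar \<phi> z)" if "c \<in> sqint (wmeas \<gamma>)" for c
  proof -
    define d where "d z = dbar \<phi> z * wt (- \<gamma>) z" for z
    have d: "C0c d" unfolding d_def by (intro C0c_mult_ball C1c_del_C0c test_fun_C1c \<phi> continuous_on_wt)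
    have cd: "integrable (wmeas \<gamma>) (\<lambda>z. c z * d z)" by (intro sqint_mult_integrable that C0c_sqint d)
    have cm: "c \<in> borel_measurable (lebesgue_on disk)" using sqintD(1)[OF that] by (simp add: measurable_wmeas)
    have dm: "f \<in> borel_measurable (lebesgue_on disk)" if "C0c f" for f
      by (rule borel_imp_lebesgue_on[OF C0c_borel[OF that]])
    have m: "(\<lambda>z. c z * d z) \<in> borel_measurable (lebesgue_on disk)" using cm dm[OF d] by measurable
    have m2: "(\<lambda>z. c z * dbar \<phi> z) \<in> borel_measurable (lebesgue_on disk)"
      using cm dm[OF C1c_del_C0c(2)[OF test_fun_C1c(1)[OF \<phi>]]] by measurable
    show ?thesis
    proof (rule integrable_cong_AE_imp[OF cd[unfolded integrable_wmeas[OF m]] m2])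
      show "AE z in lebesgue_on disk. (bdf z powr \<gamma>) *\<^sub>R (c z * d z) = c z * dbar \<phi> z"
        using null_sphere
      proof eventually_elim
        fix z :: complex assume z: "z \<in> ball 0 1"
        have "bdf z powr \<gamma> * bdf z powr (- \<gamma>) = 1" using bdf_pos[OF z] by (simp flip: powr_add)
        then have "wt (- \<gamma>) z * of_real (bdf z powr \<gamma>) = 1" by (simp add: wt_def mult.commute flip: of_real_mult)
        moreover have "(bdf z powr \<gamma>) *\<^sub>R (c z * d z) = c z * dbar \<phi> z * (wt (- \<gamma>) z * of_real (bdf z powr \<gamma>))"
          by (simp add: d_def scaleR_conv_of_real ac_simps)
        ultimately show "(bdf z powr \<gamma>) *\<^sub>R (c z * d z) = c z * dbar \<phi> z" by simp
      qed
    qed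
  qed
  have "(LINT z|lebesgue_on disk. (a z - b z) * dbar \<phi> z) =
      (LINT z|lebesgue_on disk. a z * dbar \<phi> z) - (LINT z|lebesgue_on disk. b z * dbar \<phi> z)"
    using i[OF assms(1)] i[OF assms(3)] by (simp add: left_diff_distrib)
  then show "(LINT z|lebesgue_on disk. (a z - b z) * dbar \<phi> z) = 0"
    using assms \<phi> by (simp add: ker_dbar_def)
qed

lemma wker_cnj:
  assumes "a \<in> wker b"
  shows "(\<lambda>z. cnj (a z)) \<in> wker (\<not> b)"
proof -
  have *: "(LINT z|lebesgue_on disk. cnj (a z) * cnj (e z)) = cnj (LINT z|lebesgue_on disk. a z * e z)" for e
    by (simp flip: complex_cnj_mult)
  have "(LINT z|lebesgue_on disk. cnj (a z) * del \<phi> z) = 0" if "a \<in> ker_dbar" "test_fun \<phi>" for \<phi>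
  proof -
    have "(LINT z|lebesgue_on disk. a z * dbar (\<lambda>z. cnj (\<phi> z)) z) = 0"
      using that(1) test_fun_cnj[OF that(2)] unfolding ker_dbar_def by blast
    then show ?thesis
      using *[of "dbar (\<lambda>z. cnj (\<phi> z))"] by (simp add: del_cnj[OF test_fun_C1c(1)[OF that(2)]])
  qed
  moreover have "(LINT z|lebesgue_on disk. cnj (a z) * dbar \<phi> z) = 0" if "a \<in> ker_del" "test_fun \<phi>" for \<phi>
  proof -
    have "(LINT z|lebesgue_on disk. a z * del (\<lambda>z. cnj (\<phi> z)) z) = 0"
      using that(1) test_fun_cnj[OF that(2)] unfolding ker_del_def by blast
    then show ?thesis
      using *[of "del (\<lambda>z. cnj (\<phi> z))"] by (simp add: del_cnj[OF test_fun_C1c(1)[OF that(2)]])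
  qed
  ultimately show ?thesis using assms by (auto simp: wker_def ker_del_def ker_dbar_def)
qed

text \<open>
  Project \<open>F\<close> onto the closure of the functions \<open>d\<^sup>-\<^sup>\<gamma> \<partial>\<phi>\<close>. Their orthogonal complement is
  \<open>ker \<partial>bar\<close>, since the weights cancel in the inner product, and the closure consists of functions
  \<open>d\<^sup>-\<^sup>\<gamma> \<partial>q\<close>, since convergence of \<open>\<partial>\<phi>\<^sub>n\<close> forces convergence of \<open>\<phi>\<^sub>n\<close> and of its gradient.
\<close>

lemma del_decomposition_exists:
  assumes "- 1 < \<gamma>" and F: "F \<in> sqint (wmeas \<gamma>)"
  obtains q g a where "H10_grad (- \<gamma>) q g" "a \<in> sqint (wmeas \<gamma>)" "a \<in> ker_dbar"
    "AE z in lebesgue_on disk. F z = wt (- \<gamma>) z * wirt True g z + a z"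
proof -
  let ?M = "wmeas \<gamma>" and ?N = "wmeas (- \<gamma>)"
  have "- \<gamma> < 1" using assms by simp
  obtain C where C: "C \<ge> 0" "\<And>u. C1c u \<Longrightarrow> sqnorm ?N u \<le> C * sqnorm ?N (del u)"
    "\<And>u i. C1c u \<Longrightarrow> sqnorm ?N (pd i u) \<le> C * sqnorm ?N (del u)"
    using del_controls_H1[OF \<open>- \<gamma> < 1\<close>] by blast
  define V where "V = {(\<lambda>z. wt (- \<gamma>) z * del \<phi> z) | \<phi>. test_fun \<phi>}"
  have V: "V \<subseteq> sqint ?M"
    by (auto simp: V_def intro!: sqint_weight_shift(1) test_fun_sqint(3))
  have V0: "(\<lambda>z. 0) \<in> V"
    unfolding V_def by (rule CollectI, rule exI[of _ "\<lambda>z. 0"]) (simp add: test_fun_zero del_def)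
  have Vadd: "(\<lambda>z. u z + v z) \<in> V" if "u \<in> V" "v \<in> V" for u v
  proof -
    obtain \<phi> \<psi> where *: "test_fun \<phi>" "u = (\<lambda>z. wt (- \<gamma>) z * del \<phi> z)" "test_fun \<psi>" "v = (\<lambda>z. wt (- \<gamma>) z * del \<psi> z)"
      using \<open>u \<in> V\<close> \<open>v \<in> V\<close> by (auto simp: V_def)
    have "del (\<lambda>z. \<phi> z + \<psi> z) z = del \<phi> z + del \<psi> z" for z
      using pd_add[OF test_fun_pd[OF *(1)] test_fun_pd[OF *(3)]] by (simp add: del_def field_simps)
    then show ?thesis unfolding V_def
      using test_fun_add[OF *(1,3)] by (intro CollectI exI[of _ "\<lambda>z. \<phi> z + \<psi> z"]) (simp add: * distrib_left)
  qed
  have Vscale: "(\<lambda>z. c * u z) \<in> V" if "u \<in> V" for u c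
  proof -
    obtain \<phi> where *: "test_fun \<phi>" "u = (\<lambda>z. wt (- \<gamma>) z * del \<phi> z)"
      using \<open>u \<in> V\<close> by (auto simp: V_def)
    have "del (\<lambda>z. c * \<phi> z) z = c * del \<phi> z" for z
      using pd_cmult[OF test_fun_pd[OF *(1)]] by (simp add: del_def field_simps)
    then show ?thesis unfolding V_def
      using test_fun_cmult[OF *(1)] by (intro CollectI exI[of _ "\<lambda>z. c * \<phi> z"]) (simp add: * mult.left_commute)
  qed
  obtain v w where v: "v \<in> sqint ?M" and w: "\<And>n. w n \<in> V" and lim: "(\<lambda>n. sqnorm ?M (\<lambda>x. w n x - v x)) \<longlonglongrightarrow> 0"
    and orth: "\<And>u. u \<in> V \<Longrightarrow> (LINT x|?M. (F x - v x) * cnj (u x)) = 0"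
    using sqint_projection[OF F V V0 Vadd Vscale] by blast
  have "\<forall>n. \<exists>\<phi>. test_fun \<phi> \<and> w n = (\<lambda>z. wt (- \<gamma>) z * del \<phi> z)" using w by (auto simp: V_def)
  then obtain \<phi> where \<phi>: "\<And>n. test_fun (\<phi> n)" and w\<phi>: "\<And>n. w n = (\<lambda>z. wt (- \<gamma>) z * del (\<phi> n) z)" by metis
  note \<phi>C = test_fun_C1c(1)[OF \<phi>]
  define dd where "dd n m z = \<phi> n z - \<phi> m z" for n m z
  have dd: "test_fun (dd n m)" "del (dd n m) z = del (\<phi> n) z - del (\<phi> m) z" "pd i (dd n m) z = pd i (\<phi> n) z - pd i (\<phi> m) z" for n m z i
    unfolding dd_def[abs_def] using test_fun_diff[OF \<phi> \<phi>] del_diff[OF \<phi> \<phi>] by auto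
  have dw: "sqnorm ?N (del (dd n m)) = sqnorm ?M (\<lambda>z. w n z - w m z)" for n m
  proof -
    have "(\<lambda>z. w n z - w m z) = (\<lambda>z. wt (- \<gamma>) z * del (dd n m) z)"
      by (simp add: w\<phi> dd fun_eq_iff right_diff_distrib)
    then show ?thesis using sqint_weight_shift(2)[OF test_fun_sqint(3)[OF dd(1)]] by simp
  qed
  have cauchy: "\<exists>N. \<forall>n\<ge>N. \<forall>m\<ge>N. C * sqnorm ?N (del (dd n m)) < e" if "e > 0" for e
  proof -
    have "\<exists>N. \<forall>n\<ge>N. norm (sqnorm ?M (\<lambda>x. w n x - v x) - 0) < e / (2 * (C + 1))"
      using \<open>e > 0\<close> C(1) by (intro LIMSEQ_D[OF lim]) simp
    then obtain N where N: "\<And>n. n \<ge> N \<Longrightarrow> sqnorm ?M (\<lambda>x. w n x - v x) < e / (2 * (C + 1))" by auto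
    have "C * sqnorm ?N (del (dd n m)) < e" if "n \<ge> N" "m \<ge> N" for n m
    proof -
      have "sqnorm ?N (del (dd n m)) \<le> sqnorm ?M (\<lambda>x. w n x - v x) + sqnorm ?M (\<lambda>x. v x - w m x)"
        unfolding dw using w V v by (intro sqnorm_triangle_diff) auto
      also have "\<dots> < e / (2 * (C + 1)) + e / (2 * (C + 1))"
        using N[OF that(1)] N[OF that(2)] sqnorm_minus_commute[of ?M v "w m"] by simp
      also have "\<dots> = e / (C + 1)"
      proof -
        have "e / (2 * d) + e / (2 * d) = e / d" for d :: real by (cases "d = 0") (simp_all add: field_simps)
        then show ?thesis .
      qed
      finally have "(C + 1) * sqnorm ?N (del (dd n m)) < e" using C(1) by (simp add: field_simps)
      moreover have "C * sqnorm ?N (del (dd n m)) \<le> (C + 1) * sqnorm ?N (del (dd n m))"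
        by (intro mult_right_mono) auto
      ultimately show ?thesis by simp
    qed
    then show ?thesis by blast
  qed
  have c\<phi>: "\<exists>N. \<forall>n\<ge>N. \<forall>m\<ge>N. sqnorm ?N (\<lambda>z. \<phi> n z - \<phi> m z) < e" if "e > 0" for e
    using cauchy[OF that] C(2)[OF test_fun_C1c(1)[OF dd(1)]] unfolding dd_def[abs_def] by (meson le_less_trans)
  obtain q where q: "q \<in> sqint ?N" "(\<lambda>n. sqnorm ?N (\<lambda>z. \<phi> n z - q z)) \<longlonglongrightarrow> 0"
    using sqint_complete[where u=\<phi> and M="?N", OF test_fun_sqint(1)[OF \<phi>] c\<phi>] .
  have "\<exists>gi. gi \<in> sqint ?N \<and> (\<lambda>n. sqnorm ?N (\<lambda>z. pd i (\<phi> n) z - gi z)) \<longlonglongrightarrow> 0" for i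
  proof -
    have c: "\<exists>N. \<forall>n\<ge>N. \<forall>m\<ge>N. sqnorm ?N (\<lambda>z. pd i (\<phi> n) z - pd i (\<phi> m) z) < e" if "e > 0" for e
    proof -
      have "sqnorm ?N (\<lambda>z. pd i (\<phi> n) z - pd i (\<phi> m) z) \<le> C * sqnorm ?N (del (dd n m))" for n m
        using C(3)[OF test_fun_C1c(1)[OF dd(1)], of i n m] unfolding dd(3)[abs_def] .
      then show ?thesis using cauchy[OF that] by (meson le_less_trans)
    qed
    show ?thesis
      by (rule sqint_complete[where u="\<lambda>n. pd i (\<phi> n)" and M="?N", OF test_fun_sqint(2)[OF \<phi>] c]) blast+
  qed
  then obtain g where g: "\<And>i. g i \<in> sqint ?N" "\<And>i. (\<lambda>n. sqnorm ?N (\<lambda>z. pd i (\<phi> n) z - g i z)) \<longlonglongrightarrow> 0" by metis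
  have H: "H10_grad (- \<gamma>) q g" unfolding H10_grad_iff using q g \<phi> by blast
  have lim2: "(\<lambda>n. sqnorm ?M (\<lambda>z. w n z - wt (- \<gamma>) z * wirt True g z)) \<longlonglongrightarrow> 0"
  proof -
    have "(\<lambda>n. sqnorm ?N (\<lambda>z. wirt True (\<lambda>i. pd i (\<phi> n)) z - wirt True g z)) \<longlonglongrightarrow> 0"
      by (rule sqnorm_tendsto_wirt[where u="\<lambda>n i. pd i (\<phi> n)" and g=g, OF test_fun_sqint(2)[OF \<phi>] g])
    moreover have "sqnorm ?N (\<lambda>z. wirt True (\<lambda>i. pd i (\<phi> n)) z - wirt True g z) = sqnorm ?M (\<lambda>z. w n z - wt (- \<gamma>) z * wirt True g z)" for n
      using sqint_weight_shift(2)[OF sqint_diff[OF test_fun_sqint(3)[OF \<phi>] wirt_sqint[OF g(1)]], of n True]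
      unfolding w\<phi> wirt_pd right_diff_distrib by simp
    ultimately show ?thesis by simp
  qed
  define g' where "g' z = wt (- \<gamma>) z * wirt True g z" for z
  have g's: "g' \<in> sqint ?M" unfolding g'_def by (intro sqint_weight_shift wirt_sqint g)
  have "sqnorm ?M (\<lambda>z. v z - g' z) \<le> 0"
  proof (rule LIMSEQ_le_const)
    show "(\<lambda>n. sqnorm ?M (\<lambda>x. w n x - v x) + sqnorm ?M (\<lambda>z. w n z - g' z)) \<longlonglongrightarrow> 0"
      unfolding g'_def by (rule tendsto_add_zero[OF lim lim2])
    have "sqnorm ?M (\<lambda>z. v z - g' z) \<le> sqnorm ?M (\<lambda>x. w n x - v x) + sqnorm ?M (\<lambda>z. w n z - g' z)" for n
      using sqnorm_triangle_diff[OF v _ g's, of "w n"] w V sqnorm_minus_commute[of ?M "w n" v] by auto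
    then show "\<exists>N. \<forall>n\<ge>N. sqnorm ?M (\<lambda>z. v z - g' z) \<le> sqnorm ?M (\<lambda>x. w n x - v x) + sqnorm ?M (\<lambda>z. w n z - g' z)" by blast
  qed
  then have "sqnorm ?M (\<lambda>z. v z - g' z) = 0" using sqnorm_nonneg[of ?M "\<lambda>z. v z - g' z"] by linarith
  from sqnorm_eq_0[OF sqint_diff[OF v g's] this]
  have vg: "AE z in lebesgue_on disk. v z - g' z = 0" by (simp add: AE_wmeas)
  define a where "a z = F z - v z" for z
  have as: "a \<in> sqint ?M" unfolding a_def by (intro sqint_diff F v)
  have am: "a \<in> borel_measurable (lebesgue_on disk)" using sqintD(1)[OF as] by (simp add: measurable_wmeas)
  have "a \<in> ker_dbar" unfolding ker_dbar_def
  proof (intro CollectI allI impI)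
    fix \<psi> assume \<psi>: "test_fun \<psi>"
    define \<theta> where "\<theta> z = cnj (\<psi> z)" for z
    have \<theta>: "test_fun \<theta>" unfolding \<theta>_def by (rule test_fun_cnj[OF \<psi>])
    have dt: "cnj (del \<theta> z) = dbar \<psi> z" for z
      unfolding \<theta>_def using del_cnj(1)[OF test_fun_C1c(1)[OF \<psi>]] by simp
    have m: "(\<lambda>z. a z * dbar \<psi> z) \<in> borel_measurable (lebesgue_on disk)"
      using am borel_imp_lebesgue_on[OF C0c_borel[OF C1c_del_C0c(2)[OF test_fun_C1c(1)[OF \<psi>]]]] by measurable
    have "(\<lambda>z. wt (- \<gamma>) z * del \<theta> z) \<in> V" using \<theta> by (auto simp: V_def)
    from orth[OF this] have "(LINT z|?M. wt (- \<gamma>) z * (a z * dbar \<psi> z)) = 0"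
      by (simp add: a_def dt wt_def mult.left_commute)
    then show "(LINT z|lebesgue_on disk. a z * dbar \<psi> z) = 0"
      unfolding integral_wmeas_cancel[OF m] .
  qed
  moreover have "AE z in lebesgue_on disk. F z = wt (- \<gamma>) z * wirt True g z + a z"
    using vg by eventually_elim (simp add: a_def g'_def)
  ultimately show ?thesis using that H as by blast
qed

text \<open>
  The function \<open>d\<^sup>-\<^sup>\<gamma> \<partial>q = - a\<close> is orthogonal to every \<open>d\<^sup>-\<^sup>\<gamma> \<partial>\<phi>\<close>, hence to itself as a limit of such
  functions. So \<open>\<partial>\<phi>\<^sub>n\<close> tends to \<open>0\<close>, and with it \<open>\<phi>\<^sub>n\<close> and its gradient.
\<close>

lemma del_decomposition_zero:
  assumes "- 1 < \<gamma>" and H: "H10_grad (- \<gamma>) q g" and a: "a \<in> sqint (wmeas \<gamma>)" "a \<in> ker_dbar"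
    and eq: "AE z in lebesgue_on disk. wt (- \<gamma>) z * wirt True g z + a z = 0"
  shows "AE z in lebesgue_on disk. q z = 0" "AE z in lebesgue_on disk. g i z = 0" "AE z in lebesgue_on disk. a z = 0"
proof -
  let ?M = "wmeas \<gamma>" and ?N = "wmeas (- \<gamma>)"
  have "- \<gamma> < 1" using assms by simp
  obtain C where C: "C \<ge> 0" "\<And>u. C1c u \<Longrightarrow> sqnorm ?N u \<le> C * sqnorm ?N (del u)"
    "\<And>u i. C1c u \<Longrightarrow> sqnorm ?N (pd i u) \<le> C * sqnorm ?N (del u)"
    using del_controls_H1[OF \<open>- \<gamma> < 1\<close>] by blast
  obtain \<phi> where \<phi>: "q \<in> sqint ?N" "\<And>i. g i \<in> sqint ?N" "\<And>n. test_fun (\<phi> n)"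
    "(\<lambda>n. sqnorm ?N (\<lambda>z. \<phi> n z - q z)) \<longlonglongrightarrow> 0"
    "\<And>i. (\<lambda>n. sqnorm ?N (\<lambda>z. pd i (\<phi> n) z - g i z)) \<longlonglongrightarrow> 0"
    using H unfolding H10_grad_iff by blast
  note \<phi>C = test_fun_C1c(1)[OF \<phi>(3)]
  define D where "D = wirt True g"
  have D: "D \<in> sqint ?N" unfolding D_def by (intro wirt_sqint \<phi>)
  have Dm: "D \<in> borel_measurable (lebesgue_on disk)" using sqintD(1)[OF D] by (simp add: measurable_wmeas)
  have am: "a \<in> borel_measurable (lebesgue_on disk)" using sqintD(1)[OF a(1)] by (simp add: measurable_wmeas)
  have lim: "(\<lambda>n. sqnorm ?N (\<lambda>z. del (\<phi> n) z - D z)) \<longlonglongrightarrow> 0"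
    using sqnorm_tendsto_wirt[where u="\<lambda>n i. pd i (\<phi> n)" and g=g and b=True, OF test_fun_sqint(2)[OF \<phi>(3)] \<phi>(2,5)]
    unfolding wirt_pd D_def .
  have "(LINT z|?N. cnj (del (\<phi> n) z) * D z) = 0" for n
  proof -
    define \<psi> where "\<psi> z = cnj (\<phi> n z)" for z
    have \<psi>: "test_fun \<psi>" unfolding \<psi>_def by (rule test_fun_cnj[OF \<phi>(3)])
    have d\<psi>: "cnj (del (\<phi> n) z) = dbar \<psi> z" for z
      unfolding \<psi>_def using del_cnj(2)[OF \<phi>C] by simp
    have dm: "dbar \<psi> \<in> borel_measurable (lebesgue_on disk)"
      by (rule borel_imp_lebesgue_on[OF C0c_borel[OF C1c_del_C0c(2)[OF test_fun_C1c(1)[OF \<psi>]]]])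
    have m: "(\<lambda>z. dbar \<psi> z * D z) \<in> borel_measurable (lebesgue_on disk)" using dm Dm by measurable
    have "(LINT z|?N. dbar \<psi> z * D z) = (LINT z|lebesgue_on disk. - (a z * dbar \<psi> z))"
      unfolding integral_wmeas[OF m]
    proof (rule integral_cong_AE)
      show "(\<lambda>z. (bdf z powr (- \<gamma>)) *\<^sub>R (dbar \<psi> z * D z)) \<in> borel_measurable (lebesgue_on disk)"
        by (intro borel_measurable_scaleR m bdf_powr_lebesgue_on)
      show "(\<lambda>z. - (a z * dbar \<psi> z)) \<in> borel_measurable (lebesgue_on disk)" using am dm by measurable
      show "AE z in lebesgue_on disk. (bdf z powr (- \<gamma>)) *\<^sub>R (dbar \<psi> z * D z) = - (a z * dbar \<psi> z)"
        using eq
      proof eventually_elim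
        fix z assume "wt (- \<gamma>) z * wirt True g z + a z = 0"
        then have "wt (- \<gamma>) z * D z = - a z" by (simp add: D_def eq_neg_iff_add_eq_0)
        then show "(bdf z powr (- \<gamma>)) *\<^sub>R (dbar \<psi> z * D z) = - (a z * dbar \<psi> z)"
          by (simp add: wt_def scaleR_conv_of_real mult.left_commute[of "of_real _"])
      qed
    qed
    also have "\<dots> = 0" using a(2) \<psi> by (simp add: ker_dbar_def)
    finally show ?thesis by (simp add: d\<psi>)
  qed
  moreover have "(\<lambda>n. LINT z|?N. cnj (del (\<phi> n) z) * D z) \<longlonglongrightarrow> (LINT z|?N. cnj (D z) * D z)"
    by (intro tendsto_integral_sqint sqint_cnj test_fun_sqint \<phi> D sqnorm_tendsto_cnj lim)
  ultimately have "(\<lambda>n. 0) \<longlonglongrightarrow> (LINT z|?N. cnj (D z) * D z)" by simp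
  then have "(LINT z|?N. cnj (D z) * D z) = 0" using LIMSEQ_unique tendsto_const by blast
  then have D0: "sqnorm ?N D = 0" by (simp add: integral_cnj_mult_self)
  have del0: "(\<lambda>n. sqnorm ?N (del (\<phi> n))) \<longlonglongrightarrow> 0"
    using tendsto_sqnorm[OF test_fun_sqint(3)[OF \<phi>(3)] D lim] unfolding D0 .
  have c0: "(\<lambda>n. C * sqnorm ?N (del (\<phi> n))) \<longlonglongrightarrow> 0" using tendsto_mult_left[OF del0, of C] by simp
  have *: "sqnorm ?N u = 0" if u: "u \<in> sqint ?N" and un: "\<And>n. un n \<in> sqint ?N" "\<And>n. sqnorm ?N (un n) \<le> C * sqnorm ?N (del (\<phi> n))"
    and l: "(\<lambda>n. sqnorm ?N (\<lambda>z. un n z - u z)) \<longlonglongrightarrow> 0" for u un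
  proof -
    have "(\<lambda>n. sqnorm ?N (un n)) \<longlonglongrightarrow> 0"
      by (rule Lim_null_comparison[OF _ c0]) (use un in auto)
    with tendsto_sqnorm[OF un(1) u l] show ?thesis using LIMSEQ_unique by blast
  qed
  have "sqnorm ?N q = 0" by (rule *[OF \<phi>(1) test_fun_sqint(1)[OF \<phi>(3)] C(2)[OF \<phi>C] \<phi>(4)])
  from sqnorm_eq_0[OF \<phi>(1) this] show "AE z in lebesgue_on disk. q z = 0" by (simp add: AE_wmeas)
  have "sqnorm ?N (g i) = 0" by (rule *[OF \<phi>(2) test_fun_sqint(2)[OF \<phi>(3)] C(3)[OF \<phi>C] \<phi>(5)])
  from sqnorm_eq_0[OF \<phi>(2) this] show "AE z in lebesgue_on disk. g i z = 0" by (simp add: AE_wmeas)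
  have "AE z in lebesgue_on disk. D z = 0" using sqnorm_eq_0[OF D D0] by (simp add: AE_wmeas)
  with eq show "AE z in lebesgue_on disk. a z = 0" by eventually_elim (simp add: D_def)
qed

lemma wirt_decomposition_exists:
  assumes "- 1 < \<gamma>" and F: "F \<in> L2 \<gamma>"
  obtains q g a where "H10_grad (- \<gamma>) q g" "a \<in> L2 \<gamma>" "a \<in> wker b"
    "AE z in lebesgue_on disk. F z = wt (- \<gamma>) z * wirt b g z + a z"
proof (cases b)
  case True
  obtain q g a where *: "H10_grad (- \<gamma>) q g" "a \<in> sqint (wmeas \<gamma>)" "a \<in> ker_dbar"
    "AE z in lebesgue_on disk. F z = wt (- \<gamma>) z * wirt True g z + a z"
    using del_decomposition_exists[OF assms[unfolded L2_eq_sqint]] by blast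
  show ?thesis by (rule that[of q g a]) (use * True in \<open>simp_all add: L2_eq_sqint wker_def\<close>)
next
  case False
  obtain q g a where *: "H10_grad (- \<gamma>) q g" "a \<in> sqint (wmeas \<gamma>)" "a \<in> ker_dbar"
    "AE z in lebesgue_on disk. cnj (F z) = wt (- \<gamma>) z * wirt True g z + a z"
    using del_decomposition_exists[OF assms(1) sqint_cnj[OF F[unfolded L2_eq_sqint]]] by blast
  show ?thesis
  proof (rule that)
    show "H10_grad (- \<gamma>) (\<lambda>z. cnj (q z)) (\<lambda>i z. cnj (g i z))" by (rule H10_grad_cnj[OF *(1)])
    show "(\<lambda>z. cnj (a z)) \<in> L2 \<gamma>" unfolding L2_eq_sqint by (rule sqint_cnj[OF *(2)])
    show "(\<lambda>z. cnj (a z)) \<in> wker b" using wker_cnj[of a True] *(3) False by (simp add: wker_def)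
    show "AE z in lebesgue_on disk. F z = wt (- \<gamma>) z * wirt b (\<lambda>i z. cnj (g i z)) z + cnj (a z)"
      using *(4)
    proof eventually_elim
      fix z assume "cnj (F z) = wt (- \<gamma>) z * wirt True g z + a z"
      then have "F z = cnj (wt (- \<gamma>) z * wirt True g z + a z)" by (metis complex_cnj_cnj)
      then show "F z = wt (- \<gamma>) z * wirt b (\<lambda>i z. cnj (g i z)) z + cnj (a z)"
        using False by (simp add: wirt_cnj wt_def)
    qed
  qed
qed

lemma wirt_decomposition_unique:
  assumes "- 1 < \<gamma>"
    and H: "H10_grad (- \<gamma>) q g" "a \<in> L2 \<gamma>" "a \<in> wker b"
    and H': "H10_grad (- \<gamma>) q' g'" "a' \<in> L2 \<gamma>" "a' \<in> wker b"
    and eq: "AE z in lebesgue_on disk. wt (- \<gamma>) z * wirt b g z + a z = wt (- \<gamma>) z * wirt b g' z + a' z"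
  shows "AE z in lebesgue_on disk. q z = q' z" "AE z in lebesgue_on disk. g i z = g' i z"
    "AE z in lebesgue_on disk. a z = a' z"
proof -
  define K where "K = (if b then (\<lambda>z :: complex. z) else cnj)"
  have K0: "K z = 0 \<longleftrightarrow> z = 0" for z by (simp add: K_def)
  have Kh: "H10_grad (- \<gamma>) (\<lambda>z. K (q z - q' z)) (\<lambda>i z. K (g i z - g' i z))"
    unfolding K_def using H10_grad_diff[OF H(1) H'(1)] H10_grad_cnj[OF H10_grad_diff[OF H(1) H'(1)]] by simp
  have Ka: "(\<lambda>z. K (a z)) \<in> sqint (wmeas \<gamma>)" "(\<lambda>z. K (a z)) \<in> ker_dbar"
    using H(2,3) wker_cnj[OF H(3)] by (auto simp: K_def L2_eq_sqint wker_def intro: sqint_cnj)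
  have Ka': "(\<lambda>z. K (a' z)) \<in> sqint (wmeas \<gamma>)" "(\<lambda>z. K (a' z)) \<in> ker_dbar"
    using H'(2,3) wker_cnj[OF H'(3)] by (auto simp: K_def L2_eq_sqint wker_def intro: sqint_cnj)
  have Kaa: "(\<lambda>z. K (a z) - K (a' z)) \<in> sqint (wmeas \<gamma>)" "(\<lambda>z. K (a z) - K (a' z)) \<in> ker_dbar"
    using sqint_diff[OF Ka(1) Ka'(1)] ker_dbar_diff[OF Ka Ka'] by auto
  have Keq: "AE z in lebesgue_on disk. wt (- \<gamma>) z * wirt True (\<lambda>i z. K (g i z - g' i z)) z + (K (a z) - K (a' z)) = 0"
    using eq
  proof eventually_elim
    fix z assume *: "wt (- \<gamma>) z * wirt b g z + a z = wt (- \<gamma>) z * wirt b g' z + a' z"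
    then have "K (wt (- \<gamma>) z * (wirt b g z - wirt b g' z) + (a z - a' z)) = 0"
      unfolding K0 by (simp add: algebra_simps)
    moreover have "wirt True (\<lambda>i z. K (g i z - g' i z)) z = K (wirt b g z - wirt b g' z)"
      by (cases b) (simp_all add: K_def wirt_diff wirt_cnj)
    ultimately show "wt (- \<gamma>) z * wirt True (\<lambda>i z. K (g i z - g' i z)) z + (K (a z) - K (a' z)) = 0"
      by (simp add: K_def wt_def split: if_splits)
  qed
  note * = del_decomposition_zero[OF assms(1) Kh Kaa Keq]
  show "AE z in lebesgue_on disk. q z = q' z"
    using *(1) by eventually_elim (simp add: K0)
  show "AE z in lebesgue_on disk. g i z = g' i z"
    using *(2)[of i] by eventually_elim (simp add: K0)
  show "AE z in lebesgue_on disk. a z = a' z"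
    using *(3) by eventually_elim (auto simp: K_def split: if_splits)
qed

section \<open>Santalo's formula and restriction to chords\<close>

lemma nn_integral_complex:
  fixes F :: "complex \<Rightarrow> ennreal"
  assumes [measurable]: "F \<in> borel_measurable borel"
  shows "(\<integral>\<^sup>+ z. F z \<partial>lborel) = (\<integral>\<^sup>+ y. \<integral>\<^sup>+ x. F (Complex x y) \<partial>lborel \<partial>lborel)"
proof -
  have [measurable]: "(\<lambda>p. Complex (fst p) (snd p)) \<in> borel_measurable (lborel \<Otimes>\<^sub>M lborel)"
    unfolding Complex_eq by measurable
  have "lborel = distr (lborel \<Otimes>\<^sub>M lborel) borel (\<lambda>p. Complex (fst p) (snd p))" (is "_ = ?D")
  proof (rule lborel_eqI)
    fix l u :: complex
    assume le: "\<And>b. b \<in> Basis \<Longrightarrow> l \<bullet> b \<le> u \<bullet> b"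
    have lu: "Re l \<le> Re u" "Im l \<le> Im u"
      using le[of 1] le[of \<i>] by (simp_all add: Basis_complex_def)
    have "(\<lambda>p. Complex (fst p) (snd p)) -` box l u \<inter> space (lborel \<Otimes>\<^sub>M lborel) = {Re l <..< Re u} \<times> {Im l <..< Im u}"
      by (auto simp: box_def Basis_complex_def space_pair_measure)
    then have "emeasure ?D (box l u) = emeasure (lborel \<Otimes>\<^sub>M lborel) ({Re l <..< Re u} \<times> {Im l <..< Im u})"
      by (subst emeasure_distr) auto
    also have "\<dots> = ennreal (Re u - Re l) * ennreal (Im u - Im l)"
      using lu by (subst lborel.emeasure_pair_measure_Times) auto
    also have "\<dots> = (\<Prod>b\<in>Basis. (u - l) \<bullet> b)"
      using lu by (simp add: Basis_complex_def ennreal_mult)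
    finally show "emeasure ?D (box l u) = (\<Prod>b\<in>Basis. (u - l) \<bullet> b)" .
  qed simp
  then have "(\<integral>\<^sup>+ z. F z \<partial>lborel) = (\<integral>\<^sup>+ z. F z \<partial>?D)" by simp
  also have "\<dots> = (\<integral>\<^sup>+ p. F (Complex (fst p) (snd p)) \<partial>(lborel \<Otimes>\<^sub>M lborel))"
    by (rule nn_integral_distr) simp_all
  also have "\<dots> = (\<integral>\<^sup>+ y. \<integral>\<^sup>+ x. F (Complex x y) \<partial>lborel \<partial>lborel)"
    by (subst lborel_pair.nn_integral_snd[symmetric]) simp_all
  finally show ?thesis .
qed

lemma borel_measurable_Complex [measurable (raw)]:
  assumes "f \<in> borel_measurable M" "g \<in> borel_measurable M"
  shows "(\<lambda>x. Complex (f x) (g x)) \<in> borel_measurable M"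
  unfolding Complex_eq using assms by measurable

text \<open>
  For \<open>c \<noteq> 0\<close> a rotation is an affine substitution in \<open>x\<close> followed by one in \<open>y\<close>, with factors
  \<open>\<bar>1/c\<bar>\<close> and \<open>\<bar>c\<bar>\<close>; for \<open>c = 0\<close> it exchanges the variables, up to signs.
\<close>

lemma nn_integral_rotation:
  fixes F :: "complex \<Rightarrow> ennreal"
  assumes F[measurable]: "F \<in> borel_measurable borel" and cs: "c\<^sup>2 + s\<^sup>2 = 1"
  shows "(\<integral>\<^sup>+ y. \<integral>\<^sup>+ x. F (Complex (c * x - s * y) (s * x + c * y)) \<partial>lborel \<partial>lborel) = (\<integral>\<^sup>+ z. F z \<partial>lborel)"
proof (cases "c = 0")
  case True
  have s: "s \<noteq> 0" "\<bar>s\<bar> = 1" using cs True by (auto simp: abs_square_eq_1)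
  have "(\<integral>\<^sup>+ y. \<integral>\<^sup>+ x. F (Complex (c * x - s * y) (s * x + c * y)) \<partial>lborel \<partial>lborel)
      = (\<integral>\<^sup>+ y. \<integral>\<^sup>+ x. F (Complex (0 + (- s) * y) (0 + s * x)) \<partial>lborel \<partial>lborel)"
    using True by simp
  also have "\<dots> = (\<integral>\<^sup>+ y. \<integral>\<^sup>+ x. F (Complex (0 + (- s) * y) x) \<partial>lborel \<partial>lborel)"
  proof (rule nn_integral_cong)
    fix y :: real
    show "(\<integral>\<^sup>+ x. F (Complex (0 + (- s) * y) (0 + s * x)) \<partial>lborel) = (\<integral>\<^sup>+ x. F (Complex (0 + (- s) * y) x) \<partial>lborel)"
      using nn_integral_real_affine[of "\<lambda>x. F (Complex (0 + (- s) * y) x)" s 0] s by simp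
  qed
  also have "\<dots> = (\<integral>\<^sup>+ x. \<integral>\<^sup>+ y. F (Complex (0 + (- s) * y) x) \<partial>lborel \<partial>lborel)"
    by (rule lborel_pair.Fubini') measurable
  also have "\<dots> = (\<integral>\<^sup>+ x. \<integral>\<^sup>+ y. F (Complex y x) \<partial>lborel \<partial>lborel)"
  proof (rule nn_integral_cong)
    fix x :: real
    show "(\<integral>\<^sup>+ y. F (Complex (0 + (- s) * y) x) \<partial>lborel) = (\<integral>\<^sup>+ y. F (Complex y x) \<partial>lborel)"
      using nn_integral_real_affine[of "\<lambda>y. F (Complex y x)" "- s" 0] s by simp
  qed
  finally show ?thesis by (simp add: nn_integral_complex)
next
  case False
  have "(\<integral>\<^sup>+ x. F (Complex (c * x - s * y) (s * x + c * y)) \<partial>lborel) =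
     ennreal \<bar>1 / c\<bar> * (\<integral>\<^sup>+ x. F (Complex x (s * x / c + y / c)) \<partial>lborel)" for y
  proof -
    have eq: "s * (s * y / c + 1 / c * x) + c * y = s * x / c + y / c" for x
    proof -
      have "y / c = (c\<^sup>2 + s\<^sup>2) * y / c" by (simp add: cs)
      then show ?thesis using False by (simp add: field_simps power2_eq_square)
    qed
    have "(\<integral>\<^sup>+ x. F (Complex (c * x - s * y) (s * x + c * y)) \<partial>lborel) =
      ennreal \<bar>1 / c\<bar> * (\<integral>\<^sup>+ x. F (Complex (c * (s * y / c + 1 / c * x) - s * y) (s * (s * y / c + 1 / c * x) + c * y)) \<partial>lborel)"
      using False by (intro nn_integral_real_affine) auto
    also have "(\<lambda>x. c * (s * y / c + 1 / c * x) - s * y) = (\<lambda>x. x)" using False by (simp add: field_simps)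
    then have "(\<lambda>x. F (Complex (c * (s * y / c + 1 / c * x) - s * y) (s * (s * y / c + 1 / c * x) + c * y))) =
       (\<lambda>x. F (Complex x (s * x / c + y / c)))"
      unfolding eq by (simp add: fun_eq_iff)
    finally show ?thesis .
  qed
  then have "(\<integral>\<^sup>+ y. \<integral>\<^sup>+ x. F (Complex (c * x - s * y) (s * x + c * y)) \<partial>lborel \<partial>lborel)
     = ennreal \<bar>1 / c\<bar> * (\<integral>\<^sup>+ y. \<integral>\<^sup>+ x. F (Complex x (s * x / c + y / c)) \<partial>lborel \<partial>lborel)"
    by (simp add: nn_integral_cmult)
  also have "\<dots> = ennreal \<bar>1 / c\<bar> * (\<integral>\<^sup>+ x. \<integral>\<^sup>+ y. F (Complex x (s * x / c + y / c)) \<partial>lborel \<partial>lborel)"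
    by (subst lborel_pair.Fubini') measurable
  also have "\<dots> = (\<integral>\<^sup>+ x. ennreal \<bar>1 / c\<bar> * (\<integral>\<^sup>+ y. F (Complex x (s * x / c + 1 / c * y)) \<partial>lborel) \<partial>lborel)"
    by (simp add: nn_integral_cmult)
  also have "\<dots> = (\<integral>\<^sup>+ x. \<integral>\<^sup>+ y. F (Complex x y) \<partial>lborel \<partial>lborel)"
  proof (rule nn_integral_cong)
    fix x :: real
    show "ennreal \<bar>1 / c\<bar> * (\<integral>\<^sup>+ y. F (Complex x (s * x / c + 1 / c * y)) \<partial>lborel) = (\<integral>\<^sup>+ y. F (Complex x y) \<partial>lborel)"
      by (rule nn_integral_real_affine[symmetric]) (use False in auto)
  qed
  also have "\<dots> = (\<integral>\<^sup>+ y. \<integral>\<^sup>+ x. F (Complex x y) \<partial>lborel \<partial>lborel)"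
    by (rule lborel_pair.Fubini') measurable
  finally show ?thesis by (simp add: nn_integral_complex)
qed

definition chord :: "real \<times> real \<Rightarrow> real \<Rightarrow> complex" where
  "chord x t = cis (fst x) + of_real t * cis (fst x + pi + snd x)"

definition chord_integral :: "(complex \<Rightarrow> ennreal) \<Rightarrow> real \<times> real \<Rightarrow> ennreal" where
  "chord_integral F x = (\<integral>\<^sup>+ t. F (chord x t) * indicator {0..2 * cos (snd x)} t \<partial>lborel)"

definition influx_set :: "(real \<times> real) set" where
  "influx_set = {0..<2 * pi} \<times> {- pi / 2..pi / 2}"

lemma chord_measurable [measurable]: "(\<lambda>p. chord (fst p) (snd p)) \<in> borel_measurable borel"
proof -
  have "continuous_on UNIV (\<lambda>p. chord (fst p) (snd p))"
    unfolding chord_def by (intro continuous_intros)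
  then show ?thesis by (rule borel_measurable_continuous_onI)
qed

lemma chord_measurable1 [measurable]: "chord x \<in> borel_measurable borel"
proof -
  have "continuous_on UNIV (chord x)" unfolding chord_def by (intro continuous_intros)
  then show ?thesis by (rule borel_measurable_continuous_onI)
qed

lemma chord_integral_measurable [measurable]:
  assumes [measurable]: "F \<in> borel_measurable borel"
  shows "chord_integral F \<in> borel_measurable borel"
proof -
  have [measurable]: "(\<lambda>p. chord (fst p) (snd p)) \<in> borel_measurable (borel \<Otimes>\<^sub>M lborel)"
    using chord_measurable unfolding borel_prod[symmetric] by (simp cong: measurable_cong_sets)
  have [measurable]: "(\<lambda>p :: (real \<times> real) \<times> real. 2 * cos (snd (fst p))) \<in> borel_measurable (borel \<Otimes>\<^sub>M lborel)"
  proof -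
    have "continuous_on UNIV (\<lambda>p :: (real \<times> real) \<times> real. 2 * cos (snd (fst p)))" by (intro continuous_intros)
    from borel_measurable_continuous_onI[OF this] show ?thesis
      unfolding borel_prod[symmetric] by (simp cong: measurable_cong_sets)
  qed
  have "(\<lambda>p. F (chord (fst p) (snd p)) * (if 0 \<le> snd p \<and> snd p \<le> 2 * cos (snd (fst p)) then 1 else 0)) \<in> borel_measurable (borel \<Otimes>\<^sub>M lborel)"
    by measurable
  then have "(\<lambda>p. F (chord (fst p) (snd p)) * indicator {0..2 * cos (snd (fst p))} (snd p)) \<in> borel_measurable (borel \<Otimes>\<^sub>M lborel)"
    by (simp add: indicator_def of_bool_def)
  then have "(\<lambda>x. \<integral>\<^sup>+ t. F (chord x t) * indicator {0..2 * cos (snd x)} t \<partial>lborel) \<in> borel_measurable borel"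
    using lborel.borel_measurable_nn_integral[of "\<lambda>x t. F (chord x t) * indicator {0..2 * cos (snd x)} t" borel]
    by (simp add: case_prod_beta')
  then show ?thesis by (simp add: chord_integral_def[abs_def])
qed

lemma chord_shift: "chord (\<beta>, \<alpha>) (cos \<alpha> + \<tau>) =
  Complex ((- cos (\<beta> + \<alpha>)) * \<tau> - (- sin (\<beta> + \<alpha>)) * sin \<alpha>) ((- sin (\<beta> + \<alpha>)) * \<tau> + (- cos (\<beta> + \<alpha>)) * sin \<alpha>)"
proof -
  have "cis \<beta> = cis (\<beta> + \<alpha>) * cis (- \<alpha>)" by (simp add: cis_mult)
  moreover have "cis (\<beta> + pi + \<alpha>) = - cis (\<beta> + \<alpha>)"
    by (simp add: complex_eq_iff cos_add sin_add)
  ultimately have "chord (\<beta>, \<alpha>) (cos \<alpha> + \<tau>) = cis (\<beta> + \<alpha>) * (cis (- \<alpha>) - of_real (cos \<alpha> + \<tau>))"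
    by (simp add: chord_def algebra_simps)
  also have "cis (- \<alpha>) - of_real (cos \<alpha> + \<tau>) = - Complex \<tau> (sin \<alpha>)"
    by (simp add: complex_eq_iff)
  finally show ?thesis by (simp add: complex_eq_iff algebra_simps)
qed

text \<open>
  Santalo's formula, as an inequality. In the coordinates \<open>\<theta> = \<beta> + \<alpha>\<close>, \<open>s = sin \<alpha>\<close>, \<open>t = cos \<alpha> + \<tau>\<close> a point
  of the chord is \<open>- e\<^sup>i\<^sup>\<theta> (\<tau> + i s)\<close>, a rotation of the plane for each fixed \<open>\<theta>\<close>; the factor \<open>cos \<alpha>\<close> is the
  derivative of \<open>s\<close>, and \<open>\<theta>\<close> stays between \<open>- \<pi>/2\<close> and \<open>5\<pi>/2\<close>, in the interval \<open>[-2, 10]\<close> of length \<open>12\<close>.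
\<close>

lemma Santalo_inequality:
  assumes F[measurable]: "F \<in> borel_measurable borel"
  shows "(\<integral>\<^sup>+ x. ennreal (cos (snd x)) * chord_integral F x * indicator influx_set x \<partial>lborel) \<le> 12 * (\<integral>\<^sup>+ z. F z \<partial>lborel)"
proof -
  define P where "P \<theta> s \<tau> = Complex ((- cos \<theta>) * \<tau> - (- sin \<theta>) * s) ((- sin \<theta>) * \<tau> + (- cos \<theta>) * s)" for \<theta> s \<tau> :: real
  define G where "G \<theta> s = (\<integral>\<^sup>+ \<tau>. F (P \<theta> s \<tau>) \<partial>lborel)" for \<theta> s
  have Pm: "(\<lambda>q. P (fst (fst q)) (snd (fst q)) (snd q)) \<in> borel_measurable borel"
  proof -
    have "continuous_on UNIV (\<lambda>q. P (fst (fst q)) (snd (fst q)) (snd q))"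
      unfolding P_def Complex_eq by (intro continuous_intros)
    then show ?thesis by (rule borel_measurable_continuous_onI)
  qed
  have [measurable]: "(\<lambda>q. P (fst (fst q)) (snd (fst q)) (snd q)) \<in> borel_measurable (borel \<Otimes>\<^sub>M lborel)"
    using Pm unfolding borel_prod[symmetric] by (simp cong: measurable_cong_sets)
  have "(\<lambda>q. F (P (fst (fst q)) (snd (fst q)) (snd q))) \<in> borel_measurable (borel \<Otimes>\<^sub>M lborel)"
    by measurable
  then have Gb: "(\<lambda>q. G (fst q) (snd q)) \<in> borel_measurable borel"
    unfolding G_def
    using lborel.borel_measurable_nn_integral[of "\<lambda>q \<tau>. F (P (fst q) (snd q) \<tau>)" borel] by (simp add: case_prod_beta')
  have G[measurable]: "(\<lambda>x. G (f x) (g x)) \<in> borel_measurable M" if "f \<in> borel_measurable M" "g \<in> borel_measurable M" for f g M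
  proof -
    have "(\<lambda>x. (f x, g x)) \<in> borel_measurable M" using that by measurable
    from measurable_compose[OF this Gb] show ?thesis by simp
  qed
  have ci: "chord_integral F (\<beta>, \<alpha>) \<le> G (\<beta> + \<alpha>) (sin \<alpha>)" for \<beta> \<alpha>
  proof -
    have "chord_integral F (\<beta>, \<alpha>) \<le> (\<integral>\<^sup>+ t. F (chord (\<beta>, \<alpha>) t) \<partial>lborel)"
      unfolding chord_integral_def by (intro nn_integral_mono) (auto simp: indicator_def)
    also have "\<dots> = (\<integral>\<^sup>+ \<tau>. F (chord (\<beta>, \<alpha>) (cos \<alpha> + 1 * \<tau>)) \<partial>lborel)"
      using nn_integral_real_affine[of "\<lambda>t. F (chord (\<beta>, \<alpha>) t)" 1 "cos \<alpha>"] by simp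
    also have "\<dots> = G (\<beta> + \<alpha>) (sin \<alpha>)" by (simp add: G_def P_def chord_shift)
    finally show ?thesis .
  qed
  have GF: "(\<integral>\<^sup>+ s. G \<theta> s \<partial>lborel) = (\<integral>\<^sup>+ z. F z \<partial>lborel)" for \<theta>
    unfolding G_def P_def by (rule nn_integral_rotation[OF F]) simp
  define H where "H s = (\<integral>\<^sup>+ \<theta>. G \<theta> s * indicator {-2..10} \<theta> \<partial>lborel)" for s
  have Hm: "H \<in> borel_measurable borel"
  proof -
    have "(\<lambda>q. G (snd q) (fst q) * indicator {-2..10} (snd q)) \<in> borel_measurable (borel \<Otimes>\<^sub>M lborel)"
      by measurable
    then show ?thesis unfolding H_def[abs_def]
      using lborel.borel_measurable_nn_integral[of "\<lambda>s \<theta>. G \<theta> s * indicator {-2..10} \<theta>" borel] by (simp add: case_prod_beta')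
  qed
  have "(\<integral>\<^sup>+ x. ennreal (cos (snd x)) * chord_integral F x * indicator influx_set x \<partial>lborel)
     = (\<integral>\<^sup>+ \<alpha>. \<integral>\<^sup>+ \<beta>. ennreal (cos \<alpha>) * chord_integral F (\<beta>, \<alpha>) * indicator influx_set (\<beta>, \<alpha>) \<partial>lborel \<partial>lborel)"
  proof -
    have "(\<lambda>x. ennreal (cos (snd x)) * chord_integral F x * indicator influx_set x) \<in> borel_measurable (lborel \<Otimes>\<^sub>M lborel)"
    proof -
      have "influx_set \<in> sets borel" unfolding influx_set_def borel_prod[symmetric] by (intro pair_measureI) auto
      moreover have "(\<lambda>x :: real \<times> real. ennreal (cos (snd x))) \<in> borel_measurable borel"
        by (intro measurable_compose[OF _ measurable_ennreal] borel_measurable_continuous_onI continuous_intros)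
      ultimately have "(\<lambda>x. ennreal (cos (snd x)) * chord_integral F x * indicator influx_set x) \<in> borel_measurable borel"
        by (intro borel_measurable_times_ennreal chord_integral_measurable F borel_measurable_indicator)
      then show ?thesis by (simp add: lborel_prod)
    qed
    from lborel_pair.nn_integral_snd[OF this] show ?thesis unfolding lborel_prod by simp
  qed
  also have "\<dots> \<le> (\<integral>\<^sup>+ \<alpha>. H (sin \<alpha>) * ennreal (cos \<alpha>) * indicator {- pi / 2..pi / 2} \<alpha> \<partial>lborel)"
  proof (rule nn_integral_mono)
    fix \<alpha> :: real
    show "(\<integral>\<^sup>+ \<beta>. ennreal (cos \<alpha>) * chord_integral F (\<beta>, \<alpha>) * indicator influx_set (\<beta>, \<alpha>) \<partial>lborel)
       \<le> H (sin \<alpha>) * ennreal (cos \<alpha>) * indicator {- pi / 2..pi / 2} \<alpha>"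
    proof (cases "\<alpha> \<in> {- pi / 2..pi / 2}")
      case True
      have "(\<integral>\<^sup>+ \<beta>. ennreal (cos \<alpha>) * chord_integral F (\<beta>, \<alpha>) * indicator influx_set (\<beta>, \<alpha>) \<partial>lborel)
        \<le> (\<integral>\<^sup>+ \<beta>. ennreal (cos \<alpha>) * (G (\<alpha> + 1 * \<beta>) (sin \<alpha>) * indicator {-2..10} (\<alpha> + 1 * \<beta>)) \<partial>lborel)"
      proof (rule nn_integral_mono)
        fix \<beta> :: real
        have "indicator influx_set (\<beta>, \<alpha>) \<le> (indicator {-2..10} (\<alpha> + 1 * \<beta>) :: ennreal)"
          using True pi_less_4 by (auto simp: indicator_def influx_set_def)
        then show "ennreal (cos \<alpha>) * chord_integral F (\<beta>, \<alpha>) * indicator influx_set (\<beta>, \<alpha>)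
           \<le> ennreal (cos \<alpha>) * (G (\<alpha> + 1 * \<beta>) (sin \<alpha>) * indicator {-2..10} (\<alpha> + 1 * \<beta>))"
          using ci[of \<beta> \<alpha>] unfolding mult.assoc by (intro mult_left_mono mult_mono) (auto simp: add.commute)
      qed
      also have "\<dots> = ennreal (cos \<alpha>) * (\<integral>\<^sup>+ \<beta>. G (\<alpha> + 1 * \<beta>) (sin \<alpha>) * indicator {-2..10} (\<alpha> + 1 * \<beta>) \<partial>lborel)"
        by (rule nn_integral_cmult) measurable
      also have "(\<integral>\<^sup>+ \<beta>. G (\<alpha> + 1 * \<beta>) (sin \<alpha>) * indicator {-2..10} (\<alpha> + 1 * \<beta>) \<partial>lborel) = H (sin \<alpha>)"
        unfolding H_def using nn_integral_real_affine[of "\<lambda>\<theta>. G \<theta> (sin \<alpha>) * indicator {-2..10} \<theta>" 1 \<alpha>] by simp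
      finally show ?thesis using True by (simp add: mult.commute)
    qed (auto simp: influx_set_def)
  qed
  also have "\<dots> = (\<integral>\<^sup>+ s. H s * indicator {sin (- pi / 2)..sin (pi / 2)} s \<partial>lborel)"
    by (subst nn_integral_substitution_aux[where g=sin and g'=cos])
       (auto simp: Hm intro!: derivative_eq_intros continuous_intros cos_ge_zero)
  also have "\<dots> \<le> (\<integral>\<^sup>+ s. H s \<partial>lborel)"
    by (intro nn_integral_mono) (auto simp: indicator_def)
  also have "\<dots> = (\<integral>\<^sup>+ \<theta>. \<integral>\<^sup>+ s. G \<theta> s * indicator {-2..10} \<theta> \<partial>lborel \<partial>lborel)"
    unfolding H_def by (rule lborel_pair.Fubini') measurable
  also have "\<dots> = (\<integral>\<^sup>+ \<theta>. (\<integral>\<^sup>+ z. F z \<partial>lborel) * indicator {-2..10} \<theta> \<partial>(lborel :: real measure))"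
    by (intro nn_integral_cong) (subst nn_integral_multc, measurable, simp add: GF)
  also have "\<dots> = 12 * (\<integral>\<^sup>+ z. F z \<partial>lborel)"
    by (simp add: nn_integral_cmult_indicator mult.commute)
  finally show ?thesis .
qed

lemma influx_set_borel: "influx_set \<in> sets borel"
  unfolding influx_set_def borel_prod[symmetric] by (intro pair_measureI) auto

lemma AE_influxI:
  assumes "AE x in lborel. x \<in> influx_set \<longrightarrow> 0 < cos (snd x) \<longrightarrow> P x"
  shows "AE x in influx \<gamma>. P x"
proof -
  define \<rho> where "\<rho> x = ennreal (cos (snd x) powr (- 2 * \<gamma>))" for x :: "real \<times> real"
  have [measurable]: "(\<lambda>x :: real \<times> real. cos (snd x)) \<in> borel_measurable borel"
    by (intro borel_measurable_continuous_onI continuous_intros)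
  have "\<rho> \<in> borel_measurable borel" unfolding \<rho>_def by measurable
  then have \<rho>: "\<rho> \<in> borel_measurable (lebesgue_on influx_set)"
    by (simp add: measurable_completion measurable_restrict_space1)
  have eq: "influx \<gamma> = density (lebesgue_on influx_set) \<rho>"
    unfolding influx_def influx_set_def \<rho>_def[abs_def] case_prod_beta' ..
  have il: "influx_set \<in> sets lebesgue" using influx_set_borel by simp
  have "AE x in lebesgue. x \<in> influx_set \<longrightarrow> 0 < cos (snd x) \<longrightarrow> P x"
    using assms by (rule AE_completion)
  then have "AE x in lebesgue_on influx_set. 0 < cos (snd x) \<longrightarrow> P x"
    using il by (subst AE_restrict_space_iff) auto
  then have "AE x in lebesgue_on influx_set. 0 < \<rho> x \<longrightarrow> P x"
  proof (rule AE_mp, intro AE_I2 impI)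
    fix x assume x: "x \<in> space (lebesgue_on influx_set)" and P: "0 < cos (snd x) \<longrightarrow> P x" and "0 < \<rho> x"
    then have "cos (snd x) \<noteq> 0" by (auto simp: \<rho>_def)
    moreover have "0 \<le> cos (snd x)" using x by (intro cos_ge_zero) (auto simp: influx_set_def)
    ultimately show "P x" using P by simp
  qed
  then show ?thesis unfolding eq AE_density[OF \<rho>] .
qed

lemma bdf_chord: "bdf (chord x t) = t * (2 * cos (snd x) - t)"
proof -
  have "cos (fst x + pi + snd x) = - cos (fst x + snd x)" "sin (fst x + pi + snd x) = - sin (fst x + snd x)"
    by (simp_all add: cos_add sin_add)
  then have "(cmod (chord x t))\<^sup>2 = (cos (fst x) - t * cos (fst x + snd x))\<^sup>2 + (sin (fst x) - t * sin (fst x + snd x))\<^sup>2"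
    by (simp add: chord_def cmod_power2)
  also have "\<dots> = ((cos (fst x))\<^sup>2 + (sin (fst x))\<^sup>2) - 2 * t * (cos (fst x + snd x) * cos (fst x) + sin (fst x + snd x) * sin (fst x))
      + t\<^sup>2 * ((cos (fst x + snd x))\<^sup>2 + (sin (fst x + snd x))\<^sup>2)"
  proof -
    have "(a - t * c)\<^sup>2 + (b - t * d)\<^sup>2 = (a\<^sup>2 + b\<^sup>2) - 2 * t * (c * a + d * b) + t\<^sup>2 * (c\<^sup>2 + d\<^sup>2)" for a b c d :: real
      by (simp add: power2_eq_square algebra_simps)
    then show ?thesis .
  qed
  also have "cos (fst x + snd x) * cos (fst x) + sin (fst x + snd x) * sin (fst x) = cos (snd x)"
    using cos_diff[of "fst x + snd x" "fst x"] by simp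
  finally have "(cmod (chord x t))\<^sup>2 = 1 - 2 * t * cos (snd x) + t\<^sup>2"
    by (simp only: sin_cos_squared_add2 mult_1_right)
  then show ?thesis by (simp add: bdf_def power2_eq_square algebra_simps)
qed

lemma chord_in_disk:
  assumes "t \<in> {0..2 * cos (snd x)}"
  shows "chord x t \<in> disk"
proof -
  have "0 \<le> bdf (chord x t)" using assms by (simp add: bdf_chord)
  then show ?thesis by (simp add: bdf_def abs_square_le_1)
qed

lemma chord_in_ball: "0 < t \<Longrightarrow> t < 2 * cos (snd x) \<Longrightarrow> chord x t \<in> ball 0 1"
proof -
  assume "0 < t" "t < 2 * cos (snd x)"
  then have "0 < bdf (chord x t)" by (simp add: bdf_chord)
  then show ?thesis by (simp add: bdf_def abs_square_less_1)
qed

lemma AE_chord_interior: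
  "AE t in lebesgue_on {0..2 * cos (snd x)}. chord x t \<in> ball 0 1"
proof -
  have "AE t in lborel. t \<noteq> 0 \<and> t \<noteq> 2 * cos (snd x)"
    using AE_lborel_singleton[of 0] AE_lborel_singleton[of "2 * cos (snd x)"]
    by eventually_elim simp
  from AE_completion[OF this] have "AE t in lebesgue. t \<in> {0..2 * cos (snd x)} \<longrightarrow> chord x t \<in> ball 0 1"
    by eventually_elim (use chord_in_ball[of _ x] in auto)
  then show ?thesis by (subst AE_restrict_space_iff) auto
qed

text \<open>
  By Santalo's formula, the chords that meet a given null set in positive length form a null set. Glancing
  directions, where \<open>cos \<alpha> = 0\<close>, are left out because the factor \<open>cos \<alpha>\<close> does not see them.
\<close>

lemma AE_chords_lborel:
  assumes "AE z in lebesgue_on disk. P z"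
  shows "AE x in lborel. x \<in> influx_set \<longrightarrow> 0 < cos (snd x) \<longrightarrow>
     (AE t in lebesgue_on {0..2 * cos (snd x)}. P (chord x t))"
proof -
  have "AE z in lebesgue. z \<in> disk \<longrightarrow> P z"
    using assms by (subst (asm) AE_restrict_space_iff) auto
  then have "AE z in lborel. z \<in> disk \<longrightarrow> P z" by (simp add: AE_completion_iff)
  then obtain N where N: "{z \<in> space lborel. \<not> (z \<in> disk \<longrightarrow> P z)} \<subseteq> N" "emeasure lborel N = 0" "N \<in> sets lborel"
    by (rule AE_E)
  define F where "F = (indicator N :: complex \<Rightarrow> ennreal)"
  have F[measurable]: "F \<in> borel_measurable borel" unfolding F_def using N(3) by simp
  have "(\<integral>\<^sup>+ z. F z \<partial>lborel) = 0" unfolding F_def using N by (simp add: nn_integral_indicator)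
  then have "(\<integral>\<^sup>+ x. ennreal (cos (snd x)) * chord_integral F x * indicator influx_set x \<partial>lborel) = 0"
    using Santalo_inequality[OF F] by simp
  moreover have "(\<lambda>x. ennreal (cos (snd x)) * chord_integral F x * indicator influx_set x) \<in> borel_measurable borel"
  proof -
    have "(\<lambda>x :: real \<times> real. ennreal (cos (snd x))) \<in> borel_measurable borel"
      by (intro measurable_compose[OF _ measurable_ennreal] borel_measurable_continuous_onI continuous_intros)
    then show ?thesis
      by (intro borel_measurable_times_ennreal chord_integral_measurable F borel_measurable_indicator influx_set_borel)
  qed
  ultimately have "AE x in lborel. ennreal (cos (snd x)) * chord_integral F x * indicator influx_set x = 0"
    by (subst (asm) nn_integral_0_iff_AE) auto
  then show ?thesis
  proof eventually_elim
    fix x assume *: "ennreal (cos (snd x)) * chord_integral F x * indicator influx_set x = 0"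
    show "x \<in> influx_set \<longrightarrow> 0 < cos (snd x) \<longrightarrow> (AE t in lebesgue_on {0..2 * cos (snd x)}. P (chord x t))"
    proof (intro impI)
      assume "x \<in> influx_set" "0 < cos (snd x)"
      with * have "chord_integral F x = 0" by (auto simp: ennreal_eq_0_iff)
      then have "AE t in lborel. F (chord x t) * indicator {0..2 * cos (snd x)} t = 0"
        unfolding chord_integral_def by (subst (asm) nn_integral_0_iff_AE) auto
      then have "AE t in lebesgue. F (chord x t) * indicator {0..2 * cos (snd x)} t = 0"
        by (rule AE_completion)
      then show "AE t in lebesgue_on {0..2 * cos (snd x)}. P (chord x t)"
        using N(1) chord_in_disk[of _ x]
        by (subst AE_restrict_space_iff) (auto elim!: eventually_mono simp: F_def indicator_def split: if_splits)
    qed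
  qed
qed

lemma borel_representative:
  fixes G :: "complex \<Rightarrow> real"
  assumes "G \<in> borel_measurable (lebesgue_on disk)"
  obtains G' where "G' \<in> borel_measurable borel" "AE z in lebesgue_on disk. G z = G' z"
proof -
  have "(\<lambda>z. if z \<in> disk then G z else 0) \<in> borel_measurable lebesgue"
    using borel_measurable_if_I[OF assms] by simp
  from completion_ex_borel_measurable_real[OF this]
  obtain G' where G': "G' \<in> borel_measurable lborel" "AE z in lborel. (if z \<in> disk then G z else 0) = G' z" by blast
  have "AE z in lebesgue. z \<in> disk \<longrightarrow> G z = G' z"
    using AE_completion[OF G'(2)] by eventually_elim auto
  then have "AE z in lebesgue_on disk. G z = G' z" by (subst AE_restrict_space_iff) auto
  then show ?thesis using that G' by simp
qed

lemma nn_integral_disk: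
  assumes "F \<in> borel_measurable borel"
  shows "(\<integral>\<^sup>+ z. F z \<partial>lebesgue_on disk) = (\<integral>\<^sup>+ z. F z * indicator disk z \<partial>lborel)"
  by (subst nn_integral_restrict_space) (simp_all add: nn_integral_completion)

text \<open>
  Santalo's formula bounds the mean of the chord integrals by the integral over the disk, so they are finite for
  almost every chord. For a sequence that tends to \<open>0\<close> in mean, Fatou's lemma shows that the lower limit of
  the chord integrals is \<open>0\<close> for almost every chord.
\<close>

lemma chords_of_null_sequence:
  fixes K :: "nat \<Rightarrow> complex \<Rightarrow> real"
  assumes K: "\<And>n. integrable (lebesgue_on disk) (K n)" "\<And>n z. 0 \<le> K n z"
  shows "AE x in lborel. x \<in> influx_set \<longrightarrow> 0 < cos (snd x) \<longrightarrow>
       (\<forall>n. integrable (lebesgue_on {0..2 * cos (snd x)}) (\<lambda>t. K n (chord x t)))"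
    and "(\<lambda>n. LINT z|lebesgue_on disk. K n z) \<longlonglongrightarrow> 0 \<Longrightarrow>
      AE x in lborel. x \<in> influx_set \<longrightarrow> 0 < cos (snd x) \<longrightarrow>
       (\<forall>e>0. \<exists>n. (LINT t|lebesgue_on {0..2 * cos (snd x)}. K n (chord x t)) < e)"
proof -
  have "\<exists>G. G \<in> borel_measurable borel \<and> (AE z in lebesgue_on disk. K n z = G z)" for n
    using borel_representative[OF borel_measurable_integrable[OF K(1)[of n]]] by metis
  then obtain G where G[measurable]: "\<And>n. G n \<in> borel_measurable borel"
    and KG: "\<And>n. AE z in lebesgue_on disk. K n z = G n z" by metis
  define F where "F n z = ennreal \<bar>G n z\<bar> * indicator disk z" for n z
  have F[measurable]: "F n \<in> borel_measurable borel" for n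
  proof -
    have [measurable]: "disk \<in> sets borel" by (rule borel_closed) simp
    show ?thesis unfolding F_def by measurable
  qed
  have FK: "(\<integral>\<^sup>+ z. F n z \<partial>lborel) = ennreal (LINT z|lebesgue_on disk. K n z)" for n
  proof -
    have "(\<integral>\<^sup>+ z. F n z \<partial>lborel) = (\<integral>\<^sup>+ z. ennreal \<bar>G n z\<bar> \<partial>lebesgue_on disk)"
      unfolding F_def by (rule nn_integral_disk[symmetric]) measurable
    also have "\<dots> = (\<integral>\<^sup>+ z. ennreal (K n z) \<partial>lebesgue_on disk)"
      by (rule nn_integral_cong_AE) (use KG[of n] in eventually_elim, use K(2)[of n] in \<open>metis abs_of_nonneg\<close>)
    also have "\<dots> = ennreal (LINT z|lebesgue_on disk. K n z)"
      by (rule nn_integral_eq_integral[OF K(1)]) (use K(2) in simp)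
    finally show ?thesis .
  qed
  define J where "J n x = ennreal (cos (snd x)) * chord_integral (F n) x * indicator influx_set x" for n x
  have J[measurable]: "J n \<in> borel_measurable borel" for n
  proof -
    have "(\<lambda>x :: real \<times> real. ennreal (cos (snd x))) \<in> borel_measurable borel"
      by (intro measurable_compose[OF _ measurable_ennreal] borel_measurable_continuous_onI continuous_intros)
    then show ?thesis unfolding J_def
      by (intro borel_measurable_times_ennreal chord_integral_measurable F borel_measurable_indicator influx_set_borel)
  qed
  have Jle: "(\<integral>\<^sup>+ x. J n x \<partial>lborel) \<le> 12 * ennreal (LINT z|lebesgue_on disk. K n z)" for n
    unfolding J_def using Santalo_inequality[OF F, of n] by (simp add: FK)
  have "AE x in lborel. \<forall>n. J n x \<noteq> \<infinity>"
  proof (subst AE_all_countable, intro allI nn_integral_noteq_infinite)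
    fix n
    have "(\<integral>\<^sup>+ x. J n x \<partial>lborel) < \<infinity>"
      by (rule le_less_trans[OF Jle]) (auto simp: ennreal_mult_less_top less_top[symmetric] ennreal_mult_eq_top_iff)
    then show "(\<integral>\<^sup>+ x. J n x \<partial>lborel) \<noteq> \<infinity>" by simp
  qed simp
  moreover have "AE x in lborel. \<forall>n. x \<in> influx_set \<longrightarrow> 0 < cos (snd x) \<longrightarrow>
     (AE t in lebesgue_on {0..2 * cos (snd x)}. K n (chord x t) = G n (chord x t))"
    unfolding AE_all_countable using AE_chords_lborel[OF KG] by blast
  ultimately have main: "AE x in lborel. x \<in> influx_set \<longrightarrow> 0 < cos (snd x) \<longrightarrow>
     (\<forall>n. integrable (lebesgue_on {0..2 * cos (snd x)}) (\<lambda>t. K n (chord x t)) \<and>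
       ennreal (LINT t|lebesgue_on {0..2 * cos (snd x)}. K n (chord x t)) = chord_integral (F n) x)"
  proof eventually_elim
    fix x
    assume fin: "\<forall>n. J n x \<noteq> \<infinity>"
      and AEx: "\<forall>n. x \<in> influx_set \<longrightarrow> 0 < cos (snd x) \<longrightarrow>
        (AE t in lebesgue_on {0..2 * cos (snd x)}. K n (chord x t) = G n (chord x t))"
    show "x \<in> influx_set \<longrightarrow> 0 < cos (snd x) \<longrightarrow>
     (\<forall>n. integrable (lebesgue_on {0..2 * cos (snd x)}) (\<lambda>t. K n (chord x t)) \<and>
       ennreal (LINT t|lebesgue_on {0..2 * cos (snd x)}. K n (chord x t)) = chord_integral (F n) x)"
    proof (intro impI allI)
      fix n assume x: "x \<in> influx_set" "0 < cos (snd x)"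
      let ?S = "{0..2 * cos (snd x)}"
      have ae: "AE t in lebesgue_on ?S. K n (chord x t) = G n (chord x t)" using AEx x by blast
      have Gm: "(\<lambda>t. G n (chord x t)) \<in> borel_measurable borel" by measurable
      have Km: "(\<lambda>t. K n (chord x t)) \<in> borel_measurable (lebesgue_on ?S)"
      proof (rule borel_measurable_if_D)
        have ae2: "AE t in lebesgue. (if t \<in> ?S then G n (chord x t) else 0) = (if t \<in> ?S then K n (chord x t) else 0)"
          using ae by (subst (asm) AE_restrict_space_iff) (auto elim!: eventually_mono)
        have m2: "(\<lambda>t. if t \<in> ?S then G n (chord x t) else 0) \<in> borel_measurable lebesgue"
          using Gm by (intro measurable_completion) measurable
        show "(\<lambda>t. if t \<in> ?S then K n (chord x t) else 0) \<in> borel_measurable lebesgue"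
          by (rule borel_measurable_AE[OF m2 ae2])
      qed
      have nn: "(\<integral>\<^sup>+ t. ennreal (K n (chord x t)) \<partial>lebesgue_on ?S) = chord_integral (F n) x"
      proof -
        have "(\<integral>\<^sup>+ t. ennreal (K n (chord x t)) \<partial>lebesgue_on ?S) = (\<integral>\<^sup>+ t. F n (chord x t) \<partial>lebesgue_on ?S)"
        proof (rule nn_integral_cong_AE)
          have "AE t in lebesgue_on ?S. t \<in> ?S" by (rule AE_I2) simp
          with ae show "AE t in lebesgue_on ?S. ennreal (K n (chord x t)) = F n (chord x t)"
          proof eventually_elim
            fix t assume *: "K n (chord x t) = G n (chord x t)" and "t \<in> ?S"
            then have "chord x t \<in> disk" using chord_in_disk by blast
            then show "ennreal (K n (chord x t)) = F n (chord x t)"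
              using * K(2)[of n "chord x t"] by (simp add: F_def)
          qed
        qed
        also have "\<dots> = chord_integral (F n) x"
          unfolding chord_integral_def
          by (subst nn_integral_restrict_space) (simp_all add: nn_integral_completion)
        finally show ?thesis .
      qed
      have "chord_integral (F n) x < \<infinity>"
        using fin[rule_format, of n] x unfolding J_def
        by (auto simp: ennreal_mult_eq_top_iff less_top[symmetric] ennreal_eq_0_iff)
      then have int: "integrable (lebesgue_on ?S) (\<lambda>t. K n (chord x t))"
        using nn K(2) by (intro integrableI_nonneg Km) auto
      moreover have "ennreal (LINT t|lebesgue_on ?S. K n (chord x t)) = chord_integral (F n) x"
        using nn nn_integral_eq_integral[OF int] K(2) by simp
      ultimately show "integrable (lebesgue_on ?S) (\<lambda>t. K n (chord x t)) \<and>
         ennreal (LINT t|lebesgue_on ?S. K n (chord x t)) = chord_integral (F n) x" by blast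
    qed
  qed
  then show "AE x in lborel. x \<in> influx_set \<longrightarrow> 0 < cos (snd x) \<longrightarrow>
       (\<forall>n. integrable (lebesgue_on {0..2 * cos (snd x)}) (\<lambda>t. K n (chord x t)))"
    by eventually_elim blast
  assume lim: "(\<lambda>n. LINT z|lebesgue_on disk. K n z) \<longlonglongrightarrow> 0"
  have "(\<integral>\<^sup>+ x. liminf (\<lambda>n. J n x) \<partial>lborel) \<le> liminf (\<lambda>n. \<integral>\<^sup>+ x. J n x \<partial>lborel)"
    by (rule nn_integral_liminf) simp
  also have "\<dots> \<le> liminf (\<lambda>n. ennreal (12 * (LINT z|lebesgue_on disk. K n z)))"
    using Jle by (intro Liminf_mono always_eventually allI) (simp add: ennreal_mult')
  also have "\<dots> = 0"
  proof -
    have "(\<lambda>n. ennreal (12 * (LINT z|lebesgue_on disk. K n z))) \<longlonglongrightarrow> ennreal (12 * 0)"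
      by (intro tendsto_ennrealI tendsto_mult_left lim)
    then show ?thesis by (simp add: lim_imp_Liminf)
  qed
  finally have "(\<integral>\<^sup>+ x. liminf (\<lambda>n. J n x) \<partial>lborel) = 0" by simp
  then have "AE x in lborel. liminf (\<lambda>n. J n x) = 0"
    by (subst (asm) nn_integral_0_iff_AE) auto
  with main show "AE x in lborel. x \<in> influx_set \<longrightarrow> 0 < cos (snd x) \<longrightarrow>
       (\<forall>e>0. \<exists>n. (LINT t|lebesgue_on {0..2 * cos (snd x)}. K n (chord x t)) < e)"
  proof eventually_elim
    fix x
    assume m: "x \<in> influx_set \<longrightarrow> 0 < cos (snd x) \<longrightarrow>
     (\<forall>n. integrable (lebesgue_on {0..2 * cos (snd x)}) (\<lambda>t. K n (chord x t)) \<and>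
       ennreal (LINT t|lebesgue_on {0..2 * cos (snd x)}. K n (chord x t)) = chord_integral (F n) x)"
      and l: "liminf (\<lambda>n. J n x) = 0"
    show "x \<in> influx_set \<longrightarrow> 0 < cos (snd x) \<longrightarrow>
       (\<forall>e>0. \<exists>n. (LINT t|lebesgue_on {0..2 * cos (snd x)}. K n (chord x t)) < e)"
    proof (intro impI allI)
      fix e :: real assume x: "x \<in> influx_set" "0 < cos (snd x)" and e: "0 < e"
      have "\<exists>n. J n x < ennreal (cos (snd x) * e)"
      proof (rule ccontr)
        assume "\<not> ?thesis"
        then have "ennreal (cos (snd x) * e) \<le> liminf (\<lambda>n. J n x)"
          by (intro Liminf_bounded always_eventually) (simp add: not_less)
        then show False using l x e by simp
      qed
      then obtain n where n: "J n x < ennreal (cos (snd x) * e)" by blast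
      let ?I = "LINT t|lebesgue_on {0..2 * cos (snd x)}. K n (chord x t)"
      have I0: "0 \<le> ?I" using K(2) by simp
      have "J n x = ennreal (cos (snd x)) * ennreal ?I" using m x by (simp add: J_def)
      also have "\<dots> = ennreal (cos (snd x) * ?I)" using x I0 by (simp add: ennreal_mult)
      finally have "cos (snd x) * ?I < cos (snd x) * e" using n I0 x by (simp add: ennreal_less_iff)
      then have "?I < e" using x by simp
      then show "\<exists>n. (LINT t|lebesgue_on {0..2 * cos (snd x)}. K n (chord x t)) < e" by blast
    qed
  qed
qed

section \<open>Gradients along chords\<close>

lemma emeasure_annulus:
  assumes "0 \<le> r" "r \<le> 1"
  shows "emeasure lebesgue {z \<in> disk. bdf z \<le> r} = ennreal (pi * r)"
proof -
  have eq: "{z \<in> disk. bdf z \<le> r} = cball 0 1 - ball 0 (sqrt (1 - r))"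
  proof (intro set_eqI iffI)
    fix z assume "z \<in> {z \<in> disk. bdf z \<le> r}"
    then have "cmod z \<le> 1" "1 - r \<le> (cmod z)\<^sup>2" by (auto simp: bdf_def)
    then have "sqrt (1 - r) \<le> cmod z" by (simp add: real_le_lsqrt real_sqrt_le_iff' real_le_rsqrt sqrt_le_D)
    then show "z \<in> cball 0 1 - ball 0 (sqrt (1 - r))" using \<open>cmod z \<le> 1\<close> by simp
  next
    fix z :: complex assume "z \<in> cball 0 1 - ball 0 (sqrt (1 - r))"
    then have "cmod z \<le> 1" "sqrt (1 - r) \<le> cmod z" by auto
    then have "1 - r \<le> (cmod z)\<^sup>2" using sqrt_le_D by blast
    then show "z \<in> {z \<in> disk. bdf z \<le> r}" using \<open>cmod z \<le> 1\<close> by (simp add: bdf_def)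
  qed
  have "sqrt (1 - r) \<le> 1" using assms by simp
  then have "ball 0 (sqrt (1 - r)) \<subseteq> (cball 0 1 :: complex set)" by (intro subset_trans[OF ball_subset_cball subset_cball])
  then have "emeasure lebesgue (cball 0 1 - ball 0 (sqrt (1 - r)) :: complex set)
      = emeasure lebesgue (cball 0 1 :: complex set) - emeasure lebesgue (ball 0 (sqrt (1 - r)) :: complex set)"
    using assms by (intro emeasure_Diff) (auto simp: emeasure_lborel_ball_finite less_top[symmetric] emeasure_ball ennreal_mult_eq_top_iff)
  also have "\<dots> = ennreal (pi * r)"
    using assms by (simp add: emeasure_cball emeasure_ball unit_ball_vol_2 ennreal_minus algebra_simps flip: ennreal_mult' ennreal_power)
  finally show ?thesis unfolding eq .
qed

text \<open>
  The annulus where \<open>d \<le> 2\<^sup>-\<^sup>k\<close> has area \<open>\<pi> 2\<^sup>-\<^sup>k\<close>, so that for \<open>\<gamma> < 0\<close> the integral is dominated by the geometric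
  series \<open>\<Sum>\<^sub>k 2\<^sup>-\<^sup>\<gamma>\<^sup>(\<^sup>k\<^sup>+\<^sup>1\<^sup>) \<pi> 2\<^sup>-\<^sup>k\<close>, whose ratio is \<open>2\<^sup>-\<^sup>(\<^sup>1\<^sup>+\<^sup>\<gamma>\<^sup>)\<close>.
\<close>

lemma integrable_bdf_powr:
  assumes "- 1 < \<gamma>"
  shows "integrable (lebesgue_on disk) (\<lambda>z. bdf z powr \<gamma>)"
proof (cases "0 \<le> \<gamma>")
  case True
  have "integrable (lebesgue_on disk) (\<lambda>z. 1 :: real)"
    using finite_measure_lebesgue_on[of disk] by (simp add: finite_measure.integrable_const)
  then show ?thesis
  proof (rule Bochner_Integration.integrable_bound)
    show "AE z in lebesgue_on disk. norm (bdf z powr \<gamma>) \<le> norm (1 :: real)"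
    proof (rule AE_I2)
      fix z assume "z \<in> space (lebesgue_on disk)"
      then have "0 \<le> bdf z" using bdf_nonneg by simp
      then show "norm (bdf z powr \<gamma>) \<le> norm (1 :: real)"
        using powr_mono2[OF True _ bdf_le_1, of z] by simp
    qed
  qed (rule bdf_powr_lebesgue_on)
next
  case False
  define S where "S k = {z \<in> disk. bdf z \<le> (1/2)^k}" for k :: nat
  have S: "S k \<in> sets lebesgue" for k
  proof -
    have "{z. bdf z \<le> (1/2)^k} \<in> sets borel"
      using borel_measurable_bdf by measurable
    moreover have "S k = disk \<inter> {z. bdf z \<le> (1/2)^k}" by (auto simp: S_def)
    ultimately show ?thesis by simp
  qed
  define q where "q = (1/2) powr (1 + \<gamma>)"
  have q: "0 < q" "q < 1" using assms powr_less_mono2[of "1 + \<gamma>" "1/2" 1] by (auto simp: q_def)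
  have le: "ennreal (bdf z powr \<gamma>) \<le> (\<Sum>k. ennreal (((1/2)^(Suc k)) powr \<gamma>) * indicator (S k) z)" if z: "z \<in> disk" for z
  proof (cases "bdf z = 0")
    case True then show ?thesis by simp
  next
    case False
    then have b: "0 < bdf z" using bdf_nonneg[OF z] by simp
    define n where "n = (LEAST n. (1/2 :: real)^n < bdf z)"
    have "\<exists>n. (1/2 :: real)^n < bdf z" using b by (intro real_arch_pow_inv) auto
    then have n: "(1/2 :: real)^n < bdf z" unfolding n_def by (rule LeastI_ex)
    have "n \<noteq> 0" using n bdf_le_1[of z] by (intro notI) simp
    then obtain k where k: "n = Suc k" by (auto simp: gr0_conv_Suc)
    have "\<not> (1/2 :: real)^k < bdf z" using not_less_Least[of k "\<lambda>n. (1/2 :: real)^n < bdf z"] k by (simp add: n_def)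
    then have "z \<in> S k" using z by (simp add: S_def)
    have "bdf z powr \<gamma> \<le> ((1/2)^(Suc k)) powr \<gamma>"
      using n \<open>\<not> 0 \<le> \<gamma>\<close> unfolding k by (intro powr_mono2') auto
    then have "ennreal (bdf z powr \<gamma>) \<le> ennreal (((1/2)^(Suc k)) powr \<gamma>) * indicator (S k) z"
      using \<open>z \<in> S k\<close> by (simp add: ennreal_leI)
    also have "\<dots> \<le> (\<Sum>k. ennreal (((1/2)^(Suc k)) powr \<gamma>) * indicator (S k) z)"
    proof -
      have "h k \<le> suminf h" for h :: "nat \<Rightarrow> ennreal" using sum_le_suminf[of h "{k}"] by simp
      then show ?thesis .
    qed
    finally show ?thesis .
  qed
  have "(\<integral>\<^sup>+ z. ennreal (bdf z powr \<gamma>) \<partial>lebesgue_on disk) \<le> (\<integral>\<^sup>+ z. (\<Sum>k. ennreal (((1/2)^(Suc k)) powr \<gamma>) * indicator (S k) z) \<partial>lebesgue_on disk)"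
    by (intro nn_integral_mono) (use le in auto)
  also have "\<dots> = (\<integral>\<^sup>+ z. (\<Sum>k. ennreal (((1/2)^(Suc k)) powr \<gamma>) * indicator (S k) z) * indicator disk z \<partial>lebesgue)"
    by (subst nn_integral_restrict_space) simp_all
  also have "\<dots> \<le> (\<integral>\<^sup>+ z. (\<Sum>k. ennreal (((1/2)^(Suc k)) powr \<gamma>) * indicator (S k) z) \<partial>lebesgue)"
    by (intro nn_integral_mono) (auto simp: indicator_def)
  also have "\<dots> = (\<Sum>k. \<integral>\<^sup>+ z. ennreal (((1/2)^(Suc k)) powr \<gamma>) * indicator (S k) z \<partial>lebesgue)"
    using S by (intro nn_integral_suminf) auto
  also have "\<dots> = (\<Sum>k. ennreal (((1/2)^(Suc k)) powr \<gamma>) * ennreal (pi * (1/2)^k))"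
  proof (rule suminf_cong)
    fix k
    show "(\<integral>\<^sup>+ z. ennreal (((1/2)^(Suc k)) powr \<gamma>) * indicator (S k) z \<partial>lebesgue) = ennreal (((1/2)^(Suc k)) powr \<gamma>) * ennreal (pi * (1/2)^k)"
      using S[of k] emeasure_annulus[of "(1/2)^k"] by (simp add: nn_integral_cmult_indicator S_def power_le_one)
  qed
  also have "\<dots> = (\<Sum>k. ennreal (2 * pi * q * q^k))"
  proof (rule suminf_cong)
    fix k
    have "((1/2)^(Suc k)) powr \<gamma> * (pi * (1/2)^k) = 2 * pi * q * q^k"
    proof -
      have "q^(Suc k) = ((1/2)^(Suc k)) powr (1 + \<gamma>)"
        unfolding q_def by (simp add: powr_powr powr_realpow[symmetric] mult.commute del: power_Suc)
      also have "\<dots> = (1/2)^(Suc k) * ((1/2)^(Suc k)) powr \<gamma>" by (subst powr_add) simp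
      finally have "q * q^k = (1/2)^(Suc k) * ((1/2)^(Suc k)) powr \<gamma>" by simp
      moreover have "2 * ((1/2 :: real)^(Suc k)) = (1/2)^k" by simp
      moreover have "x * (p * B) = 2 * p * q * Q" if "q * Q = A * x" "2 * A = B" for x p B q Q A :: real
        using that by algebra
      ultimately show ?thesis by blast
    qed
    then show "ennreal (((1/2)^(Suc k)) powr \<gamma>) * ennreal (pi * (1/2)^k) = ennreal (2 * pi * q * q^k)"
      by (simp only: ennreal_mult'[symmetric] powr_ge_zero)
  qed
  also have "\<dots> < \<infinity>"
    using q by (subst suminf_ennreal2) (auto intro!: summable_mult summable_geometric simp: less_top[symmetric])
  finally show ?thesis
    by (intro integrableI_nonneg bdf_powr_lebesgue_on) auto
qed

lemma const_one_sqint: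
  assumes "- 1 < \<gamma>"
  shows "(\<lambda>z. 1) \<in> sqint (wmeas \<gamma>)"
  unfolding sqint_def using integrable_bdf_powr[OF assms] integrable_wmeas[of "\<lambda>z. 1 :: real" \<gamma>] by simp

lemma integrable_wmeas_cancel:
  fixes f :: "complex \<Rightarrow> complex"
  assumes f: "f \<in> borel_measurable (lebesgue_on disk)" and i: "integrable (wmeas \<gamma>) (\<lambda>z. wt (- \<gamma>) z * f z)"
  shows "integrable (lebesgue_on disk) f"
proof -
  have m: "(\<lambda>z. wt (- \<gamma>) z * f z) \<in> borel_measurable (lebesgue_on disk)"
    using borel_measurable_wt[of "- \<gamma>" disk] f by measurable
  show ?thesis
  proof (rule integrable_cong_AE_imp[OF i[unfolded integrable_wmeas[OF m]] f])
    show "AE z in lebesgue_on disk. (bdf z powr \<gamma>) *\<^sub>R (wt (- \<gamma>) z * f z) = f z"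
      using null_sphere
    proof eventually_elim
      fix z :: complex assume z: "z \<in> ball 0 1"
      have "bdf z powr \<gamma> * bdf z powr (- \<gamma>) = 1" using bdf_pos[OF z] by (simp flip: powr_add)
      then have "wt \<gamma> z * wt (- \<gamma>) z = 1" by (simp add: wt_def flip: of_real_mult)
      then show "(bdf z powr \<gamma>) *\<^sub>R (wt (- \<gamma>) z * f z) = f z"
        by (simp add: wt_def scaleR_conv_of_real mult.assoc[symmetric])
    qed
  qed
qed

text \<open>
  The weights \<open>d\<^sup>\<gamma>\<close> and \<open>d\<^sup>-\<^sup>\<gamma>\<close> are dual to each other: Cauchy--Schwarz against the constant \<open>1\<close>, which is
  square integrable for the weight \<open>d\<^sup>\<gamma>\<close>.
\<close>

lemma sqint_dual_integrable:
  assumes "- 1 < \<gamma>" and u: "u \<in> sqint (wmeas (- \<gamma>))"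
  shows "integrable (lebesgue_on disk) u"
    "(LINT z|lebesgue_on disk. cmod (u z)) \<le> sqnorm (wmeas (- \<gamma>)) u * sqnorm (wmeas \<gamma>) (\<lambda>z. 1)"
proof -
  have um: "u \<in> borel_measurable (lebesgue_on disk)" using sqintD(1)[OF u] by (simp add: measurable_wmeas)
  have ws: "(\<lambda>z. wt (- \<gamma>) z * u z) \<in> sqint (wmeas \<gamma>)" by (rule sqint_weight_shift[OF u])
  show "integrable (lebesgue_on disk) u"
    using sqint_mult_integrable[OF ws const_one_sqint[OF assms(1)]]
    by (intro integrable_wmeas_cancel[OF um]) simp
  define v where "v z = complex_of_real (cmod (u z))" for z
  have vm: "v \<in> borel_measurable (lebesgue_on disk)" unfolding v_def using um by measurable
  have v: "v \<in> sqint (wmeas (- \<gamma>))" "sqnorm (wmeas (- \<gamma>)) v = sqnorm (wmeas (- \<gamma>)) u"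
    using u vm by (auto simp: sqint_def v_def measurable_wmeas sqnorm_def)
  have "(LINT z|lebesgue_on disk. cmod (u z)) = cmod (LINT z|lebesgue_on disk. v z)"
    unfolding v_def by simp
  also have "\<dots> = cmod (LINT z|wmeas \<gamma>. (wt (- \<gamma>) z * v z) * 1)"
    using integral_wmeas_cancel[OF vm, of \<gamma>] by simp
  also have "\<dots> \<le> sqnorm (wmeas \<gamma>) (\<lambda>z. wt (- \<gamma>) z * v z) * sqnorm (wmeas \<gamma>) (\<lambda>z. 1)"
    by (intro Cauchy_Schwarz_integral const_one_sqint assms(1) sqint_weight_shift v)
  also have "\<dots> = sqnorm (wmeas (- \<gamma>)) u * sqnorm (wmeas \<gamma>) (\<lambda>z. 1)"
    unfolding sqint_weight_shift(2)[OF v(1)] v(2) ..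
  finally show "(LINT z|lebesgue_on disk. cmod (u z)) \<le> sqnorm (wmeas (- \<gamma>)) u * sqnorm (wmeas \<gamma>) (\<lambda>z. 1)" .
qed

lemma sqint_weighted_integrable:
  assumes "- 1 < \<gamma>" and u: "u \<in> sqint (wmeas \<gamma>)"
  shows "integrable (lebesgue_on disk) (\<lambda>z. u z * of_real (bdf z powr \<gamma>))"
proof -
  have um: "u \<in> borel_measurable (lebesgue_on disk)" using sqintD(1)[OF u] by (simp add: measurable_wmeas)
  have "integrable (wmeas \<gamma>) u"
    using sqint_mult_integrable[OF u const_one_sqint[OF assms(1)]] by simp
  then show ?thesis unfolding integrable_wmeas[OF um] by (simp add: scaleR_conv_of_real mult.commute)
qed

text \<open>
  Lebesgue measure on \<open>\<partial>\<^sub>+SD\<close> and its weighted versions have the same null sets, so a statement about almost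
  every chord needs no weight. Glancing directions form a null set.
\<close>

definition AE_chord :: "(real \<times> real \<Rightarrow> bool) \<Rightarrow> bool" where
  "AE_chord P \<longleftrightarrow> (AE x in lborel. x \<in> influx_set \<longrightarrow> 0 < cos (snd x) \<longrightarrow> P x)"

lemma AE_chord_conj:
  assumes "AE_chord P" "AE_chord Q"
  shows "AE_chord (\<lambda>x. P x \<and> Q x)"
  using assms unfolding AE_chord_def by eventually_elim blast

lemma AE_chord_mono: "AE_chord P \<Longrightarrow> (\<And>x. 0 < cos (snd x) \<Longrightarrow> P x \<Longrightarrow> Q x) \<Longrightarrow> AE_chord Q"
  unfolding AE_chord_def by (auto elim!: eventually_mono)

lemma AE_chord_finite: "finite A \<Longrightarrow> (\<And>a. a \<in> A \<Longrightarrow> AE_chord (P a)) \<Longrightarrow> AE_chord (\<lambda>x. \<forall>a\<in>A. P a x)"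
proof (induction A rule: finite_induct)
  case empty show ?case by (simp add: AE_chord_def)
next
  case (insert a A)
  then show ?case using AE_chord_conj[of "P a" "\<lambda>x. \<forall>a\<in>A. P a x"] by simp
qed

abbreviation chord_meas :: "real \<times> real \<Rightarrow> real measure" where
  "chord_meas x \<equiv> lebesgue_on {0..2 * cos (snd x)}"

lemma AE_chord_points:
  "AE z in lebesgue_on disk. P z \<Longrightarrow> AE_chord (\<lambda>x. AE t in chord_meas x. P (chord x t))"
  unfolding AE_chord_def by (rule AE_chords_lborel)

lemma AE_chord_integrable:
  fixes G :: "complex \<Rightarrow> complex"
  assumes G: "integrable (lebesgue_on disk) G"
  shows "AE_chord (\<lambda>x. integrable (chord_meas x) (\<lambda>t. G (chord x t)))"
proof -
  have *: "AE_chord (\<lambda>x. integrable (chord_meas x) (\<lambda>t. R (chord x t)))"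
    if R: "integrable (lebesgue_on disk) R" for R :: "complex \<Rightarrow> real"
  proof -
    have "AE_chord (\<lambda>x. integrable (chord_meas x) (\<lambda>t. max 0 (R (chord x t))))"
         "AE_chord (\<lambda>x. integrable (chord_meas x) (\<lambda>t. max 0 (- R (chord x t))))"
      using chords_of_null_sequence(1)[of "\<lambda>n z. max 0 (R z)"] chords_of_null_sequence(1)[of "\<lambda>n z. max 0 (- R z)"] R
      unfolding AE_chord_def by auto
    from AE_chord_conj[OF this] show ?thesis
    proof (rule AE_chord_mono)
      fix x :: "real \<times> real"
      assume "integrable (chord_meas x) (\<lambda>t. max 0 (R (chord x t))) \<and> integrable (chord_meas x) (\<lambda>t. max 0 (- R (chord x t)))"
      then have "integrable (chord_meas x) (\<lambda>t. max 0 (R (chord x t)) - max 0 (- R (chord x t)))"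
        by (intro Bochner_Integration.integrable_diff) auto
      moreover have "max 0 r - max 0 (- r) = r" for r :: real by simp
      ultimately show "integrable (chord_meas x) (\<lambda>t. R (chord x t))" by simp
    qed
  qed
  from AE_chord_conj[OF *[OF integrable_Re[OF G]] *[OF integrable_Im[OF G]]] show ?thesis
  proof (rule AE_chord_mono)
    fix x :: "real \<times> real"
    assume "integrable (chord_meas x) (\<lambda>t. Re (G (chord x t))) \<and> integrable (chord_meas x) (\<lambda>t. Im (G (chord x t)))"
    then have "integrable (chord_meas x) (\<lambda>t. of_real (Re (G (chord x t))) + \<i> * of_real (Im (G (chord x t))))"
      by (intro Bochner_Integration.integrable_add integrable_mult_right integrable_of_real) auto
    then show "integrable (chord_meas x) (\<lambda>t. G (chord x t))" by (simp flip: complex_eq)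
  qed
qed

definition chord_dir :: "real \<times> real \<Rightarrow> complex" where
  "chord_dir x = cis (fst x + pi + snd x)"

lemma chord_integral_gradient:
  assumes u: "C1c u" and c: "0 < cos (snd x)"
  shows "integrable (chord_meas x) (\<lambda>t. pd i u (chord x t))"
    "(LINT t|chord_meas x. of_real (coord Xdir (chord_dir x)) * pd Xdir u (chord x t)
        + of_real (coord Ydir (chord_dir x)) * pd Ydir u (chord x t)) = 0"
proof -
  let ?S = "{0..2 * cos (snd x)}"
  have cc: "continuous_on UNIV (chord x)" unfolding chord_def by (intro continuous_intros)
  have pc: "continuous_on UNIV (\<lambda>t. pd i u (chord x t))" for i
    by (rule continuous_on_compose2[OF C1cD(3)[OF u] cc]) simp
  have conv: "integral\<^sup>L (chord_meas x) f = (LINT t|lborel. indicator ?S t *\<^sub>R f t)"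
    "integrable (chord_meas x) f \<longleftrightarrow> integrable lborel (\<lambda>t. indicator ?S t *\<^sub>R f t)"
    if "continuous_on UNIV f" for f :: "real \<Rightarrow> complex"
  proof -
    have "(\<lambda>t. indicator ?S t *\<^sub>R f t) \<in> borel_measurable borel"
      using borel_measurable_continuous_onI[OF that] by measurable
    then show "integral\<^sup>L (chord_meas x) f = (LINT t|lborel. indicator ?S t *\<^sub>R f t)"
      "integrable (chord_meas x) f \<longleftrightarrow> integrable lborel (\<lambda>t. indicator ?S t *\<^sub>R f t)"
      by (simp_all add: integral_restrict_space integrable_restrict_space integral_completion integrable_completion)
  qed
  show "integrable (chord_meas x) (\<lambda>t. pd i u (chord x t))"
    unfolding conv(2)[OF pc] by (rule borel_integrable_compact) (auto intro: continuous_on_subset[OF pc])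
  let ?f = "\<lambda>t. of_real (coord Xdir (chord_dir x)) * pd Xdir u (chord x t) + of_real (coord Ydir (chord_dir x)) * pd Ydir u (chord x t)"
  have fc: "continuous_on UNIV ?f" by (intro continuous_intros pc)
  have "(LINT t|lborel. indicator ?S t *\<^sub>R ?f t) = u (chord x (2 * cos (snd x))) - u (chord x 0)"
  proof (rule integral_FTC_Icc)
    fix t :: real
    have "((\<lambda>t. u (cis (fst x) + of_real t * chord_dir x)) has_vector_derivative ?f t) (at t)"
      using has_vector_derivative_line[OF C1cD(1)[OF u], where z="cis (fst x)" and t=t and v="chord_dir x"] by (simp add: chord_def chord_dir_def)
    then show "((\<lambda>t. u (chord x t)) has_vector_derivative ?f t) (at t within ?S)"
      by (simp add: chord_def chord_dir_def has_vector_derivative_at_within)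
    show "continuous_on ?S ?f" using fc continuous_on_subset by blast
  qed (use c in simp)
  also have "u (chord x (2 * cos (snd x))) = 0"
    using bdf_chord[of x "2 * cos (snd x)"] by (intro C1c_zero_outside[OF u]) (auto simp: bdf_def abs_square_eq_1)
  also have "u (chord x 0) = 0"
    using bdf_chord[of x 0] by (intro C1c_zero_outside[OF u]) (auto simp: bdf_def abs_square_eq_1)
  finally show "integral\<^sup>L (chord_meas x) ?f = 0" unfolding conv(1)[OF fc] by simp
qed

text \<open>
  Along almost every chord the gradient of a function in \<open>H\<^sub>0\<^sup>1\<close> integrates to \<open>0\<close>. Test functions
  vanish at both ends of the chord, and their gradients converge in mean, since \<open>L\<^sup>2\<close> for the weight
  \<open>d\<^sup>-\<^sup>\<gamma>\<close> embeds into \<open>L\<^sup>1\<close>.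
\<close>

lemma AE_chord_gradient:
  assumes "- 1 < \<gamma>" and H: "H10_grad (- \<gamma>) u g"
  shows "AE_chord (\<lambda>x. integrable (chord_meas x) (\<lambda>t. g i (chord x t)))"
    "AE_chord (\<lambda>x. (LINT t|chord_meas x. of_real (coord Xdir (chord_dir x)) * g Xdir (chord x t)
        + of_real (coord Ydir (chord_dir x)) * g Ydir (chord x t)) = 0)"
proof -
  obtain \<phi> where \<phi>: "\<And>i. g i \<in> sqint (wmeas (- \<gamma>))" "\<And>n. test_fun (\<phi> n)"
    "\<And>i. (\<lambda>n. sqnorm (wmeas (- \<gamma>)) (\<lambda>z. pd i (\<phi> n) z - g i z)) \<longlonglongrightarrow> 0"
    using H unfolding H10_grad_iff by blast
  note u = test_fun_C1c(1)[OF \<phi>(2)]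
  show g: "AE_chord (\<lambda>x. integrable (chord_meas x) (\<lambda>t. g i (chord x t)))" for i
    by (rule AE_chord_integrable[OF sqint_dual_integrable(1)[OF assms(1) \<phi>(1)]])
  define K where "K n z = cmod (pd Xdir (\<phi> n) z - g Xdir z) + cmod (pd Ydir (\<phi> n) z - g Ydir z)" for n z
  have di: "(\<lambda>z. pd i (\<phi> n) z - g i z) \<in> sqint (wmeas (- \<gamma>))" for i n
    by (intro sqint_diff test_fun_sqint \<phi>)
  note dint = integrable_norm[OF sqint_dual_integrable(1)[OF assms(1) di]]
  have K1: "integrable (lebesgue_on disk) (K n)" for n
    unfolding K_def by (intro Bochner_Integration.integrable_add dint)
  have K2: "(\<lambda>n. LINT z|lebesgue_on disk. K n z) \<longlonglongrightarrow> 0"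
  proof (rule Lim_null_comparison)
    let ?c = "sqnorm (wmeas \<gamma>) (\<lambda>z. 1)"
    show "(\<lambda>n. sqnorm (wmeas (- \<gamma>)) (\<lambda>z. pd Xdir (\<phi> n) z - g Xdir z) * ?c
        + sqnorm (wmeas (- \<gamma>)) (\<lambda>z. pd Ydir (\<phi> n) z - g Ydir z) * ?c) \<longlonglongrightarrow> 0"
      using tendsto_add[OF tendsto_mult_right[OF \<phi>(3)[of Xdir], of ?c] tendsto_mult_right[OF \<phi>(3)[of Ydir], of ?c]] by simp
    have "norm (LINT z|lebesgue_on disk. K n z) \<le> sqnorm (wmeas (- \<gamma>)) (\<lambda>z. pd Xdir (\<phi> n) z - g Xdir z) * ?c
        + sqnorm (wmeas (- \<gamma>)) (\<lambda>z. pd Ydir (\<phi> n) z - g Ydir z) * ?c" for n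
    proof -
      have "0 \<le> (LINT z|lebesgue_on disk. K n z)" by (simp add: K_def)
      moreover have "(LINT z|lebesgue_on disk. K n z) = (LINT z|lebesgue_on disk. cmod (pd Xdir (\<phi> n) z - g Xdir z))
         + (LINT z|lebesgue_on disk. cmod (pd Ydir (\<phi> n) z - g Ydir z))"
        unfolding K_def by (intro Bochner_Integration.integral_add dint)
      ultimately show ?thesis
        using sqint_dual_integrable(2)[OF assms(1) di[of Xdir n]] sqint_dual_integrable(2)[OF assms(1) di[of Ydir n]] by simp
    qed
    then show "\<forall>\<^sub>F n in sequentially. norm (LINT z|lebesgue_on disk. K n z) \<le>
        sqnorm (wmeas (- \<gamma>)) (\<lambda>z. pd Xdir (\<phi> n) z - g Xdir z) * ?c
        + sqnorm (wmeas (- \<gamma>)) (\<lambda>z. pd Ydir (\<phi> n) z - g Ydir z) * ?c" by simp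
  qed
  have Kc: "AE_chord (\<lambda>x. \<forall>e>0. \<exists>n. (LINT t|chord_meas x. K n (chord x t)) < e)"
    unfolding AE_chord_def by (rule chords_of_null_sequence(2)[OF K1 _ K2]) (simp add: K_def)
  from AE_chord_conj[OF AE_chord_conj[OF g[of Xdir] g[of Ydir]] Kc]
  show "AE_chord (\<lambda>x. (LINT t|chord_meas x. of_real (coord Xdir (chord_dir x)) * g Xdir (chord x t)
        + of_real (coord Ydir (chord_dir x)) * g Ydir (chord x t)) = 0)"
  proof (rule AE_chord_mono)
    fix x :: "real \<times> real"
    assume c: "0 < cos (snd x)"
      and a: "(integrable (chord_meas x) (\<lambda>t. g Xdir (chord x t)) \<and> integrable (chord_meas x) (\<lambda>t. g Ydir (chord x t)))
        \<and> (\<forall>e>0. \<exists>n. (LINT t|chord_meas x. K n (chord x t)) < e)"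
    let ?a = "complex_of_real (coord Xdir (chord_dir x))" and ?b = "complex_of_real (coord Ydir (chord_dir x))"
    have ab: "cmod ?a \<le> 1" "cmod ?b \<le> 1"
      using abs_Re_le_cmod[of "chord_dir x"] abs_Im_le_cmod[of "chord_dir x"] by (auto simp: chord_dir_def)
    let ?I = "LINT t|chord_meas x. ?a * g Xdir (chord x t) + ?b * g Ydir (chord x t)"
    have "cmod ?I \<le> e" if e: "e > 0" for e
    proof -
      obtain n where n: "(LINT t|chord_meas x. K n (chord x t)) < e" using a e by blast
      note ints = conjunct1[OF conjunct1[OF a]] conjunct2[OF conjunct1[OF a]]
        chord_integral_gradient(1)[OF u[of n] c, of Xdir] chord_integral_gradient(1)[OF u[of n] c, of Ydir]
      have "?I = ?I - (LINT t|chord_meas x. ?a * pd Xdir (\<phi> n) (chord x t) + ?b * pd Ydir (\<phi> n) (chord x t))"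
        using chord_integral_gradient(2)[OF u[of n] c] by simp
      also have "\<dots> = (LINT t|chord_meas x. (?a * g Xdir (chord x t) + ?b * g Ydir (chord x t))
          - (?a * pd Xdir (\<phi> n) (chord x t) + ?b * pd Ydir (\<phi> n) (chord x t)))"
        by (intro Bochner_Integration.integral_diff[symmetric] Bochner_Integration.integrable_add integrable_mult_right ints)
      finally have eq: "?I = (LINT t|chord_meas x. (?a * g Xdir (chord x t) + ?b * g Ydir (chord x t))
          - (?a * pd Xdir (\<phi> n) (chord x t) + ?b * pd Ydir (\<phi> n) (chord x t)))" .
      have "cmod ?I \<le> (LINT t|chord_meas x. cmod ((?a * g Xdir (chord x t) + ?b * g Ydir (chord x t))
          - (?a * pd Xdir (\<phi> n) (chord x t) + ?b * pd Ydir (\<phi> n) (chord x t))))"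
        by (subst eq, rule integral_norm_bound)
      also have "\<dots> \<le> (LINT t|chord_meas x. K n (chord x t))"
      proof (rule integral_mono)
        show "integrable (chord_meas x) (\<lambda>t. cmod ((?a * g Xdir (chord x t) + ?b * g Ydir (chord x t))
          - (?a * pd Xdir (\<phi> n) (chord x t) + ?b * pd Ydir (\<phi> n) (chord x t))))"
          by (intro integrable_norm Bochner_Integration.integrable_diff Bochner_Integration.integrable_add integrable_mult_right ints)
        show "integrable (chord_meas x) (\<lambda>t. K n (chord x t))"
          unfolding K_def by (intro Bochner_Integration.integrable_add integrable_norm Bochner_Integration.integrable_diff ints)
        fix t
        let ?X = "pd Xdir (\<phi> n) (chord x t) - g Xdir (chord x t)" and ?Y = "pd Ydir (\<phi> n) (chord x t) - g Ydir (chord x t)"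
        have "cmod ((?a * g Xdir (chord x t) + ?b * g Ydir (chord x t))
          - (?a * pd Xdir (\<phi> n) (chord x t) + ?b * pd Ydir (\<phi> n) (chord x t))) = cmod (?a * ?X + ?b * ?Y)"
          by (subst norm_minus_commute) (simp add: algebra_simps)
        also have "\<dots> \<le> cmod ?a * cmod ?X + cmod ?b * cmod ?Y"
          using norm_triangle_ineq[of "?a * ?X" "?b * ?Y"] by (simp only: norm_mult)
        also have "\<dots> \<le> K n (chord x t)"
          unfolding K_def using ab by (intro add_mono mult_left_le_one_le) auto
        finally show "cmod ((?a * g Xdir (chord x t) + ?b * g Ydir (chord x t))
          - (?a * pd Xdir (\<phi> n) (chord x t) + ?b * pd Ydir (\<phi> n) (chord x t))) \<le> K n (chord x t)" .
      qed
      finally show ?thesis using n by simp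
    qed
    then have "cmod ?I \<le> 0" using field_le_epsilon[of "cmod ?I" 0] by simp
    then show "?I = 0" by simp
  qed
qed

section \<open>Symmetric tensors and their Fourier modes\<close>

lemma finite_axis_UNIV: "finite (UNIV :: axis set)"
proof -
  have "(UNIV :: axis set) = {Xdir, Ydir}" using axis.exhaust by blast
  then show ?thesis by (metis finite.emptyI finite_insert)
qed

lemma finite_index_lists: "finite {I :: axis list. length I = m}"
  using finite_lists_length_eq[OF finite_axis_UNIV, of m] by simp

lemma sum_axis: "(\<Sum>i\<in>UNIV. h i) = h Xdir + (h Ydir :: 'a :: comm_monoid_add)"
proof -
  have eq: "(UNIV :: axis set) = {Xdir, Ydir}" using axis.exhaust by blast
  show ?thesis unfolding eq by simp
qed

lemma sum_index_lists_Suc: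
  fixes h :: "axis list \<Rightarrow> 'a :: comm_monoid_add"
  shows "(\<Sum>I | length I = Suc m. h I) = (\<Sum>i\<in>UNIV. \<Sum>I | length I = m. h (i # I))"
proof -
  have "(\<Sum>I | length I = Suc m. h I) = (\<Sum>(i, I)\<in>UNIV \<times> {I. length I = m}. h (i # I))"
  proof (rule sum.reindex_bij_witness[where i="\<lambda>(i, I). i # I" and j="\<lambda>I. (hd I, tl I)"])
    fix I :: "axis list" assume "I \<in> {I. length I = Suc m}"
    then show "(\<lambda>(i, I). i # I) (hd I, tl I) = I" "(hd I, tl I) \<in> UNIV \<times> {I. length I = m}"
      "(case (hd I, tl I) of (i, I) \<Rightarrow> h (i # I)) = h I" by (cases I; simp)+
  qed auto
  also have "\<dots> = (\<Sum>i\<in>UNIV. \<Sum>I | length I = m. h (i # I))"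
    by (rule sum.cartesian_product[symmetric])
  finally show ?thesis .
qed

definition vpow :: "complex \<Rightarrow> axis list \<Rightarrow> complex" where
  "vpow v I = of_real (prod_list (map (\<lambda>i. coord i v) I))"

lemma vpow_Nil [simp]: "vpow v [] = 1" and vpow_Cons [simp]: "vpow v (i # I) = of_real (coord i v) * vpow v I"
  by (simp_all add: vpow_def)

lemma vpow_mset: "mset I = mset J \<Longrightarrow> vpow v I = vpow v J"
  unfolding vpow_def by (metis mset_map prod_mset_prod_list)

lemma apply_diag_vpow: "apply_diag m S v = (\<Sum>I | length I = m. S I * vpow v I)"
  by (simp add: apply_diag_def vpow_def)

lemma apply_diag_Suc:
  "apply_diag (Suc m) S v = (\<Sum>i\<in>UNIV. of_real (coord i v) * apply_diag m (\<lambda>I. S (i # I)) v)"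
  unfolding apply_diag_vpow sum_index_lists_Suc by (simp add: sum_distrib_left mult.left_commute)

lemma apply_diag_0: "apply_diag 0 S v = S []"
  by (simp add: apply_diag_vpow)

lemma apply_diag_cong: "(\<And>I. length I = m \<Longrightarrow> S I = T I) \<Longrightarrow> apply_diag m S v = apply_diag m T v"
  unfolding apply_diag_vpow by (intro sum.cong) auto

lemma apply_diag_add: "apply_diag m (\<lambda>I. S I + T I) v = apply_diag m S v + apply_diag m T v"
  unfolding apply_diag_vpow by (simp add: distrib_right sum.distrib)

lemma apply_diag_diff: "apply_diag m (\<lambda>I. S I - T I) v = apply_diag m S v - apply_diag m T v"
  unfolding apply_diag_vpow by (simp add: left_diff_distrib sum_subtractf)

lemma apply_diag_cmult: "apply_diag m (\<lambda>I. c * S I) v = c * apply_diag m S v"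
  unfolding apply_diag_vpow by (simp add: sum_distrib_left mult.assoc)

lemma apply_diag_sum: "apply_diag m (\<lambda>I. \<Sum>j\<in>A. S j I) v = (\<Sum>j\<in>A. apply_diag m (S j) v)"
  unfolding apply_diag_vpow by (subst sum.swap) (simp add: sum_distrib_right)

lemma coord_complex: "complex_of_real (Re v) = (v + cnj v) / 2" "complex_of_real (Im v) = (- \<i>) * (v - cnj v) / 2"
  by (simp_all add: complex_eq_iff)

lemma apply_diag_cov_power:
  "apply_diag m (cov_power dz) v = v ^ m" "apply_diag m (cov_power dzbar) v = (cnj v) ^ m"
proof -
  have "of_real (Re v) + of_real (Im v) * \<i> = v" "of_real (Re v) - of_real (Im v) * \<i> = cnj v"
    by (simp_all add: complex_eq_iff)
  then have *: "of_real (Re v) * c + of_real (Im v) * (\<i> * c) = v * c" "of_real (Re v) * c - of_real (Im v) * (\<i> * c) = cnj v * c" for c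
    by (metis distrib_right mult.assoc, metis left_diff_distrib mult.assoc)
  have "cov_power \<omega> (i # I) = \<omega> i * cov_power \<omega> I" for \<omega> i I by (simp add: cov_power_def)
  then have **: "apply_diag (Suc m) (cov_power \<omega>) v = (\<Sum>i\<in>UNIV. of_real (coord i v) * (\<omega> i * apply_diag m (cov_power \<omega>) v))" for \<omega> m
    by (simp add: apply_diag_Suc apply_diag_cmult)
  show "apply_diag m (cov_power dz) v = v ^ m"
    by (induction m) (simp_all add: apply_diag_0 cov_power_def[of _ "[]"] ** sum_axis *)
  show "apply_diag m (cov_power dzbar) v = (cnj v) ^ m"
    by (induction m) (simp_all add: apply_diag_0 cov_power_def[of _ "[]"] ** sum_axis *)
qed

lemma symmetrize_mset:
  assumes "mset I = mset J"
  shows "symmetrize T z I = symmetrize T z J"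
proof -
  obtain \<sigma> where \<sigma>: "\<sigma> permutes {..<length J}" "permute_list \<sigma> J = I"
    using mset_eq_permutation[OF assms] by blast
  have len: "length I = length J" using assms by (metis size_mset)
  have "(\<Sum>\<pi> | \<pi> permutes {..<length J}. T z (permute_list \<pi> J)) = (\<Sum>\<pi> | \<pi> permutes {..<length J}. T z (permute_list (\<sigma> \<circ> \<pi>) J))"
    by (rule setum_permutations_compose_left[OF \<sigma>(1)])
  also have "\<dots> = (\<Sum>\<pi> | \<pi> permutes {..<length I}. T z (permute_list \<pi> I))"
    unfolding len
  proof (rule sum.cong[OF refl])
    fix \<pi> assume "\<pi> \<in> {\<pi>. \<pi> permutes {..<length J}}"
    then show "T z (permute_list (\<sigma> \<circ> \<pi>) J) = T z (permute_list \<pi> I)"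
      using permute_list_compose[of \<pi> J \<sigma>] \<sigma>(2) by simp
  qed
  finally show ?thesis by (simp add: symmetrize_def len)
qed

lemma symmetric_symmetrize: "symmetric m (symmetrize T)"
  unfolding symmetric_def using symmetrize_mset by blast

lemma apply_diag_symmetrize: "apply_diag m (symmetrize T z) v = apply_diag m (T z) v"
proof -
  have *: "(\<Sum>I | length I = m. T z (permute_list \<pi> I) * vpow v I) = (\<Sum>I | length I = m. T z I * vpow v I)"
    if \<pi>: "\<pi> permutes {..<m}" for \<pi>
  proof (rule sum.reindex_bij_witness[where i="permute_list (inv \<pi>)" and j="permute_list \<pi>"])
    fix I :: "axis list" assume I: "I \<in> {I. length I = m}"
    then have \<pi>I: "\<pi> permutes {..<length I}" and \<pi>i: "inv \<pi> permutes {..<length I}"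
      using \<pi> permutes_inv[OF \<pi>] by auto
    show "permute_list (inv \<pi>) (permute_list \<pi> I) = I"
      using permute_list_compose[OF \<pi>i, of \<pi>] permutes_inv_o(1)[OF \<pi>] by simp
    show "permute_list \<pi> (permute_list (inv \<pi>) I) = I"
      using permute_list_compose[OF \<pi>I, of "inv \<pi>"] permutes_inv_o(2)[OF \<pi>] by simp
    show "permute_list \<pi> I \<in> {I. length I = m}" "permute_list (inv \<pi>) I \<in> {I. length I = m}" using I by auto
    have "vpow v (permute_list \<pi> I) = vpow v I" by (rule vpow_mset) (simp add: mset_permute_list[OF \<pi>I])
    then show "T z (permute_list \<pi> I) * vpow v (permute_list \<pi> I) = T z (permute_list \<pi> I) * vpow v I" by simp
  qed
  have "apply_diag m (symmetrize T z) v = (\<Sum>I | length I = m. (\<Sum>\<pi> | \<pi> permutes {..<m}. T z (permute_list \<pi> I) * vpow v I) / fact m)"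
    unfolding apply_diag_vpow symmetrize_def by (intro sum.cong) (auto simp: sum_distrib_right)
  also have "\<dots> = (\<Sum>\<pi> | \<pi> permutes {..<m}. \<Sum>I | length I = m. T z (permute_list \<pi> I) * vpow v I) / fact m"
    by (simp add: sum_divide_distrib[symmetric] sum.swap[of _ "{\<pi>. \<pi> permutes {..<m}}"])
  also have "\<dots> = (\<Sum>\<pi> | \<pi> permutes {..<m}. apply_diag m (T z) v) / fact m"
    using * by (simp add: apply_diag_vpow)
  also have "\<dots> = apply_diag m (T z) v"
    by (simp add: card_permutations[of "{..<m}" m])
  finally show ?thesis .
qed

lemma apply_diag_Lop: "apply_diag (Suc (Suc m)) (Lop T z) v = v * cnj v * apply_diag m (T z) v"
proof -
  have "apply_diag (Suc (Suc m)) (Lop T z) v = apply_diag (Suc (Suc m)) (metric_times T z) v"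
    unfolding Lop_def by (rule apply_diag_symmetrize)
  also have "\<dots> = (of_real (Re v) * of_real (Re v) + of_real (Im v) * of_real (Im v)) * apply_diag m (T z) v"
  proof -
    have e: "apply_diag m (\<lambda>I. 0) v = 0" by (simp add: apply_diag_vpow)
    show ?thesis by (simp add: apply_diag_Suc sum_axis e algebra_simps)
  qed
  also have "of_real (Re v) * of_real (Re v) + of_real (Im v) * of_real (Im v) = v * cnj v"
    by (simp add: complex_eq_iff)
  finally show ?thesis .
qed

lemma apply_diag_Lop_power: "apply_diag (m + 2 * n) ((Lop ^^ n) T z) v = (v * cnj v) ^ n * apply_diag m (T z) v"
  by (induction n) (simp_all add: apply_diag_Lop mult.assoc)

lemma apply_diag_ds:
  "apply_diag (Suc m) (ds \<mu> T z) v = apply_diag m (\<lambda>I. of_real (coord Xdir v) * grad \<mu> (\<lambda>w. T w I) Xdir z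
      + of_real (coord Ydir v) * grad \<mu> (\<lambda>w. T w I) Ydir z) v"
  unfolding ds_def apply_diag_symmetrize apply_diag_Suc sum_axis nabla.simps apply_diag_add apply_diag_cmult ..

lemma coord_wirt: "of_real (coord Xdir v) * g Xdir z + of_real (coord Ydir v) * g Ydir z = v * wirt True g z + cnj v * wirt False g z"
proof -
  have "((v + w) / 2) * x + ((- \<i>) * (v - w) / 2) * y = v * ((x + (- \<i>) * y) / 2) + w * ((x + \<i> * y) / 2)" for v w x y
    by (simp add: field_simps)
  then show ?thesis unfolding coord.simps coord_complex wirt_def by simp
qed

lemma polynomial_coefficients_zero:
  fixes c :: "nat \<Rightarrow> complex"
  assumes "infinite A" "\<And>x. x \<in> A \<Longrightarrow> (\<Sum>j\<le>m. c j * x ^ j) = 0" "j \<le> m"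
  shows "c j = 0"
proof (rule ccontr)
  assume "c j \<noteq> 0"
  then have "finite {x. (\<Sum>j\<le>m. c j * x ^ j) = 0}"
    using polyfun_finite_roots[of c m] \<open>j \<le> m\<close> by blast
  moreover have "A \<subseteq> {x. (\<Sum>j\<le>m. c j * x ^ j) = 0}" using assms(2) by blast
  ultimately show False using assms(1) finite_subset by blast
qed

text \<open>
  On vectors \<open>1 + i t\<close> the values of a symmetric tensor on \<open>(v, \<dots>, v)\<close> form a polynomial in \<open>t\<close> whose \<open>j\<close>-th
  coefficient is a positive multiple of the component with \<open>j\<close> indices \<open>y\<close>.
\<close>

lemma symmetric_apply_diag_zero:
  assumes sym: "\<And>I J. length I = m \<Longrightarrow> mset I = mset J \<Longrightarrow> S I = S J"
    and zero: "\<And>v. apply_diag m S v = 0" and I: "length I = m"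
  shows "S I = 0"
proof -
  \<comment> \<open>The number of indices \<open>y\<close> determines an index list up to order.\<close>
  define cy where "cy I = count (mset I) Ydir" for I
  have vp: "vpow (Complex 1 t) I = of_real t ^ cy I" for t I
    unfolding cy_def
  proof (induction I)
    case (Cons i I) then show ?case by (cases i) auto
  qed simp
  have cyle: "cy I \<le> length I" for I unfolding cy_def by (metis count_le_size size_mset)
  have cym: "mset I = mset J" if "length I = length J" "cy I = cy J" for I J
  proof (rule multiset_eqI)
    fix i
    have split: "count (mset K) Xdir + count (mset K) Ydir = length K" for K :: "axis list"
    proof (induction K)
      case (Cons i K) then show ?case by (cases i) auto
    qed simp
    show "count (mset I) i = count (mset J) i"
      using split[of I] split[of J] that by (cases i) (auto simp: cy_def)
  qed
  define c where "c j = (\<Sum>I | length I = m \<and> cy I = j. S I)" for j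
  have "(\<Sum>j\<le>m. c j * x ^ j) = 0" if "x \<in> range complex_of_real" for x
  proof -
    from that obtain t where t: "x = of_real t" by blast
    have "(\<Sum>j\<le>m. c j * x ^ j) = (\<Sum>j\<le>m. \<Sum>I | I \<in> {I. length I = m} \<and> cy I = j. S I * x ^ cy I)"
      unfolding c_def sum_distrib_right by (intro sum.cong refl) auto
    also have "\<dots> = (\<Sum>I | length I = m. S I * x ^ cy I)"
      by (rule sum.group) (use finite_index_lists cyle in auto)
    also have "\<dots> = apply_diag m S (Complex 1 t)" by (simp add: apply_diag_vpow vp t)
    finally show ?thesis using zero by simp
  qed
  moreover have "infinite (range complex_of_real)"
    by (simp add: finite_image_iff inj_of_real infinite_UNIV_char_0)
  ultimately have "c (cy I) = 0" using polynomial_coefficients_zero[where A="range complex_of_real" and c=c and m=m and j="cy I"] cyle[of I] I by blast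
  moreover have "c (cy I) = of_nat (card {J. length J = m \<and> cy J = cy I}) * S I"
  proof -
    have "c (cy I) = (\<Sum>J | length J = m \<and> cy J = cy I. S I)"
      unfolding c_def
    proof (rule sum.cong[OF refl])
      fix J assume "J \<in> {J. length J = m \<and> cy J = cy I}"
      then have "mset I = mset J" using cym[of I J] I by simp
      from sym[OF I this] show "S J = S I" by simp
    qed
    then show ?thesis by simp
  qed
  moreover have "card {J. length J = m \<and> cy J = cy I} \<noteq> 0"
    using finite_subset[OF _ finite_index_lists[of m], of "{J. length J = m \<and> cy J = cy I}"] I by (auto simp: card_eq_0_iff)
  ultimately show ?thesis by simp
qed

lemma symmetric_eqI:
  assumes "symmetric m S" "symmetric m T" "z \<in> disk" "\<And>v. apply_diag m (S z) v = apply_diag m (T z) v" "length I = m"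
  shows "S z I = T z I"
proof -
  have "S z I - T z I = 0"
  proof (rule symmetric_apply_diag_zero[of m "\<lambda>I. S z I - T z I"])
    fix I J :: "axis list" assume "length I = m" "mset I = mset J"
    then show "S z I - T z I = S z J - T z J"
      using assms(1-3) unfolding symmetric_def by metis
  qed (use assms in \<open>auto simp: apply_diag_diff\<close>)
  then show ?thesis by simp
qed

text \<open>
  The Fourier modes of a symmetric tensor: \<open>hom m c v\<close> is the value on \<open>(v, \<dots>, v)\<close> of the tensor
  \<open>\<Sum>\<^sub>k c\<^sub>k dz\<^sup>m\<^sup>-\<^sup>k dzbar\<^sup>k\<close>.
\<close>

definition hom :: "nat \<Rightarrow> (nat \<Rightarrow> complex) \<Rightarrow> complex \<Rightarrow> complex" where
  "hom m c v = (\<Sum>k\<le>m. c k * (v ^ (m - k) * cnj v ^ k))"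

text \<open>
  For \<open>v = 1 + i t\<close> the quotient \<open>w = cnj v / v\<close> takes infinitely many values, and \<open>hom m c v\<close> is \<open>v\<^sup>m\<close> times
  the polynomial \<open>\<Sum>\<^sub>k c\<^sub>k w\<^sup>k\<close>.
\<close>

lemma hom_unique:
  assumes "\<And>v. hom m c v = hom m c' v" "k \<le> m"
  shows "c k = c' k"
proof -
  define w where "w t = Complex 1 (- t) / Complex 1 t" for t :: real
  have nz: "Complex 1 t \<noteq> 0" for t by (simp add: complex_eq_iff)
  have "inj w"
  proof (rule injI)
    fix s t assume "w s = w t"
    then have "Complex 1 (- s) * Complex 1 t = Complex 1 (- t) * Complex 1 s"
      using nz by (simp add: w_def divide_simps mult.commute)
    then show "s = t" by (simp add: complex_eq_iff)
  qed
  then have inf: "infinite (range w)" by (simp add: finite_image_iff infinite_UNIV_char_0)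
  have "(\<Sum>j\<le>m. (c j - c' j) * x ^ j) = 0" if "x \<in> range w" for x
  proof -
    from that obtain t where t: "x = w t" by blast
    let ?v = "Complex 1 t"
    have cv: "cnj ?v = ?v * x" using nz[of t] by (simp add: t w_def complex_eq_iff)
    have "?v ^ m * (\<Sum>j\<le>m. (c j - c' j) * x ^ j) = (\<Sum>j\<le>m. (c j - c' j) * (?v ^ (m - j) * cnj ?v ^ j))"
      unfolding cv sum_distrib_left
    proof (rule sum.cong[OF refl])
      fix j assume "j \<in> {..m}"
      then have "?v ^ m = ?v ^ (m - j) * ?v ^ j" by (simp flip: power_add)
      then show "?v ^ m * ((c j - c' j) * x ^ j) = (c j - c' j) * (?v ^ (m - j) * (?v * x) ^ j)"
        by (simp add: power_mult_distrib)
    qed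
    also have "\<dots> = hom m c ?v - hom m c' ?v"
      by (simp add: hom_def left_diff_distrib sum_subtractf)
    finally show ?thesis using assms(1) nz[of t] by simp
  qed
  from polynomial_coefficients_zero[OF inf this assms(2)] show ?thesis by simp
qed

text \<open>
  The modes of the monomial \<open>vpow v I\<close>, obtained by expanding \<open>dx = (dz + dzbar) / 2\<close> and
  \<open>dy = (dz - dzbar) / (2 i)\<close>.
\<close>

fun mode_coeff :: "axis list \<Rightarrow> nat \<Rightarrow> complex" where
  "mode_coeff [] k = (if k = 0 then 1 else 0)"
| "mode_coeff (i # I) 0 = cnj (dz i) / 2 * mode_coeff I 0"
| "mode_coeff (i # I) (Suc k) = cnj (dz i) / 2 * mode_coeff I (Suc k) + dz i / 2 * mode_coeff I k"

lemma mode_coeff_big: "length I < k \<Longrightarrow> mode_coeff I k = 0"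
proof (induction I arbitrary: k)
  case (Cons i I) then show ?case by (cases k) auto
qed simp

lemma vpow_mode_coeff: "vpow v I = hom (length I) (mode_coeff I) v"
proof (induction I)
  case (Cons i I)
  let ?m = "length I"
  have "of_real (coord i v) = cnj (dz i) / 2 * v + dz i / 2 * cnj v"
    by (cases i) (simp_all add: complex_eq_iff)
  then have "vpow v (i # I) = (cnj (dz i) / 2 * v) * hom ?m (mode_coeff I) v + (dz i / 2 * cnj v) * hom ?m (mode_coeff I) v"
    by (simp add: Cons distrib_right)
  also have "(cnj (dz i) / 2 * v) * hom ?m (mode_coeff I) v = (\<Sum>k\<le>Suc ?m. cnj (dz i) / 2 * mode_coeff I k * (v ^ (Suc ?m - k) * cnj v ^ k))"
  proof -
    have "(cnj (dz i) / 2 * v) * hom ?m (mode_coeff I) v = (\<Sum>k\<le>?m. cnj (dz i) / 2 * mode_coeff I k * (v ^ (Suc ?m - k) * cnj v ^ k))"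
      unfolding hom_def sum_distrib_left by (intro sum.cong refl) (simp add: Suc_diff_le)
    then show ?thesis by (simp add: mode_coeff_big)
  qed
  also have "(dz i / 2 * cnj v) * hom ?m (mode_coeff I) v = (\<Sum>k\<le>?m. dz i / 2 * mode_coeff I k * (v ^ (Suc ?m - Suc k) * cnj v ^ Suc k))"
    unfolding hom_def sum_distrib_left by (intro sum.cong refl) simp
  also have "(\<Sum>k\<le>Suc ?m. cnj (dz i) / 2 * mode_coeff I k * (v ^ (Suc ?m - k) * cnj v ^ k)) + \<dots> = hom (Suc ?m) (mode_coeff (i # I)) v"
    unfolding hom_def sum.atMost_Suc_shift by (simp add: distrib_right sum.distrib add.assoc)
  finally show ?case by simp
qed (simp add: hom_def)

definition tmode :: "nat \<Rightarrow> tfield \<Rightarrow> nat \<Rightarrow> complex \<Rightarrow> complex" where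
  "tmode m T k z = (\<Sum>I | length I = m. mode_coeff I k * T z I)"

lemma apply_diag_tmode: "apply_diag m (T z) v = hom m (\<lambda>k. tmode m T k z) v"
proof -
  have "apply_diag m (T z) v = (\<Sum>I | length I = m. \<Sum>k\<le>m. mode_coeff I k * T z I * (v ^ (m - k) * cnj v ^ k))"
    unfolding apply_diag_vpow vpow_mode_coeff hom_def sum_distrib_left by (intro sum.cong refl) (auto simp: mult_ac)
  also have "\<dots> = hom m (\<lambda>k. tmode m T k z) v"
    unfolding hom_def tmode_def sum_distrib_right by (rule sum.swap)
  finally show ?thesis .
qed

text \<open>
  The components of the symmetric product \<open>dz\<^sup>m\<^sup>-\<^sup>k dzbar\<^sup>k\<close>; they do not depend on the point.
\<close>

definition mode_basis :: "nat \<Rightarrow> nat \<Rightarrow> axis list \<Rightarrow> complex" where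
  "mode_basis m k = symmetrize (\<lambda>z I. cov_power dz (take (m - k) I) * cov_power dzbar (drop (m - k) I)) 0"

lemma apply_diag_append:
  "apply_diag (a + b) (\<lambda>I. S (take a I) * T (drop a I)) v = apply_diag a S v * apply_diag b T v"
proof (induction a arbitrary: S)
  case 0 show ?case by (simp add: apply_diag_0 apply_diag_cmult)
next
  case (Suc a)
  show ?case by (simp add: apply_diag_Suc Suc[of "\<lambda>I. S (_ # I)"] sum_distrib_right mult.assoc)
qed

lemma mode_basis_mset: "mset I = mset J \<Longrightarrow> mode_basis m k I = mode_basis m k J"
  unfolding mode_basis_def by (rule symmetrize_mset)

lemma apply_diag_mode_basis:
  assumes "k \<le> m"
  shows "apply_diag m (mode_basis m k) v = v ^ (m - k) * cnj v ^ k"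
proof -
  have "apply_diag m (mode_basis m k) v = apply_diag ((m - k) + k) (\<lambda>I. cov_power dz (take (m - k) I) * cov_power dzbar (drop (m - k) I)) v"
    unfolding mode_basis_def apply_diag_symmetrize using assms by simp
  also have "\<dots> = v ^ (m - k) * cnj v ^ k"
    unfolding apply_diag_append apply_diag_cov_power ..
  finally show ?thesis .
qed

definition from_modes :: "nat \<Rightarrow> (nat \<Rightarrow> complex \<Rightarrow> complex) \<Rightarrow> tfield" where
  "from_modes m c z I = (\<Sum>k\<le>m. mode_basis m k I * c k z)"

lemma symmetric_from_modes: "symmetric m (from_modes m c)"
  unfolding symmetric_def from_modes_def
proof (intro ballI allI impI)
  fix z and I J :: "axis list" assume "length I = m \<and> mset I = mset J"
  then have "mode_basis m k I = mode_basis m k J" for k using mode_basis_mset by blast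
  then show "(\<Sum>k\<le>m. mode_basis m k I * c k z) = (\<Sum>k\<le>m. mode_basis m k J * c k z)" by simp
qed

lemma apply_diag_from_modes: "apply_diag m (from_modes m c z) v = hom m (\<lambda>k. c k z) v"
proof -
  have "apply_diag m (from_modes m c z) v = (\<Sum>k\<le>m. c k z * apply_diag m (mode_basis m k) v)"
    unfolding from_modes_def[abs_def] apply_diag_sum apply_diag_cmult[symmetric] by (simp add: mult.commute)
  then show ?thesis by (simp add: apply_diag_mode_basis hom_def)
qed

section \<open>The decomposition in Fourier modes\<close>

text \<open>
  The system is solved recursively: the contribution of the predecessor is moved to the left-hand side, which
  stays square integrable because the gradient of \<open>H\<^sub>0\<^sup>1\<close> for the weight \<open>d\<^sup>-\<^sup>\<gamma>\<close> is multiplied by \<open>d\<^sup>-\<^sup>\<gamma>\<close>.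
\<close>

lemma wirt_chain_exists:
  fixes F :: "nat \<Rightarrow> complex \<Rightarrow> complex"
  assumes \<gamma>: "- 1 < \<gamma>" and F: "\<And>k. F k \<in> L2 \<gamma>"
  obtains q g a where "\<And>k. H10_grad (- \<gamma>) (q k) (g k)" "\<And>k. a k \<in> L2 \<gamma> \<inter> wker b"
    "\<And>k. AE z in lebesgue_on disk. F k z =
       wt (- \<gamma>) z * (wirt b (g k) z + (if k = 0 then 0 else wirt (\<not> b) (g (k - 1)) z)) + a k z"
proof -
  define good where "good x \<longleftrightarrow> H10_grad (- \<gamma>) (fst x) (fst (snd x)) \<and> snd (snd x) \<in> L2 \<gamma> \<inter> wker b"
    for x :: "(complex \<Rightarrow> complex) \<times> (axis \<Rightarrow> complex \<Rightarrow> complex) \<times> (complex \<Rightarrow> complex)"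
  define eqn where "eqn F' x \<longleftrightarrow> (AE z in lebesgue_on disk. F' z = wt (- \<gamma>) z * wirt b (fst (snd x)) z + snd (snd x) z)"
    for F' :: "complex \<Rightarrow> complex" and x :: "(complex \<Rightarrow> complex) \<times> (axis \<Rightarrow> complex \<Rightarrow> complex) \<times> (complex \<Rightarrow> complex)"
  have solve: "\<exists>x. good x \<and> eqn F' x" if F': "F' \<in> L2 \<gamma>" for F'
  proof -
    obtain q g a where "H10_grad (- \<gamma>) q g" "a \<in> L2 \<gamma>" "a \<in> wker b"
      "AE z in lebesgue_on disk. F' z = wt (- \<gamma>) z * wirt b g z + a z"
      using wirt_decomposition_exists[OF \<gamma> F'] by blast
    then have "good (q, g, a) \<and> eqn F' (q, g, a)" by (simp add: good_def eqn_def)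
    then show ?thesis by blast
  qed
  have "\<exists>s. \<forall>n. (good (s n) \<and> (n = 0 \<longrightarrow> eqn (F 0) (s n))) \<and>
      eqn (\<lambda>z. F (Suc n) z - wt (- \<gamma>) z * wirt (\<not> b) (fst (snd (s n))) z) (s (Suc n))"
  proof (rule dependent_nat_choice)
    show "\<exists>x. good x \<and> (0 = (0 :: nat) \<longrightarrow> eqn (F 0) x)" using solve[OF F] by blast
  next
    fix x and n :: nat assume x: "good x \<and> (n = 0 \<longrightarrow> eqn (F 0) x)"
    have "(\<lambda>z. F (Suc n) z - wt (- \<gamma>) z * wirt (\<not> b) (fst (snd x)) z) \<in> L2 \<gamma>"
    proof -
      have "wirt (\<not> b) (fst (snd x)) \<in> sqint (wmeas (- \<gamma>))"
        using x H10_gradD(2) by (intro wirt_sqint) (auto simp: good_def)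
      then show ?thesis using F[of "Suc n"] unfolding L2_eq_sqint by (intro sqint_diff sqint_weight_shift(1))
    qed
    from solve[OF this] show "\<exists>y. (good y \<and> (Suc n = 0 \<longrightarrow> eqn (F 0) y)) \<and>
        eqn (\<lambda>z. F (Suc n) z - wt (- \<gamma>) z * wirt (\<not> b) (fst (snd x)) z) y" by blast
  qed
  then obtain s where s: "\<And>n. good (s n)" "eqn (F 0) (s 0)"
    "\<And>n. eqn (\<lambda>z. F (Suc n) z - wt (- \<gamma>) z * wirt (\<not> b) (fst (snd (s n))) z) (s (Suc n))" by blast
  show ?thesis
  proof (rule that[of "\<lambda>k. fst (s k)" "\<lambda>k. fst (snd (s k))" "\<lambda>k. snd (snd (s k))"])
    show "H10_grad (- \<gamma>) (fst (s k)) (fst (snd (s k)))" "snd (snd (s k)) \<in> L2 \<gamma> \<inter> wker b" for k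
      using s(1)[of k] by (simp_all add: good_def)
    show "AE z in lebesgue_on disk. F k z = wt (- \<gamma>) z * (wirt b (fst (snd (s k))) z
        + (if k = 0 then 0 else wirt (\<not> b) (fst (snd (s (k - 1)))) z)) + snd (snd (s k)) z" for k
    proof (cases k)
      case 0
      then show ?thesis using s(2) by (simp add: eqn_def)
    next
      case (Suc n)
      show ?thesis using s(3)[of n, unfolded eqn_def]
        by eventually_elim (simp add: Suc algebra_simps)
    qed
  qed
qed

lemma wirt_chain_unique:
  fixes N k :: nat
  assumes \<gamma>: "- 1 < \<gamma>"
    and H: "\<And>k. k < N \<Longrightarrow> H10_grad (- \<gamma>) (q k) (g k)" "\<And>k. k < N \<Longrightarrow> a k \<in> L2 \<gamma> \<inter> wker b"
    and H': "\<And>k. k < N \<Longrightarrow> H10_grad (- \<gamma>) (q' k) (g' k)" "\<And>k. k < N \<Longrightarrow> a' k \<in> L2 \<gamma> \<inter> wker b"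
    and eq: "\<And>k. k < N \<Longrightarrow> AE z in lebesgue_on disk.
       wt (- \<gamma>) z * (wirt b (g k) z + (if k = 0 then 0 else wirt (\<not> b) (g (k - 1)) z)) + a k z =
       wt (- \<gamma>) z * (wirt b (g' k) z + (if k = 0 then 0 else wirt (\<not> b) (g' (k - 1)) z)) + a' k z"
    and "k < N"
  shows "(AE z in lebesgue_on disk. q k z = q' k z) \<and> (\<forall>i. AE z in lebesgue_on disk. g k i z = g' k i z)
    \<and> (AE z in lebesgue_on disk. a k z = a' k z)"
  using \<open>k < N\<close>
proof (induction k)
  case 0
  have "AE z in lebesgue_on disk. wt (- \<gamma>) z * wirt b (g 0) z + a 0 z = wt (- \<gamma>) z * wirt b (g' 0) z + a' 0 z"
    using eq[OF 0] by simp
  from wirt_decomposition_unique[OF \<gamma> H(1)[OF 0] _ _ H'(1)[OF 0] _ _ this] H(2)[OF 0] H'(2)[OF 0]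
  show ?case by blast
next
  case (Suc k)
  then have IH: "\<forall>i. AE z in lebesgue_on disk. g k i z = g' k i z" by simp
  have "AE z in lebesgue_on disk. wirt (\<not> b) (g k) z = wirt (\<not> b) (g' k) z"
    using IH[rule_format, of Xdir] IH[rule_format, of Ydir] by eventually_elim (simp add: wirt_def)
  then have "AE z in lebesgue_on disk. wt (- \<gamma>) z * wirt b (g (Suc k)) z + a (Suc k) z = wt (- \<gamma>) z * wirt b (g' (Suc k)) z + a' (Suc k) z"
    using eq[OF Suc.prems] by eventually_elim (simp add: distrib_left)
  from wirt_decomposition_unique[OF \<gamma> H(1)[OF Suc.prems] _ _ H'(1)[OF Suc.prems] _ _ this] H(2)[OF Suc.prems] H'(2)[OF Suc.prems]
  show ?case by blast
qed

lemma teq_AE_all: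
  assumes "teq m S T"
  shows "AE z in lebesgue_on disk. \<forall>I. length I = m \<longrightarrow> S z I = T z I"
proof -
  have "AE z in lebesgue_on disk. \<forall>I\<in>{I. length I = m}. S z I = T z I"
    using assms by (intro AE_finite_allI finite_index_lists) (auto simp: teq_def)
  then show ?thesis by eventually_elim simp
qed

lemma teq_apply_diag:
  assumes "teq m S T"
  shows "AE z in lebesgue_on disk. \<forall>v. apply_diag m (S z) v = apply_diag m (T z) v"
  using teq_AE_all[OF assms] by eventually_elim (auto intro: apply_diag_cong)

lemma teq_symmetricI:
  assumes "symmetric m S" "symmetric m T"
    and "AE z in lebesgue_on disk. \<forall>v. apply_diag m (S z) v = apply_diag m (T z) v"
  shows "teq m S T"
  unfolding teq_def
proof (intro allI impI)
  fix I :: "axis list" assume I: "length I = m"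
  have "AE z in lebesgue_on disk. z \<in> disk" by (rule AE_I2) simp
  with assms(3) show "AE z in lebesgue_on disk. S z I = T z I"
    by eventually_elim (use symmetric_eqI[OF assms(1,2)] I in blast)
qed

lemma Lop_L2T:
  assumes "T \<in> L2T \<gamma> m"
  shows "Lop T \<in> L2T \<gamma> (m + 2)"
proof -
  have mt: "(\<lambda>z. metric_times T z J) \<in> sqint (wmeas \<gamma>)" if J: "length J = m + 2" for J
  proof -
    obtain i j K where J': "J = i # j # K" "length K = m" using J by (cases J; cases "tl J") auto
    then show ?thesis using assms by (cases "i = j") (auto simp: L2T_def L2_eq_sqint)
  qed
  have "(\<lambda>z. Lop T z I) \<in> sqint (wmeas \<gamma>)" if I: "length I = m + 2" for I
  proof -
    have "(\<lambda>z. (1 / fact (m + 2)) * (\<Sum>\<pi> | \<pi> permutes {..<m + 2}. metric_times T z (permute_list \<pi> I))) \<in> sqint (wmeas \<gamma>)"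
      by (intro sqint_scale sqint_sum mt) (simp add: I)
    then show ?thesis by (simp add: Lop_def symmetrize_def I)
  qed
  then show ?thesis using symmetric_symmetrize[of "m + 2" "metric_times T"]
    by (simp add: L2T_def L2_eq_sqint Lop_def)
qed

lemma Lop_power_L2T: "T \<in> L2T \<gamma> m \<Longrightarrow> (Lop ^^ n) T \<in> L2T \<gamma> (m + 2 * n)"
proof (induction n)
  case (Suc n)
  then show ?case using Lop_L2T[of "(Lop ^^ n) T" \<gamma> "m + 2 * n"] by simp
qed simp

lemma L2T_sum:
  assumes "\<And>j. j \<in> A \<Longrightarrow> T j \<in> L2T \<gamma> m"
  shows "(\<lambda>z I. \<Sum>j\<in>A. T j z I) \<in> L2T \<gamma> m"
proof -
  have "symmetric m (\<lambda>z I. \<Sum>j\<in>A. T j z I)"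
    unfolding symmetric_def
  proof (intro ballI allI impI sum.cong refl)
    fix z j and I J :: "axis list" assume "z \<in> disk" "length I = m \<and> mset I = mset J" "j \<in> A"
    then show "T j z I = T j z J" using assms[of j] by (auto simp: L2T_def symmetric_def)
  qed
  moreover have "(\<lambda>z. \<Sum>j\<in>A. T j z I) \<in> sqint (wmeas \<gamma>)" if "length I = m" for I
    using assms that by (intro sqint_sum) (auto simp: L2T_def L2_eq_sqint)
  ultimately show ?thesis by (simp add: L2T_def L2_eq_sqint)
qed

lemma L2T_tadd:
  assumes "S \<in> L2T \<gamma> m" "T \<in> L2T \<gamma> m"
  shows "tadd S T \<in> L2T \<gamma> m"
  unfolding L2T_def mem_Collect_eq
proof (intro conjI allI impI)
  show "symmetric m (tadd S T)"
    unfolding symmetric_def tadd_def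
  proof (intro ballI allI impI)
    fix z and I J :: "axis list" assume "z \<in> disk" "length I = m \<and> mset I = mset J"
    then have "S z I = S z J" "T z I = T z J" using assms by (auto simp: L2T_def symmetric_def)
    then show "S z I + T z I = S z J + T z J" by simp
  qed
  fix I :: "axis list" assume "length I = m"
  then show "(\<lambda>z. tadd S T z I) \<in> L2 \<gamma>"
    using assms unfolding L2_eq_sqint tadd_def by (intro sqint_add) (auto simp: L2T_def L2_eq_sqint)
qed

lemma cov_power_mset: "mset I = mset J \<Longrightarrow> cov_power \<omega> I = cov_power \<omega> J"
  unfolding cov_power_def by (metis mset_map prod_mset_prod_list)

lemma L2ttI:
  assumes "a \<in> L2 \<gamma> \<inter> ker_dbar" "b \<in> L2 \<gamma> \<inter> ker_del"
  shows "(\<lambda>z I. a z * cov_power dz I + b z * cov_power dzbar I) \<in> L2tt \<gamma> m"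
proof -
  have "symmetric m (\<lambda>z I. a z * cov_power dz I + b z * cov_power dzbar I)"
    unfolding symmetric_def
  proof (intro ballI allI impI)
    fix z and I J :: "axis list" assume "length I = m \<and> mset I = mset J"
    then have "cov_power dz I = cov_power dz J" "cov_power dzbar I = cov_power dzbar J"
      using cov_power_mset by blast+
    then show "a z * cov_power dz I + b z * cov_power dzbar I = a z * cov_power dz J + b z * cov_power dzbar J" by simp
  qed
  moreover have "(\<lambda>z. a z * cov_power dz I + b z * cov_power dzbar I) \<in> L2 \<gamma>" for I
    using sqint_add[OF sqint_scale[of a _ "cov_power dz I"] sqint_scale[of b _ "cov_power dzbar I"]] assms
    by (simp add: L2_eq_sqint mult.commute)
  ultimately have "(\<lambda>z I. a z * cov_power dz I + b z * cov_power dzbar I) \<in> L2T \<gamma> m"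
    by (simp add: L2T_def)
  then show ?thesis unfolding L2tt_def using assms
    by (intro CollectI conjI exI[of _ a] exI[of _ b]) (simp_all add: teq_def)
qed

text \<open>
  In modes, \<open>d\<^sup>s\<close> adds \<open>\<partial>\<close> of the \<open>k\<close>-th mode and \<open>\<partial>bar\<close> of its predecessor; \<open>G k\<close> is the gradient of
  the \<open>k\<close>-th mode of a tensor of rank \<open>n\<close>.
\<close>

definition dmode :: "nat \<Rightarrow> (nat \<Rightarrow> axis \<Rightarrow> complex \<Rightarrow> complex) \<Rightarrow> nat \<Rightarrow> complex \<Rightarrow> complex" where
  "dmode n G k z = (if k \<le> n then wirt True (G k) z else 0) + (if 0 < k then wirt False (G (k - 1)) z else 0)"

lemma hom_raise:
  "v * hom n a v + cnj v * hom n b v = hom (Suc n) (\<lambda>k. (if k \<le> n then a k else 0) + (if 0 < k then b (k - 1) else 0)) v"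
proof -
  have "v * hom n a v = (\<Sum>k\<le>Suc n. (if k \<le> n then a k else 0) * (v ^ (Suc n - k) * cnj v ^ k))"
  proof -
    have "v * hom n a v = (\<Sum>k\<le>n. (if k \<le> n then a k else 0) * (v ^ (Suc n - k) * cnj v ^ k))"
      unfolding hom_def sum_distrib_left by (intro sum.cong refl) (simp add: Suc_diff_le)
    then show ?thesis by simp
  qed
  moreover have "cnj v * hom n b v = (\<Sum>k\<le>Suc n. (if 0 < k then b (k - 1) else 0) * (v ^ (Suc n - k) * cnj v ^ k))"
    unfolding hom_def sum_distrib_left sum.atMost_Suc_shift[of _ n] by (simp add: mult.left_commute)
  ultimately show ?thesis unfolding hom_def by (simp add: distrib_right sum.distrib del: sum.atMost_Suc)
qed

definition gmode :: "real \<Rightarrow> nat \<Rightarrow> tfield \<Rightarrow> nat \<Rightarrow> axis \<Rightarrow> complex \<Rightarrow> complex" where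
  "gmode \<mu> n q k i z = (\<Sum>I | length I = n. mode_coeff I k * grad \<mu> (\<lambda>w. q w I) i z)"

lemma apply_diag_ds_modes:
  "apply_diag (Suc n) (ds \<mu> q z) v = hom (Suc n) (\<lambda>k. dmode n (gmode \<mu> n q) k z) v"
proof -
  have w: "tmode n (\<lambda>z I. wirt b (grad \<mu> (\<lambda>w. q w I)) z) k z = wirt b (gmode \<mu> n q k) z" for b k
    unfolding tmode_def wirt_def gmode_def
    by (simp add: sum_distrib_left sum.distrib[symmetric] sum_divide_distrib distrib_left mult.left_commute)
  have "apply_diag (Suc n) (ds \<mu> q z) v = apply_diag n (\<lambda>I. v * wirt True (grad \<mu> (\<lambda>w. q w I)) z + cnj v * wirt False (grad \<mu> (\<lambda>w. q w I)) z) v"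
    unfolding apply_diag_ds coord_wirt ..
  also have "\<dots> = v * apply_diag n ((\<lambda>z I. wirt True (grad \<mu> (\<lambda>w. q w I)) z) z) v + cnj v * apply_diag n ((\<lambda>z I. wirt False (grad \<mu> (\<lambda>w. q w I)) z) z) v"
    unfolding apply_diag_add apply_diag_cmult ..
  also have "\<dots> = hom (Suc n) (\<lambda>k. dmode n (gmode \<mu> n q) k z) v"
    unfolding apply_diag_tmode[of n "\<lambda>z I. wirt _ (grad \<mu> (\<lambda>w. q w I)) z"] w hom_raise dmode_def ..
  finally show ?thesis .
qed

lemma decomposes_hom:
  assumes "decomposes \<gamma> (Suc n) f q fitt"
  shows "AE z in lebesgue_on disk. \<forall>v. apply_diag (Suc n) (f z) v =
     wt (- \<gamma>) z * hom (Suc n) (\<lambda>k. dmode n (gmode (- \<gamma>) n q) k z) v + apply_diag (Suc n) (fitt z) v"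
proof -
  have "teq (Suc n) f (tadd (wmul (- \<gamma>) (ds (- \<gamma>) q)) fitt)" using assms by (simp add: decomposes_def)
  from teq_apply_diag[OF this] show ?thesis
    by eventually_elim (simp add: tadd_def wmul_def apply_diag_add apply_diag_cmult apply_diag_ds_modes wt_def)
qed

lemma H10T_modes:
  assumes "q \<in> H10T \<mu> n"
  shows "H10_grad \<mu> (tmode n q k) (gmode \<mu> n q k)"
proof -
  have "H10_grad \<mu> (\<lambda>z. \<Sum>I | length I = n. mode_coeff I k * q z I) (\<lambda>i z. \<Sum>I | length I = n. mode_coeff I k * grad \<mu> (\<lambda>w. q w I) i z)"
    using assms by (intro H10_grad_sum H10_grad_cmult H10_grad_grad) (auto simp: H10T_def)
  then show ?thesis by (simp add: tmode_def[abs_def] gmode_def[abs_def])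
qed

lemma from_modes_H10T:
  assumes "\<And>k. k \<le> n \<Longrightarrow> H10_grad \<mu> (Q k) (G k)"
  shows "from_modes n Q \<in> H10T \<mu> n"
    "AE z in lebesgue_on disk. \<forall>v. apply_diag (Suc n) (ds \<mu> (from_modes n Q) z) v = hom (Suc n) (\<lambda>k. dmode n G k z) v"
proof -
  have H: "H10_grad \<mu> (\<lambda>w. from_modes n Q w I) (\<lambda>i z. \<Sum>k\<le>n. mode_basis n k I * G k i z)" for I
    unfolding from_modes_def by (intro H10_grad_sum H10_grad_cmult assms) simp
  then have H10: "(\<lambda>w. from_modes n Q w I) \<in> H10 \<mu>" for I unfolding H10_def by blast
  then show "from_modes n Q \<in> H10T \<mu> n" by (simp add: H10T_def symmetric_from_modes)
  have g: "AE z in lebesgue_on disk. grad \<mu> (\<lambda>w. from_modes n Q w I) i z = (\<Sum>k\<le>n. mode_basis n k I * G k i z)" for I i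
    by (rule H10_grad_unique[OF H10_grad_grad[OF H10] H]) simp
  have "AE z in lebesgue_on disk. \<forall>I\<in>{I. length I = n}. \<forall>i\<in>UNIV. grad \<mu> (\<lambda>w. from_modes n Q w I) i z = (\<Sum>k\<le>n. mode_basis n k I * G k i z)"
    by (intro AE_finite_allI finite_index_lists finite_axis_UNIV g)
  then show "AE z in lebesgue_on disk. \<forall>v. apply_diag (Suc n) (ds \<mu> (from_modes n Q) z) v = hom (Suc n) (\<lambda>k. dmode n G k z) v"
  proof (eventually_elim, intro allI)
    fix z v
    assume g: "\<forall>I\<in>{I. length I = n}. \<forall>i\<in>UNIV. grad \<mu> (\<lambda>w. from_modes n Q w I) i z = (\<Sum>k\<le>n. mode_basis n k I * G k i z)"
    have G: "apply_diag n (\<lambda>I. \<Sum>k\<le>n. mode_basis n k I * c k) v = hom n c v" for c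
      using apply_diag_from_modes[of n "\<lambda>k z. c k" z v] unfolding from_modes_def[abs_def] .
    have "apply_diag (Suc n) (ds \<mu> (from_modes n Q) z) v =
       apply_diag n (\<lambda>I. of_real (coord Xdir v) * (\<Sum>k\<le>n. mode_basis n k I * G k Xdir z) + of_real (coord Ydir v) * (\<Sum>k\<le>n. mode_basis n k I * G k Ydir z)) v"
      unfolding apply_diag_ds by (rule apply_diag_cong) (use g in simp)
    also have "\<dots> = of_real (coord Xdir v) * hom n (\<lambda>k. G k Xdir z) v + of_real (coord Ydir v) * hom n (\<lambda>k. G k Ydir z) v"
      unfolding apply_diag_add apply_diag_cmult G ..
    also have "\<dots> = hom n (\<lambda>k. v * wirt True (G k) z + cnj v * wirt False (G k) z) v"
      unfolding coord_wirt[symmetric] hom_def sum_distrib_left by (simp add: distrib_right sum.distrib mult.assoc)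
    also have "\<dots> = v * hom n (\<lambda>k. wirt True (G k) z) v + cnj v * hom n (\<lambda>k. wirt False (G k) z) v"
      unfolding hom_def sum_distrib_left by (simp add: distrib_right sum.distrib mult.assoc)
    also have "\<dots> = hom (Suc n) (\<lambda>k. dmode n G k z) v" unfolding hom_raise dmode_def ..
    finally show "apply_diag (Suc n) (ds \<mu> (from_modes n Q) z) v = hom (Suc n) (\<lambda>k. dmode n G k z) v" .
  qed
qed

text \<open>
  A tensor \<open>q\<close> with prescribed modes exists, so a decomposition can be found mode by mode.
\<close>

lemma decomposesI:
  assumes f: "f \<in> L2T \<gamma> (Suc n)" and fitt: "fitt \<in> L2T \<gamma> (Suc n)"
    and H: "\<And>k. k \<le> n \<Longrightarrow> H10_grad (- \<gamma>) (Q k) (G k)"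
    and c: "AE z in lebesgue_on disk. \<forall>v. apply_diag (Suc n) (fitt z) v = hom (Suc n) (\<lambda>k. c k z) v"
    and eq: "\<And>k. k \<le> Suc n \<Longrightarrow> AE z in lebesgue_on disk. tmode (Suc n) f k z = wt (- \<gamma>) z * dmode n G k z + c k z"
  shows "decomposes \<gamma> (Suc n) f (from_modes n Q) fitt"
proof -
  have q: "from_modes n Q \<in> H10T (- \<gamma>) n"
    "AE z in lebesgue_on disk. \<forall>v. apply_diag (Suc n) (ds (- \<gamma>) (from_modes n Q) z) v = hom (Suc n) (\<lambda>k. dmode n G k z) v"
    using from_modes_H10T[of n "- \<gamma>" Q G] H by blast+
  have "teq (Suc n) f (tadd (wmul (- \<gamma>) (ds (- \<gamma>) (from_modes n Q))) fitt)"
  proof (rule teq_symmetricI)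
    show "symmetric (Suc n) f" using f by (simp add: L2T_def)
    show "symmetric (Suc n) (tadd (wmul (- \<gamma>) (ds (- \<gamma>) (from_modes n Q))) fitt)"
    proof -
      have "symmetric (Suc n) (ds (- \<gamma>) (from_modes n Q))" unfolding ds_def by (rule symmetric_symmetrize)
      moreover have "symmetric (Suc n) fitt" using fitt by (simp add: L2T_def)
      ultimately show ?thesis unfolding symmetric_def tadd_def wmul_def by metis
    qed
    have "AE z in lebesgue_on disk. \<forall>k\<in>{..Suc n}. tmode (Suc n) f k z = wt (- \<gamma>) z * dmode n G k z + c k z"
      by (intro AE_finite_allI) (use eq in auto)
    with q(2) c show "AE z in lebesgue_on disk. \<forall>v. apply_diag (Suc n) (f z) v =
        apply_diag (Suc n) (tadd (wmul (- \<gamma>) (ds (- \<gamma>) (from_modes n Q))) fitt z) v"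
    proof (eventually_elim, intro allI)
      fix z v
      assume *: "\<forall>v. apply_diag (Suc n) (ds (- \<gamma>) (from_modes n Q) z) v = hom (Suc n) (\<lambda>k. dmode n G k z) v"
        "\<forall>v. apply_diag (Suc n) (fitt z) v = hom (Suc n) (\<lambda>k. c k z) v"
        "\<forall>k\<in>{..Suc n}. tmode (Suc n) f k z = wt (- \<gamma>) z * dmode n G k z + c k z"
      have "apply_diag (Suc n) (f z) v = hom (Suc n) (\<lambda>k. wt (- \<gamma>) z * dmode n G k z + c k z) v"
        unfolding apply_diag_tmode[of "Suc n" f] hom_def by (intro sum.cong refl) (use *(3) in simp)
      also have "\<dots> = wt (- \<gamma>) z * hom (Suc n) (\<lambda>k. dmode n G k z) v + hom (Suc n) (\<lambda>k. c k z) v"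
        unfolding hom_def sum_distrib_left by (simp only: distrib_right sum.distrib mult.assoc)
      finally show "apply_diag (Suc n) (f z) v =
        apply_diag (Suc n) (tadd (wmul (- \<gamma>) (ds (- \<gamma>) (from_modes n Q))) fitt z) v"
        using * by (simp add: tadd_def wmul_def apply_diag_add apply_diag_cmult wt_def)
    qed
  qed
  then show ?thesis using q(1) fitt by (simp add: decomposes_def)
qed

lemma decomposes_modes:
  assumes d: "decomposes \<gamma> (Suc n) f q fitt"
    and c: "AE z in lebesgue_on disk. \<forall>v. apply_diag (Suc n) (fitt z) v = hom (Suc n) (\<lambda>k. c k z) v"
  shows "AE z in lebesgue_on disk. \<forall>k\<le>Suc n. tmode (Suc n) f k z = wt (- \<gamma>) z * dmode n (gmode (- \<gamma>) n q) k z + c k z"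
  using decomposes_hom[OF d] c
proof eventually_elim
  fix z
  assume *: "\<forall>v. apply_diag (Suc n) (f z) v = wt (- \<gamma>) z * hom (Suc n) (\<lambda>k. dmode n (gmode (- \<gamma>) n q) k z) v + apply_diag (Suc n) (fitt z) v"
    "\<forall>v. apply_diag (Suc n) (fitt z) v = hom (Suc n) (\<lambda>k. c k z) v"
  have "hom (Suc n) (\<lambda>k. tmode (Suc n) f k z) v = hom (Suc n) (\<lambda>k. wt (- \<gamma>) z * dmode n (gmode (- \<gamma>) n q) k z + c k z) v" for v
  proof -
    have "hom (Suc n) (\<lambda>k. tmode (Suc n) f k z) v = wt (- \<gamma>) z * hom (Suc n) (\<lambda>k. dmode n (gmode (- \<gamma>) n q) k z) v + hom (Suc n) (\<lambda>k. c k z) v"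
      using * apply_diag_tmode[of "Suc n" f z v] by simp
    also have "\<dots> = hom (Suc n) (\<lambda>k. wt (- \<gamma>) z * dmode n (gmode (- \<gamma>) n q) k z + c k z) v"
      unfolding hom_def sum_distrib_left by (simp only: distrib_right sum.distrib mult.assoc)
    finally show ?thesis .
  qed
  then show "\<forall>k\<le>Suc n. tmode (Suc n) f k z = wt (- \<gamma>) z * dmode n (gmode (- \<gamma>) n q) k z + c k z"
    using hom_unique[of "Suc n" "\<lambda>k. tmode (Suc n) f k z"] by blast
qed

lemma teq_of_modes:
  assumes "q \<in> H10T \<mu> n" "q' \<in> H10T \<mu> n"
    and "\<And>k. k \<le> n \<Longrightarrow> AE z in lebesgue_on disk. tmode n q k z = tmode n q' k z"
  shows "teq n q q'"
proof (rule teq_symmetricI)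
  show "symmetric n q" "symmetric n q'" using assms by (simp_all add: H10T_def)
  have "AE z in lebesgue_on disk. \<forall>k\<in>{..n}. tmode n q k z = tmode n q' k z"
    by (intro AE_finite_allI) (use assms in auto)
  then show "AE z in lebesgue_on disk. \<forall>v. apply_diag n (q z) v = apply_diag n (q' z) v"
    by eventually_elim (auto simp: apply_diag_tmode[of n q] apply_diag_tmode[of n q'] hom_def intro!: sum.cong)
qed

lemma fitt_unique:
  assumes d: "decomposes \<gamma> (Suc n) f q fitt" and d': "decomposes \<gamma> (Suc n) f q' fitt'"
    and g: "\<And>k i. k \<le> n \<Longrightarrow> AE z in lebesgue_on disk. gmode (- \<gamma>) n q k i z = gmode (- \<gamma>) n q' k i z"
  shows "teq (Suc n) fitt fitt'"
proof (rule teq_symmetricI)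
  show "symmetric (Suc n) fitt" "symmetric (Suc n) fitt'" using d d' by (simp_all add: decomposes_def L2T_def)
  have "AE z in lebesgue_on disk. \<forall>k\<in>{..n}. \<forall>i\<in>UNIV. gmode (- \<gamma>) n q k i z = gmode (- \<gamma>) n q' k i z"
    by (intro AE_finite_allI finite_axis_UNIV) (use g in auto)
  then have "AE z in lebesgue_on disk. \<forall>k\<le>Suc n. dmode n (gmode (- \<gamma>) n q) k z = dmode n (gmode (- \<gamma>) n q') k z"
  proof eventually_elim
    fix z assume *: "\<forall>k\<in>{..n}. \<forall>i\<in>UNIV. gmode (- \<gamma>) n q k i z = gmode (- \<gamma>) n q' k i z"
    have "wirt b (gmode (- \<gamma>) n q k) z = wirt b (gmode (- \<gamma>) n q' k) z" if "k \<le> n" for b k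
      using * that by (simp add: wirt_def)
    then show "\<forall>k\<le>Suc n. dmode n (gmode (- \<gamma>) n q) k z = dmode n (gmode (- \<gamma>) n q') k z"
      by (simp add: dmode_def)
  qed
  with decomposes_hom[OF d] decomposes_hom[OF d']
  show "AE z in lebesgue_on disk. \<forall>v. apply_diag (Suc n) (fitt z) v = apply_diag (Suc n) (fitt' z) v"
  proof (eventually_elim, intro allI)
    fix z v
    assume *: "\<forall>v. apply_diag (Suc n) (f z) v = wt (- \<gamma>) z * hom (Suc n) (\<lambda>k. dmode n (gmode (- \<gamma>) n q) k z) v + apply_diag (Suc n) (fitt z) v"
      "\<forall>v. apply_diag (Suc n) (f z) v = wt (- \<gamma>) z * hom (Suc n) (\<lambda>k. dmode n (gmode (- \<gamma>) n q') k z) v + apply_diag (Suc n) (fitt' z) v"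
      "\<forall>k\<le>Suc n. dmode n (gmode (- \<gamma>) n q) k z = dmode n (gmode (- \<gamma>) n q') k z"
    have "hom (Suc n) (\<lambda>k. dmode n (gmode (- \<gamma>) n q) k z) v = hom (Suc n) (\<lambda>k. dmode n (gmode (- \<gamma>) n q') k z) v"
      unfolding hom_def by (intro sum.cong refl) (use *(3) in simp)
    then show "apply_diag (Suc n) (fitt z) v = apply_diag (Suc n) (fitt' z) v"
      using *(1)[rule_format, of v] *(2)[rule_format, of v] by simp
  qed
qed

lemma tmode_L2:
  assumes "f \<in> L2T \<gamma> m"
  shows "tmode m f k \<in> L2 \<gamma>"
proof -
  have "(\<lambda>z. \<Sum>I | length I = m. mode_coeff I k * f z I) \<in> sqint (wmeas \<gamma>)"
    using assms by (intro sqint_sum sqint_scale) (auto simp: L2T_def L2_eq_sqint)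
  then show ?thesis by (simp add: tmode_def[abs_def] L2_eq_sqint)
qed

lemma dmode_sqint:
  assumes "\<And>k. k \<le> n \<Longrightarrow> H10_grad \<mu> (Q k) (G k)" "k \<le> Suc n"
  shows "dmode n G k \<in> sqint (wmeas \<mu>)"
proof -
  have w: "wirt b (G j) \<in> sqint (wmeas \<mu>)" if "j \<le> n" for b j
    by (intro wirt_sqint H10_gradD(2)[OF assms(1)[OF that]])
  have "(\<lambda>z. (if k \<le> n then wirt True (G k) z else 0) + (if 0 < k then wirt False (G (k - 1)) z else 0)) \<in> sqint (wmeas \<mu>)"
  proof (intro sqint_add)
    show "(\<lambda>z. if k \<le> n then wirt True (G k) z else 0) \<in> sqint (wmeas \<mu>)"
      using w[of k True] by (cases "k \<le> n") simp_all
    show "(\<lambda>z. if 0 < k then wirt False (G (k - 1)) z else 0) \<in> sqint (wmeas \<mu>)"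
      using w[of "k - 1" False] assms(2) by (cases "0 < k") simp_all
  qed
  then show ?thesis by (simp add: dmode_def[abs_def])
qed

section \<open>Even rank\<close>

lemma apply_diag_Lop_sum:
  "apply_diag (2 * p + e) (\<lambda>I. \<Sum>j=0..p. (Lop ^^ (p - j)) (ft j) z I) v =
     (\<Sum>j=0..p. (v * cnj v) ^ (p - j) * apply_diag (2 * j + e) (ft j z) v)"
  unfolding apply_diag_sum
proof (rule sum.cong[OF refl])
  fix j assume "j \<in> {0..p}"
  then have rank: "2 * p + e = (2 * j + e) + 2 * (p - j)" by simp
  show "apply_diag (2 * p + e) ((Lop ^^ (p - j)) (ft j) z) v = (v * cnj v) ^ (p - j) * apply_diag (2 * j + e) (ft j z) v"
    unfolding rank by (rule apply_diag_Lop_power)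
qed

lemma sum_split_even:
  fixes h :: "nat \<Rightarrow> 'a :: comm_monoid_add"
  shows "(\<Sum>k\<le>2 * p. h k) = h p + (\<Sum>j=1..p. h (p - j) + h (p + j))"
proof (induction p arbitrary: h)
  case (Suc p)
  have "(\<Sum>k\<le>2 * Suc p. h k) = h 0 + (\<Sum>k\<le>2 * p. h (Suc k)) + h (2 * p + 2)"
    using sum.atMost_Suc_shift[of h "2 * p"] by (simp del: sum.atMost_Suc) (simp add: sum.atMost_Suc)
  also have "(\<Sum>k\<le>2 * p. h (Suc k)) = h (Suc p) + (\<Sum>j=1..p. h (Suc p - j) + h (Suc p + j))"
    unfolding Suc.IH[of "\<lambda>k. h (Suc k)"] by (intro arg_cong2[of _ _ _ _ "(+)"] sum.cong refl) (simp_all add: Suc_diff_le)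
  finally show ?case by (simp add: ac_simps mult_2_right)
qed simp

lemma sum_split_odd:
  fixes h :: "nat \<Rightarrow> 'a :: comm_monoid_add"
  shows "(\<Sum>k\<le>2 * p + 1. h k) = (\<Sum>j=0..p. h (p - j) + h (p + 1 + j))"
proof (induction p arbitrary: h)
  case (Suc p)
  have "(\<Sum>k\<le>2 * Suc p + 1. h k) = h 0 + (\<Sum>k\<le>2 * p + 1. h (Suc k)) + h (2 * p + 3)"
    using sum.atMost_Suc_shift[of h "2 * p + 1"] by (simp add: numeral_3_eq_3)
  also have "(\<Sum>k\<le>2 * p + 1. h (Suc k)) = (\<Sum>j=0..p. h (Suc p - j) + h (Suc p + 1 + j))"
    unfolding Suc.IH[of "\<lambda>k. h (Suc k)"] by (intro sum.cong refl) (simp add: Suc_diff_le)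
  finally show ?case by (simp add: ac_simps numeral_3_eq_3 mult_2_right)
qed simp

definition tt_field :: "(complex \<Rightarrow> complex) \<Rightarrow> (complex \<Rightarrow> complex) \<Rightarrow> tfield" where
  "tt_field a b = (\<lambda>z I. a z * cov_power dz I + b z * cov_power dzbar I)"

lemma apply_diag_tt_field: "apply_diag m (tt_field a b z) v = a z * v ^ m + b z * cnj v ^ m"
  by (simp add: tt_field_def apply_diag_add apply_diag_cmult apply_diag_cov_power)

lemma L2tt_tt_field: "a \<in> L2 \<gamma> \<inter> wker True \<Longrightarrow> b \<in> L2 \<gamma> \<inter> wker False \<Longrightarrow> tt_field a b \<in> L2tt \<gamma> m"
  unfolding tt_field_def by (rule L2ttI) (simp_all add: wker_def)

lemma L2ttE:
  assumes "T \<in> L2tt \<gamma> m"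
  obtains a b where "a \<in> L2 \<gamma> \<inter> wker True" "b \<in> L2 \<gamma> \<inter> wker False" "teq m T (tt_field a b)"
  using assms unfolding L2tt_def tt_field_def wker_def by auto

lemma L2tt_L2T: "T \<in> L2tt \<gamma> m \<Longrightarrow> T \<in> L2T \<gamma> m"
  by (simp add: L2tt_def)

lemma L2tt_choose:
  assumes "\<And>j. j \<in> A \<Longrightarrow> ft j \<in> L2tt \<gamma> (r j)"
  obtains a b where "\<And>j. j \<in> A \<Longrightarrow> a j \<in> L2 \<gamma> \<inter> wker True" "\<And>j. j \<in> A \<Longrightarrow> b j \<in> L2 \<gamma> \<inter> wker False"
    "\<And>j. j \<in> A \<Longrightarrow> teq (r j) (ft j) (tt_field (a j) (b j))"
proof -
  have "\<forall>j\<in>A. \<exists>a b. a \<in> L2 \<gamma> \<inter> wker True \<and> b \<in> L2 \<gamma> \<inter> wker False \<and> teq (r j) (ft j) (tt_field a b)"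
    using assms L2ttE by metis
  then obtain a b where "\<forall>j\<in>A. a j \<in> L2 \<gamma> \<inter> wker True \<and> b j \<in> L2 \<gamma> \<inter> wker False \<and> teq (r j) (ft j) (tt_field (a j) (b j))"
    by metis
  then show ?thesis using that by blast
qed

lemma teq_tt_field_cong:
  assumes "teq m T (tt_field a b)" "teq m T' (tt_field a' b')"
    and "AE z in lebesgue_on disk. a z = a' z" "AE z in lebesgue_on disk. b z = b' z"
  shows "teq m T T'"
  unfolding teq_def
proof (intro allI impI)
  fix I :: "axis list" assume I: "length I = m"
  have "AE z in lebesgue_on disk. T z I = tt_field a b z I" "AE z in lebesgue_on disk. T' z I = tt_field a' b' z I"
    using assms(1,2) I by (auto simp: teq_def)
  with assms(3,4) show "AE z in lebesgue_on disk. T z I = T' z I"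
    by eventually_elim (simp add: tt_field_def)
qed

lemma AE_teq_apply_diag_tt:
  assumes "finite A" "\<And>j. j \<in> A \<Longrightarrow> teq (r j) (ft j) (tt_field (a j) (b j))"
  shows "AE z in lebesgue_on disk. \<forall>j\<in>A. \<forall>v. apply_diag (r j) (ft j z) v = a j z * v ^ r j + b j z * cnj v ^ r j"
  using assms teq_apply_diag[of "r _" "ft _" "tt_field (a _) (b _)"]
  by (intro AE_finite_allI) (auto simp: apply_diag_tt_field)

text \<open>
  The transverse trace-free part of rank \<open>2j\<close>, shifted by \<open>L\<^sup>p\<^sup>-\<^sup>j\<close>, occupies the degrees \<open>p - j\<close> and \<open>p + j\<close>.
\<close>

definition even_itt_mode ::
    "nat \<Rightarrow> (nat \<Rightarrow> complex \<Rightarrow> complex) \<Rightarrow> (nat \<Rightarrow> complex \<Rightarrow> complex) \<Rightarrow> (complex \<Rightarrow> complex) \<Rightarrow> nat \<Rightarrow> complex \<Rightarrow> complex" where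
  "even_itt_mode p a b f0 k = (if k < p then a (p - k) else if k = p then f0 else b (k - p))"

lemma itt_even_hom:
  assumes itt: "itt_even \<gamma> p fitt ft"
    and ab: "\<And>j. j \<in> {1..p} \<Longrightarrow> teq (2 * j) (ft j) (tt_field (a j) (b j))"
  shows "AE z in lebesgue_on disk. \<forall>v. apply_diag (2 * p) (fitt z) v =
     hom (2 * p) (\<lambda>k. even_itt_mode p a b (\<lambda>z. ft 0 z []) k z) v"
proof -
  have "teq (2 * p) fitt (\<lambda>z I. \<Sum>j=0..p. (Lop ^^ (p - j)) (ft j) z I)" using itt by (simp add: itt_even_def)
  from teq_apply_diag[OF this]
  have sums: "AE z in lebesgue_on disk. \<forall>v. apply_diag (2 * p) (fitt z) v = apply_diag (2 * p) (\<lambda>I. \<Sum>j=0..p. (Lop ^^ (p - j)) (ft j) z I) v" .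
  have "AE z in lebesgue_on disk. \<forall>j\<in>{1..p}. \<forall>v. apply_diag (2 * j) (ft j z) v = a j z * v ^ (2 * j) + b j z * cnj v ^ (2 * j)"
    by (rule AE_teq_apply_diag_tt) (use ab in auto)
  with sums show ?thesis
  proof (eventually_elim, intro allI)
    fix z v
    assume *: "\<forall>v. apply_diag (2 * p) (fitt z) v = apply_diag (2 * p) (\<lambda>I. \<Sum>j=0..p. (Lop ^^ (p - j)) (ft j) z I) v"
      "\<forall>j\<in>{1..p}. \<forall>v. apply_diag (2 * j) (ft j z) v = a j z * v ^ (2 * j) + b j z * cnj v ^ (2 * j)"
    have "apply_diag (2 * p) (fitt z) v = (\<Sum>j=0..p. (v * cnj v) ^ (p - j) * apply_diag (2 * j) (ft j z) v)"
      using *(1) apply_diag_Lop_sum[of p 0 ft z v] by simp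
    also have "\<dots> = (v * cnj v) ^ p * ft 0 z [] + (\<Sum>j=1..p. (v * cnj v) ^ (p - j) * apply_diag (2 * j) (ft j z) v)"
      by (simp add: sum.atLeast_Suc_atMost[of 0 p] apply_diag_0)
    also have "(\<Sum>j=1..p. (v * cnj v) ^ (p - j) * apply_diag (2 * j) (ft j z) v) =
      (\<Sum>j=1..p. even_itt_mode p a b (\<lambda>z. ft 0 z []) (p - j) z * (v ^ (2 * p - (p - j)) * cnj v ^ (p - j))
        + even_itt_mode p a b (\<lambda>z. ft 0 z []) (p + j) z * (v ^ (2 * p - (p + j)) * cnj v ^ (p + j)))"
    proof (rule sum.cong[OF refl])
      fix j assume j: "j \<in> {1..p}"
      then have e: "2 * p - (p - j) = (p - j) + 2 * j" "2 * p - (p + j) = p - j" "p + j = (p - j) + 2 * j" by auto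
      have c: "even_itt_mode p a b (\<lambda>z. ft 0 z []) (p - j) z = a j z" "even_itt_mode p a b (\<lambda>z. ft 0 z []) (p + j) z = b j z"
        using j by (auto simp: even_itt_mode_def)
      show "(v * cnj v) ^ (p - j) * apply_diag (2 * j) (ft j z) v =
         even_itt_mode p a b (\<lambda>z. ft 0 z []) (p - j) z * (v ^ (2 * p - (p - j)) * cnj v ^ (p - j))
        + even_itt_mode p a b (\<lambda>z. ft 0 z []) (p + j) z * (v ^ (2 * p - (p + j)) * cnj v ^ (p + j))"
      proof -
        have "cnj v ^ (p + j) = cnj v ^ (p - j) * cnj v ^ (2 * j)" by (metis e(3) power_add)
        moreover have "apply_diag (2 * j) (ft j z) v = a j z * v ^ (2 * j) + b j z * cnj v ^ (2 * j)" using *(2) j by blast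
        ultimately show ?thesis unfolding c e(1,2) power_add power_mult_distrib by (simp only: algebra_simps)
      qed
    qed
    also have "(v * cnj v) ^ p * ft 0 z [] + \<dots> = hom (2 * p) (\<lambda>k. even_itt_mode p a b (\<lambda>z. ft 0 z []) k z) v"
      unfolding hom_def sum_split_even by (simp add: even_itt_mode_def power_mult_distrib mult.commute)
    finally show "apply_diag (2 * p) (fitt z) v = hom (2 * p) (\<lambda>k. even_itt_mode p a b (\<lambda>z. ft 0 z []) k z) v" .
  qed
qed

text \<open>
  The chain from below determines \<open>q\<^sub>k\<close> for \<open>k < p\<close>, the chain from above for \<open>p \<le> k < 2p\<close>. Together they give all
  modes of \<open>q\<close> without using the equation in degree \<open>p\<close>, which then defines the function \<open>f0\<close>.
\<close>

lemma even_exists: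
  assumes \<gamma>: "- 1 < \<gamma>" and p: "1 \<le> p" and f: "f \<in> L2T \<gamma> (2 * p)"
  shows "\<exists>q fitt ft. decomposes \<gamma> (2 * p) f q fitt \<and> itt_even \<gamma> p fitt ft"
proof -
  define n where "n = 2 * p - 1"
  have n: "2 * p = Suc n" using p by (simp add: n_def)
  let ?F = "tmode (2 * p) f"
  obtain qA gA aA where A: "\<And>k. H10_grad (- \<gamma>) (qA k) (gA k)" "\<And>k. aA k \<in> L2 \<gamma> \<inter> wker True"
    "\<And>k. AE z in lebesgue_on disk. ?F k z =
       wt (- \<gamma>) z * (wirt True (gA k) z + (if k = 0 then 0 else wirt (\<not> True) (gA (k - 1)) z)) + aA k z"
    using wirt_chain_exists[where F="?F" and b=True, OF \<gamma> tmode_L2[OF f]] by blast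
  obtain qB gB aB where B: "\<And>k. H10_grad (- \<gamma>) (qB k) (gB k)" "\<And>k. aB k \<in> L2 \<gamma> \<inter> wker False"
    "\<And>k. AE z in lebesgue_on disk. ?F (2 * p - k) z =
       wt (- \<gamma>) z * (wirt False (gB k) z + (if k = 0 then 0 else wirt (\<not> False) (gB (k - 1)) z)) + aB k z"
    using wirt_chain_exists[where F="\<lambda>k. ?F (2 * p - k)" and b=False, OF \<gamma> tmode_L2[OF f]] by blast
  define Q where "Q k = (if k < p then qA k else qB (n - k))" for k
  define G where "G k = (if k < p then gA k else gB (n - k))" for k
  have H: "H10_grad (- \<gamma>) (Q k) (G k)" for k using A(1) B(1) by (simp add: Q_def G_def)
  define f0 where "f0 z = ?F p z - wt (- \<gamma>) z * dmode n G p z" for z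
  have f0: "f0 \<in> L2 \<gamma>"
    unfolding f0_def L2_eq_sqint using tmode_L2[OF f, of p] dmode_sqint[OF H, of p n] n
    by (intro sqint_diff sqint_weight_shift) (auto simp: L2_eq_sqint)
  define a where "a j = aA (p - j)" for j
  define b where "b j = aB (p - j)" for j
  define ft where "ft j = (if j = 0 then scal f0 else tt_field (a j) (b j))" for j
  define fitt where "fitt = (\<lambda>z I. \<Sum>j=0..p. (Lop ^^ (p - j)) (ft j) z I)"
  have ft0: "ft 0 \<in> L2T \<gamma> 0" using f0 by (simp add: ft_def scal_def L2T_def symmetric_def)
  have ftj: "ft j \<in> L2tt \<gamma> (2 * j)" if "j \<in> {1..p}" for j
    using that A(2) B(2) by (auto simp: ft_def a_def b_def intro!: L2tt_tt_field)
  have itt: "itt_even \<gamma> p fitt ft"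
    using ft0 ftj by (simp add: itt_even_def fitt_def teq_def)
  have fittL: "fitt \<in> L2T \<gamma> (Suc n)"
    unfolding fitt_def n[symmetric]
  proof (rule L2T_sum)
    fix j assume j: "j \<in> {0..p}"
    have "ft j \<in> L2T \<gamma> (2 * j)" using ft0 ftj[of j] j by (cases "j = 0") (auto simp: L2tt_L2T)
    moreover have "2 * j + 2 * (p - j) = 2 * p" using j by simp
    ultimately show "(Lop ^^ (p - j)) (ft j) \<in> L2T \<gamma> (2 * p)" using Lop_power_L2T by metis
  qed
  have hom: "AE z in lebesgue_on disk. \<forall>v. apply_diag (Suc n) (fitt z) v = hom (Suc n) (\<lambda>k. even_itt_mode p a b f0 k z) v"
    using itt_even_hom[OF itt, of a b] by (simp add: n ft_def teq_def scal_def)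
  have "decomposes \<gamma> (Suc n) f (from_modes n Q) fitt"
  proof (rule decomposesI[OF _ fittL H hom])
    show "f \<in> L2T \<gamma> (Suc n)" using f n by simp
    fix k assume k: "k \<le> Suc n"
    consider "k < p" | "k = p" | "p < k" by linarith
    then show "AE z in lebesgue_on disk. tmode (Suc n) f k z = wt (- \<gamma>) z * dmode n G k z + even_itt_mode p a b f0 k z"
    proof cases
      case 1
      then have kn: "k \<le> n" "k - 1 < p" using n by auto
      show ?thesis using A(3)[of k]
        by eventually_elim (use 1 kn n in \<open>simp add: dmode_def G_def even_itt_mode_def a_def\<close>)
    next
      case 2
      then show ?thesis using n by (simp add: f0_def even_itt_mode_def)
    next
      case 3
      define k' where "k' = 2 * p - k"
      have k': "k' < p" "k = 2 * p - k'" "k \<le> n \<longleftrightarrow> k' \<noteq> 0" "n - k = k' - 1" "n - (k - 1) = k'" "p - (k - p) = k'" "0 < k" "\<not> k < p" "\<not> k - 1 < p" "k \<noteq> p"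
        using 3 k n by (auto simp: k'_def)
      show ?thesis using B(3)[of k', folded k'(2)]
        by eventually_elim (use k' n in \<open>simp add: dmode_def G_def even_itt_mode_def b_def\<close>)
    qed
  qed
  then show ?thesis using itt n by metis
qed

text \<open>
  Both chains are unique, hence so are all modes of \<open>q\<close>, and the equation in degree \<open>p\<close> determines the remaining
  function.
\<close>

lemma even_unique:
  assumes \<gamma>: "- 1 < \<gamma>" and p: "1 \<le> p"
    and d: "decomposes \<gamma> (2 * p) f q fitt" "itt_even \<gamma> p fitt ft"
    and d': "decomposes \<gamma> (2 * p) f q' fitt'" "itt_even \<gamma> p fitt' ft'"
  shows "teq (2 * p - 1) q q' \<and> teq (2 * p) fitt fitt' \<and> (\<forall>j\<in>{0..p}. teq (2 * j) (ft j) (ft' j))"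
proof -
  define n where "n = 2 * p - 1"
  have n: "2 * p = Suc n" using p by (simp add: n_def)
  have tt: "\<And>j. j \<in> {1..p} \<Longrightarrow> ft j \<in> L2tt \<gamma> (2 * j)" "\<And>j. j \<in> {1..p} \<Longrightarrow> ft' j \<in> L2tt \<gamma> (2 * j)"
    using d d' by (simp_all add: itt_even_def)
  obtain a b where ab: "\<And>j. j \<in> {1..p} \<Longrightarrow> a j \<in> L2 \<gamma> \<inter> wker True" "\<And>j. j \<in> {1..p} \<Longrightarrow> b j \<in> L2 \<gamma> \<inter> wker False"
    "\<And>j. j \<in> {1..p} \<Longrightarrow> teq (2 * j) (ft j) (tt_field (a j) (b j))"
    using L2tt_choose[of "{1..p}" ft \<gamma> "\<lambda>j. 2 * j", OF tt(1)] by blast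
  obtain a' b' where ab': "\<And>j. j \<in> {1..p} \<Longrightarrow> a' j \<in> L2 \<gamma> \<inter> wker True" "\<And>j. j \<in> {1..p} \<Longrightarrow> b' j \<in> L2 \<gamma> \<inter> wker False"
    "\<And>j. j \<in> {1..p} \<Longrightarrow> teq (2 * j) (ft' j) (tt_field (a' j) (b' j))"
    using L2tt_choose[of "{1..p}" ft' \<gamma> "\<lambda>j. 2 * j", OF tt(2)] by blast
  define G where "G = gmode (- \<gamma>) n q"
  define G' where "G' = gmode (- \<gamma>) n q'"
  have qT: "q \<in> H10T (- \<gamma>) n" "q' \<in> H10T (- \<gamma>) n" using d d' by (simp_all add: decomposes_def n)
  have H: "H10_grad (- \<gamma>) (tmode n q k) (G k)" "H10_grad (- \<gamma>) (tmode n q' k) (G' k)" for k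
    unfolding G_def G'_def by (intro H10T_modes qT)+
  define c where "c = even_itt_mode p a b (\<lambda>z. ft 0 z [])"
  define c' where "c' = even_itt_mode p a' b' (\<lambda>z. ft' 0 z [])"
  have "AE z in lebesgue_on disk. \<forall>k\<le>Suc n. tmode (Suc n) f k z = wt (- \<gamma>) z * dmode n G k z + c k z"
    unfolding G_def c_def using d(1) itt_even_hom[OF d(2) ab(3)] unfolding n by (rule decomposes_modes)
  moreover have "AE z in lebesgue_on disk. \<forall>k\<le>Suc n. tmode (Suc n) f k z = wt (- \<gamma>) z * dmode n G' k z + c' k z"
    unfolding G'_def c'_def using d'(1) itt_even_hom[OF d'(2) ab'(3)] unfolding n by (rule decomposes_modes)
  ultimately have ME: "AE z in lebesgue_on disk. \<forall>k\<le>Suc n. wt (- \<gamma>) z * dmode n G k z + c k z = wt (- \<gamma>) z * dmode n G' k z + c' k z"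
    by eventually_elim simp
  have left: "(AE z in lebesgue_on disk. tmode n q k z = tmode n q' k z) \<and> (\<forall>i. AE z in lebesgue_on disk. G k i z = G' k i z)
    \<and> (AE z in lebesgue_on disk. a (p - k) z = a' (p - k) z)" if "k < p" for k
  proof (rule wirt_chain_unique[OF \<gamma>, where N=p and b=True and a="\<lambda>k. a (p - k)" and a'="\<lambda>k. a' (p - k)"])
    fix k assume k: "k < p"
    then have j: "p - k \<in> {1..p}" by auto
    show "a (p - k) \<in> L2 \<gamma> \<inter> wker True" "a' (p - k) \<in> L2 \<gamma> \<inter> wker True" using ab(1)[OF j] ab'(1)[OF j] .
    show "AE z in lebesgue_on disk.
       wt (- \<gamma>) z * (wirt True (G k) z + (if k = 0 then 0 else wirt (\<not> True) (G (k - 1)) z)) + a (p - k) z =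
       wt (- \<gamma>) z * (wirt True (G' k) z + (if k = 0 then 0 else wirt (\<not> True) (G' (k - 1)) z)) + a' (p - k) z"
      using ME
    proof eventually_elim
      fix z assume *: "\<forall>k\<le>Suc n. wt (- \<gamma>) z * dmode n G k z + c k z = wt (- \<gamma>) z * dmode n G' k z + c' k z"
      have "k \<le> n" "k \<le> Suc n" using k n by auto
      then show "wt (- \<gamma>) z * (wirt True (G k) z + (if k = 0 then 0 else wirt (\<not> True) (G (k - 1)) z)) + a (p - k) z =
        wt (- \<gamma>) z * (wirt True (G' k) z + (if k = 0 then 0 else wirt (\<not> True) (G' (k - 1)) z)) + a' (p - k) z"
        using *[rule_format, of k] k by (simp add: dmode_def c_def c'_def even_itt_mode_def split: if_splits)
    qed
  qed (use H that in auto)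
  have right: "(AE z in lebesgue_on disk. tmode n q (n - k) z = tmode n q' (n - k) z) \<and> (\<forall>i. AE z in lebesgue_on disk. G (n - k) i z = G' (n - k) i z)
    \<and> (AE z in lebesgue_on disk. b (p - k) z = b' (p - k) z)" if "k < p" for k
  proof (rule wirt_chain_unique[OF \<gamma>, where N=p and b=False and a="\<lambda>k. b (p - k)" and a'="\<lambda>k. b' (p - k)"
        and q="\<lambda>k. tmode n q (n - k)" and q'="\<lambda>k. tmode n q' (n - k)" and g="\<lambda>k. G (n - k)" and g'="\<lambda>k. G' (n - k)"])
    fix k assume k: "k < p"
    then have j: "p - k \<in> {1..p}" by auto
    show "b (p - k) \<in> L2 \<gamma> \<inter> wker False" "b' (p - k) \<in> L2 \<gamma> \<inter> wker False" using ab(2)[OF j] ab'(2)[OF j] .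
    show "AE z in lebesgue_on disk.
       wt (- \<gamma>) z * (wirt False (G (n - k)) z + (if k = 0 then 0 else wirt (\<not> False) (G (n - (k - 1))) z)) + b (p - k) z =
       wt (- \<gamma>) z * (wirt False (G' (n - k)) z + (if k = 0 then 0 else wirt (\<not> False) (G' (n - (k - 1))) z)) + b' (p - k) z"
      using ME
    proof eventually_elim
      fix z assume *: "\<forall>k\<le>Suc n. wt (- \<gamma>) z * dmode n G k z + c k z = wt (- \<gamma>) z * dmode n G' k z + c' k z"
      define l where "l = 2 * p - k"
      have l: "l \<le> Suc n" "l \<le> n \<longleftrightarrow> k \<noteq> 0" "k \<noteq> 0 \<longrightarrow> n - (k - 1) = l" "l - 1 = n - k" "0 < l" "\<not> l < p" "l \<noteq> p" "l - p = p - k"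
        using k n by (auto simp: l_def)
      show "wt (- \<gamma>) z * (wirt False (G (n - k)) z + (if k = 0 then 0 else wirt (\<not> False) (G (n - (k - 1))) z)) + b (p - k) z =
       wt (- \<gamma>) z * (wirt False (G' (n - k)) z + (if k = 0 then 0 else wirt (\<not> False) (G' (n - (k - 1))) z)) + b' (p - k) z"
        using *[rule_format, OF l(1)] l by (cases "k = 0") (simp_all add: dmode_def c_def c'_def even_itt_mode_def add.commute)
    qed
  qed (use H that in auto)
  have modes: "(AE z in lebesgue_on disk. tmode n q k z = tmode n q' k z) \<and> (\<forall>i. AE z in lebesgue_on disk. G k i z = G' k i z)"
    if "k \<le> n" for k
  proof (cases "k < p")
    case True then show ?thesis using left by blast
  next
    case False
    then have "n - k < p" "n - (n - k) = k" using that n by auto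
    then show ?thesis using right[of "n - k"] by simp
  qed
  have q: "teq n q q'" by (rule teq_of_modes[OF qT modes[THEN conjunct1]])
  have "teq (Suc n) fitt fitt'"
  proof (rule fitt_unique)
    show "decomposes \<gamma> (Suc n) f q fitt" "decomposes \<gamma> (Suc n) f q' fitt'" using d(1) d'(1) by (simp_all add: n)
    show "AE z in lebesgue_on disk. gmode (- \<gamma>) n q k i z = gmode (- \<gamma>) n q' k i z" if "k \<le> n" for k i
      using modes[OF that, THEN conjunct2, rule_format] unfolding G_def G'_def .
  qed
  moreover have "teq (2 * j) (ft j) (ft' j)" if j: "j \<in> {0..p}" for j
  proof (cases "j = 0")
    case True
    have pn: "p \<le> n" "p - 1 \<le> n" "p \<le> Suc n" using n p by auto
    have "AE z in lebesgue_on disk. ft 0 z [] = ft' 0 z []"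
      using ME modes[OF pn(1), THEN conjunct2, rule_format, of Xdir] modes[OF pn(1), THEN conjunct2, rule_format, of Ydir]
       modes[OF pn(2), THEN conjunct2, rule_format, of Xdir] modes[OF pn(2), THEN conjunct2, rule_format, of Ydir]
    proof eventually_elim
      fix z
      assume *: "\<forall>k\<le>Suc n. wt (- \<gamma>) z * dmode n G k z + c k z = wt (- \<gamma>) z * dmode n G' k z + c' k z"
        "G p Xdir z = G' p Xdir z" "G p Ydir z = G' p Ydir z" "G (p - 1) Xdir z = G' (p - 1) Xdir z" "G (p - 1) Ydir z = G' (p - 1) Ydir z"
      have "dmode n G p z = dmode n G' p z" using *(2-5) p by (simp add: dmode_def wirt_def)
      then show "ft 0 z [] = ft' 0 z []"
        using *(1)[rule_format, OF pn(3)] by (simp add: c_def c'_def even_itt_mode_def)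
    qed
    then show ?thesis using True by (simp add: teq_def)
  next
    case False
    then have j1: "j \<in> {1..p}" "p - j < p" "p - (p - j) = j" using j by auto
    show ?thesis
      by (rule teq_tt_field_cong[OF ab(3)[OF j1(1)] ab'(3)[OF j1(1)]])
         (use left[OF j1(2)] right[OF j1(2)] j1(3) in auto)
  qed
  ultimately show ?thesis using q by (simp add: n)
qed

section \<open>Odd rank\<close>

text \<open>
  The modes of \<open>d\<^sup>-\<^sup>\<gamma> \<star>dh\<close> are \<open>- i d\<^sup>-\<^sup>\<gamma> \<partial>h\<close> and \<open>i d\<^sup>-\<^sup>\<gamma> \<partial>bar h\<close>, shifted by \<open>L\<^sup>p\<close> to the two middle degrees
  \<open>p\<close> and \<open>p + 1\<close>; \<open>g\<close> is the gradient of \<open>h\<close>.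
\<close>

definition odd_itt_mode :: "real \<Rightarrow> nat \<Rightarrow> (nat \<Rightarrow> complex \<Rightarrow> complex) \<Rightarrow> (nat \<Rightarrow> complex \<Rightarrow> complex) \<Rightarrow>
    (axis \<Rightarrow> complex \<Rightarrow> complex) \<Rightarrow> nat \<Rightarrow> complex \<Rightarrow> complex" where
  "odd_itt_mode \<gamma> p a b g k z =
     (if k \<le> p then a (p - k) z else b (k - p - 1) z)
     + wt (- \<gamma>) z * (if k = p then - \<i> * wirt True g z else if k = p + 1 then \<i> * wirt False g z else 0)"

lemma star_d_singleton:
  "star_d \<mu> h z [Xdir] = - grad \<mu> h Ydir z" "star_d \<mu> h z [Ydir] = grad \<mu> h Xdir z"
  by (simp_all add: star_d_def scal_def)

lemma apply_diag_star_d: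
  "apply_diag 1 (wmul (- \<gamma>) (star_d (- \<gamma>) h) z) v =
     wt (- \<gamma>) z * (- \<i> * wirt True (grad (- \<gamma>) h) z) * v + wt (- \<gamma>) z * (\<i> * wirt False (grad (- \<gamma>) h) z) * cnj v"
proof -
  let ?x = "grad (- \<gamma>) h Xdir z" and ?y = "grad (- \<gamma>) h Ydir z"
  have "apply_diag (Suc 0) (wmul (- \<gamma>) (star_d (- \<gamma>) h) z) v = wt (- \<gamma>) z * (of_real (Re v) * (- ?y) + of_real (Im v) * ?x)"
    by (simp add: apply_diag_Suc apply_diag_0 sum_axis wmul_def star_d_singleton wt_def algebra_simps)
  also have "of_real (Re v) * (- ?y) + of_real (Im v) * ?x = (- \<i> * wirt True (grad (- \<gamma>) h) z) * v + (\<i> * wirt False (grad (- \<gamma>) h) z) * cnj v"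
  proof -
    have "((v + w) / 2) * (- y) + ((- \<i>) * (v - w) / 2) * x = (- \<i> * ((x + (- \<i>) * y) / 2)) * v + (\<i> * ((x + \<i> * y) / 2)) * w"
      for v w x y :: complex by (simp add: field_simps)
    then show ?thesis unfolding coord_complex wirt_def by simp
  qed
  finally show ?thesis by (simp add: algebra_simps)
qed

lemma star_d_L2T:
  assumes "h \<in> H10 (- \<gamma>)"
  shows "wmul (- \<gamma>) (star_d (- \<gamma>) h) \<in> L2T \<gamma> 1"
proof -
  have g: "grad (- \<gamma>) h i \<in> sqint (wmeas (- \<gamma>))" for i
    by (rule H10_gradD(2)[OF H10_grad_grad[OF assms]])
  have "(\<lambda>z. wmul (- \<gamma>) (star_d (- \<gamma>) h) z [i]) \<in> sqint (wmeas \<gamma>)" for i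
  proof (cases i)
    case Xdir
    have "(\<lambda>z. wt (- \<gamma>) z * ((- 1) * grad (- \<gamma>) h Ydir z)) \<in> sqint (wmeas \<gamma>)"
      by (intro sqint_weight_shift sqint_scale g)
    then show ?thesis by (simp add: Xdir wmul_def star_d_singleton wt_def)
  next
    case Ydir
    have "(\<lambda>z. wt (- \<gamma>) z * grad (- \<gamma>) h Xdir z) \<in> sqint (wmeas \<gamma>)"
      by (intro sqint_weight_shift g)
    then show ?thesis by (simp add: Ydir wmul_def star_d_singleton wt_def)
  qed
  moreover have "\<exists>i. I = [i]" if "length I = 1" for I :: "axis list"
    using that by (cases I) auto
  ultimately have "(\<lambda>z. wmul (- \<gamma>) (star_d (- \<gamma>) h) z I) \<in> sqint (wmeas \<gamma>)" if "length I = 1" for I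
    using that by metis
  moreover have "symmetric 1 (wmul (- \<gamma>) (star_d (- \<gamma>) h))"
    unfolding symmetric_def
  proof (intro ballI allI impI)
    fix z and I J :: "axis list" assume *: "length I = 1 \<and> mset I = mset J"
    then have "length J = 1" by (metis size_mset)
    with * obtain i j where "I = [i]" "J = [j]" by (cases I; cases J) auto
    then have "I = J" using * by simp
    then show "wmul (- \<gamma>) (star_d (- \<gamma>) h) z I = wmul (- \<gamma>) (star_d (- \<gamma>) h) z J" by simp
  qed
  ultimately show ?thesis by (simp add: L2T_def L2_eq_sqint)
qed

lemma itt_odd_apply_diag:
  assumes "itt_odd \<gamma> p fitt h ft"
  shows "AE z in lebesgue_on disk. \<forall>v. apply_diag (2 * p + 1) (fitt z) v =
     (v * cnj v) ^ p * apply_diag 1 (wmul (- \<gamma>) (star_d (- \<gamma>) h) z) v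
     + (\<Sum>j=0..p. (v * cnj v) ^ (p - j) * apply_diag (2 * j + 1) (ft j z) v)"
proof -
  have "teq (2 * p + 1) fitt (tadd ((Lop ^^ p) (wmul (- \<gamma>) (star_d (- \<gamma>) h))) (\<lambda>z I. \<Sum>j=0..p. (Lop ^^ (p - j)) (ft j) z I))"
    using assms by (simp add: itt_odd_def)
  from teq_apply_diag[OF this] show ?thesis
  proof (eventually_elim, intro allI)
    fix z v
    assume *: "\<forall>v. apply_diag (2 * p + 1) (fitt z) v = apply_diag (2 * p + 1)
      (tadd ((Lop ^^ p) (wmul (- \<gamma>) (star_d (- \<gamma>) h))) (\<lambda>z I. \<Sum>j=0..p. (Lop ^^ (p - j)) (ft j) z I) z) v"
    have rank: "2 * p + 1 = 1 + 2 * p" by simp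
    have "apply_diag (2 * p + 1) ((Lop ^^ p) (wmul (- \<gamma>) (star_d (- \<gamma>) h)) z) v = (v * cnj v) ^ p * apply_diag 1 (wmul (- \<gamma>) (star_d (- \<gamma>) h) z) v"
      unfolding rank by (rule apply_diag_Lop_power)
    then show "apply_diag (2 * p + 1) (fitt z) v = (v * cnj v) ^ p * apply_diag 1 (wmul (- \<gamma>) (star_d (- \<gamma>) h) z) v
     + (\<Sum>j=0..p. (v * cnj v) ^ (p - j) * apply_diag (2 * j + 1) (ft j z) v)"
      unfolding *[rule_format] tadd_def apply_diag_add apply_diag_Lop_sum by simp
  qed
qed

lemma itt_odd_hom:
  assumes itt: "itt_odd \<gamma> p fitt h ft"
    and ab: "\<And>j. j \<in> {0..p} \<Longrightarrow> teq (2 * j + 1) (ft j) (tt_field (a j) (b j))"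
  shows "AE z in lebesgue_on disk. \<forall>v. apply_diag (2 * p + 1) (fitt z) v =
     hom (2 * p + 1) (\<lambda>k. odd_itt_mode \<gamma> p a b (grad (- \<gamma>) h) k z) v"
proof -
  have "AE z in lebesgue_on disk. \<forall>j\<in>{0..p}. \<forall>v. apply_diag (2 * j + 1) (ft j z) v = a j z * v ^ (2 * j + 1) + b j z * cnj v ^ (2 * j + 1)"
    by (rule AE_teq_apply_diag_tt) (use ab in auto)
  with itt_odd_apply_diag[OF itt] show ?thesis
  proof (eventually_elim, intro allI)
    fix z v
    assume *: "\<forall>v. apply_diag (2 * p + 1) (fitt z) v = (v * cnj v) ^ p * apply_diag 1 (wmul (- \<gamma>) (star_d (- \<gamma>) h) z) v
     + (\<Sum>j=0..p. (v * cnj v) ^ (p - j) * apply_diag (2 * j + 1) (ft j z) v)"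
      "\<forall>j\<in>{0..p}. \<forall>v. apply_diag (2 * j + 1) (ft j z) v = a j z * v ^ (2 * j + 1) + b j z * cnj v ^ (2 * j + 1)"
    define e where "e k = (if k \<le> p then a (p - k) z else b (k - p - 1) z)" for k
    define r where "r k = wt (- \<gamma>) z * (if k = p then - \<i> * wirt True (grad (- \<gamma>) h) z
        else if k = p + 1 then \<i> * wirt False (grad (- \<gamma>) h) z else 0)" for k
    have "hom (2 * p + 1) r v = (\<Sum>j=0..p. r (p - j) * (v ^ (2 * p + 1 - (p - j)) * cnj v ^ (p - j))
        + r (p + 1 + j) * (v ^ (2 * p + 1 - (p + 1 + j)) * cnj v ^ (p + 1 + j)))"
      unfolding hom_def by (rule sum_split_odd)
    also have "\<dots> = (\<Sum>j=0..p. if j = 0 then r p * (v ^ (p + 1) * cnj v ^ p) + r (p + 1) * (v ^ p * cnj v ^ (p + 1)) else 0)"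
      by (intro sum.cong refl) (auto simp: r_def)
    also have "\<dots> = r p * (v ^ (p + 1) * cnj v ^ p) + r (p + 1) * (v ^ p * cnj v ^ (p + 1))"
      by simp
    also have "\<dots> = (v * cnj v) ^ p * apply_diag 1 (wmul (- \<gamma>) (star_d (- \<gamma>) h) z) v"
      unfolding apply_diag_star_d by (simp add: r_def power_mult_distrib algebra_simps)
    finally have R: "hom (2 * p + 1) r v = (v * cnj v) ^ p * apply_diag 1 (wmul (- \<gamma>) (star_d (- \<gamma>) h) z) v" .
    have "hom (2 * p + 1) e v = (\<Sum>j=0..p. e (p - j) * (v ^ (2 * p + 1 - (p - j)) * cnj v ^ (p - j))
        + e (p + 1 + j) * (v ^ (2 * p + 1 - (p + 1 + j)) * cnj v ^ (p + 1 + j)))"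
      unfolding hom_def by (rule sum_split_odd)
    also have "\<dots> = (\<Sum>j=0..p. (v * cnj v) ^ (p - j) * apply_diag (2 * j + 1) (ft j z) v)"
    proof (rule sum.cong[OF refl])
      fix j assume j: "j \<in> {0..p}"
      then have ex: "2 * p + 1 - (p - j) = (p - j) + (2 * j + 1)" "2 * p + 1 - (p + 1 + j) = p - j" "p + 1 + j = (p - j) + (2 * j + 1)" by auto
      have c: "e (p - j) = a j z" "e (p + 1 + j) = b j z" using j by (auto simp: e_def)
      have "cnj v ^ (p + 1 + j) = cnj v ^ (p - j) * cnj v ^ (2 * j + 1)" by (metis ex(3) power_add)
      moreover have "apply_diag (2 * j + 1) (ft j z) v = a j z * v ^ (2 * j + 1) + b j z * cnj v ^ (2 * j + 1)" using *(2) j by blast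
      moreover have "v ^ (2 * p + 1 - (p - j)) = v ^ (p - j) * v ^ (2 * j + 1)" unfolding ex(1) by (rule power_add)
      ultimately show "e (p - j) * (v ^ (2 * p + 1 - (p - j)) * cnj v ^ (p - j))
        + e (p + 1 + j) * (v ^ (2 * p + 1 - (p + 1 + j)) * cnj v ^ (p + 1 + j)) = (v * cnj v) ^ (p - j) * apply_diag (2 * j + 1) (ft j z) v"
        unfolding c ex(2) power_mult_distrib by (simp only: algebra_simps)
    qed
    finally have E: "hom (2 * p + 1) e v = (\<Sum>j=0..p. (v * cnj v) ^ (p - j) * apply_diag (2 * j + 1) (ft j z) v)" .
    have "hom (2 * p + 1) (\<lambda>k. odd_itt_mode \<gamma> p a b (grad (- \<gamma>) h) k z) v = hom (2 * p + 1) e v + hom (2 * p + 1) r v"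
      unfolding hom_def odd_itt_mode_def e_def r_def by (simp only: distrib_right sum.distrib)
    then show "apply_diag (2 * p + 1) (fitt z) v = hom (2 * p + 1) (\<lambda>k. odd_itt_mode \<gamma> p a b (grad (- \<gamma>) h) k z) v"
      unfolding R E *(1)[rule_format] by simp
  qed
qed

text \<open>
  Both chains have length \<open>p + 1\<close>. In degree \<open>p\<close> the derivative \<open>\<partial>\<close> falls on \<open>q\<^sub>p - i h\<close>, in degree \<open>p + 1\<close> the
  derivative \<open>\<partial>bar\<close> falls on \<open>q\<^sub>p + i h\<close>, so the last members of the chains determine \<open>q\<^sub>p\<close> and \<open>h\<close>.
\<close>

lemma odd_exists:
  assumes \<gamma>: "- 1 < \<gamma>" and f: "f \<in> L2T \<gamma> (2 * p + 1)"
  shows "\<exists>q fitt h ft. decomposes \<gamma> (2 * p + 1) f q fitt \<and> itt_odd \<gamma> p fitt h ft"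
proof -
  define n where "n = 2 * p"
  have n: "2 * p + 1 = Suc n" by (simp add: n_def)
  let ?F = "tmode (2 * p + 1) f"
  obtain qA gA aA where A: "\<And>k. H10_grad (- \<gamma>) (qA k) (gA k)" "\<And>k. aA k \<in> L2 \<gamma> \<inter> wker True"
    "\<And>k. AE z in lebesgue_on disk. ?F k z =
       wt (- \<gamma>) z * (wirt True (gA k) z + (if k = 0 then 0 else wirt (\<not> True) (gA (k - 1)) z)) + aA k z"
    using wirt_chain_exists[where F="?F" and b=True, OF \<gamma> tmode_L2[OF f]] by blast
  obtain qB gB aB where B: "\<And>k. H10_grad (- \<gamma>) (qB k) (gB k)" "\<And>k. aB k \<in> L2 \<gamma> \<inter> wker False"
    "\<And>k. AE z in lebesgue_on disk. ?F (2 * p + 1 - k) z =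
       wt (- \<gamma>) z * (wirt False (gB k) z + (if k = 0 then 0 else wirt (\<not> False) (gB (k - 1)) z)) + aB k z"
    using wirt_chain_exists[where F="\<lambda>k. ?F (2 * p + 1 - k)" and b=False, OF \<gamma> tmode_L2[OF f]] by blast
  \<comment> \<open>In the middle degree the two chains meet in \<open>q\<^sub>p - i h = qA p\<close> and \<open>q\<^sub>p + i h = qB p\<close>.\<close>
  define qm where "qm z = (1/2) * (qA p z + qB p z)" for z
  define gm where "gm i z = (1/2) * (gA p i z + gB p i z)" for i z
  define h where "h z = (\<i>/2) * (qA p z - qB p z)" for z
  define gh where "gh i z = (\<i>/2) * (gA p i z - gB p i z)" for i z
  have Hm: "H10_grad (- \<gamma>) qm gm" unfolding qm_def[abs_def] gm_def[abs_def]
    by (intro H10_grad_cmult H10_grad_add A B)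
  have Hh: "H10_grad (- \<gamma>) h gh" unfolding h_def[abs_def] gh_def[abs_def]
    by (intro H10_grad_cmult H10_grad_diff A B)
  have hH: "h \<in> H10 (- \<gamma>)" using Hh unfolding H10_def by blast
  have wm: "wirt b gm z = (1/2) * (wirt b (gA p) z + wirt b (gB p) z)" for b z
    unfolding gm_def[abs_def] wirt_cmult wirt_add ..
  have wh: "wirt b gh z = (\<i>/2) * (wirt b (gA p) z - wirt b (gB p) z)" for b z
    unfolding gh_def[abs_def] wirt_cmult wirt_diff ..
  have grad_h: "AE z in lebesgue_on disk. \<forall>b. wirt b (grad (- \<gamma>) h) z = wirt b gh z"
    using H10_grad_unique[OF H10_grad_grad[OF hH] Hh, of Xdir] H10_grad_unique[OF H10_grad_grad[OF hH] Hh, of Ydir]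
    by (auto elim!: eventually_elim2 simp: wirt_def)
  define Q where "Q k = (if k < p then qA k else if k = p then qm else qB (n - k))" for k
  define G where "G k = (if k < p then gA k else if k = p then gm else gB (n - k))" for k
  have H: "H10_grad (- \<gamma>) (Q k) (G k)" for k using A(1) B(1) Hm by (simp add: Q_def G_def)
  define a where "a j = aA (p - j)" for j
  define b where "b j = aB (p - j)" for j
  define ft where "ft j = tt_field (a j) (b j)" for j
  define fitt where "fitt = tadd ((Lop ^^ p) (wmul (- \<gamma>) (star_d (- \<gamma>) h))) (\<lambda>z I. \<Sum>j=0..p. (Lop ^^ (p - j)) (ft j) z I)"
  have ftj: "ft j \<in> L2tt \<gamma> (2 * j + 1)" for j
    using A(2) B(2) by (auto simp: ft_def a_def b_def intro!: L2tt_tt_field)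
  have itt: "itt_odd \<gamma> p fitt h ft"
    using ftj hH by (simp add: itt_odd_def fitt_def teq_def)
  have fittL: "fitt \<in> L2T \<gamma> (Suc n)"
    unfolding fitt_def n[symmetric]
  proof (intro L2T_tadd L2T_sum)
    have "1 + 2 * p = 2 * p + 1" by simp
    then show "(Lop ^^ p) (wmul (- \<gamma>) (star_d (- \<gamma>) h)) \<in> L2T \<gamma> (2 * p + 1)"
      using Lop_power_L2T[OF star_d_L2T[OF hH], of p] by metis
    fix j assume j: "j \<in> {0..p}"
    then have "(2 * j + 1) + 2 * (p - j) = 2 * p + 1" by simp
    then show "(Lop ^^ (p - j)) (ft j) \<in> L2T \<gamma> (2 * p + 1)" using Lop_power_L2T[OF L2tt_L2T[OF ftj]] by metis
  qed
  define c where "c = odd_itt_mode \<gamma> p a b (grad (- \<gamma>) h)"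
  have hom: "AE z in lebesgue_on disk. \<forall>v. apply_diag (Suc n) (fitt z) v = hom (Suc n) (\<lambda>k. c k z) v"
    using itt_odd_hom[OF itt, of a b] unfolding n c_def by (simp add: ft_def teq_def)
  have "decomposes \<gamma> (Suc n) f (from_modes n Q) fitt"
  proof (rule decomposesI[OF _ fittL H hom])
    show "f \<in> L2T \<gamma> (Suc n)" using f n by simp
    fix k assume k: "k \<le> Suc n"
    consider "k < p" | "k = p" | "k = p + 1" | "p + 1 < k" by linarith
    then show "AE z in lebesgue_on disk. tmode (Suc n) f k z = wt (- \<gamma>) z * dmode n G k z + c k z"
    proof cases
      case 1
      then have kn: "k \<le> n" "k - 1 < p" using n by auto
      show ?thesis using A(3)[of k]
        by eventually_elim (use 1 kn n in \<open>simp add: dmode_def G_def c_def odd_itt_mode_def a_def\<close>)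
    next
      case 2
      have kn: "p \<le> n" by (simp add: n_def)
      show ?thesis using A(3)[of k] grad_h
      proof eventually_elim
        fix z
        assume *: "?F k z = wt (- \<gamma>) z * (wirt True (gA k) z + (if k = 0 then 0 else wirt (\<not> True) (gA (k - 1)) z)) + aA k z"
          and g: "\<forall>b. wirt b (grad (- \<gamma>) h) z = wirt b gh z"
        have "wirt True gm z - \<i> * wirt True gh z = wirt True (gA p) z"
          unfolding wm wh by (simp add: field_simps)
        then have e: "wirt True (gA p) z = wirt True gm z + - \<i> * wirt True (grad (- \<gamma>) h) z" using g by simp
        have d: "dmode n G p z = wirt True gm z + (if p = 0 then 0 else wirt False (gA (p - 1)) z)"
          using kn by (auto simp: dmode_def G_def)
        have cp: "c p z = aA p z + wt (- \<gamma>) z * (- \<i> * wirt True (grad (- \<gamma>) h) z)"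
          by (simp add: c_def odd_itt_mode_def a_def)
        show "tmode (Suc n) f k z = wt (- \<gamma>) z * dmode n G k z + c k z"
          using *[unfolded n] unfolding 2 e d cp by (simp add: algebra_simps)
      qed
    next
      case 3
      have k': "2 * p + 1 - p = k" using 3 by simp
      show ?thesis using B(3)[of p, unfolded k'] grad_h
      proof eventually_elim
        fix z
        assume *: "?F k z = wt (- \<gamma>) z * (wirt False (gB p) z + (if p = 0 then 0 else wirt (\<not> False) (gB (p - 1)) z)) + aB p z"
          and g: "\<forall>b. wirt b (grad (- \<gamma>) h) z = wirt b gh z"
        have "wirt False gm z + \<i> * wirt False gh z = wirt False (gB p) z"
          unfolding wm wh by (simp add: field_simps)
        then have e: "wirt False (gB p) z = wirt False gm z + \<i> * wirt False (grad (- \<gamma>) h) z" using g by simp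
        have kn: "p + 1 \<le> n \<longleftrightarrow> p \<noteq> 0" "n - (p + 1) = p - 1" by (auto simp: n_def)
        have d: "dmode n G (p + 1) z = wirt False gm z + (if p = 0 then 0 else wirt True (gB (p - 1)) z)"
          unfolding dmode_def kn using kn(2) by (auto simp: G_def)
        have cp: "c (p + 1) z = aB p z + wt (- \<gamma>) z * (\<i> * wirt False (grad (- \<gamma>) h) z)"
          by (simp add: c_def odd_itt_mode_def b_def)
        show "tmode (Suc n) f k z = wt (- \<gamma>) z * dmode n G k z + c k z"
          using *[unfolded n] unfolding 3 e d cp by (simp add: algebra_simps)
      qed
    next
      case 4
      define k' where "k' = 2 * p + 1 - k"
      have k': "k' < p" "k = 2 * p + 1 - k'" "k \<le> n \<longleftrightarrow> k' \<noteq> 0" "n - k = k' - 1" "n - (k - 1) = k'" "p - (k - p - 1) = k'" "0 < k"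
        "\<not> k < p" "\<not> k - 1 < p" "k \<noteq> p" "k - 1 \<noteq> p" "k \<noteq> p + 1" "\<not> k \<le> p"
        using 4 k n by (auto simp: k'_def)
      show ?thesis using B(3)[of k', folded k'(2)]
      proof eventually_elim
        fix z
        assume *: "?F k z = wt (- \<gamma>) z * (wirt False (gB k') z + (if k' = 0 then 0 else wirt (\<not> False) (gB (k' - 1)) z)) + aB k' z"
        have d: "dmode n G k z = wirt False (gB k') z + (if k' = 0 then 0 else wirt True (gB (k' - 1)) z)"
          unfolding dmode_def G_def using k'(3-11) by (cases "k' = 0") simp_all
        have cp: "c k z = aB k' z" unfolding c_def odd_itt_mode_def b_def using k'(6,10,12,13) by simp
        show "tmode (Suc n) f k z = wt (- \<gamma>) z * dmode n G k z + c k z"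
          using *[unfolded n] unfolding d cp by simp
      qed
    qed
  qed
  then show ?thesis using itt n by metis
qed

lemma odd_unique:
  assumes \<gamma>: "- 1 < \<gamma>"
    and d: "decomposes \<gamma> (2 * p + 1) f q fitt" "itt_odd \<gamma> p fitt h ft"
    and d': "decomposes \<gamma> (2 * p + 1) f q' fitt'" "itt_odd \<gamma> p fitt' h' ft'"
  shows "teq (2 * p) q q' \<and> teq (2 * p + 1) fitt fitt' \<and> (AE z in lebesgue_on disk. h z = h' z) \<and>
    (\<forall>j\<in>{0..p}. teq (2 * j + 1) (ft j) (ft' j))"
proof -
  define n where "n = 2 * p"
  have n: "2 * p + 1 = Suc n" by (simp add: n_def)
  have tt: "\<And>j. j \<in> {0..p} \<Longrightarrow> ft j \<in> L2tt \<gamma> (2 * j + 1)" "\<And>j. j \<in> {0..p} \<Longrightarrow> ft' j \<in> L2tt \<gamma> (2 * j + 1)"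
    and hH: "h \<in> H10 (- \<gamma>)" "h' \<in> H10 (- \<gamma>)"
    using d d' by (simp_all add: itt_odd_def)
  obtain a b where ab: "\<And>j. j \<in> {0..p} \<Longrightarrow> a j \<in> L2 \<gamma> \<inter> wker True" "\<And>j. j \<in> {0..p} \<Longrightarrow> b j \<in> L2 \<gamma> \<inter> wker False"
    "\<And>j. j \<in> {0..p} \<Longrightarrow> teq (2 * j + 1) (ft j) (tt_field (a j) (b j))"
    using L2tt_choose[of "{0..p}" ft \<gamma> "\<lambda>j. 2 * j + 1", OF tt(1)] by blast
  obtain a' b' where ab': "\<And>j. j \<in> {0..p} \<Longrightarrow> a' j \<in> L2 \<gamma> \<inter> wker True" "\<And>j. j \<in> {0..p} \<Longrightarrow> b' j \<in> L2 \<gamma> \<inter> wker False"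
    "\<And>j. j \<in> {0..p} \<Longrightarrow> teq (2 * j + 1) (ft' j) (tt_field (a' j) (b' j))"
    using L2tt_choose[of "{0..p}" ft' \<gamma> "\<lambda>j. 2 * j + 1", OF tt(2)] by blast
  define G where "G = gmode (- \<gamma>) n q"
  define G' where "G' = gmode (- \<gamma>) n q'"
  define g where "g = grad (- \<gamma>) h"
  define g' where "g' = grad (- \<gamma>) h'"
  have qT: "q \<in> H10T (- \<gamma>) n" "q' \<in> H10T (- \<gamma>) n" using d d' by (simp_all add: decomposes_def n_def)
  have H: "H10_grad (- \<gamma>) (tmode n q k) (G k)" "H10_grad (- \<gamma>) (tmode n q' k) (G' k)" for k
    unfolding G_def G'_def by (intro H10T_modes qT)+
  have Hg: "H10_grad (- \<gamma>) h g" "H10_grad (- \<gamma>) h' g'"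
    unfolding g_def g'_def by (intro H10_grad_grad hH)+
  define c where "c = odd_itt_mode \<gamma> p a b g"
  define c' where "c' = odd_itt_mode \<gamma> p a' b' g'"
  have "AE z in lebesgue_on disk. \<forall>k\<le>Suc n. tmode (Suc n) f k z = wt (- \<gamma>) z * dmode n G k z + c k z"
    unfolding G_def c_def g_def using d(1) itt_odd_hom[OF d(2) ab(3)] unfolding n by (rule decomposes_modes)
  moreover have "AE z in lebesgue_on disk. \<forall>k\<le>Suc n. tmode (Suc n) f k z = wt (- \<gamma>) z * dmode n G' k z + c' k z"
    unfolding G'_def c'_def g'_def using d'(1) itt_odd_hom[OF d'(2) ab'(3)] unfolding n by (rule decomposes_modes)
  ultimately have ME: "AE z in lebesgue_on disk. \<forall>k\<le>Suc n. wt (- \<gamma>) z * dmode n G k z + c k z = wt (- \<gamma>) z * dmode n G' k z + c' k z"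
    by eventually_elim simp
  \<comment> \<open>The chains from the two ends, each extended by its middle combination \<open>q\<^sub>p - i h\<close> and \<open>q\<^sub>p + i h\<close>.\<close>
  define lq where "lq q h k z = (if k = p then tmode n q k z - \<i> * h z else tmode n q k z)" for q h k z
  define lg where "lg G g k i z = (if k = p then G k i z - \<i> * g i z else G k i z)"
    for G :: "nat \<Rightarrow> axis \<Rightarrow> complex \<Rightarrow> complex" and g k i z
  define rq where "rq q h k z = (if k = p then tmode n q (n - k) z + \<i> * h z else tmode n q (n - k) z)" for q h k z
  define rg where "rg G g k i z = (if k = p then G (n - k) i z + \<i> * g i z else G (n - k) i z)"
    for G :: "nat \<Rightarrow> axis \<Rightarrow> complex \<Rightarrow> complex" and g k i z
  have Hl: "H10_grad (- \<gamma>) (lq q h k) (lg G g k)" "H10_grad (- \<gamma>) (lq q' h' k) (lg G' g' k)" for k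
    unfolding lq_def[abs_def] lg_def[abs_def]
    by (cases "k = p"; simp add: H H10_grad_diff[OF H(1) H10_grad_cmult[OF Hg(1)]] H10_grad_diff[OF H(2) H10_grad_cmult[OF Hg(2)]])+
  have Hr: "H10_grad (- \<gamma>) (rq q h k) (rg G g k)" "H10_grad (- \<gamma>) (rq q' h' k) (rg G' g' k)" for k
    unfolding rq_def[abs_def] rg_def[abs_def]
    by (cases "k = p"; simp add: H H10_grad_add[OF H(1) H10_grad_cmult[OF Hg(1)]] H10_grad_add[OF H(2) H10_grad_cmult[OF Hg(2)]])+
  have wl: "wirt s (lg G g k) z = wirt s (G k) z - (if k = p then \<i> * wirt s g z else 0)" for s G g k z
  proof (cases "k = p")
    case True
    then have "lg G g k = (\<lambda>i z. G k i z - \<i> * g i z)" by (simp add: lg_def fun_eq_iff)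
    then show ?thesis using True by (simp add: wirt_diff wirt_cmult)
  next
    case False
    then have "lg G g k = G k" by (simp add: lg_def fun_eq_iff)
    then show ?thesis using False by simp
  qed
  have wr: "wirt s (rg G g k) z = wirt s (G (n - k)) z + (if k = p then \<i> * wirt s g z else 0)" for s G g k z
  proof (cases "k = p")
    case True
    then have "rg G g k = (\<lambda>i z. G (n - k) i z + \<i> * g i z)" by (simp add: rg_def fun_eq_iff)
    then show ?thesis using True by (simp add: wirt_add wirt_cmult)
  next
    case False
    then have "rg G g k = G (n - k)" by (simp add: rg_def fun_eq_iff)
    then show ?thesis using False by simp
  qed
  have left: "(AE z in lebesgue_on disk. lq q h k z = lq q' h' k z) \<and> (\<forall>i. AE z in lebesgue_on disk. lg G g k i z = lg G' g' k i z)
    \<and> (AE z in lebesgue_on disk. a (p - k) z = a' (p - k) z)" if "k < p + 1" for k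
  proof (rule wirt_chain_unique[OF \<gamma>, where N="p + 1" and b=True and a="\<lambda>k. a (p - k)" and a'="\<lambda>k. a' (p - k)"
        and g="lg G g" and g'="lg G' g'" and q="lq q h" and q'="lq q' h'"])
    fix k assume k: "k < p + 1"
    then have j: "p - k \<in> {0..p}" by auto
    show "a (p - k) \<in> L2 \<gamma> \<inter> wker True" "a' (p - k) \<in> L2 \<gamma> \<inter> wker True" using ab(1)[OF j] ab'(1)[OF j] .
    have kn: "k \<le> n" "k \<le> Suc n" "k \<le> p" "k - 1 \<noteq> p \<or> k = 0" using k by (auto simp: n_def)
    have eq: "wt (- \<gamma>) z * (wirt True (lg G g k) z + (if k = 0 then 0 else wirt (\<not> True) (lg G g (k - 1)) z)) + a (p - k) z
       = wt (- \<gamma>) z * dmode n G k z + odd_itt_mode \<gamma> p a b g k z" for G g a b z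
      unfolding wl dmode_def odd_itt_mode_def using kn by (auto simp: algebra_simps)
    show "AE z in lebesgue_on disk.
       wt (- \<gamma>) z * (wirt True (lg G g k) z + (if k = 0 then 0 else wirt (\<not> True) (lg G g (k - 1)) z)) + a (p - k) z =
       wt (- \<gamma>) z * (wirt True (lg G' g' k) z + (if k = 0 then 0 else wirt (\<not> True) (lg G' g' (k - 1)) z)) + a' (p - k) z"
      using ME unfolding eq[where G=G and g=g and a=a and b=b] eq[where G=G' and g=g' and a=a' and b=b'] c_def[symmetric] c'_def[symmetric]
      by eventually_elim (use kn(2) in blast)
  qed (use Hl that in auto)
  have right: "(AE z in lebesgue_on disk. rq q h k z = rq q' h' k z) \<and> (\<forall>i. AE z in lebesgue_on disk. rg G g k i z = rg G' g' k i z)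
    \<and> (AE z in lebesgue_on disk. b (p - k) z = b' (p - k) z)" if "k < p + 1" for k
  proof (rule wirt_chain_unique[OF \<gamma>, where N="p + 1" and b=False and a="\<lambda>k. b (p - k)" and a'="\<lambda>k. b' (p - k)"
        and g="rg G g" and g'="rg G' g'" and q="rq q h" and q'="rq q' h'"])
    fix k assume k: "k < p + 1"
    then have j: "p - k \<in> {0..p}" by auto
    show "b (p - k) \<in> L2 \<gamma> \<inter> wker False" "b' (p - k) \<in> L2 \<gamma> \<inter> wker False" using ab(2)[OF j] ab'(2)[OF j] .
    define l where "l = 2 * p + 1 - k"
    have l: "l \<le> Suc n" "l \<le> n \<longleftrightarrow> k \<noteq> 0" "k \<noteq> 0 \<Longrightarrow> n - (k - 1) = l" "l - 1 = n - k" "0 < l" "\<not> l \<le> p" "l \<noteq> p"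
      "l - p - 1 = p - k" "l = p + 1 \<longleftrightarrow> k = p" "k \<noteq> 0 \<Longrightarrow> k - 1 \<noteq> p"
      using k by (auto simp: l_def n_def)
    have eq: "wt (- \<gamma>) z * (wirt False (rg G g k) z + (if k = 0 then 0 else wirt (\<not> False) (rg G g (k - 1)) z)) + b (p - k) z
       = wt (- \<gamma>) z * dmode n G l z + odd_itt_mode \<gamma> p a b g l z" for G g a b z
    proof -
      have "dmode n G l z = (if k = 0 then 0 else wirt True (G l) z) + wirt False (G (n - k)) z"
        unfolding dmode_def l(2,4) using l(5) by simp
      moreover have "odd_itt_mode \<gamma> p a b g l z = b (p - k) z + wt (- \<gamma>) z * (if k = p then \<i> * wirt False g z else 0)"
        unfolding odd_itt_mode_def l(8,9) using l(6,7) by simp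
      moreover have "(if k = 0 then 0 else wirt (\<not> False) (rg G g (k - 1)) z) = (if k = 0 then 0 else wirt True (G l) z)"
        unfolding wr using l(3,10) by simp
      ultimately show ?thesis unfolding wr[of _ _ _ k] by (simp add: algebra_simps)
    qed
    show "AE z in lebesgue_on disk.
       wt (- \<gamma>) z * (wirt False (rg G g k) z + (if k = 0 then 0 else wirt (\<not> False) (rg G g (k - 1)) z)) + b (p - k) z =
       wt (- \<gamma>) z * (wirt False (rg G' g' k) z + (if k = 0 then 0 else wirt (\<not> False) (rg G' g' (k - 1)) z)) + b' (p - k) z"
      using ME unfolding eq[where G=G and g=g and a=a and b=b] eq[where G=G' and g=g' and a=a' and b=b'] c_def[symmetric] c'_def[symmetric]
      by eventually_elim (use l(1) in blast)
  qed (use Hr that in auto)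
  have np: "n - p = p" by (simp add: n_def)
  have mid: "(AE z in lebesgue_on disk. tmode n q p z = tmode n q' p z \<and> h z = h' z)"
    "AE z in lebesgue_on disk. G p i z = G' p i z" for i
  proof -
    have *: "x = x' \<and> y = y'" if "x - \<i> * y = x' - \<i> * y'" "x + \<i> * y = x' + \<i> * y'" for x y x' y' :: complex
    proof -
      have "2 * x = 2 * x'" using arg_cong2[OF that, of "(+)"] by simp
      then have "x = x'" by simp
      then show ?thesis using that(2) by simp
    qed
    show "AE z in lebesgue_on disk. tmode n q p z = tmode n q' p z \<and> h z = h' z"
    proof -
      have "AE z in lebesgue_on disk. tmode n q p z - \<i> * h z = tmode n q' p z - \<i> * h' z"
        using left[of p, THEN conjunct1] by (simp add: lq_def)
      moreover have "AE z in lebesgue_on disk. tmode n q p z + \<i> * h z = tmode n q' p z + \<i> * h' z"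
        using right[of p, THEN conjunct1] by (simp add: rq_def np)
      ultimately show ?thesis by eventually_elim (rule *)
    qed
    show "AE z in lebesgue_on disk. G p i z = G' p i z"
    proof -
      have "AE z in lebesgue_on disk. G p i z - \<i> * g i z = G' p i z - \<i> * g' i z"
        using left[of p, THEN conjunct2, THEN conjunct1, rule_format, of i] by (simp add: lg_def)
      moreover have "AE z in lebesgue_on disk. G p i z + \<i> * g i z = G' p i z + \<i> * g' i z"
        using right[of p, THEN conjunct2, THEN conjunct1, rule_format, of i] by (simp add: rg_def np)
      ultimately show ?thesis by eventually_elim (rule *[THEN conjunct1])
    qed
  qed
  have modes: "(AE z in lebesgue_on disk. tmode n q k z = tmode n q' k z) \<and> (\<forall>i. AE z in lebesgue_on disk. G k i z = G' k i z)"
    if "k \<le> n" for k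
  proof -
    consider "k < p" | "k = p" | "p < k" by linarith
    then show ?thesis
    proof cases
      case 1 then show ?thesis using left[of k] by (simp add: lq_def lg_def)
    next
      case 2 then show ?thesis using mid by (auto elim: eventually_mono)
    next
      case 3
      then have "n - k < p + 1" "n - (n - k) = k" "n - k \<noteq> p" using that by (auto simp: n_def)
      then show ?thesis using right[of "n - k"] by (simp add: rq_def rg_def)
    qed
  qed
  have "teq n q q'" by (rule teq_of_modes[OF qT modes[THEN conjunct1]])
  moreover have "teq (Suc n) fitt fitt'"
  proof (rule fitt_unique)
    show "decomposes \<gamma> (Suc n) f q fitt" "decomposes \<gamma> (Suc n) f q' fitt'" using d(1) d'(1) unfolding n .
    show "AE z in lebesgue_on disk. gmode (- \<gamma>) n q k i z = gmode (- \<gamma>) n q' k i z" if "k \<le> n" for k i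
      using modes[OF that, THEN conjunct2, rule_format] unfolding G_def G'_def .
  qed
  moreover have "AE z in lebesgue_on disk. h z = h' z" using mid(1) by eventually_elim simp
  moreover have "teq (2 * j + 1) (ft j) (ft' j)" if j: "j \<in> {0..p}" for j
  proof -
    have j1: "p - j < p + 1" "p - (p - j) = j" using j by auto
    show ?thesis
      by (rule teq_tt_field_cong[OF ab(3)[OF j] ab'(3)[OF j]])
         (use left[OF j1(1)] right[OF j1(1)] j1(2) in auto)
  qed
  ultimately show ?thesis unfolding n by (simp add: n_def)
qed

section \<open>The X-ray transform of the decomposition\<close>

lemma xray_chord:
  "xray m \<gamma> f x = (LINT t|chord_meas x. apply_diag m (f (chord x t)) (chord_dir x) * of_real (bdf (chord x t) powr \<gamma>))"
  by (cases x) (simp add: xray_def Let_def chord_def chord_dir_def)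

lemma chord_dir_unit: "chord_dir x * cnj (chord_dir x) = 1"
  by (simp add: chord_dir_def cis_mult cis_cnj)

lemma AE_chord_xray_integrable:
  assumes "- 1 < \<gamma>" and T: "T \<in> L2T \<gamma> m"
  shows "AE_chord (\<lambda>x. integrable (chord_meas x)
     (\<lambda>t. apply_diag m (T (chord x t)) (chord_dir x) * of_real (bdf (chord x t) powr \<gamma>)))"
proof -
  have "AE_chord (\<lambda>x. \<forall>I\<in>{I. length I = m}. integrable (chord_meas x) (\<lambda>t. T (chord x t) I * of_real (bdf (chord x t) powr \<gamma>)))"
  proof (rule AE_chord_finite[OF finite_index_lists])
    fix I :: "axis list" assume "I \<in> {I. length I = m}"
    then have "(\<lambda>z. T z I) \<in> sqint (wmeas \<gamma>)" using T by (simp add: L2T_def L2_eq_sqint)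
    from AE_chord_integrable[OF sqint_weighted_integrable[OF assms(1) this]]
    show "AE_chord (\<lambda>x. integrable (chord_meas x) (\<lambda>t. T (chord x t) I * of_real (bdf (chord x t) powr \<gamma>)))" .
  qed
  then show ?thesis
  proof (rule AE_chord_mono)
    fix x :: "real \<times> real"
    assume *: "\<forall>I\<in>{I. length I = m}. integrable (chord_meas x) (\<lambda>t. T (chord x t) I * of_real (bdf (chord x t) powr \<gamma>))"
    have "integrable (chord_meas x) (\<lambda>t. \<Sum>I | length I = m. vpow (chord_dir x) I * (T (chord x t) I * of_real (bdf (chord x t) powr \<gamma>)))"
      by (intro Bochner_Integration.integrable_sum integrable_mult_right) (use * in auto)
    moreover have "apply_diag m S v * w = (\<Sum>I | length I = m. vpow v I * (S I * w))" for S v w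
      unfolding apply_diag_vpow sum_distrib_right by (intro sum.cong refl) (simp only: mult_ac)
    ultimately show "integrable (chord_meas x) (\<lambda>t. apply_diag m (T (chord x t)) (chord_dir x) * of_real (bdf (chord x t) powr \<gamma>))"
      by simp
  qed
qed

text \<open>
  The factors \<open>(v cnj v)\<^sup>e\<close>, which come from powers of \<open>L\<close>, are \<open>1\<close> on the unit direction of a chord.
\<close>

lemma AE_chord_xray_sum:
  assumes "- 1 < \<gamma>" and "finite A" and F: "F \<in> L2T \<gamma> m" and S: "\<And>l. l \<in> A \<Longrightarrow> S l \<in> L2T \<gamma> (r l)"
    and eq: "AE z in lebesgue_on disk. \<forall>v. apply_diag m (F z) v = (\<Sum>l\<in>A. (v * cnj v) ^ e l * apply_diag (r l) (S l z) v)"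
  shows "AE_chord (\<lambda>x. xray m \<gamma> F x = (\<Sum>l\<in>A. xray (r l) \<gamma> (S l) x))"
proof -
  let ?w = "\<lambda>x t. complex_of_real (bdf (chord x t) powr \<gamma>)"
  have "AE_chord (\<lambda>x. \<forall>l\<in>A. integrable (chord_meas x) (\<lambda>t. apply_diag (r l) (S l (chord x t)) (chord_dir x) * ?w x t))"
    by (intro AE_chord_finite assms(2) AE_chord_xray_integrable assms(1) S)
  from AE_chord_conj[OF AE_chord_conj[OF this AE_chord_xray_integrable[OF assms(1) F]] AE_chord_points[OF eq]]
  show ?thesis
  proof (rule AE_chord_mono)
    fix x :: "real \<times> real"
    assume *: "((\<forall>l\<in>A. integrable (chord_meas x) (\<lambda>t. apply_diag (r l) (S l (chord x t)) (chord_dir x) * ?w x t)) \<and>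
       integrable (chord_meas x) (\<lambda>t. apply_diag m (F (chord x t)) (chord_dir x) * ?w x t)) \<and>
       (AE t in chord_meas x. \<forall>v. apply_diag m (F (chord x t)) v = (\<Sum>l\<in>A. (v * cnj v) ^ e l * apply_diag (r l) (S l (chord x t)) v))"
    have "xray m \<gamma> F x = (LINT t|chord_meas x. (\<Sum>l\<in>A. apply_diag (r l) (S l (chord x t)) (chord_dir x) * ?w x t))"
      unfolding xray_chord
    proof (rule integral_cong_AE)
      show "(\<lambda>t. apply_diag m (F (chord x t)) (chord_dir x) * ?w x t) \<in> borel_measurable (chord_meas x)"
        using * by (intro borel_measurable_integrable) blast
      show "(\<lambda>t. \<Sum>l\<in>A. apply_diag (r l) (S l (chord x t)) (chord_dir x) * ?w x t) \<in> borel_measurable (chord_meas x)"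
        using * by (intro borel_measurable_integrable Bochner_Integration.integrable_sum) blast
      have "AE t in chord_meas x. \<forall>v. apply_diag m (F (chord x t)) v = (\<Sum>l\<in>A. (v * cnj v) ^ e l * apply_diag (r l) (S l (chord x t)) v)"
        using * by blast
      then show "AE t in chord_meas x. apply_diag m (F (chord x t)) (chord_dir x) * ?w x t =
          (\<Sum>l\<in>A. apply_diag (r l) (S l (chord x t)) (chord_dir x) * ?w x t)"
        by eventually_elim (simp add: chord_dir_unit sum_distrib_right)
    qed
    also have "\<dots> = (\<Sum>l\<in>A. xray (r l) \<gamma> (S l) x)"
      unfolding xray_chord using * by (intro Bochner_Integration.integral_sum) blast
    finally show "xray m \<gamma> F x = (\<Sum>l\<in>A. xray (r l) \<gamma> (S l) x)" .
  qed
qed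

text \<open>The potential part \<open>d\<^sup>-\<^sup>\<gamma> d\<^sup>s q\<close> is invisible: the weights cancel, and chord integrals of gradients vanish.\<close>

lemma AE_chord_xray_decomposes:
  assumes "- 1 < \<gamma>" and f: "f \<in> L2T \<gamma> (Suc n)" and d: "decomposes \<gamma> (Suc n) f q fitt"
  shows "AE_chord (\<lambda>x. xray (Suc n) \<gamma> f x = xray (Suc n) \<gamma> fitt x)"
proof -
  let ?w = "\<lambda>x t. complex_of_real (bdf (chord x t) powr \<gamma>)"
  define g where "g I = grad (- \<gamma>) (\<lambda>w. q w I)" for I
  have fitt: "fitt \<in> L2T \<gamma> (Suc n)" using d by (simp add: decomposes_def)
  have H: "H10_grad (- \<gamma>) (\<lambda>w. q w I) (g I)" if "length I = n" for I
    unfolding g_def using d that by (intro H10_grad_grad) (simp add: decomposes_def H10T_def)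
  define p where "p x t I = of_real (coord Xdir (chord_dir x)) * g I Xdir (chord x t) + of_real (coord Ydir (chord_dir x)) * g I Ydir (chord x t)"
    for x t I
  have "AE z in lebesgue_on disk. \<forall>v. apply_diag (Suc n) (f z) v = apply_diag (Suc n) (tadd (wmul (- \<gamma>) (ds (- \<gamma>) q)) fitt z) v"
    using d by (intro teq_apply_diag) (simp add: decomposes_def)
  then have pts: "AE_chord (\<lambda>x. AE t in chord_meas x. \<forall>v. apply_diag (Suc n) (f (chord x t)) v =
      apply_diag (Suc n) (tadd (wmul (- \<gamma>) (ds (- \<gamma>) q)) fitt (chord x t)) v)"
    by (rule AE_chord_points)
  have gi: "AE_chord (\<lambda>x. \<forall>I\<in>{I. length I = n}. (integrable (chord_meas x) (\<lambda>t. g I Xdir (chord x t)) \<and>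
      integrable (chord_meas x) (\<lambda>t. g I Ydir (chord x t))) \<and> (LINT t|chord_meas x. p x t I) = 0)"
  proof (rule AE_chord_finite[OF finite_index_lists])
    fix I :: "axis list" assume "I \<in> {I. length I = n}"
    then have "H10_grad (- \<gamma>) (\<lambda>w. q w I) (g I)" by (intro H) simp
    then show "AE_chord (\<lambda>x. (integrable (chord_meas x) (\<lambda>t. g I Xdir (chord x t)) \<and>
      integrable (chord_meas x) (\<lambda>t. g I Ydir (chord x t))) \<and> (LINT t|chord_meas x. p x t I) = 0)"
      unfolding p_def by (intro AE_chord_conj AE_chord_gradient[OF assms(1)])
  qed
  from AE_chord_conj[OF AE_chord_conj[OF AE_chord_xray_integrable[OF assms(1) f] AE_chord_xray_integrable[OF assms(1) fitt]]
      AE_chord_conj[OF gi pts]]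
  show ?thesis
  proof (rule AE_chord_mono)
    fix x :: "real \<times> real"
    assume *: "(integrable (chord_meas x) (\<lambda>t. apply_diag (Suc n) (f (chord x t)) (chord_dir x) * ?w x t) \<and>
       integrable (chord_meas x) (\<lambda>t. apply_diag (Suc n) (fitt (chord x t)) (chord_dir x) * ?w x t)) \<and>
      (\<forall>I\<in>{I. length I = n}. (integrable (chord_meas x) (\<lambda>t. g I Xdir (chord x t)) \<and>
      integrable (chord_meas x) (\<lambda>t. g I Ydir (chord x t))) \<and> (LINT t|chord_meas x. p x t I) = 0) \<and>
      (AE t in chord_meas x. \<forall>v. apply_diag (Suc n) (f (chord x t)) v =
      apply_diag (Suc n) (tadd (wmul (- \<gamma>) (ds (- \<gamma>) q)) fitt (chord x t)) v)"
    have pint: "integrable (chord_meas x) (\<lambda>t. p x t I)" if "length I = n" for I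
      unfolding p_def using * that by (intro Bochner_Integration.integrable_add integrable_mult_right) auto
    let ?P = "\<lambda>t. \<Sum>I | length I = n. p x t I * vpow (chord_dir x) I"
    have Pint: "integrable (chord_meas x) ?P"
      using pint by (intro Bochner_Integration.integrable_sum integrable_mult_left) auto
    have "xray (Suc n) \<gamma> f x = (LINT t|chord_meas x. ?P t + apply_diag (Suc n) (fitt (chord x t)) (chord_dir x) * ?w x t)"
      unfolding xray_chord
    proof (rule integral_cong_AE)
      show "(\<lambda>t. apply_diag (Suc n) (f (chord x t)) (chord_dir x) * ?w x t) \<in> borel_measurable (chord_meas x)"
        using * by (intro borel_measurable_integrable) blast
      show "(\<lambda>t. ?P t + apply_diag (Suc n) (fitt (chord x t)) (chord_dir x) * ?w x t) \<in> borel_measurable (chord_meas x)"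
        using * Pint by (intro borel_measurable_integrable Bochner_Integration.integrable_add) blast+
      have "AE t in chord_meas x. \<forall>v. apply_diag (Suc n) (f (chord x t)) v =
        apply_diag (Suc n) (tadd (wmul (- \<gamma>) (ds (- \<gamma>) q)) fitt (chord x t)) v" using * by blast
      with AE_chord_interior[of x]
      show "AE t in chord_meas x. apply_diag (Suc n) (f (chord x t)) (chord_dir x) * ?w x t =
          ?P t + apply_diag (Suc n) (fitt (chord x t)) (chord_dir x) * ?w x t"
      proof eventually_elim
        fix t
        assume z: "chord x t \<in> ball 0 1" and eq: "\<forall>v. apply_diag (Suc n) (f (chord x t)) v =
          apply_diag (Suc n) (tadd (wmul (- \<gamma>) (ds (- \<gamma>) q)) fitt (chord x t)) v"
        have "bdf (chord x t) powr (- \<gamma>) * bdf (chord x t) powr \<gamma> = 1" using bdf_pos[OF z] by (simp flip: powr_add)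
        then have w: "complex_of_real (bdf (chord x t) powr (- \<gamma>)) * ?w x t = 1" by (simp flip: of_real_mult)
        have P: "apply_diag (Suc n) (ds (- \<gamma>) q (chord x t)) (chord_dir x) = ?P t"
          unfolding apply_diag_ds unfolding apply_diag_vpow p_def g_def ..
        have "apply_diag (Suc n) (f (chord x t)) (chord_dir x) * ?w x t =
          (complex_of_real (bdf (chord x t) powr (- \<gamma>)) * ?w x t) * ?P t + apply_diag (Suc n) (fitt (chord x t)) (chord_dir x) * ?w x t"
          unfolding eq[rule_format] tadd_def wmul_def apply_diag_add apply_diag_cmult P by (simp add: algebra_simps)
        then show "apply_diag (Suc n) (f (chord x t)) (chord_dir x) * ?w x t =
          ?P t + apply_diag (Suc n) (fitt (chord x t)) (chord_dir x) * ?w x t" unfolding w by simp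
      qed
    qed
    also have "\<dots> = (LINT t|chord_meas x. ?P t) + xray (Suc n) \<gamma> fitt x"
      unfolding xray_chord using * Pint by (intro Bochner_Integration.integral_add) blast+
    also have "(LINT t|chord_meas x. ?P t) = (\<Sum>I | length I = n. LINT t|chord_meas x. p x t I * vpow (chord_dir x) I)"
      using pint by (intro Bochner_Integration.integral_sum integrable_mult_left) auto
    also have "\<dots> = 0" using * by (intro sum.neutral) simp
    finally show "xray (Suc n) \<gamma> f x = xray (Suc n) \<gamma> fitt x" by simp
  qed
qed

lemma AE_influx_chord: "AE_chord P \<Longrightarrow> AE x in influx \<gamma>. P x"
  unfolding AE_chord_def by (rule AE_influxI)

lemma even_xray:
  assumes \<gamma>: "- 1 < \<gamma>" and p: "1 \<le> p" and f: "f \<in> L2T \<gamma> (2 * p)"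
    and d: "decomposes \<gamma> (2 * p) f q fitt" "itt_even \<gamma> p fitt ft"
  shows "AE x in influx \<gamma>. xray (2 * p) \<gamma> f x = xray (2 * p) \<gamma> fitt x \<and>
    xray (2 * p) \<gamma> fitt x = (\<Sum>j=0..p. xray (2 * j) \<gamma> (ft j) x)"
proof -
  obtain n where n: "2 * p = Suc n" using p by (cases "2 * p") auto
  have fitt: "fitt \<in> L2T \<gamma> (2 * p)" using d by (simp add: decomposes_def)
  have S: "ft j \<in> L2T \<gamma> (2 * j)" if "j \<in> {0..p}" for j
    using d(2) that by (cases "j = 0") (auto simp: itt_even_def L2tt_L2T)
  have eq: "AE z in lebesgue_on disk. \<forall>v. apply_diag (2 * p) (fitt z) v = (\<Sum>j\<in>{0..p}. (v * cnj v) ^ (p - j) * apply_diag (2 * j) (ft j z) v)"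
  proof -
    have "teq (2 * p) fitt (\<lambda>z I. \<Sum>j=0..p. (Lop ^^ (p - j)) (ft j) z I)" using d(2) by (simp add: itt_even_def)
    from teq_apply_diag[OF this] show ?thesis
      by eventually_elim (use apply_diag_Lop_sum[of p 0 ft] in simp)
  qed
  have "AE_chord (\<lambda>x. xray (2 * p) \<gamma> f x = xray (2 * p) \<gamma> fitt x)"
    using AE_chord_xray_decomposes[OF \<gamma>, of f n q fitt] f d(1) unfolding n by blast
  moreover have "AE_chord (\<lambda>x. xray (2 * p) \<gamma> fitt x = (\<Sum>j=0..p. xray (2 * j) \<gamma> (ft j) x))"
    by (rule AE_chord_xray_sum[where r="\<lambda>j. 2 * j" and e="\<lambda>j. p - j", OF \<gamma> _ fitt S eq]) simp
  ultimately show ?thesis by (intro AE_influx_chord AE_chord_conj)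
qed

lemma odd_xray:
  assumes \<gamma>: "- 1 < \<gamma>" and f: "f \<in> L2T \<gamma> (2 * p + 1)"
    and d: "decomposes \<gamma> (2 * p + 1) f q fitt" "itt_odd \<gamma> p fitt h ft"
  shows "AE x in influx \<gamma>. xray (2 * p + 1) \<gamma> f x = xray (2 * p + 1) \<gamma> fitt x \<and>
    xray (2 * p + 1) \<gamma> fitt x = xray 1 \<gamma> (wmul (- \<gamma>) (star_d (- \<gamma>) h)) x + (\<Sum>j=0..p. xray (2 * j + 1) \<gamma> (ft j) x)"
proof -
  have n: "2 * p + 1 = Suc (2 * p)" by simp
  have fitt: "fitt \<in> L2T \<gamma> (2 * p + 1)" using d by (simp add: decomposes_def)
  have hH: "h \<in> H10 (- \<gamma>)" using d(2) by (simp add: itt_odd_def)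
  \<comment> \<open>The rotational term is adjoined to the sum as the term of index \<open>p + 1\<close>.\<close>
  define S where "S j = (if j = p + 1 then wmul (- \<gamma>) (star_d (- \<gamma>) h) else ft j)" for j
  define r where "r j = (if j = p + 1 then 1 else 2 * j + 1)" for j
  define e where "e j = (if j = p + 1 then p else p - j)" for j
  have split: "(\<Sum>j\<in>{0..p + 1}. t j) = t (p + 1) + (\<Sum>j=0..p. t j)" for t :: "nat \<Rightarrow> complex"
    by (simp add: add.commute)
  have SL: "S j \<in> L2T \<gamma> (r j)" if "j \<in> {0..p + 1}" for j
    using d(2) that star_d_L2T[OF hH] by (auto simp: S_def r_def itt_odd_def L2tt_L2T)
  have eq: "AE z in lebesgue_on disk. \<forall>v. apply_diag (2 * p + 1) (fitt z) v = (\<Sum>j\<in>{0..p + 1}. (v * cnj v) ^ e j * apply_diag (r j) (S j z) v)"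
    using itt_odd_apply_diag[OF d(2)] unfolding split
    by eventually_elim (simp add: S_def r_def e_def)
  have "AE_chord (\<lambda>x. xray (2 * p + 1) \<gamma> f x = xray (2 * p + 1) \<gamma> fitt x)"
    using AE_chord_xray_decomposes[OF \<gamma>, of f "2 * p" q fitt] f d(1) unfolding n by blast
  moreover have "AE_chord (\<lambda>x. xray (2 * p + 1) \<gamma> fitt x = (\<Sum>j\<in>{0..p + 1}. xray (r j) \<gamma> (S j) x))"
    by (rule AE_chord_xray_sum[where e=e, OF \<gamma> _ fitt SL eq]) simp
  then have "AE_chord (\<lambda>x. xray (2 * p + 1) \<gamma> fitt x = xray 1 \<gamma> (wmul (- \<gamma>) (star_d (- \<gamma>) h)) x + (\<Sum>j=0..p. xray (2 * j + 1) \<gamma> (ft j) x))"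
    unfolding split by (simp add: S_def r_def)
  ultimately show ?thesis by (intro AE_influx_chord AE_chord_conj)
qed

section \<open>The decomposition theorem\<close>

theorem corollary6:
  fixes \<gamma> :: real and m :: nat and f :: tfield
  assumes "- 1 < \<gamma>" and "\<gamma> < 1" and "1 \<le> m" and "f \<in> L2T \<gamma> m"
  shows
    "(\<forall>p. m = 2 * p \<longrightarrow>
        (\<exists>q fitt ft. decomposes \<gamma> m f q fitt \<and> itt_even \<gamma> p fitt ft) \<and>
        (\<forall>q fitt ft q' fitt' ft'.
           decomposes \<gamma> m f q fitt \<and> itt_even \<gamma> p fitt ft \<and>
           decomposes \<gamma> m f q' fitt' \<and> itt_even \<gamma> p fitt' ft' \<longrightarrow>
           teq (m - 1) q q' \<and> teq m fitt fitt' \<and> (\<forall>j\<in>{0..p}. teq (2 * j) (ft j) (ft' j))) \<and>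
        (\<forall>q fitt ft. decomposes \<gamma> m f q fitt \<and> itt_even \<gamma> p fitt ft \<longrightarrow>
           (AE x in influx \<gamma>. xray m \<gamma> f x = xray m \<gamma> fitt x \<and>
              xray m \<gamma> fitt x = (\<Sum>j=0..p. xray (2 * j) \<gamma> (ft j) x)))) \<and>
     (\<forall>p. m = 2 * p + 1 \<longrightarrow>
        (\<exists>q fitt h ft. decomposes \<gamma> m f q fitt \<and> itt_odd \<gamma> p fitt h ft) \<and>
        (\<forall>q fitt h ft q' fitt' h' ft'.
           decomposes \<gamma> m f q fitt \<and> itt_odd \<gamma> p fitt h ft \<and>
           decomposes \<gamma> m f q' fitt' \<and> itt_odd \<gamma> p fitt' h' ft' \<longrightarrow>
           teq (m - 1) q q' \<and> teq m fitt fitt' \<and> (AE z in lebesgue_on disk. h z = h' z) \<and>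
           (\<forall>j\<in>{0..p}. teq (2 * j + 1) (ft j) (ft' j))) \<and>
        (\<forall>q fitt h ft. decomposes \<gamma> m f q fitt \<and> itt_odd \<gamma> p fitt h ft \<longrightarrow>
           (AE x in influx \<gamma>. xray m \<gamma> f x = xray m \<gamma> fitt x \<and>
              xray m \<gamma> fitt x =
                xray 1 \<gamma> (wmul (- \<gamma>) (star_d (- \<gamma>) h)) x +
                (\<Sum>j=0..p. xray (2 * j + 1) \<gamma> (ft j) x))))"
proof (rule conjI; rule allI; rule impI)
  fix p assume m: "m = 2 * p"
  then have p: "1 \<le> p" using assms(3) by simp
  have f: "f \<in> L2T \<gamma> (2 * p)" using assms(4) unfolding m .
  show "(\<exists>q fitt ft. decomposes \<gamma> m f q fitt \<and> itt_even \<gamma> p fitt ft) \<and>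
        (\<forall>q fitt ft q' fitt' ft'.
           decomposes \<gamma> m f q fitt \<and> itt_even \<gamma> p fitt ft \<and>
           decomposes \<gamma> m f q' fitt' \<and> itt_even \<gamma> p fitt' ft' \<longrightarrow>
           teq (m - 1) q q' \<and> teq m fitt fitt' \<and> (\<forall>j\<in>{0..p}. teq (2 * j) (ft j) (ft' j))) \<and>
        (\<forall>q fitt ft. decomposes \<gamma> m f q fitt \<and> itt_even \<gamma> p fitt ft \<longrightarrow>
           (AE x in influx \<gamma>. xray m \<gamma> f x = xray m \<gamma> fitt x \<and>
              xray m \<gamma> fitt x = (\<Sum>j=0..p. xray (2 * j) \<gamma> (ft j) x)))"
    unfolding m
  proof (intro conjI)
    show "\<exists>q fitt ft. decomposes \<gamma> (2 * p) f q fitt \<and> itt_even \<gamma> p fitt ft"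
      by (rule even_exists[OF assms(1) p f])
    show "\<forall>q fitt ft q' fitt' ft'.
           decomposes \<gamma> (2 * p) f q fitt \<and> itt_even \<gamma> p fitt ft \<and>
           decomposes \<gamma> (2 * p) f q' fitt' \<and> itt_even \<gamma> p fitt' ft' \<longrightarrow>
           teq (2 * p - 1) q q' \<and> teq (2 * p) fitt fitt' \<and> (\<forall>j\<in>{0..p}. teq (2 * j) (ft j) (ft' j))"
      by (intro allI impI, elim conjE) (rule even_unique[OF assms(1) p])
    show "\<forall>q fitt ft. decomposes \<gamma> (2 * p) f q fitt \<and> itt_even \<gamma> p fitt ft \<longrightarrow>
           (AE x in influx \<gamma>. xray (2 * p) \<gamma> f x = xray (2 * p) \<gamma> fitt x \<and>
              xray (2 * p) \<gamma> fitt x = (\<Sum>j=0..p. xray (2 * j) \<gamma> (ft j) x))"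
      by (intro allI impI, elim conjE) (rule even_xray[OF assms(1) p f])
  qed
next
  fix p assume m: "m = 2 * p + 1"
  have f: "f \<in> L2T \<gamma> (2 * p + 1)" using assms(4) unfolding m .
  show "(\<exists>q fitt h ft. decomposes \<gamma> m f q fitt \<and> itt_odd \<gamma> p fitt h ft) \<and>
        (\<forall>q fitt h ft q' fitt' h' ft'.
           decomposes \<gamma> m f q fitt \<and> itt_odd \<gamma> p fitt h ft \<and>
           decomposes \<gamma> m f q' fitt' \<and> itt_odd \<gamma> p fitt' h' ft' \<longrightarrow>
           teq (m - 1) q q' \<and> teq m fitt fitt' \<and> (AE z in lebesgue_on disk. h z = h' z) \<and>
           (\<forall>j\<in>{0..p}. teq (2 * j + 1) (ft j) (ft' j))) \<and>
        (\<forall>q fitt h ft. decomposes \<gamma> m f q fitt \<and> itt_odd \<gamma> p fitt h ft \<longrightarrow>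
           (AE x in influx \<gamma>. xray m \<gamma> f x = xray m \<gamma> fitt x \<and>
              xray m \<gamma> fitt x =
                xray 1 \<gamma> (wmul (- \<gamma>) (star_d (- \<gamma>) h)) x +
                (\<Sum>j=0..p. xray (2 * j + 1) \<gamma> (ft j) x)))"
    unfolding m
  proof (intro conjI)
    show "\<exists>q fitt h ft. decomposes \<gamma> (2 * p + 1) f q fitt \<and> itt_odd \<gamma> p fitt h ft"
      by (rule odd_exists[OF assms(1) f])
    show "\<forall>q fitt h ft q' fitt' h' ft'.
           decomposes \<gamma> (2 * p + 1) f q fitt \<and> itt_odd \<gamma> p fitt h ft \<and>
           decomposes \<gamma> (2 * p + 1) f q' fitt' \<and> itt_odd \<gamma> p fitt' h' ft' \<longrightarrow>
           teq (2 * p + 1 - 1) q q' \<and> teq (2 * p + 1) fitt fitt' \<and> (AE z in lebesgue_on disk. h z = h' z) \<and>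
           (\<forall>j\<in>{0..p}. teq (2 * j + 1) (ft j) (ft' j))"
      unfolding add_diff_cancel_right' by (intro allI impI, elim conjE) (rule odd_unique[OF assms(1)])
    show "\<forall>q fitt h ft. decomposes \<gamma> (2 * p + 1) f q fitt \<and> itt_odd \<gamma> p fitt h ft \<longrightarrow>
           (AE x in influx \<gamma>. xray (2 * p + 1) \<gamma> f x = xray (2 * p + 1) \<gamma> fitt x \<and>
              xray (2 * p + 1) \<gamma> fitt x =
                xray 1 \<gamma> (wmul (- \<gamma>) (star_d (- \<gamma>) h)) x +
                (\<Sum>j=0..p. xray (2 * j + 1) \<gamma> (ft j) x))"
      by (intro allI impI, elim conjE) (rule odd_xray[OF assms(1) f])
  qed
qed

end
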